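(* Let $f:S\to S^5(1)$ be a minimal immersion with non-degenerate non-circular ellipse of curvature. Then the following three statements are equivalent: 1. $\gamma^+=0$; 2. $f$ is the bipolar surface of a non-totally geodesic minimal surface in $S^3(1)$; 3. the $(+)$transform $f^+$ is the reflection of $f$ in a great subsphere of $S^5(1)$.
   Context: $S$ is an oriented surface and $f:S\to S^5(1)\subset\mathbb R^6$ is a minimal immersion into the unit 5-sphere; $S$ is given the Riemann surface structure determined by the orientation and the induced metric. $II$ is the second fundamental form of $f$ in $S^5(1)$, extended complex bilinearly, and $(\cdot,\cdot)$ is the complex bilinear extension to $\mathbb C^6$ of the standard inner product of $\mathbb R^6$. The ellipse of curvature at $p\in S$ is $E(p)=\{II(X,X): X\text{ a unit tangent vector to }S\text{ at }p\}$, a possibly degenerate ellipse centred at $0$ in the normal space; it is assumed to be non-degenerate and not a circle at every point of $S$. For a local complex coordinate $z=x+iy$ on $S$ put $\partial=\partial/\partial z$, $f_0=f$, $f_1=\partial f$, $f_2=II(\partial,\partial)$. The coordinate $z$ is called adapted for $f$ if $(f_2,f_2)=-1$; since the ellipse of curvature is not a circle, such coordinates exist locally, and they are defined up to rotations by $\pi/2$. Let $z$ be an adapted complex coordinate for $f$ and write $f_2=a-ib$ with $a,b$ being $\mathbb R^6$-valued; then $(a,b)=0$ and there is a positive function $\phi$ with $|a|=\sinh\phi$, $|b|=\cosh\phi$. Let $N$ be the real unit vector orthogonal to $f_0,f_1,\bar f_1,f_2,\bar f_2$ such that $\{f_0,\tfrac{\partial f_0}{\partial x},\tfrac{\partial f_0}{\partial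 y},II(\tfrac{\partial}{\partial x},\tfrac{\partial}{\partial x}),II(\tfrac{\partial}{\partial x},\tfrac{\partial}{\partial y}),N\}$ is a positively oriented moving frame of $\mathbb R^6$. The $(+)$transform of $f$ is $$f^{+}=-\frac{1}{\cosh\phi}\frac{b}{|b|}+\tanh\phi\,N ,$$ which is again a minimal immersion of $S$ into $S^5(1)$. Put $f_1^+=\partial f^+$ and $\gamma^+=(\partial f_1,f_1^+)$; the condition $\gamma^+=0$ means that $\gamma^+$ is identically zero. Bipolar surface (in the sense of Lawson): if $G_1$ is a minimal surface in $S^3(1)\subset\mathbb R^4$ with unit normal $G_2$ in $S^3(1)$, its bipolar surface is the minimal surface in $S^5(1)$ given by $G_1\wedge G_2$ in $\Lambda^2\mathbb R^4=\mathbb R^6$.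
   Formalization: Rotating the adapted coordinate by π/2 changes the (+)transform, so 1⇔2 and 3⇔2 are stated for some choice of it (1⇔3 for every choice); and the minimal surface in S³ may be defined on a covering of S, since it need not descend to S when S is not simply connected. *)

theory Defs
  imports "HOL-Analysis.Analysis"
begin

section \<open>Riemann surfaces\<close>

definition chart :: "'a::t2_space set \<Rightarrow> 'a set \<Rightarrow> ('a \<Rightarrow> complex) \<Rightarrow> bool" where
  "chart S U z \<longleftrightarrow> openin (top_of_set S) U \<and> open (z ` U) \<and>
     homeomorphism U (z ` U) z (inv_into U z)"

definition chart_compatible ::
    "'a set \<Rightarrow> ('a \<Rightarrow> complex) \<Rightarrow> 'a set \<Rightarrow> ('a \<Rightarrow> complex) \<Rightarrow> bool" where
  "chart_compatible U z V w \<longleftrightarrow>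
     (w \<circ> inv_into U z) holomorphic_on (z ` (U \<inter> V)) \<and>
     (z \<circ> inv_into V w) holomorphic_on (w ` (U \<inter> V))"

text \<open>Second countability need not be required: it is automatic for connected Riemann
  surfaces (Rado).\<close>

definition riemann_surface :: "'a::t2_space set \<Rightarrow> ('a set \<times> ('a \<Rightarrow> complex)) set \<Rightarrow> bool" where
  "riemann_surface S \<A> \<longleftrightarrow> S \<noteq> {} \<and> connected S \<and>
     (\<forall>(U, z) \<in> \<A>. chart S U z) \<and> (\<Union>(U, z) \<in> \<A>. U) = S \<and>
     (\<forall>(U, z) \<in> \<A>. \<forall>(V, w) \<in> \<A>. chart_compatible U z V w)"

text \<open>The local complex coordinates are all the charts of the maximal atlas containing \<open>\<A>\<close>.\<close>

definition complex_coordinate ::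
    "'a::t2_space set \<Rightarrow> ('a set \<times> ('a \<Rightarrow> complex)) set \<Rightarrow> 'a set \<Rightarrow> ('a \<Rightarrow> complex) \<Rightarrow> bool" where
  "complex_coordinate S \<A> U z \<longleftrightarrow> chart S U z \<and> (\<forall>(V, w) \<in> \<A>. chart_compatible U z V w)"

definition holomorphic_map ::
    "'b::t2_space set \<Rightarrow> ('b set \<times> ('b \<Rightarrow> complex)) set \<Rightarrow>
     'a::t2_space set \<Rightarrow> ('a set \<times> ('a \<Rightarrow> complex)) set \<Rightarrow> ('b \<Rightarrow> 'a) \<Rightarrow> bool" where
  "holomorphic_map C \<B> S \<A> \<pi> \<longleftrightarrow> continuous_on C \<pi> \<and> \<pi> ` C \<subseteq> S \<and>
     (\<forall>W w U z. complex_coordinate C \<B> W w \<and> complex_coordinate S \<A> U z \<longrightarrow>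
        (z \<circ> \<pi> \<circ> inv_into W w) holomorphic_on (w ` (W \<inter> \<pi> -` U)))"

definition local_expr :: "('a \<Rightarrow> 'e) \<Rightarrow> 'a set \<Rightarrow> ('a \<Rightarrow> complex) \<Rightarrow> complex \<Rightarrow> 'e" where
  "local_expr f U z = f \<circ> inv_into U z"


section \<open>Immersions into spheres, in a local coordinate\<close>

text \<open>Below, \<open>g\<close> is the local expression of a map on an open set of the plane, and a complex
  number \<open>v\<close> stands for the real tangent vector
  \<open>Re v \<partial>/\<partial>x + Im v \<partial>/\<partial>y\<close>.\<close>

definition dd :: "complex \<Rightarrow> (complex \<Rightarrow> 'e::real_normed_vector) \<Rightarrow> complex \<Rightarrow> 'e" where
  "dd v g w = frechet_derivative g (at w) v"

primrec C_k_on :: "nat \<Rightarrow> complex set \<Rightarrow> (complex \<Rightarrow> 'e::real_normed_vector) \<Rightarrow> bool" where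
  "C_k_on 0 D g \<longleftrightarrow> continuous_on D g"
| "C_k_on (Suc k) D g \<longleftrightarrow>
     (\<forall>w\<in>D. g differentiable (at w)) \<and> C_k_on k D (dd 1 g) \<and> C_k_on k D (dd \<i> g)"

definition smooth_on :: "complex set \<Rightarrow> (complex \<Rightarrow> 'e::real_normed_vector) \<Rightarrow> bool" where
  "smooth_on D g \<longleftrightarrow> (\<forall>k. C_k_on k D g)"

definition normal_part :: "'e::euclidean_space set \<Rightarrow> 'e \<Rightarrow> 'e" where
  "normal_part W v = (THE n. (\<forall>w\<in>W. n \<bullet> w = 0) \<and> v - n \<in> span W)"

text \<open>Second fundamental form in the unit sphere: the part of the second derivative that is
  normal to the surface and tangent to the sphere.\<close>

definition II :: "(complex \<Rightarrow> 'e::euclidean_space) \<Rightarrow> complex \<Rightarrow> complex \<Rightarrow> complex \<Rightarrow> 'e" where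
  "II g w u v = normal_part {g w, dd 1 g w, dd \<i> g w} (dd u (dd v g) w)"

definition conformal_at :: "(complex \<Rightarrow> 'e::euclidean_space) \<Rightarrow> complex \<Rightarrow> bool" where
  "conformal_at g w \<longleftrightarrow> norm (dd 1 g w) = norm (dd \<i> g w) \<and> dd 1 g w \<bullet> dd \<i> g w = 0"

definition mean_curvature_zero_at :: "(complex \<Rightarrow> 'e::euclidean_space) \<Rightarrow> complex \<Rightarrow> bool" where
  "mean_curvature_zero_at g w \<longleftrightarrow>
     (\<forall>u v. norm (dd u g w) = 1 \<and> norm (dd v g w) = 1 \<and> dd u g w \<bullet> dd v g w = 0 \<longrightarrow>
        II g w u u + II g w v v = 0)"

text \<open>Minimal immersion into the unit sphere of \<open>'e\<close>. Conformality says that the Riemann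
  surface structure is the one determined by the orientation and the induced metric.\<close>

definition minimal_immersion ::
    "'a::t2_space set \<Rightarrow> ('a set \<times> ('a \<Rightarrow> complex)) set \<Rightarrow> ('a \<Rightarrow> 'e::euclidean_space) \<Rightarrow> bool" where
  "minimal_immersion S \<A> f \<longleftrightarrow> f ` S \<subseteq> sphere 0 1 \<and>
     (\<forall>U z. complex_coordinate S \<A> U z \<longrightarrow>
        smooth_on (z ` U) (local_expr f U z) \<and>
        (\<forall>w \<in> z ` U. inj (frechet_derivative (local_expr f U z) (at w)) \<and>
           conformal_at (local_expr f U z) w \<and>
           mean_curvature_zero_at (local_expr f U z) w))"

definition totally_geodesic ::
    "'a::t2_space set \<Rightarrow> ('a set \<times> ('a \<Rightarrow> complex)) set \<Rightarrow> ('a \<Rightarrow> 'e::euclidean_space) \<Rightarrow> bool" where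
  "totally_geodesic S \<A> f \<longleftrightarrow>
     (\<forall>U z. complex_coordinate S \<A> U z \<longrightarrow> (\<forall>w \<in> z ` U. \<forall>u v. II (local_expr f U z) w u v = 0))"

definition curvature_ellipse :: "(complex \<Rightarrow> 'e::euclidean_space) \<Rightarrow> complex \<Rightarrow> 'e set" where
  "curvature_ellipse g w = {II g w v v | v. norm (dd v g w) = 1}"

text \<open>For a minimal immersion the curvature ellipse is centred at 0, so it degenerates (to a segment
  or a point) iff its span has dimension less than 2, and it is a circle iff all its points
  have the same norm.\<close>

definition nondegenerate_noncircular_ellipse ::
    "'a::t2_space set \<Rightarrow> ('a set \<times> ('a \<Rightarrow> complex)) set \<Rightarrow> ('a \<Rightarrow> 'e::euclidean_space) \<Rightarrow> bool" where
  "nondegenerate_noncircular_ellipse S \<A> f \<longleftrightarrow>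
     (\<forall>U z. complex_coordinate S \<A> U z \<longrightarrow> (\<forall>w \<in> z ` U.
        dim (curvature_ellipse (local_expr f U z) w) = 2 \<and>
        \<not> (\<exists>r. \<forall>y \<in> curvature_ellipse (local_expr f U z) w. norm y = r)))"


section \<open>Adapted coordinates and the (+)transform\<close>

definition cvec :: "real^'n \<Rightarrow> complex^'n" where
  "cvec x = (\<chi> i. complex_of_real (x $ i))"

definition conj_vec :: "complex^'n \<Rightarrow> complex^'n" where
  "conj_vec x = (\<chi> i. cnj (x $ i))"

text \<open>The complex bilinear (not Hermitian) extension of the inner product.\<close>

definition cdot :: "complex^'n \<Rightarrow> complex^'n \<Rightarrow> complex" where
  "cdot x y = (\<Sum>i\<in>UNIV. x $ i * y $ i)"

definition del :: "(complex \<Rightarrow> complex^'n) \<Rightarrow> complex \<Rightarrow> complex^'n" where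
  "del h w = (1/2) *s (dd 1 h w - \<i> *s dd \<i> h w)"

definition f_1 :: "(complex \<Rightarrow> real^'n) \<Rightarrow> complex \<Rightarrow> complex^'n" where
  "f_1 g = del (cvec \<circ> g)"

text \<open>\<open>II(\<partial>, \<partial>)\<close> with \<open>\<partial> = (\<partial>/\<partial>x - \<i> \<partial>/\<partial>y) / 2\<close>, expanded
  complex bilinearly.\<close>

definition f_2 :: "(complex \<Rightarrow> real^'n) \<Rightarrow> complex \<Rightarrow> complex^'n" where
  "f_2 g w = (1/4) *s (cvec (II g w 1 1) - \<i> *s cvec (II g w 1 \<i>)
                        - \<i> *s cvec (II g w \<i> 1) - cvec (II g w \<i> \<i>))"

definition adapted_coordinate ::
    "'a::t2_space set \<Rightarrow> ('a set \<times> ('a \<Rightarrow> complex)) set \<Rightarrow> ('a \<Rightarrow> real^'n) \<Rightarrow>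
     'a set \<Rightarrow> ('a \<Rightarrow> complex) \<Rightarrow> bool" where
  "adapted_coordinate S \<A> f U z \<longleftrightarrow> complex_coordinate S \<A> U z \<and>
     (\<forall>w \<in> z ` U. cdot (f_2 (local_expr f U z) w) (f_2 (local_expr f U z) w) = -1)"

text \<open>\<open>f\<^sub>2 = a - \<i> b\<close>, \<open>|a| = sinh \<phi>\<close>, \<open>|b| = cosh \<phi>\<close>.\<close>

definition a_part :: "(complex \<Rightarrow> real^'n) \<Rightarrow> complex \<Rightarrow> real^'n" where
  "a_part g w = (\<chi> i. Re (f_2 g w $ i))"

definition b_part :: "(complex \<Rightarrow> real^'n) \<Rightarrow> complex \<Rightarrow> real^'n" where
  "b_part g w = (\<chi> i. - Im (f_2 g w $ i))"

definition phi :: "(complex \<Rightarrow> real^'n) \<Rightarrow> complex \<Rightarrow> real" where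
  "phi g w = (THE t. 0 < t \<and> norm (a_part g w) = sinh t \<and> norm (b_part g w) = cosh t)"

definition unit_N :: "(complex \<Rightarrow> real^6) \<Rightarrow> complex \<Rightarrow> real^6" where
  "unit_N g w = (THE n. norm n = 1 \<and> n \<bullet> g w = 0 \<and>
     cdot (cvec n) (f_1 g w) = 0 \<and> cdot (cvec n) (conj_vec (f_1 g w)) = 0 \<and>
     cdot (cvec n) (f_2 g w) = 0 \<and> cdot (cvec n) (conj_vec (f_2 g w)) = 0 \<and>
     det (vector [g w, dd 1 g w, dd \<i> g w, II g w 1 1, II g w 1 \<i>, n] :: real^6^6) > 0)"

definition f_plus :: "(complex \<Rightarrow> real^6) \<Rightarrow> complex \<Rightarrow> real^6" where
  "f_plus g w = - ((1 / cosh (phi g w)) *\<^sub>R ((1 / norm (b_part g w)) *\<^sub>R b_part g w))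
                  + tanh (phi g w) *\<^sub>R unit_N g w"

text \<open>Replacing an adapted coordinate \<open>z\<close> by \<open>-z\<close> does not change \<open>f_plus\<close>, but replacing it
  by \<open>\<i> z\<close> changes \<open>b\<close> into \<open>-b\<close> and keeps \<open>N\<close>. So \<open>f\<close> has locally two (+)transforms, and a
  (+)transform on \<open>S\<close> is a map that is given near every point by some adapted coordinate.\<close>

definition is_plus_transform ::
    "'a::t2_space set \<Rightarrow> ('a set \<times> ('a \<Rightarrow> complex)) set \<Rightarrow> ('a \<Rightarrow> real^6) \<Rightarrow> ('a \<Rightarrow> real^6) \<Rightarrow> bool" where
  "is_plus_transform S \<A> f F \<longleftrightarrow>
     (\<forall>p\<in>S. \<exists>U z. p \<in> U \<and> adapted_coordinate S \<A> f U z \<and>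
        (\<forall>q\<in>U. F q = f_plus (local_expr f U z) (z q)))"

definition gamma_plus :: "(complex \<Rightarrow> real^6) \<Rightarrow> complex \<Rightarrow> complex" where
  "gamma_plus g w = cdot (del (f_1 g) w) (f_1 (f_plus g) w)"

text \<open>\<open>\<gamma>\<^sup>+ = 0\<close> for the (+)transform \<open>F\<close>, in all adapted coordinates that define \<open>F\<close>.\<close>

definition gamma_plus_zero ::
    "'a::t2_space set \<Rightarrow> ('a set \<times> ('a \<Rightarrow> complex)) set \<Rightarrow> ('a \<Rightarrow> real^6) \<Rightarrow> ('a \<Rightarrow> real^6) \<Rightarrow> bool" where
  "gamma_plus_zero S \<A> f F \<longleftrightarrow>
     (\<forall>U z. adapted_coordinate S \<A> f U z \<and> (\<forall>q\<in>U. F q = f_plus (local_expr f U z) (z q)) \<longrightarrow>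
        (\<forall>w \<in> z ` U. gamma_plus (local_expr f U z) w = 0))"


section \<open>Reflections in great subspheres\<close>

text \<open>The great subspheres are the sets \<open>V \<inter> sphere 0 1\<close>, \<open>V\<close> a nonzero proper subspace; the
  reflection fixes \<open>V\<close> and is \<open>-1\<close> on its orthogonal complement.\<close>

definition reflection_across :: "'e::euclidean_space set \<Rightarrow> 'e \<Rightarrow> 'e" where
  "reflection_across V x = x - 2 *\<^sub>R normal_part V x"

definition is_great_sphere_reflection_of ::
    "'a set \<Rightarrow> ('a \<Rightarrow> 'e::euclidean_space) \<Rightarrow> ('a \<Rightarrow> 'e) \<Rightarrow> bool" where
  "is_great_sphere_reflection_of S F f \<longleftrightarrow>
     (\<exists>V. subspace V \<and> 0 < dim V \<and> dim V < DIM('e) \<and> (\<forall>p\<in>S. F p = reflection_across V (f p)))"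


section \<open>Bipolar surfaces\<close>

text \<open>Coordinates with respect to the orthonormal basis \<open>e\<^sub>i \<and> e\<^sub>j\<close>, \<open>i < j\<close>, of the exterior square.\<close>

definition wedge :: "real^4 \<Rightarrow> real^4 \<Rightarrow> real^6" where
  "wedge u v = vector [u$1 * v$2 - u$2 * v$1, u$1 * v$3 - u$3 * v$1, u$1 * v$4 - u$4 * v$1,
                       u$2 * v$3 - u$3 * v$2, u$2 * v$4 - u$4 * v$2, u$3 * v$4 - u$4 * v$3]"

definition unit_normal_in_sphere ::
    "'a::t2_space set \<Rightarrow> ('a set \<times> ('a \<Rightarrow> complex)) set \<Rightarrow>
     ('a \<Rightarrow> 'e::euclidean_space) \<Rightarrow> ('a \<Rightarrow> 'e) \<Rightarrow> bool" where
  "unit_normal_in_sphere S \<A> G1 G2 \<longleftrightarrow>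
     (\<forall>U z. complex_coordinate S \<A> U z \<longrightarrow>
        smooth_on (z ` U) (local_expr G2 U z) \<and>
        (\<forall>w \<in> z ` U. norm (local_expr G2 U z w) = 1 \<and>
           local_expr G2 U z w \<bullet> local_expr G1 U z w = 0 \<and>
           (\<forall>v. local_expr G2 U z w \<bullet> dd v (local_expr G1 U z) w = 0)))"

text \<open>The minimal surface \<open>G\<^sub>1\<close> may live on a covering \<open>C\<close> of \<open>S\<close>: for instance
  \<open>(G\<^sub>1, G\<^sub>2)\<close> and \<open>(-G\<^sub>1, -G\<^sub>2)\<close> have the same bipolar surface, so an antipodally symmetric
  \<open>G\<^sub>1\<close> has a bipolar surface that descends to a quotient on which \<open>G\<^sub>1\<close> is not defined. If \<open>S\<close> is
  simply connected, the covering is an isomorphism and \<open>G\<^sub>1\<close> is defined on \<open>S\<close>. The orthogonal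
  transformation \<open>A\<close> is the identification of the exterior square of \<open>\<real>\<^sup>4\<close> with \<open>\<real>\<^sup>6\<close>. The type of
  \<open>C\<close> is no restriction: \<open>p \<mapsto> (\<pi> p, G\<^sub>1 p, G\<^sub>2 p)\<close> maps any such covering onto one of that type.\<close>

definition is_bipolar_surface ::
    "'a::t2_space set \<Rightarrow> ('a set \<times> ('a \<Rightarrow> complex)) set \<Rightarrow> ('a \<Rightarrow> real^6) \<Rightarrow> bool" where
  "is_bipolar_surface S \<A> f \<longleftrightarrow>
     (\<exists>(C :: ('a \<times> (real^4) \<times> (real^4)) set) \<B> \<pi> G1 G2 A.
        riemann_surface C \<B> \<and> covering_space C \<pi> S \<and> holomorphic_map C \<B> S \<A> \<pi> \<and>
        minimal_immersion C \<B> G1 \<and> \<not> totally_geodesic C \<B> G1 \<and>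
        unit_normal_in_sphere C \<B> G1 G2 \<and>
        orthogonal_transformation A \<and>
        (\<forall>p\<in>C. f (\<pi> p) = A (wedge (G1 p) (G2 p))))"

end

theory Submission
 imports Defs "HOL-Complex_Analysis.Complex_Analysis"
begin

text \<open>In an adapted coordinate the (+)transform \<open>X = f\<^sup>+\<close> is characterised, up to a sign on \<open>N\<close>, by
 \<open>|X| = 1\<close>, \<open>(f, X) = (f\<^sub>1, X) = 0\<close> and \<open>(f\<^sub>2, X) = \<i>\<close>. If \<open>X = R f\<close> with \<open>R\<close> linear and self-adjoint, then
 differentiating \<open>(f\<^sub>1, R f) = 0\<close> gives \<open>\<gamma>\<^sup>+ = 0\<close>. Conversely, if \<open>\<gamma>\<^sup>+ = 0\<close>, the structure equations are symmetric in
 \<open>f\<close> and \<open>X\<close>, and \<open>f + X\<close> solves a closed linear system; hence every \<open>f(p) + X(p)\<close> is orthogonal to every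
 \<open>f(q) - X(q)\<close>, and \<open>X\<close> is the reflection of \<open>f\<close> in the span of \<open>f + X\<close>.

 For the bipolar surface \<open>G \<and> N\<close> the transform is, up to sign, the Hodge star of \<open>G \<and> N\<close>, a linear self-adjoint
 image of \<open>f\<close>. Conversely, if \<open>\<gamma>\<^sup>+ = 0\<close>, the Gram determinant of \<open>y, \<partial>y, \<partial>\<partial>y\<close> for \<open>y = f \<plusminus> X\<close> does not vanish, so
 both spans have dimension 3, and \<open>f + X\<close>, \<open>f - X\<close> rescale to maps \<open>s\<close>, \<open>t\<close> into the unit sphere of imaginary
 quaternions. After a global choice of the sign of \<open>t\<close>, the unit quaternions \<open>G\<close> with \<open>G s = t G\<close> and
 \<open>\<i> G s \<partial>s = \<partial>t G\<close> form a double covering of \<open>S\<close>; on a component of it \<open>G\<close> is a minimal surface in \<open>S\<^sup>3\<close>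
 with unit normal \<open>G s\<close>, and \<open>f\<close> is its bipolar surface.\<close>

text \<open>The exterior square of \<real>^4 is the sum of the two eigenspaces of the Hodge star,
  each a copy of the imaginary quaternions. If N = G s with s imaginary, the components of G \<and>
  N are, up to scale, s and t = G s G^-1. So recovering G from f means finding a unit quaternion
  that rotates s to t and also matches their derivatives.

  The linear system for f + X closes because \<open>\<gamma>\<^sup>+ = 0\<close> makes the metrics
  of f and X equal. By the Gauss equation |f_11|^2 is a function of the metric, and so is every
  coefficient in the expansion of the third derivative; f and X satisfy the same equation with their
  roles exchanged.

  The other difficulty is signs. Replacing z by \<i> z changes the sign of b but not N, so a
  transform on S is a choice of coordinates. The sign of the N-part of a candidate and the sign
  relating t to s do not depend on the coordinate and are locally constant, hence constant on the
  connected S. The sign of G can have monodromy, which is why a covering appears.\<close>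

no_notation fps_nth (infixl \<open>$\<close> 75)

section \<open>Smooth functions on open subsets of the plane\<close>

lemma dd_eqI: "(g has_derivative g') (at w) \<Longrightarrow> dd v g w = g' v"
 unfolding dd_def by (metis frechet_derivative_at)

lemma has_derivative_dd: "g differentiable (at w) \<Longrightarrow> (g has_derivative (\<lambda>v. dd v g w)) (at w)"
 unfolding dd_def using frechet_derivative_works by auto

lemma dd_cong:
 assumes "open D" "w \<in> D" "\<And>x. x \<in> D \<Longrightarrow> g x = h x"
 shows "dd v g w = dd v h w"
proof -
 have "(g has_derivative g') (at w) \<longleftrightarrow> (h has_derivative g') (at w)" for g'
  using has_derivative_transform_within_open[OF _ assms(1,2), of g g' UNIV h]
   has_derivative_transform_within_open[OF _ assms(1,2), of h g' UNIV g] assms(3) by auto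
 then show ?thesis unfolding dd_def frechet_derivative_def by simp
qed

lemma dd_linear:
 assumes "g differentiable (at w)"
 shows "dd v g w = Re v *\<^sub>R dd 1 g w + Im v *\<^sub>R dd \<i> g w"
proof -
 have l: "linear (\<lambda>v. dd v g w)" using has_derivative_dd[OF assms] has_derivative_linear by blast
 have "v = Re v *\<^sub>R 1 + Im v *\<^sub>R \<i>" by (simp add: complex_eq_iff)
 then have "dd v g w = dd (Re v *\<^sub>R 1 + Im v *\<^sub>R \<i>) g w" by simp
 also have "\<dots> = Re v *\<^sub>R dd 1 g w + Im v *\<^sub>R dd \<i> g w" by (simp only: linear_add[OF l] linear_scale[OF l])
 finally show ?thesis .
qed

lemma differentiable_cong_open:
 assumes "open D" "w \<in> D" "\<And>x. x \<in> D \<Longrightarrow> g x = h x"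
 shows "g differentiable (at w) \<longleftrightarrow> h differentiable (at w)"
proof -
 have "(g has_derivative g') (at w) \<longleftrightarrow> (h has_derivative g') (at w)" for g'
  using has_derivative_transform_within_open[OF _ assms(1,2), of g g' UNIV h]
   has_derivative_transform_within_open[OF _ assms(1,2), of h g' UNIV g] assms(3) by auto
 then show ?thesis unfolding differentiable_def by simp
qed

lemma C_k_on_cong:
 assumes "open D"
 shows "(\<And>x. x \<in> D \<Longrightarrow> g x = h x) \<Longrightarrow> C_k_on k D g \<longleftrightarrow> C_k_on k D h"
proof (induction k arbitrary: g h)
 case 0
 have "continuous_on D g \<longleftrightarrow> continuous_on D h" by (rule continuous_on_cong[OF refl 0])
 then show ?case by simp
next
 case (Suc k)
 have "\<And>v x. x \<in> D \<Longrightarrow> dd v g x = dd v h x" by (rule dd_cong[OF assms]) (auto simp: Suc.prems)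
 then have "C_k_on k D (dd v g) \<longleftrightarrow> C_k_on k D (dd v h)" for v by (rule Suc.IH)
 moreover have "g differentiable (at w) \<longleftrightarrow> h differentiable (at w)" if "w \<in> D" for w
  by (rule differentiable_cong_open[OF assms that]) (auto simp: Suc.prems)
 ultimately show ?case by auto
qed

lemma smooth_on_cong:
 "open D \<Longrightarrow> (\<And>x. x \<in> D \<Longrightarrow> g x = h x) \<Longrightarrow> smooth_on D g \<longleftrightarrow> smooth_on D h"
 unfolding smooth_on_def using C_k_on_cong by blast

lemma C_k_on_subset: "C_k_on k D g \<Longrightarrow> E \<subseteq> D \<Longrightarrow> C_k_on k E g"
 by (induction k arbitrary: g) (auto intro: continuous_on_subset)

lemma smooth_on_subset: "smooth_on D g \<Longrightarrow> E \<subseteq> D \<Longrightarrow> smooth_on E g"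
 unfolding smooth_on_def using C_k_on_subset by blast

lemma C_k_on_imp_continuous_on: "C_k_on k D g \<Longrightarrow> continuous_on D g"
 by (cases k) (auto intro!: continuous_at_imp_continuous_on differentiable_imp_continuous_within)

lemma C_k_on_SucD: "C_k_on (Suc k) D g \<Longrightarrow> C_k_on k D g"
proof (induction k arbitrary: g)
 case 0
 then show ?case using C_k_on_imp_continuous_on by fastforce
next
 case (Suc k)
 then show ?case by (metis C_k_on.simps(2))
qed

text \<open>Needed because some maps are smooth only through a formula that varies from point to
  point, such as a lift that is locally a normalised section chosen near the point.\<close>

lemma C_k_on_local:
 assumes "\<And>w. w \<in> D \<Longrightarrow> \<exists>E. open E \<and> w \<in> E \<and> C_k_on k E g"
 shows "C_k_on k D g" using assms
proof (induction k arbitrary: g)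
 case 0
 have "continuous (at w) g" if "w \<in> D" for w using 0[OF that] continuous_on_eq_continuous_at by auto
 then show ?case by (simp add: continuous_at_imp_continuous_on)
next
 case (Suc k)
 have "g differentiable at w" if "w \<in> D" for w using Suc.prems[OF that] by auto
 moreover have "C_k_on k D (dd v g)" if "v \<in> {1,\<i>}" for v using Suc.prems that by (intro Suc.IH) fastforce
 ultimately show ?case by simp
qed

lemma smooth_on_local:
 assumes "\<And>w. w \<in> D \<Longrightarrow> \<exists>E. open E \<and> w \<in> E \<and> smooth_on E g"
 shows "smooth_on D g" unfolding smooth_on_def using assms C_k_on_local[of D _ g] by (metis smooth_on_def)

lemma smooth_on_differentiable: "smooth_on D g \<Longrightarrow> w \<in> D \<Longrightarrow> g differentiable (at w)"
 unfolding smooth_on_def by (metis C_k_on.simps(2))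

lemma smooth_on_continuous_on: "smooth_on D g \<Longrightarrow> continuous_on D g"
 unfolding smooth_on_def by (metis C_k_on.simps(1))

lemma C_k_on_const: "C_k_on k D (\<lambda>w. c)"
proof (induction k arbitrary: c)
 case (Suc k)
 have "dd v (\<lambda>w::complex. c) = (\<lambda>w. 0)" for v by (auto simp: dd_def)
 then show ?case using Suc by simp
qed simp

lemma C_k_on_add:
 assumes "open D" "C_k_on k D g" "C_k_on k D h"
 shows "C_k_on k D (\<lambda>w. g w + h w)" using assms(2,3)
proof (induction k arbitrary: g h)
 case 0
 then show ?case by (simp add: continuous_on_add)
next
 case (Suc k)
 have d: "g differentiable at w" "h differentiable at w" if "w \<in> D" for w using Suc.prems that by auto
 have "dd v (\<lambda>w. g w + h w) w = dd v g w + dd v h w" if "w \<in> D" for v w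
  by (intro dd_eqI) (intro has_derivative_add has_derivative_dd d that)
 moreover have "C_k_on k D (\<lambda>w. dd v g w + dd v h w)" if "v \<in> {1,\<i>}" for v
  using Suc.prems that by (intro Suc.IH) auto
 ultimately have "C_k_on k D (dd v (\<lambda>w. g w + h w))" if "v \<in> {1,\<i>}" for v
  using C_k_on_cong[OF assms(1), of "dd v (\<lambda>w. g w + h w)" "\<lambda>w. dd v g w + dd v h w"] that by blast
 then show ?case using d by simp
qed

lemma C_k_on_linear:
 assumes "open D" "bounded_linear L" "C_k_on k D g"
 shows "C_k_on k D (\<lambda>w. L (g w))" using assms(3)
proof (induction k arbitrary: g)
 case 0
 then show ?case using assms(2) by (simp add: linear_continuous_on_compose bounded_linear.linear bounded_linear.continuous_on)
next
 case (Suc k)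
 have d: "g differentiable at w" if "w \<in> D" for w using Suc.prems that by auto
 have "((\<lambda>w. L (g w)) has_derivative (\<lambda>v. L (dd v g w))) (at w)" if "w \<in> D" for w
  by (intro bounded_linear.has_derivative[OF assms(2)] has_derivative_dd d that)
 then have e: "dd v (\<lambda>w. L (g w)) w = L (dd v g w)" and "(\<lambda>w. L (g w)) differentiable at w" if "w \<in> D" for v w
  using that dd_eqI differentiableI by blast+
 moreover have "C_k_on k D (\<lambda>w. L (dd v g w))" if "v \<in> {1,\<i>}" for v
  using Suc.prems that by (intro Suc.IH) auto
 ultimately show ?case using C_k_on_cong[OF assms(1), of "dd _ (\<lambda>w. L (g w))" "\<lambda>w. L (dd _ g w)"] by auto
qed

lemma C_k_on_bilinear:
 assumes "open D" "bounded_bilinear P" "C_k_on k D g" "C_k_on k D h"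
 shows "C_k_on k D (\<lambda>w. P (g w) (h w))" using assms(3,4)
proof (induction k arbitrary: g h)
 case 0
 then show ?case using assms(2) by (simp add: bounded_bilinear.continuous_on)
next
 case (Suc k)
 have d: "g differentiable at w" "h differentiable at w" if "w \<in> D" for w using Suc.prems that by auto
 have "((\<lambda>w. P (g w) (h w)) has_derivative (\<lambda>v. P (g w) (dd v h w) + P (dd v g w) (h w))) (at w)" if "w \<in> D" for w
  by (intro bounded_bilinear.FDERIV[OF assms(2)] has_derivative_dd d that)
 then have e: "dd v (\<lambda>w. P (g w) (h w)) w = P (g w) (dd v h w) + P (dd v g w) (h w)"
  and "(\<lambda>w. P (g w) (h w)) differentiable at w" if "w \<in> D" for v w
  using that dd_eqI[of "\<lambda>w. P (g w) (h w)"] differentiableI by blast+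
 moreover have "C_k_on k D (\<lambda>w. P (g w) (dd v h w) + P (dd v g w) (h w))" if "v \<in> {1,\<i>}" for v
  using Suc.prems that C_k_on_SucD[of k D g] C_k_on_SucD[of k D h]
  by (intro Suc.IH C_k_on_add assms(1)) auto
 ultimately show ?case
  using C_k_on_cong[OF assms(1), of "dd _ (\<lambda>w. P (g w) (h w))" "\<lambda>w. P (g w) (dd _ h w) + P (dd _ g w) (h w)"] by auto
qed

text \<open>A bootstrap for functions such as \<open>inverse\<close> and \<open>sqrt\<close>, whose
  derivative is an algebraic expression in the function itself: regularity of order k passes from
  the composite to the derivative by \<open>step\<close>, and the chain rule then gives order k +
  1.\<close>

lemma C_k_on_compose_real:
 fixes h :: "complex \<Rightarrow> real"
 assumes D: "open D"
  and der: "\<And>w. w \<in> D \<Longrightarrow> (\<phi> has_real_derivative \<phi>' w) (at (h w))"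
  and h: "\<And>k. C_k_on k D h"
  and step: "\<And>k. C_k_on k D (\<lambda>w. \<phi> (h w)) \<Longrightarrow> C_k_on k D \<phi>'"
 shows "C_k_on k D (\<lambda>w. \<phi> (h w))"
proof (induction k)
 case 0
 have "continuous_on D (\<lambda>w. \<phi> (h w))"
 proof (rule continuous_at_imp_continuous_on, rule ballI)
  fix w assume w: "w \<in> D"
  have "isCont \<phi> (h w)" using der[OF w] DERIV_isCont by blast
  moreover have "h differentiable (at w)" using h[of "Suc 0"] w by simp
  then have "isCont h w" by (rule differentiable_imp_continuous_within)
  ultimately show "isCont (\<lambda>w. \<phi> (h w)) w" using isCont_o2 by blast
 qed
 then show ?case by simp
next
 case (Suc k)
 have dh: "(h has_derivative (\<lambda>v. dd v h w)) (at w)" if "w \<in> D" for w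
  using h[of "Suc 0"] that by (intro has_derivative_dd) simp
 have der': "((\<lambda>w. \<phi> (h w)) has_derivative (\<lambda>v. \<phi>' w * dd v h w)) (at w)" if "w \<in> D" for w
  using has_derivative_compose[OF dh[OF that]] der[OF that] unfolding has_field_derivative_def by blast
 have e: "dd v (\<lambda>w. \<phi> (h w)) w = \<phi>' w * dd v h w" if "w \<in> D" for v w by (rule dd_eqI[OF der'[OF that]])
 have d: "(\<lambda>w. \<phi> (h w)) differentiable at w" if "w \<in> D" for w by (rule differentiableI[OF der'[OF that]])
 have "C_k_on k D (dd 1 h)" "C_k_on k D (dd \<i> h)" using h[of "Suc k"] by simp_all
 then have "C_k_on k D (\<lambda>w. \<phi>' w * dd 1 h w)" "C_k_on k D (\<lambda>w. \<phi>' w * dd \<i> h w)"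
  using C_k_on_bilinear[OF D bounded_bilinear_mult step[OF Suc]] by blast+
 then have "C_k_on k D (dd 1 (\<lambda>w. \<phi> (h w)))" "C_k_on k D (dd \<i> (\<lambda>w. \<phi> (h w)))"
  using C_k_on_cong[OF D, of "dd 1 (\<lambda>w. \<phi> (h w))" "\<lambda>w. \<phi>' w * dd 1 h w" k, OF e]
   C_k_on_cong[OF D, of "dd \<i> (\<lambda>w. \<phi> (h w))" "\<lambda>w. \<phi>' w * dd \<i> h w" k, OF e] by blast+
 then show ?case using d by simp
qed

lemma smooth_on_const: "smooth_on D (\<lambda>w. c)" by (simp add: smooth_on_def C_k_on_const)

lemma smooth_on_add: "open D \<Longrightarrow> smooth_on D g \<Longrightarrow> smooth_on D h \<Longrightarrow> smooth_on D (\<lambda>w. g w + h w)"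
 by (simp add: smooth_on_def C_k_on_add)

lemma smooth_on_linear: "open D \<Longrightarrow> bounded_linear L \<Longrightarrow> smooth_on D g \<Longrightarrow> smooth_on D (\<lambda>w. L (g w))"
 by (simp add: smooth_on_def C_k_on_linear)

lemma smooth_on_bilinear:
 "open D \<Longrightarrow> bounded_bilinear P \<Longrightarrow> smooth_on D g \<Longrightarrow> smooth_on D h \<Longrightarrow> smooth_on D (\<lambda>w. P (g w) (h w))"
 by (simp add: smooth_on_def C_k_on_bilinear)

lemma smooth_on_minus: "open D \<Longrightarrow> smooth_on D g \<Longrightarrow> smooth_on D (\<lambda>w. - g w)"
 by (rule smooth_on_linear) (auto intro: bounded_linear_minus bounded_linear_ident)

lemma smooth_on_diff: "open D \<Longrightarrow> smooth_on D g \<Longrightarrow> smooth_on D h \<Longrightarrow> smooth_on D (\<lambda>w. g w - h w)"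
 using smooth_on_add[of D g "\<lambda>w. - h w"] smooth_on_minus[of D h] by simp

lemma smooth_on_mult:
 fixes g h :: "complex \<Rightarrow> 'b::real_normed_algebra"
 shows "open D \<Longrightarrow> smooth_on D g \<Longrightarrow> smooth_on D h \<Longrightarrow> smooth_on D (\<lambda>w. g w * h w)"
 by (rule smooth_on_bilinear[OF _ bounded_bilinear_mult])

lemma smooth_on_scaleR:
 "open D \<Longrightarrow> smooth_on D g \<Longrightarrow> smooth_on D h \<Longrightarrow> smooth_on D (\<lambda>w. g w *\<^sub>R h w)"
 by (rule smooth_on_bilinear[OF _ bounded_bilinear_scaleR])

lemma smooth_on_inner:
 "open D \<Longrightarrow> smooth_on D g \<Longrightarrow> smooth_on D h \<Longrightarrow> smooth_on D (\<lambda>w. g w \<bullet> h w)"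
 by (rule smooth_on_bilinear[OF _ bounded_bilinear_inner])

lemma smooth_on_sum:
 assumes "open D" "\<And>i. i \<in> I \<Longrightarrow> smooth_on D (g i)"
 shows "smooth_on D (\<lambda>w. \<Sum>i\<in>I. g i w)"
 using assms(2) by (induction I rule: infinite_finite_induct) (auto intro: smooth_on_const smooth_on_add assms(1))

lemma smooth_on_prod:
 fixes g :: "'i \<Rightarrow> complex \<Rightarrow> real"
 assumes "open D" "\<And>i. i \<in> I \<Longrightarrow> smooth_on D (g i)"
 shows "smooth_on D (\<lambda>w. \<Prod>i\<in>I. g i w)"
 using assms(2) by (induction I rule: infinite_finite_induct) (auto intro: smooth_on_const smooth_on_mult assms(1))

lemma smooth_on_inverse:
 fixes h :: "complex \<Rightarrow> real"
 assumes D: "open D" and h: "smooth_on D h" and nz: "\<And>w. w \<in> D \<Longrightarrow> h w \<noteq> 0"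
 shows "smooth_on D (\<lambda>w. inverse (h w))" unfolding smooth_on_def
proof (rule allI, rule C_k_on_compose_real[OF D, where \<phi> = inverse and h = h and \<phi>' = "\<lambda>w. - (inverse (h w) * inverse (h w))"])
 show "(inverse has_real_derivative - (inverse (h w) * inverse (h w))) (at (h w))" if "w \<in> D" for w
  using DERIV_inverse[OF nz[OF that]] by (simp add: power2_eq_square)
 show "C_k_on k D (\<lambda>w. - (inverse (h w) * inverse (h w)))" if "C_k_on k D (\<lambda>w. inverse (h w))" for k
  by (rule C_k_on_linear[OF D bounded_linear_minus[OF bounded_linear_ident]])
    (rule C_k_on_bilinear[OF D bounded_bilinear_mult that that])
qed (use h in \<open>simp add: smooth_on_def\<close>)

lemma smooth_on_divide:
 fixes h :: "complex \<Rightarrow> real"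
 assumes D: "open D" and "smooth_on D g" "smooth_on D h" and nz: "\<And>w. w \<in> D \<Longrightarrow> h w \<noteq> 0"
 shows "smooth_on D (\<lambda>w. g w / h w)"
 unfolding divide_inverse by (intro smooth_on_mult D assms smooth_on_inverse)

lemma smooth_on_sqrt:
 fixes h :: "complex \<Rightarrow> real"
 assumes D: "open D" and h: "smooth_on D h" and nz: "\<And>w. w \<in> D \<Longrightarrow> 0 < h w"
 shows "smooth_on D (\<lambda>w. sqrt (h w))" unfolding smooth_on_def
proof (rule allI, rule C_k_on_compose_real[OF D, where \<phi> = sqrt and h = h and \<phi>' = "\<lambda>w. inverse (sqrt (h w)) / 2"])
 show "(sqrt has_real_derivative inverse (sqrt (h w)) / 2) (at (h w))" if "w \<in> D" for w
  using DERIV_real_sqrt[OF nz[OF that]] .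
 have inv: "smooth_on E (\<lambda>w. inverse (h w))" if "E = D" for E
  using smooth_on_inverse[OF D h] nz that by fastforce
 show "C_k_on k D (\<lambda>w. inverse (sqrt (h w)) / 2)" if C: "C_k_on k D (\<lambda>w. sqrt (h w))" for k
 proof -
  \<comment> \<open>The derivative is rewritten as \<open>sqrt (h w) * inverse (h w) / 2\<close>, so
    that the square root enters only as a factor and its regularity of order k suffices.\<close>
  have "C_k_on k D (\<lambda>w. (sqrt (h w) * inverse (h w)) / 2)" using inv[OF refl]
   by (intro C_k_on_linear[OF D bounded_linear_divide] C_k_on_bilinear[OF D bounded_bilinear_mult C])
     (simp add: smooth_on_def)
  moreover have "(sqrt (h w) * inverse (h w)) / 2 = inverse (sqrt (h w)) / 2" if "w \<in> D" for w
   using nz[OF that] by (simp add: field_simps real_sqrt_pow2 power2_eq_square[symmetric])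
  ultimately show ?thesis
   using C_k_on_cong[OF D, of "\<lambda>w. (sqrt (h w) * inverse (h w)) / 2" "\<lambda>w. inverse (sqrt (h w)) / 2"] by simp
 qed
qed (use h in \<open>simp add: smooth_on_def\<close>)

lemma smooth_on_norm:
 fixes g :: "complex \<Rightarrow> 'b::euclidean_space"
 assumes D: "open D" and g: "smooth_on D g" and nz: "\<And>w. w \<in> D \<Longrightarrow> g w \<noteq> 0"
 shows "smooth_on D (\<lambda>w. norm (g w))"
 unfolding norm_eq_sqrt_inner using nz by (intro smooth_on_sqrt smooth_on_inner D g) simp

lemma smooth_on_dd:
 assumes "open D" "smooth_on D g"
 shows "smooth_on D (dd v g)"
proof -
 have "C_k_on (Suc k) D g" for k using assms(2) unfolding smooth_on_def by blast
 then have "smooth_on D (dd 1 g)" "smooth_on D (dd \<i> g)" by (simp_all add: smooth_on_def)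
 then have "smooth_on D (\<lambda>w. Re v *\<^sub>R dd 1 g w + Im v *\<^sub>R dd \<i> g w)"
  by (intro smooth_on_add assms(1) smooth_on_scaleR smooth_on_const)
 moreover have "dd v g w = Re v *\<^sub>R dd 1 g w + Im v *\<^sub>R dd \<i> g w" if "w \<in> D" for w
  by (rule dd_linear[OF smooth_on_differentiable[OF assms(2) that]])
 ultimately show ?thesis
  using smooth_on_cong[OF assms(1), of "dd v g" "\<lambda>w. Re v *\<^sub>R dd 1 g w + Im v *\<^sub>R dd \<i> g w"] by blast
qed

lemma dd_holomorphic: "h field_differentiable (at w) \<Longrightarrow> dd v h w = deriv h w * v"
 by (rule dd_eqI) (use field_differentiable_derivI has_field_derivative_def in blast)

lemma smooth_on_holomorphic:
 assumes D: "open D" and "h holomorphic_on D"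
 shows "smooth_on D h"
proof -
 have "C_k_on k D h" for k using assms(2)
 proof (induction k arbitrary: h)
  case 0
  then show ?case by (simp add: holomorphic_on_imp_continuous_on)
 next
  case (Suc k)
  have fd: "h field_differentiable (at w)" if "w \<in> D" for w
   using Suc.prems D that holomorphic_on_imp_differentiable_at by blast
  have "C_k_on k D (\<lambda>w. deriv h w * v)" for v
   by (rule C_k_on_linear[OF D bounded_linear_mult_left Suc.IH[OF holomorphic_deriv[OF Suc.prems D]]])
  then have "C_k_on k D (dd v h)" for v
   using C_k_on_cong[OF D, of "dd v h" "\<lambda>w. deriv h w * v"] dd_holomorphic[OF fd] by simp
  then show ?case using fd field_differentiable_imp_differentiable by auto
 qed
 then show ?thesis by (simp add: smooth_on_def)
qed

lemma dd_compose_holomorphic: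
 assumes "\<tau> field_differentiable (at w)" "g differentiable (at (\<tau> w))"
 shows "dd v (\<lambda>w. g (\<tau> w)) w = dd (deriv \<tau> w * v) g (\<tau> w)"
  and "(\<lambda>w. g (\<tau> w)) differentiable (at w)"
proof -
 have "(\<tau> has_derivative (\<lambda>v. deriv \<tau> w * v)) (at w)"
  using field_differentiable_derivI[OF assms(1)] unfolding has_field_derivative_def .
 from has_derivative_compose[OF this has_derivative_dd[OF assms(2)]]
 show "dd v (\<lambda>w. g (\<tau> w)) w = dd (deriv \<tau> w * v) g (\<tau> w)" "(\<lambda>w. g (\<tau> w)) differentiable (at w)"
  using dd_eqI[of "\<lambda>w. g (\<tau> w)"] differentiableI by blast+
qed

text \<open>By induction on the order with g arbitrary: a derivative of the composite is a
  combination of derivatives of g composed with \<tau>, with coefficients built from the holomorphic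
  function \<tau>'.\<close>

lemma smooth_on_compose_holomorphic:
 assumes D: "open D" and E: "open E" and t: "\<tau> holomorphic_on E" "\<tau> ` E \<subseteq> D" and "smooth_on D g"
 shows "smooth_on E (\<lambda>w. g (\<tau> w))"
proof -
 have fd: "\<tau> field_differentiable (at w)" if "w \<in> E" for w
  using t(1) E that holomorphic_on_imp_differentiable_at by blast
 have sd: "smooth_on E (\<lambda>w. deriv \<tau> w * v)" for v
  by (rule smooth_on_linear[OF E bounded_linear_mult_left smooth_on_holomorphic[OF E holomorphic_deriv[OF t(1) E]]])
 have "C_k_on k E (\<lambda>w. g (\<tau> w))" if "smooth_on D g" for k and g :: "complex \<Rightarrow> 'a" using that
 proof (induction k arbitrary: g)
  case 0
  have "continuous_on E \<tau>" using t(1) holomorphic_on_imp_continuous_on by blast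
  then show ?case using continuous_on_compose2[OF smooth_on_continuous_on[OF 0] _ t(2)] by simp
 next
  case (Suc k)
  have d: "g differentiable (at (\<tau> w))" if "w \<in> E" for w
   using Suc.prems t(2) that smooth_on_differentiable by blast
  have "C_k_on k E (\<lambda>w. Re (deriv \<tau> w * v) *\<^sub>R dd 1 g (\<tau> w) + Im (deriv \<tau> w * v) *\<^sub>R dd \<i> g (\<tau> w))" for v
  proof -
   have sdk: "C_k_on k E (\<lambda>w. deriv \<tau> w * v)" using sd[of v] unfolding smooth_on_def by blast
   have "C_k_on k E (\<lambda>w. dd u g (\<tau> w))" for u using Suc.IH[OF smooth_on_dd[OF D Suc.prems, of u]] .
   then show ?thesis by (intro C_k_on_add[OF E] C_k_on_bilinear[OF E bounded_bilinear_scaleR]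
       C_k_on_linear[OF E bounded_linear_Re sdk] C_k_on_linear[OF E bounded_linear_Im sdk])
  qed
  moreover have "dd v (\<lambda>w. g (\<tau> w)) w = Re (deriv \<tau> w * v) *\<^sub>R dd 1 g (\<tau> w) + Im (deriv \<tau> w * v) *\<^sub>R dd \<i> g (\<tau> w)"
   if "w \<in> E" for v w
   unfolding dd_compose_holomorphic(1)[OF fd[OF that] d[OF that], of v] by (rule dd_linear[OF d[OF that]])
  ultimately have "C_k_on k E (dd v (\<lambda>w. g (\<tau> w)))" for v
   using C_k_on_cong[OF E, of "dd v (\<lambda>w. g (\<tau> w))" "\<lambda>w. Re (deriv \<tau> w * v) *\<^sub>R dd 1 g (\<tau> w) + Im (deriv \<tau> w * v) *\<^sub>R dd \<i> g (\<tau> w)" k] by blast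
  moreover have "(\<lambda>w. g (\<tau> w)) differentiable (at w)" if "w \<in> E" for w
   by (rule dd_compose_holomorphic(2)[OF fd[OF that] d[OF that]])
  ultimately show ?case by simp
 qed
 then show ?thesis using assms(5) unfolding smooth_on_def[of E] by blast
qed

section \<open>Symmetry of mixed second derivatives\<close>

lemma second_derivative_mvt:
 fixes h :: "complex \<Rightarrow> real"
 assumes B: "ball w r \<subseteq> D" and h: "smooth_on D h" and D: "open D" and t: "0 < t" "2 * t < r"
  and uv: "cmod u = 1" "cmod v = 1"
 shows "\<exists>p. dist w p \<le> 2 * t \<and>
  h (w + of_real t * u + of_real t * v) - h (w + of_real t * u) - h (w + of_real t * v) + h w
   = t\<^sup>2 * dd v (dd u h) p"
proof -
 have dist_add: "dist w (w + x) = cmod x" for x by (simp add: dist_norm)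
 have inD: "w + of_real s * u + of_real s' * v \<in> D" if "0 \<le> s" "s \<le> t" "0 \<le> s'" "s' \<le> t" for s s'
 proof -
  have "cmod (of_real s * u + of_real s' * v) \<le> s + s'"
   using norm_triangle_ineq[of "of_real s * u" "of_real s' * v"] that uv by (simp add: norm_mult)
  also have "\<dots> < r" using that t by linarith
  finally have "dist w (w + (of_real s * u + of_real s' * v)) < r" by (simp only: dist_add)
  then show ?thesis using B by (auto simp: add.assoc)
 qed
 have der: "((\<lambda>s. g (a + of_real s * x)) has_real_derivative dd x g (a + of_real s * x)) (at s)"
  if "a + of_real s * x \<in> D" "smooth_on D g" for s a x and g :: "complex \<Rightarrow> real"
 proof -
  have "((\<lambda>s. a + of_real s * x) has_derivative (\<lambda>s'. of_real s' * x)) (at s)"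
   by (auto intro!: derivative_eq_intros)
  from has_derivative_compose[OF this has_derivative_dd[OF smooth_on_differentiable[OF that(2,1)]]]
  have "((\<lambda>s. g (a + of_real s * x)) has_derivative (\<lambda>s'. dd (of_real s' * x) g (a + of_real s * x))) (at s)" .
  moreover have "dd (of_real s' * x) g (a + of_real s * x) = dd x g (a + of_real s * x) * s'" for s'
   using dd_linear[OF smooth_on_differentiable[OF that(2,1)], of "of_real s' * x"]
      dd_linear[OF smooth_on_differentiable[OF that(2,1)], of x] by (simp add: algebra_simps)
  ultimately show ?thesis by (simp add: has_field_derivative_def)
 qed
 \<comment> \<open>The first difference in direction v, as a function of the step along u. The mean
   value theorem is applied to it and then to \<open>dd u h\<close> along v.\<close>
 define \<phi> where "\<phi> s = h (w + of_real t * v + of_real s * u) - h (w + of_real s * u)" for s :: real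
 have "DERIV \<phi> s :> dd u h (w + of_real t * v + of_real s * u) - dd u h (w + of_real s * u)"
  if "0 \<le> s" "s \<le> t" for s unfolding \<phi>_def using inD[OF that, of t] inD[OF that, of 0] t
  by (intro DERIV_diff der h) (simp_all add: algebra_simps)
 from MVT2[OF t(1) this] obtain \<xi> where xi: "0 < \<xi>" "\<xi> < t"
  "\<phi> t - \<phi> 0 = t * (dd u h (w + of_real t * v + of_real \<xi> * u) - dd u h (w + of_real \<xi> * u))" by auto
 have "DERIV (\<lambda>s. dd u h (w + of_real \<xi> * u + of_real s * v)) s :> dd v (dd u h) (w + of_real \<xi> * u + of_real s * v)"
  if "0 \<le> s" "s \<le> t" for s using inD[of \<xi> s] that xi by (intro der smooth_on_dd D h) auto
 from MVT2[OF t(1) this] obtain \<eta> where eta: "0 < \<eta>" "\<eta> < t"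
  "dd u h (w + of_real \<xi> * u + of_real t * v) - dd u h (w + of_real \<xi> * u) = t * dd v (dd u h) (w + of_real \<xi> * u + of_real \<eta> * v)"
  by auto
 have "cmod (of_real \<xi> * u + of_real \<eta> * v) \<le> \<xi> + \<eta>"
  using norm_triangle_ineq[of "of_real \<xi> * u" "of_real \<eta> * v"] xi eta uv by (simp add: norm_mult)
 then have "dist w (w + of_real \<xi> * u + of_real \<eta> * v) \<le> 2 * t"
  using xi eta by (simp only: dist_add add.assoc)
 moreover have "h (w + of_real t * u + of_real t * v) - h (w + of_real t * u) - h (w + of_real t * v) + h w = \<phi> t - \<phi> 0"
  by (simp add: \<phi>_def algebra_simps)
 moreover have "\<phi> t - \<phi> 0 = t\<^sup>2 * dd v (dd u h) (w + of_real \<xi> * u + of_real \<eta> * v)"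
  using xi(3) eta(3) by (simp add: algebra_simps power2_eq_square)
 ultimately show ?thesis by metis
qed

text \<open>The second difference over a small square is symmetric in the two directions, so by
  \<open>second_derivative_mvt\<close> it equals t^2 times either mixed derivative at some nearby
  point. Continuity of both mixed derivatives then forces equality at w.\<close>

lemma dd_commute_real:
 fixes h :: "complex \<Rightarrow> real"
 assumes D: "open D" and h: "smooth_on D h" and w: "w \<in> D"
 shows "dd \<i> (dd 1 h) w = dd 1 (dd \<i> h) w"
proof (rule ccontr)
 let ?a = "dd \<i> (dd 1 h)" and ?b = "dd 1 (dd \<i> h)"
 assume ne: "?a w \<noteq> ?b w"
 define e where "e = \<bar>?a w - ?b w\<bar> / 2"
 have e: "e > 0" using ne by (simp add: e_def)
 have c: "isCont ?a w" "isCont ?b w"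
  using smooth_on_continuous_on[OF smooth_on_dd[OF D smooth_on_dd[OF D h]]] D w continuous_on_eq_continuous_at by blast+
 obtain r where r: "r > 0" "ball w r \<subseteq> D" using D w openE by blast
 obtain d1 where d1: "d1 > 0" "\<And>x. dist w x < d1 \<Longrightarrow> dist (?a w) (?a x) < e"
  using c(1) e unfolding continuous_at_eps_delta by (metis dist_commute)
 obtain d2 where d2: "d2 > 0" "\<And>x. dist w x < d2 \<Longrightarrow> dist (?b w) (?b x) < e"
  using c(2) e unfolding continuous_at_eps_delta by (metis dist_commute)
 \<comment> \<open>The divisor 3 keeps points at distance up to 2 t strictly within all three
   radii.\<close>
 define t where "t = min r (min d1 d2) / 3"
 have t: "0 < t" "2 * t < r" "2 * t < d1" "2 * t < d2" using r d1 d2 by (auto simp: t_def)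
 obtain p where p: "dist w p \<le> 2 * t"
  "h (w + of_real t * 1 + of_real t * \<i>) - h (w + of_real t * 1) - h (w + of_real t * \<i>) + h w = t\<^sup>2 * ?a p"
  using second_derivative_mvt[OF r(2) h D t(1,2), of 1 \<i>] by auto
 obtain q where q: "dist w q \<le> 2 * t"
  "h (w + of_real t * \<i> + of_real t * 1) - h (w + of_real t * \<i>) - h (w + of_real t * 1) + h w = t\<^sup>2 * ?b q"
  using second_derivative_mvt[OF r(2) h D t(1,2), of \<i> 1] by auto
 have "t\<^sup>2 * ?a p = t\<^sup>2 * ?b q" using p(2) q(2) by (simp add: algebra_simps)
 then have "?a p = ?b q" using t by simp
 moreover have "dist (?a w) (?a p) < e" "dist (?b w) (?b q) < e" using d1(2) d2(2) p(1) q(1) t by auto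
 ultimately show False unfolding e_def dist_real_def by (smt (verit) field_sum_of_halves)
qed

lemma dd_linear_map:
 assumes "bounded_linear L" "g differentiable (at w)"
 shows "dd v (\<lambda>w. L (g w)) w = L (dd v g w)"
 using dd_eqI[OF bounded_linear.has_derivative[OF assms(1) has_derivative_dd[OF assms(2)]]] .

lemma dd_commute:
 fixes h :: "complex \<Rightarrow> 'b::euclidean_space"
 assumes D: "open D" and h: "smooth_on D h" and w: "w \<in> D"
 shows "dd \<i> (dd 1 h) w = dd 1 (dd \<i> h) w"
proof (rule euclidean_eqI)
 fix b :: 'b
 have L: "bounded_linear (\<lambda>x::'b. x \<bullet> b)" by (rule bounded_linear_inner_left)
 have "dd v (dd u h) w \<bullet> b = dd v (dd u (\<lambda>w. h w \<bullet> b)) w" for u v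
 proof -
  have "dd v (dd u (\<lambda>w. h w \<bullet> b)) w = dd v (\<lambda>w. dd u h w \<bullet> b) w"
   using dd_linear_map[OF L smooth_on_differentiable[OF h]] by (intro dd_cong[OF D w])
  also have "\<dots> = dd v (dd u h) w \<bullet> b"
   by (rule dd_linear_map[OF L smooth_on_differentiable[OF smooth_on_dd[OF D h] w]])
  finally show ?thesis by simp
 qed
 then show "dd \<i> (dd 1 h) w \<bullet> b = dd 1 (dd \<i> h) w \<bullet> b"
  using dd_commute_real[OF D smooth_on_inner[OF D h smooth_on_const] w] by simp
qed

section \<open>The complex bilinear product and orthogonal frames\<close>

definition Re_vec :: "complex^'n \<Rightarrow> real^'n" where "Re_vec x = (\<chi> i. Re (x $ i))"
definition Im_vec :: "complex^'n \<Rightarrow> real^'n" where "Im_vec x = (\<chi> i. Im (x $ i))"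

lemma vec_eq_Re_Im: "x = cvec (Re_vec x) + \<i> *s cvec (Im_vec x)"
 by (simp add: vec_eq_iff cvec_def Re_vec_def Im_vec_def complex_eq_iff)

lemma scaleR_smult: "r *\<^sub>R (x::complex^'n) = complex_of_real r *s x"
 unfolding vec_eq_iff by (simp add: complex_eq_iff)

lemma cdot_commute: "cdot x y = cdot y x" by (simp add: cdot_def mult.commute)

lemma cdot_simps:
 "cdot (x + y) z = cdot x z + cdot y z" "cdot z (x + y) = cdot z x + cdot z y"
 "cdot (x - y) z = cdot x z - cdot y z" "cdot z (x - y) = cdot z x - cdot z y"
 "cdot (- x) z = - cdot x z" "cdot z (- x) = - cdot z x"
 "cdot (c *s x) z = c * cdot x z" "cdot z (c *s x) = c * cdot z x"
 "cdot 0 z = 0" "cdot z 0 = 0"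
 by (simp_all add: cdot_def sum.distrib sum_subtractf sum_negf sum_distrib_left algebra_simps)

lemma conj_vec_simps:
 "conj_vec (conj_vec x) = x" "conj_vec (x + y) = conj_vec x + conj_vec y"
 "conj_vec (x - y) = conj_vec x - conj_vec y" "conj_vec (- x) = - conj_vec x"
 "conj_vec (c *s x) = cnj c *s conj_vec x" "conj_vec 0 = 0" "conj_vec (cvec a) = cvec a"
 by (simp_all add: conj_vec_def cvec_def vec_eq_iff)

lemma cdot_conj: "cdot (conj_vec x) (conj_vec y) = cnj (cdot x y)" by (simp add: cdot_def conj_vec_def)

lemma cdot_conj_left: "cdot (conj_vec x) y = cnj (cdot x (conj_vec y))"
 using cdot_conj[of x "conj_vec y"] by (simp add: conj_vec_simps)

lemma cvec_simps:
 "cvec (a + b) = cvec a + cvec b" "cvec (a - b) = cvec a - cvec b" "cvec (- a) = - cvec a"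
 "cvec (r *\<^sub>R a) = of_real r *s cvec a" "cvec 0 = 0" by (simp_all add: cvec_def vec_eq_iff)

lemma cvec_inject: "cvec a = cvec b \<longleftrightarrow> a = b" by (simp add: cvec_def vec_eq_iff)

lemma cdot_cvec: "cdot (cvec a) (cvec b) = of_real (a \<bullet> b)" by (simp add: cdot_def cvec_def inner_vec_def)

lemma Re_Im_vec_simps:
 "Re_vec (cvec a) = a" "Im_vec (cvec a) = 0"
 "Re_vec (x + y) = Re_vec x + Re_vec y" "Im_vec (x + y) = Im_vec x + Im_vec y"
 "Re_vec (x - y) = Re_vec x - Re_vec y" "Im_vec (x - y) = Im_vec x - Im_vec y"
 "Re_vec (c *s x) = Re c *\<^sub>R Re_vec x - Im c *\<^sub>R Im_vec x"
 "Im_vec (c *s x) = Re c *\<^sub>R Im_vec x + Im c *\<^sub>R Re_vec x"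
 "Re_vec (conj_vec x) = Re_vec x" "Im_vec (conj_vec x) = - Im_vec x"
 by (simp_all add: Re_vec_def Im_vec_def cvec_def conj_vec_def vec_eq_iff)

lemma cdot_self_conj: "cdot x (conj_vec x) = of_real ((norm (Re_vec x))\<^sup>2 + (norm (Im_vec x))\<^sup>2)"
 unfolding power2_norm_eq_inner
 by (simp add: cdot_def conj_vec_def Re_vec_def Im_vec_def inner_vec_def complex_eq_iff
   sum.distrib mult.commute)

lemma cdot_self_conj_norm: "cdot x (conj_vec x) = of_real ((norm x)\<^sup>2)" unfolding power2_norm_eq_inner
 by (simp add: cdot_def conj_vec_def inner_vec_def complex_eq_iff inner_complex_def mult.commute)

lemma cdot_self_conj_pos: "x \<noteq> 0 \<Longrightarrow> 0 < Re (cdot x (conj_vec x))" "Im (cdot x (conj_vec x)) = 0"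
 "x \<noteq> 0 \<Longrightarrow> cdot x (conj_vec x) \<noteq> 0" by (simp_all add: cdot_self_conj_norm)

lemma bounded_bilinear_smult: "bounded_bilinear ((*s) :: complex \<Rightarrow> complex^'n \<Rightarrow> complex^'n)"
 unfolding bilinear_conv_bounded_bilinear[symmetric] bilinear_def
 by (auto intro!: linearI simp: scaleR_smult vec_eq_iff algebra_simps scaleR_conv_of_real)

lemma bounded_bilinear_cdot: "bounded_bilinear (cdot :: complex^'n \<Rightarrow> complex^'n \<Rightarrow> complex)"
 unfolding bilinear_conv_bounded_bilinear[symmetric] bilinear_def
 by (auto intro!: linearI simp: scaleR_smult cdot_simps scaleR_conv_of_real)

lemma bounded_linear_conj_vec: "bounded_linear (conj_vec :: complex^'n \<Rightarrow> complex^'n)"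
 unfolding linear_conv_bounded_linear[symmetric] by (auto intro!: linearI simp: scaleR_smult conj_vec_simps)

lemma bounded_linear_cvec: "bounded_linear (cvec :: real^'n \<Rightarrow> complex^'n)"
 unfolding linear_conv_bounded_linear[symmetric] by (auto intro!: linearI simp: scaleR_smult cvec_simps)

lemma bounded_linear_Re_vec: "bounded_linear (Re_vec :: complex^'n \<Rightarrow> real^'n)"
 unfolding linear_conv_bounded_linear[symmetric] by (auto intro!: linearI simp: scaleR_smult Re_Im_vec_simps)

lemma bounded_linear_Im_vec: "bounded_linear (Im_vec :: complex^'n \<Rightarrow> real^'n)"
 unfolding linear_conv_bounded_linear[symmetric] by (auto intro!: linearI simp: scaleR_smult Re_Im_vec_simps)

text \<open>Stating orthogonality by \<open>sorted_wrt\<close> on a list lets a concrete frame be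
  checked by simplification, with one product for each pair of positions i < j.\<close>

lemma orthogonal_frame_zero:
 fixes y :: "'b::euclidean_space"
 assumes "sorted_wrt (\<lambda>u v. u \<bullet> v = 0) es" "0 \<notin> set es" "length es = DIM('b)"
  and "\<And>u. u \<in> set es \<Longrightarrow> y \<bullet> u = 0"
 shows "y = 0"
proof -
 have d: "distinct es \<and> pairwise orthogonal (set es)" using assms(1,2)
 proof (induction es)
  case (Cons u es)
  then have "u \<bullet> u \<noteq> 0" by simp
  then show ?case using Cons by (auto simp: pairwise_insert orthogonal_def inner_commute)
 qed simp
 then have "independent (set es)" using pairwise_orthogonal_independent assms(2) by blast
 moreover have "card (set es) = DIM('b)" using d assms(3) distinct_card by fastforce
 ultimately have "UNIV \<subseteq> span (set es)" by (intro card_ge_dim_independent) auto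
 moreover have "orthogonal y x" if "x \<in> span (set es)" for x
  using orthogonal_to_span[OF that] assms(4) by (simp add: orthogonal_def)
 ultimately have "orthogonal y y" by blast
 then show ?thesis by (simp add: orthogonal_def)
qed

text \<open>The frame is real, so the claim splits into the real case for the two parts of y.
  Identities in \<complex>^n are proved below by testing the difference of both sides on such a
  frame.\<close>

lemma orthogonal_frame_zero_complex:
 fixes y :: "complex^'n"
 assumes "sorted_wrt (\<lambda>u v. u \<bullet> v = 0) es" "0 \<notin> set es" "length es = CARD('n)"
  and "\<And>u. u \<in> set es \<Longrightarrow> cdot y (cvec u) = 0"
 shows "y = 0"
proof -
 have e: "cdot y (cvec u) = of_real (Re_vec y \<bullet> u) + \<i> * of_real (Im_vec y \<bullet> u)" for u
  by (subst vec_eq_Re_Im[of y]) (simp add: cdot_simps cdot_cvec)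
 have "Re_vec y = 0" by (rule orthogonal_frame_zero[OF assms(1,2)])
    (use assms(3,4) e in \<open>auto simp: complex_eq_iff\<close>)
 moreover have "Im_vec y = 0" by (rule orthogonal_frame_zero[OF assms(1,2)])
    (use assms(3,4) e in \<open>auto simp: complex_eq_iff\<close>)
 ultimately show ?thesis using vec_eq_Re_Im[of y] by (simp add: cvec_simps)
qed

subsection \<open>Wirtinger derivatives\<close>

definition delb :: "(complex \<Rightarrow> complex^'n) \<Rightarrow> complex \<Rightarrow> complex^'n" where
 "delb h w = (1/2) *s (dd 1 h w + \<i> *s dd \<i> h w)"

definition dz :: "(complex \<Rightarrow> complex) \<Rightarrow> complex \<Rightarrow> complex" where
 "dz h w = (dd 1 h w - \<i> * dd \<i> h w) / 2"

definition dzb :: "(complex \<Rightarrow> complex) \<Rightarrow> complex \<Rightarrow> complex" where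
 "dzb h w = (dd 1 h w + \<i> * dd \<i> h w) / 2"

text \<open>A real linear map of v has exactly one form \<open>v *s a + cnj v *s b\<close>. All
  product and chain rules below come from sorting a derivative into this form.\<close>

lemma del_delb_eqI:
 assumes "(h has_derivative (\<lambda>v. v *s a + cnj v *s b)) (at w)"
 shows "del h w = a" "delb h w = b"
proof -
 have 1: "dd 1 h w = a + b" "dd \<i> h w = \<i> *s a - \<i> *s b"
  using dd_eqI[OF assms, of 1] dd_eqI[OF assms, of \<i>] by (simp_all add: vec_eq_iff)
 show "del h w = a" "delb h w = b" unfolding del_def delb_def 1 by (simp_all add: vec_eq_iff algebra_simps)
qed

lemma dz_dzb_eqI:
 assumes "(h has_derivative (\<lambda>v. v * a + cnj v * b)) (at w)"
 shows "dz h w = a" "dzb h w = b"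
proof -
 have 1: "dd 1 h w = a + b" "dd \<i> h w = \<i> * a - \<i> * b"
  using dd_eqI[OF assms, of 1] dd_eqI[OF assms, of \<i>] by simp_all
 show "dz h w = a" "dzb h w = b" unfolding dz_def dzb_def 1 by (simp_all add: algebra_simps)
qed

lemma dd_del:
 assumes "h differentiable (at w)"
 shows "dd v h w = v *s del h w + cnj v *s delb h w" unfolding dd_linear[OF assms, of v] del_def delb_def
 by (simp add: vec_eq_iff complex_eq_iff field_simps)

lemma dd_dz:
 fixes h :: "complex \<Rightarrow> complex"
 assumes "h differentiable (at w)"
 shows "dd v h w = v * dz h w + cnj v * dzb h w" unfolding dd_linear[OF assms, of v] dz_def dzb_def
 by (simp add: complex_eq_iff field_simps)

lemma has_derivative_del:
 "h differentiable (at w) \<Longrightarrow> (h has_derivative (\<lambda>v. v *s del h w + cnj v *s delb h w)) (at w)"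
 by (rule has_derivative_eq_rhs[OF has_derivative_dd]) (simp_all add: dd_del)

lemma has_derivative_dz:
 fixes h :: "complex \<Rightarrow> complex"
 shows "h differentiable (at w) \<Longrightarrow> (h has_derivative (\<lambda>v. v * dz h w + cnj v * dzb h w)) (at w)"
 by (rule has_derivative_eq_rhs[OF has_derivative_dd]) (simp_all add: dd_dz)

lemma dz_cdot:
 assumes "u differentiable (at w)" "v differentiable (at w)"
 shows "dz (\<lambda>w. cdot (u w) (v w)) w = cdot (del u w) (v w) + cdot (u w) (del v w)"
  and "dzb (\<lambda>w. cdot (u w) (v w)) w = cdot (delb u w) (v w) + cdot (u w) (delb v w)"
proof -
 from bounded_bilinear.FDERIV[OF bounded_bilinear_cdot has_derivative_del[OF assms(1)] has_derivative_del[OF assms(2)]]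
 have "((\<lambda>w. cdot (u w) (v w)) has_derivative (\<lambda>x. x * (cdot (del u w) (v w) + cdot (u w) (del v w))
   + cnj x * (cdot (delb u w) (v w) + cdot (u w) (delb v w)))) (at w)"
  by (rule has_derivative_eq_rhs) (simp add: fun_eq_iff cdot_simps algebra_simps)
 from dz_dzb_eqI[OF this] show "dz (\<lambda>w. cdot (u w) (v w)) w = cdot (del u w) (v w) + cdot (u w) (del v w)"
  "dzb (\<lambda>w. cdot (u w) (v w)) w = cdot (delb u w) (v w) + cdot (u w) (delb v w)" by blast+
qed

lemma del_smult:
 assumes "k differentiable (at w)" "u differentiable (at w)"
 shows "del (\<lambda>w. k w *s u w) w = dz k w *s u w + k w *s del u w"
  and "delb (\<lambda>w. k w *s u w) w = dzb k w *s u w + k w *s delb u w"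
proof -
 from bounded_bilinear.FDERIV[OF bounded_bilinear_smult has_derivative_dz[OF assms(1)] has_derivative_del[OF assms(2)]]
 have "((\<lambda>w. k w *s u w) has_derivative (\<lambda>x. x *s (dz k w *s u w + k w *s del u w)
   + cnj x *s (dzb k w *s u w + k w *s delb u w))) (at w)"
  by (rule has_derivative_eq_rhs) (simp add: fun_eq_iff vec_eq_iff algebra_simps)
 from del_delb_eqI[OF this] show "del (\<lambda>w. k w *s u w) w = dz k w *s u w + k w *s del u w"
  "delb (\<lambda>w. k w *s u w) w = dzb k w *s u w + k w *s delb u w" by blast+
qed

lemma dz_mult:
 assumes "k differentiable (at w)" "u differentiable (at w)"
 shows "dz (\<lambda>w. k w * u w) w = dz k w * u w + k w * dz u w"
  and "dzb (\<lambda>w. k w * u w) w = dzb k w * u w + k w * dzb u w"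
proof -
 from bounded_bilinear.FDERIV[OF bounded_bilinear_mult has_derivative_dz[OF assms(1)] has_derivative_dz[OF assms(2)]]
 have "((\<lambda>w. k w * u w) has_derivative (\<lambda>x. x * (dz k w * u w + k w * dz u w)
   + cnj x * (dzb k w * u w + k w * dzb u w))) (at w)"
  by (rule has_derivative_eq_rhs) (simp add: fun_eq_iff algebra_simps)
 from dz_dzb_eqI[OF this] show "dz (\<lambda>w. k w * u w) w = dz k w * u w + k w * dz u w"
  "dzb (\<lambda>w. k w * u w) w = dzb k w * u w + k w * dzb u w" by blast+
qed

lemma del_add:
 assumes "u differentiable (at w)" "v differentiable (at w)"
 shows "del (\<lambda>w. u w + v w) w = del u w + del v w" "delb (\<lambda>w. u w + v w) w = delb u w + delb v w"
proof -
 from has_derivative_add[OF has_derivative_del[OF assms(1)] has_derivative_del[OF assms(2)]]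
 have "((\<lambda>w. u w + v w) has_derivative (\<lambda>x. x *s (del u w + del v w) + cnj x *s (delb u w + delb v w))) (at w)"
  by (rule has_derivative_eq_rhs) (simp add: fun_eq_iff vec_eq_iff algebra_simps)
 from del_delb_eqI[OF this] show "del (\<lambda>w. u w + v w) w = del u w + del v w" "delb (\<lambda>w. u w + v w) w = delb u w + delb v w" .
qed

lemma del_clinear:
 fixes L :: "complex^'n \<Rightarrow> complex^'m"
 assumes L: "\<And>x y. L (x + y) = L x + L y" "\<And>c x. L (c *s x) = c *s L x" and u: "u differentiable (at w)"
 shows "del (\<lambda>w. L (u w)) w = L (del u w)" "delb (\<lambda>w. L (u w)) w = L (delb u w)"
proof -
 have "linear L" using L by (intro linearI) (simp_all add: scaleR_smult)
 then have "bounded_linear L" by (simp add: linear_conv_bounded_linear)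
 from bounded_linear.has_derivative[OF this has_derivative_del[OF u]]
 have "((\<lambda>w. L (u w)) has_derivative (\<lambda>x. x *s L (del u w) + cnj x *s L (delb u w))) (at w)" by (simp add: L)
 from del_delb_eqI[OF this] show "del (\<lambda>w. L (u w)) w = L (del u w)" "delb (\<lambda>w. L (u w)) w = L (delb u w)" .
qed

lemma del_conj:
 assumes u: "u differentiable (at w)"
 shows "del (\<lambda>w. conj_vec (u w)) w = conj_vec (delb u w)" "delb (\<lambda>w. conj_vec (u w)) w = conj_vec (del u w)"
proof -
 from bounded_linear.has_derivative[OF bounded_linear_conj_vec has_derivative_del[OF u]]
 have "((\<lambda>w. conj_vec (u w)) has_derivative (\<lambda>x. x *s conj_vec (delb u w) + cnj x *s conj_vec (del u w))) (at w)"
  by (simp add: conj_vec_simps add.commute)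
 from del_delb_eqI[OF this] show "del (\<lambda>w. conj_vec (u w)) w = conj_vec (delb u w)" "delb (\<lambda>w. conj_vec (u w)) w = conj_vec (del u w)" .
qed

lemma del_compose:
 assumes t: "\<tau> field_differentiable (at w)" and u: "u differentiable (at (\<tau> w))"
 shows "del (\<lambda>w. u (\<tau> w)) w = deriv \<tau> w *s del u (\<tau> w)"
  "delb (\<lambda>w. u (\<tau> w)) w = cnj (deriv \<tau> w) *s delb u (\<tau> w)"
proof -
 have "(\<tau> has_derivative (\<lambda>v. deriv \<tau> w * v)) (at w)"
  using field_differentiable_derivI[OF t] unfolding has_field_derivative_def .
 from has_derivative_compose[OF this has_derivative_del[OF u]]
 have "((\<lambda>w. u (\<tau> w)) has_derivative (\<lambda>x. x *s (deriv \<tau> w *s del u (\<tau> w)) + cnj x *s (cnj (deriv \<tau> w) *s delb u (\<tau> w)))) (at w)"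
  by (rule has_derivative_eq_rhs) (simp add: fun_eq_iff vec_eq_iff algebra_simps)
 from del_delb_eqI[OF this] show "del (\<lambda>w. u (\<tau> w)) w = deriv \<tau> w *s del u (\<tau> w)"
  "delb (\<lambda>w. u (\<tau> w)) w = cnj (deriv \<tau> w) *s delb u (\<tau> w)" .
qed

lemma del_cong:
 assumes "open D" "w \<in> D" "\<And>x. x \<in> D \<Longrightarrow> g x = h x"
 shows "del g w = del h w" "delb g w = delb h w"
 unfolding del_def delb_def using dd_cong[OF assms] by simp_all

lemma dz_cong:
 assumes "open D" "w \<in> D" "\<And>x. x \<in> D \<Longrightarrow> g x = h x"
 shows "dz g w = dz h w" "dzb g w = dzb h w" unfolding dz_def dzb_def using dd_cong[OF assms] by simp_all

lemma dz_const: "dz (\<lambda>w. c) w = 0" "dzb (\<lambda>w. c) w = 0" by (simp_all add: dz_def dzb_def dd_def)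

lemma del_const: "del (\<lambda>w. c) w = 0" "delb (\<lambda>w. c) w = 0" by (simp_all add: del_def delb_def dd_def)

lemma cdot_eq_deriv:
 assumes D: "open D" "w \<in> D" and e: "\<And>x. x \<in> D \<Longrightarrow> cdot (u x) (v x) = k x"
  and d: "smooth_on D u" "smooth_on D v"
 shows "cdot (del u w) (v w) + cdot (u w) (del v w) = dz k w"
  and "cdot (delb u w) (v w) + cdot (u w) (delb v w) = dzb k w"
 using dz_cdot[OF smooth_on_differentiable[OF d(1) D(2)] smooth_on_differentiable[OF d(2) D(2)]]
  dz_cong[OF D e] by simp_all

lemma cdot_const_deriv:
 assumes D: "open D" "w \<in> D" and e: "\<And>x. x \<in> D \<Longrightarrow> cdot (u x) (v x) = k"
  and d: "smooth_on D u" "smooth_on D v"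
 shows "cdot (del u w) (v w) + cdot (u w) (del v w) = 0"
  and "cdot (delb u w) (v w) + cdot (u w) (delb v w) = 0"
 using cdot_eq_deriv[OF D, of u v "\<lambda>_. k"] assms by (simp_all add: dz_const)

lemma smooth_on_smult:
 fixes u :: "complex \<Rightarrow> complex^'n"
 shows "open D \<Longrightarrow> smooth_on D k \<Longrightarrow> smooth_on D u \<Longrightarrow> smooth_on D (\<lambda>w. k w *s u w)"
 by (rule smooth_on_bilinear[OF _ bounded_bilinear_smult])

lemma smooth_on_cdot:
 "open D \<Longrightarrow> smooth_on D u \<Longrightarrow> smooth_on D v \<Longrightarrow> smooth_on D (\<lambda>w. cdot (u w) (v w))"
 by (rule smooth_on_bilinear[OF _ bounded_bilinear_cdot])

lemma smooth_on_conj_vec: "open D \<Longrightarrow> smooth_on D u \<Longrightarrow> smooth_on D (\<lambda>w. conj_vec (u w))"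
 by (rule smooth_on_linear[OF _ bounded_linear_conj_vec])

lemma smooth_on_cvec: "open D \<Longrightarrow> smooth_on D u \<Longrightarrow> smooth_on D (\<lambda>w. cvec (u w))"
 by (rule smooth_on_linear[OF _ bounded_linear_cvec])

lemma smooth_on_Re_vec: "open D \<Longrightarrow> smooth_on D u \<Longrightarrow> smooth_on D (\<lambda>w. Re_vec (u w))"
 by (rule smooth_on_linear[OF _ bounded_linear_Re_vec])

lemma smooth_on_Im_vec: "open D \<Longrightarrow> smooth_on D u \<Longrightarrow> smooth_on D (\<lambda>w. Im_vec (u w))"
 by (rule smooth_on_linear[OF _ bounded_linear_Im_vec])

lemma smooth_on_Re: "open D \<Longrightarrow> smooth_on D u \<Longrightarrow> smooth_on D (\<lambda>w. Re (u w))"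
 by (rule smooth_on_linear[OF _ bounded_linear_Re])

lemma smooth_on_of_real:
 "open D \<Longrightarrow> smooth_on D u \<Longrightarrow> smooth_on D (\<lambda>w. complex_of_real (u w))"
 by (rule smooth_on_linear[OF _ bounded_linear_of_real])

lemma smooth_on_del: "open D \<Longrightarrow> smooth_on D u \<Longrightarrow> smooth_on D (del u)"
 unfolding del_def[abs_def] by (intro smooth_on_smult smooth_on_diff smooth_on_const smooth_on_dd)

lemma smooth_on_dz: "open D \<Longrightarrow> smooth_on D u \<Longrightarrow> smooth_on D (dz u)" unfolding dz_def[abs_def] divide_inverse
 by (intro smooth_on_mult smooth_on_diff smooth_on_const smooth_on_dd)

lemma del_delb_commute:
 assumes D: "open D" "w \<in> D" and u: "smooth_on D u"
 shows "delb (del u) w = del (delb u) w"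
proof -
 have d: "dd v u differentiable (at w)" for v
  using smooth_on_differentiable[OF smooth_on_dd[OF D(1) u] D(2)] .
 have m: "((\<lambda>w. c *s x w) has_derivative (\<lambda>v. c *s x' v)) (at w)" if "(x has_derivative x') (at w)"
  for c :: complex and x :: "complex \<Rightarrow> complex^'a" and x'
  using bounded_linear.has_derivative[OF bounded_bilinear.bounded_linear_right[OF bounded_bilinear_smult] that] .
 have 1: "dd v (del u) w = (1/2) *s (dd v (dd 1 u) w - \<i> *s dd v (dd \<i> u) w)" for v
  unfolding del_def[abs_def] by (rule dd_eqI) (intro m has_derivative_diff has_derivative_dd d)
 have 2: "dd v (delb u) w = (1/2) *s (dd v (dd 1 u) w + \<i> *s dd v (dd \<i> u) w)" for v
  unfolding delb_def[abs_def] by (rule dd_eqI) (intro m has_derivative_add has_derivative_dd d)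
 show ?thesis unfolding del_def[of "delb u"] delb_def[of "del u"] 1 2
  using dd_commute[OF D(1) u D(2)] by (simp add: vec_eq_iff algebra_simps)
qed

section \<open>Minimal surfaces in spheres in a conformal coordinate\<close>

definition rho :: "(complex \<Rightarrow> real^'n) \<Rightarrow> complex \<Rightarrow> complex" where
 "rho g w = cdot (f_1 g w) (conj_vec (f_1 g w))"

definition f_11 :: "(complex \<Rightarrow> real^'n) \<Rightarrow> complex \<Rightarrow> complex^'n" where
 "f_11 g = del (f_1 g)"

text \<open>In a conformal coordinate the induced metric is \<open>2 * rho\<close> times |dz|^2, and
  minimality in the unit sphere becomes the harmonic map equation in the last line. This form is
  free of \<open>II\<close> and is the one that gets differentiated.\<close>

definition conf_min :: "complex set \<Rightarrow> (complex \<Rightarrow> real^'n) \<Rightarrow> bool" where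
 "conf_min D g \<longleftrightarrow> open D \<and> smooth_on D g \<and>
   (\<forall>w\<in>D. norm (g w) = 1 \<and> f_1 g w \<noteq> 0 \<and> cdot (f_1 g w) (f_1 g w) = 0 \<and>
    delb (f_1 g) w = - rho g w *s cvec (g w))"

lemma normal_part_eqI:
 assumes "\<And>w. w \<in> W \<Longrightarrow> n \<bullet> w = 0" "v - n \<in> span W"
 shows "normal_part W v = n" unfolding normal_part_def
proof (rule the_equality)
 show "(\<forall>w\<in>W. n \<bullet> w = 0) \<and> v - n \<in> span W" using assms by blast
next
 fix m assume m: "(\<forall>w\<in>W. m \<bullet> w = 0) \<and> v - m \<in> span W"
 have "(v - n) - (v - m) \<in> span W" using assms(2) m span_diff by blast
 then have "m - n \<in> span W" by simp
 moreover have "orthogonal (m - n) x" if "x \<in> span W" for x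
  using orthogonal_to_span[OF that] m assms(1) by (simp add: orthogonal_def inner_diff_left)
 ultimately have "orthogonal (m - n) (m - n)" by blast
 then show "m = n" by (simp add: orthogonal_def)
qed

lemma f_1_real:
 fixes g :: "complex \<Rightarrow> real^'n"
 assumes "g differentiable (at w)"
 shows "f_1 g w = (1/2) *s (cvec (dd 1 g w) - \<i> *s cvec (dd \<i> g w))"
  and "delb (cvec \<circ> g) w = conj_vec (f_1 g w)"
  and "cvec (dd v g w) = v *s f_1 g w + cnj v *s conj_vec (f_1 g w)"
proof -
 have d: "dd v (cvec \<circ> g) w = cvec (dd v g w)" for v
  unfolding comp_def by (rule dd_linear_map[OF bounded_linear_cvec assms])
 show 1: "f_1 g w = (1/2) *s (cvec (dd 1 g w) - \<i> *s cvec (dd \<i> g w))" unfolding f_1_def del_def d ..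
 show 2: "delb (cvec \<circ> g) w = conj_vec (f_1 g w)" unfolding 1 delb_def d by (simp add: conj_vec_simps)
 have "(cvec \<circ> g) differentiable (at w)"
  unfolding comp_def using bounded_linear.has_derivative[OF bounded_linear_cvec has_derivative_dd[OF assms]] differentiableI by blast
 from dd_del[OF this, of v] show "cvec (dd v g w) = v *s f_1 g w + cnj v *s conj_vec (f_1 g w)"
  unfolding d 2 f_1_def .
qed

lemma f_1_cdot_real:
 fixes g :: "complex \<Rightarrow> real^'n"
 assumes "g differentiable (at w)"
 shows "cdot (f_1 g w) (f_1 g w) = Complex (((norm (dd 1 g w))\<^sup>2 - (norm (dd \<i> g w))\<^sup>2) / 4) (- (dd 1 g w \<bullet> dd \<i> g w) / 2)"
  and "rho g w = of_real (((norm (dd 1 g w))\<^sup>2 + (norm (dd \<i> g w))\<^sup>2) / 4)"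
 unfolding rho_def f_1_real(1)[OF assms]
 by (simp_all add: cdot_simps conj_vec_simps cdot_cvec complex_eq_iff inner_commute power2_norm_eq_inner algebra_simps)

lemma conformal_at_iff:
 fixes g :: "complex \<Rightarrow> real^'n"
 assumes "g differentiable (at w)"
 shows "conformal_at g w \<longleftrightarrow> cdot (f_1 g w) (f_1 g w) = 0"
 unfolding conformal_at_def f_1_cdot_real(1)[OF assms] by (auto simp: complex_eq_iff)

lemma dd_inner_conformal:
 fixes g :: "complex \<Rightarrow> real^'n"
 assumes "g differentiable (at w)" "cdot (f_1 g w) (f_1 g w) = 0"
 shows "dd u g w \<bullet> dd v g w = 2 * Re (u * cnj v) * Re (rho g w)"
proof -
 have "of_real (dd u g w \<bullet> dd v g w) = u * (cnj v * rho g w) + cnj u * (v * rho g w)"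
  unfolding cdot_cvec[symmetric] f_1_real(3)[OF assms(1)] rho_def
  using assms(2) cdot_conj[of "f_1 g w" "f_1 g w"]
  by (simp add: cdot_simps cdot_commute[of "conj_vec (f_1 g w)" "f_1 g w"])
 then have "dd u g w \<bullet> dd v g w = Re (u * (cnj v * rho g w) + cnj u * (v * rho g w))"
  by (metis Re_complex_of_real)
 also have "\<dots> = 2 * Re (u * cnj v) * Re (rho g w)"
  using f_1_cdot_real(2)[OF assms(1)] by (simp add: algebra_simps)
 finally show ?thesis .
qed

lemma inj_derivative_iff:
 fixes g :: "complex \<Rightarrow> real^'n"
 assumes d: "g differentiable (at w)" and c: "cdot (f_1 g w) (f_1 g w) = 0"
 shows "inj (frechet_derivative g (at w)) \<longleftrightarrow> f_1 g w \<noteq> 0"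
proof
 assume "inj (frechet_derivative g (at w))"
 moreover have "frechet_derivative g (at w) 0 = 0"
  using has_derivative_dd[OF d] unfolding dd_def by (simp add: has_derivative_linear linear_0)
 ultimately have "dd 1 g w \<noteq> 0" unfolding dd_def by (metis inj_eq zero_neq_one)
 moreover have "cvec (dd 1 g w) = cvec 0" if "f_1 g w = 0"
  using f_1_real(3)[OF d, of 1] that by (simp add: conj_vec_simps cvec_simps)
 ultimately show "f_1 g w \<noteq> 0" by (auto simp: cvec_inject)
next
 assume "f_1 g w \<noteq> 0"
 then have pos: "0 < Re (rho g w)" unfolding rho_def by (rule cdot_self_conj_pos)
 have l: "linear (frechet_derivative g (at w))"
  using has_derivative_dd[OF d] has_derivative_linear unfolding dd_def by blast
 have "v = 0" if "frechet_derivative g (at w) v = 0" for v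
 proof -
  have "dd v g w = 0" using that by (simp add: dd_def)
  then have "2 * Re (v * cnj v) * Re (rho g w) = 0"
   using dd_inner_conformal[OF d c, of v v] by (metis inner_zero_left)
  then have "Re (v * cnj v) = 0" using pos by (metis mult_eq_0_iff less_irrefl zero_neq_numeral)
  moreover have "Re (v * cnj v) = Re v * Re v + Im v * Im v" by simp
  ultimately have "Re v * Re v + Im v * Im v = 0" by linarith
  then show ?thesis by (simp add: complex_eq_iff sum_squares_eq_zero_iff)
 qed
 then show "inj (frechet_derivative g (at w))" using l linear_injective_0 by blast
qed

text \<open>The setting in which vanishing mean curvature is shown equivalent to the harmonic map
  equation. Conformality is required on a neighbourhood because it gets differentiated.\<close>

locale conformal_point =
 fixes D and g :: "complex \<Rightarrow> real^'n" and w
 assumes open_D: "open D" and w_in: "w \<in> D" and smooth: "smooth_on D g"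
  and unit: "\<And>x. x \<in> D \<Longrightarrow> norm (g x) = 1"
  and conf: "\<And>x. x \<in> D \<Longrightarrow> cdot (f_1 g x) (f_1 g x) = 0"
  and imm: "f_1 g w \<noteq> 0"
begin

lemma smooth_cvec: "smooth_on D (cvec \<circ> g)" unfolding comp_def by (rule smooth_on_cvec[OF open_D smooth])

lemma smooth_f_1: "smooth_on D (f_1 g)" unfolding f_1_def by (rule smooth_on_del[OF open_D smooth_cvec])

lemma diff: "x \<in> D \<Longrightarrow> g differentiable (at x)" using smooth_on_differentiable[OF smooth] .

lemma gg: "x \<in> D \<Longrightarrow> cdot ((cvec \<circ> g) x) ((cvec \<circ> g) x) = 1"
 using unit by (simp add: cdot_cvec power2_norm_eq_inner[symmetric])

lemma g_f_1: "x \<in> D \<Longrightarrow> cdot ((cvec \<circ> g) x) (f_1 g x) = 0"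
 using cdot_const_deriv(1)[OF open_D _ gg smooth_cvec smooth_cvec, of x]
 by (simp add: f_1_def cdot_commute[of "del (cvec \<circ> g) x"])

lemma g_conj_f_1: "x \<in> D \<Longrightarrow> cdot ((cvec \<circ> g) x) (conj_vec (f_1 g x)) = 0"
 using g_f_1[of x] cdot_conj[of "(cvec \<circ> g) x" "f_1 g x"] by (simp add: conj_vec_simps)

lemma g_f_11: "cdot (cvec (g w)) (f_11 g w) = 0"
 using cdot_const_deriv(1)[OF open_D w_in g_f_1 smooth_cvec smooth_f_1] conf[OF w_in]
 by (simp add: f_1_def f_11_def)

lemma f_1_f_11: "cdot (f_1 g w) (f_11 g w) = 0"
 using cdot_const_deriv(1)[OF open_D w_in conf smooth_f_1 smooth_f_1]
 by (simp add: f_11_def cdot_commute[of "del (f_1 g) w"])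

lemma g_delb_f_1: "cdot (cvec (g w)) (delb (f_1 g) w) = - rho g w"
proof -
 have "cdot (conj_vec (f_1 g w)) (f_1 g w) + cdot (cvec (g w)) (delb (f_1 g) w) = 0"
  using cdot_const_deriv(2)[OF open_D w_in g_f_1 smooth_cvec smooth_f_1] f_1_real(2)[OF diff[OF w_in]] by simp
 then show ?thesis by (simp add: rho_def cdot_commute[of "conj_vec _"] eq_neg_iff_add_eq_0 add.commute)
qed

lemma f_1_delb_f_1: "cdot (f_1 g w) (delb (f_1 g) w) = 0"
 using cdot_const_deriv(2)[OF open_D w_in conf smooth_f_1 smooth_f_1]
 by (simp add: cdot_commute[of "delb (f_1 g) w"])

text \<open>The Laplacian of a real map is real: the two Wirtinger derivatives commute, and
  \<open>delb\<close> of the real map is the conjugate of \<open>f_1\<close>.\<close>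

lemma conj_delb_f_1: "conj_vec (delb (f_1 g) w) = delb (f_1 g) w"
proof -
 have "delb (f_1 g) w = del (delb (cvec \<circ> g)) w"
  unfolding f_1_def by (rule del_delb_commute[OF open_D w_in smooth_cvec])
 also have "\<dots> = del (\<lambda>x. conj_vec (f_1 g x)) w" by (rule del_cong[OF open_D w_in f_1_real(2)[OF diff]])
 also have "\<dots> = conj_vec (delb (f_1 g) w)"
  by (rule del_conj(1)[OF smooth_on_differentiable[OF smooth_f_1 w_in]])
 finally show ?thesis ..
qed

lemma conj_f_1_delb_f_1: "cdot (conj_vec (f_1 g w)) (delb (f_1 g) w) = 0"
 using f_1_delb_f_1 cdot_conj[of "f_1 g w" "delb (f_1 g) w"] conj_delb_f_1 by simp

lemma rho_real: "rho g w = of_real (Re (rho g w))" "0 < Re (rho g w)" "rho g w \<noteq> 0"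
 unfolding rho_def using cdot_self_conj_pos(1,3)[OF imm] cdot_self_conj_pos(2) by (auto simp: complex_eq_iff)

lemma second_dd: "cvec (dd u (dd v g) w) = (u * v) *s f_11 g w + (u * cnj v + cnj u * v) *s delb (f_1 g) w
  + cnj (u * v) *s conj_vec (f_11 g w)"
proof -
 have df: "(\<lambda>x. v *s f_1 g x) differentiable (at w)" "(\<lambda>x. cnj v *s conj_vec (f_1 g x)) differentiable (at w)" for v
  by (rule smooth_on_differentiable[OF smooth_on_smult[OF open_D smooth_on_const] w_in],
    (rule smooth_f_1 smooth_on_conj_vec[OF open_D smooth_f_1]))+
 have df1: "f_1 g differentiable (at w)" "(\<lambda>x. conj_vec (f_1 g x)) differentiable (at w)"
  by (rule smooth_on_differentiable[OF _ w_in], (rule smooth_f_1 smooth_on_conj_vec[OF open_D smooth_f_1]))+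
 have "cvec (dd u (dd v g) w) = dd u (\<lambda>x. cvec (dd v g x)) w"
  by (rule dd_linear_map[OF bounded_linear_cvec smooth_on_differentiable[OF smooth_on_dd[OF open_D smooth] w_in], symmetric])
 also have "\<dots> = dd u (\<lambda>x. v *s f_1 g x + cnj v *s conj_vec (f_1 g x)) w"
  by (rule dd_cong[OF open_D w_in f_1_real(3)[OF diff]])
 also have "\<dots> = u *s del (\<lambda>x. v *s f_1 g x + cnj v *s conj_vec (f_1 g x)) w + cnj u *s delb (\<lambda>x. v *s f_1 g x + cnj v *s conj_vec (f_1 g x)) w"
  by (rule dd_del[OF differentiable_add[OF df]])
 also have "del (\<lambda>x. v *s f_1 g x + cnj v *s conj_vec (f_1 g x)) w = v *s f_11 g w + cnj v *s conj_vec (delb (f_1 g) w)"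
  unfolding del_add(1)[OF df] del_smult(1)[OF differentiable_const df1(1)] del_smult(1)[OF differentiable_const df1(2)]
   del_conj[OF df1(1)] f_11_def by (simp add: dz_const)
 also have "delb (\<lambda>x. v *s f_1 g x + cnj v *s conj_vec (f_1 g x)) w = v *s delb (f_1 g) w + cnj v *s conj_vec (f_11 g w)"
  unfolding del_add(2)[OF df] del_smult(2)[OF differentiable_const df1(1)] del_smult(2)[OF differentiable_const df1(2)]
   del_conj[OF df1(1)] f_11_def by (simp add: dz_const)
 finally show ?thesis by (simp add: conj_delb_f_1 vec_eq_iff algebra_simps)
qed

text \<open>\<open>f_1\<close> and its conjugate are isotropic and pair to \<open>rho\<close>, so in
  the complexified tangent plane each is, up to that factor, dual to the other. Hence the
  coefficient of \<open>f_1\<close> is a pairing with its conjugate.\<close>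

lemma cvec_normal_part:
 "cvec (normal_part {g w, dd 1 g w, dd \<i> g w} y) =
   cvec y - cdot (cvec y) (cvec (g w)) *s cvec (g w)
   - (cdot (cvec y) (conj_vec (f_1 g w)) / rho g w) *s f_1 g w
   - (cdot (cvec y) (f_1 g w) / rho g w) *s conj_vec (f_1 g w)"
proof -
 define p q L where "p = dd 1 g w" "q = dd \<i> g w" "L = 2 * Re (rho g w)"
 have pq: "p \<bullet> p = L" "q \<bullet> q = L" "p \<bullet> q = 0" "q \<bullet> p = 0"
  unfolding p_q_L_def dd_inner_conformal[OF diff[OF w_in] conf[OF w_in]] by simp_all
 have L: "L > 0" using rho_real by (simp add: p_q_L_def)
 have gv: "g w \<bullet> dd v g w = 0" for v
 proof -
  have "of_real (g w \<bullet> dd v g w) = (0::complex)"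
   unfolding cdot_cvec[symmetric] f_1_real(3)[OF diff[OF w_in]]
   using g_f_1[OF w_in] g_conj_f_1[OF w_in] by (simp add: cdot_simps)
  then show ?thesis by simp
 qed
 have g1: "g w \<bullet> g w = 1" using unit[OF w_in] by (simp add: power2_norm_eq_inner[symmetric])
 have gp: "g w \<bullet> p = 0" "g w \<bullet> q = 0" "p \<bullet> g w = 0" "q \<bullet> g w = 0"
  using gv by (simp_all add: p_q_L_def inner_commute)
 define n where "n = y - (y \<bullet> g w) *\<^sub>R g w - (y \<bullet> p / L) *\<^sub>R p - (y \<bullet> q / L) *\<^sub>R q"
 have "normal_part {g w, p, q} y = n"
 proof (rule normal_part_eqI)
  show "n \<bullet> x = 0" if "x \<in> {g w, p, q}" for x using that L by (auto simp: n_def inner_diff_left pq gp g1)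
  have "y - n = (y \<bullet> g w) *\<^sub>R g w + (y \<bullet> p / L) *\<^sub>R p + (y \<bullet> q / L) *\<^sub>R q" by (simp add: n_def)
  also have "\<dots> \<in> span {g w, p, q}" by (intro span_add span_scale span_base) auto
  finally show "y - n \<in> span {g w, p, q}" .
 qed
 moreover have "cvec n = cvec y - cdot (cvec y) (cvec (g w)) *s cvec (g w)
   - (cdot (cvec y) (conj_vec (f_1 g w)) / rho g w) *s f_1 g w
   - (cdot (cvec y) (f_1 g w) / rho g w) *s conj_vec (f_1 g w)"
 proof -
  define F where "F = f_1 g w"
  have e: "cvec p = F + conj_vec F" "cvec q = \<i> *s F - \<i> *s conj_vec F"
   using f_1_real(3)[OF diff[OF w_in], of 1] f_1_real(3)[OF diff[OF w_in], of \<i>]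
   by (simp_all add: p_q_L_def F_def)
  have yp: "of_real (y \<bullet> p) = cdot (cvec y) F + cdot (cvec y) (conj_vec F)"
    "of_real (y \<bullet> q) = \<i> * cdot (cvec y) F - \<i> * cdot (cvec y) (conj_vec F)"
   unfolding cdot_cvec[symmetric] e by (simp_all add: cdot_simps)
  have Lr: "complex_of_real L = 2 * rho g w" using rho_real(1) by (simp add: p_q_L_def)
  show ?thesis
   unfolding F_def[symmetric] n_def cvec_simps of_real_divide yp e Lr cdot_cvec[symmetric] cdot_simps
   using rho_real(3) by (simp add: vec_eq_iff field_simps)
 qed
 ultimately show ?thesis by (simp add: p_q_L_def)
qed

definition F2 where "F2 = f_11 g w - (cdot (f_11 g w) (conj_vec (f_1 g w)) / rho g w) *s f_1 g w"

text \<open>The mixed coefficient is 2 Re (u cnj v), a multiple of the metric. So the middle vector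
  carries the trace of \<open>II\<close>, and \<open>F2\<close> with its conjugate the traceless
  part.\<close>

lemma cvec_II: "cvec (II g w u v) = (u * v) *s F2 + (u * cnj v + cnj u * v) *s (delb (f_1 g) w + rho g w *s cvec (g w))
  + cnj (u * v) *s conj_vec F2"
proof -
 have r: "cnj (rho g w) = rho g w" using rho_real(1) by (metis complex_cnj_complex_of_real)
 have c: "cdot (conj_vec (f_11 g w)) (f_1 g w) = cnj (cdot (f_11 g w) (conj_vec (f_1 g w)))"
  by (rule cdot_conj_left)
 have c1: "cdot (f_11 g w) (f_1 g w) = 0" "cdot (f_11 g w) (cvec (g w)) = 0"
  using f_1_f_11 g_f_11 by (metis cdot_commute)+
 have c2: "cdot (conj_vec (f_11 g w)) (conj_vec (f_1 g w)) = 0" "cdot (conj_vec (f_11 g w)) (cvec (g w)) = 0"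
  using c1 cdot_conj[of "f_11 g w"] cdot_conj_left[of "f_11 g w" "cvec (g w)"] by (simp_all add: conj_vec_simps)
 have c3: "cdot (delb (f_1 g) w) (f_1 g w) = 0" "cdot (delb (f_1 g) w) (conj_vec (f_1 g w)) = 0"
  "cdot (delb (f_1 g) w) (cvec (g w)) = - rho g w"
  using f_1_delb_f_1 conj_f_1_delb_f_1 g_delb_f_1 by (metis cdot_commute)+
 show ?thesis unfolding II_def cvec_normal_part second_dd F2_def
  by (simp add: cdot_simps c c1 c2 c3 vec_eq_iff conj_vec_simps r rho_real(3) field_simps)
qed

lemma f_2_F2: "f_2 g w = F2" unfolding f_2_def cvec_II by (simp add: vec_eq_iff algebra_simps)

lemma mean_curvature_zero_iff:
 "mean_curvature_zero_at g w \<longleftrightarrow> delb (f_1 g) w = - rho g w *s cvec (g w)"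
proof
 assume m: "mean_curvature_zero_at g w"
 \<comment> \<open>The metric is \<open>2 * rho\<close> times |dz|^2, so 1/l and \<i>/l are
   orthonormal tangent vectors.\<close>
 define l where "l = sqrt (2 * Re (rho g w))"
 have l: "l > 0" "l\<^sup>2 = 2 * Re (rho g w)" using rho_real by (simp_all add: l_def)
 have ip: "dd (of_real (1/l) * x) g w \<bullet> dd (of_real (1/l) * y) g w = Re (x * cnj y)" for x y
  unfolding dd_inner_conformal[OF diff[OF w_in] conf[OF w_in]] using l rho_real(2) by (simp add: field_simps power2_eq_square)
 have "norm (dd (of_real (1/l) * x) g w) = 1" if "cmod x = 1" for x
  unfolding norm_eq_sqrt_inner ip using that by (simp add: complex_norm_square[symmetric] cmod_def power2_eq_square)
 from m[unfolded mean_curvature_zero_at_def, rule_format, of "of_real (1/l) * 1" "of_real (1/l) * \<i>"] this[of 1] this[of \<i>] ip[of 1 \<i>]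
 have "II g w (of_real (1/l) * 1) (of_real (1/l) * 1) + II g w (of_real (1/l) * \<i>) (of_real (1/l) * \<i>) = 0" by simp
 then have "cvec (II g w (of_real (1/l) * 1) (of_real (1/l) * 1)) + cvec (II g w (of_real (1/l) * \<i>) (of_real (1/l) * \<i>)) = 0"
  by (simp add: cvec_simps flip: cvec_simps(1))
 then have "(4 / (of_real l)\<^sup>2) *s (delb (f_1 g) w + rho g w *s cvec (g w)) = 0"
  unfolding cvec_II by (simp add: vec_eq_iff power2_eq_square field_simps)
 then have "4 / (complex_of_real l)\<^sup>2 = 0 \<or> delb (f_1 g) w + rho g w *s cvec (g w) = 0"
  by (simp only: vector_mul_eq_0)
 then have "delb (f_1 g) w + rho g w *s cvec (g w) = 0" using l by simp
 then show "delb (f_1 g) w = - rho g w *s cvec (g w)" by (simp add: vec_eq_iff eq_neg_iff_add_eq_0)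
next
 assume h: "delb (f_1 g) w = - rho g w *s cvec (g w)"
 show "mean_curvature_zero_at g w" unfolding mean_curvature_zero_at_def
 proof (intro allI impI)
  fix u v
  assume a: "norm (dd u g w) = 1 \<and> norm (dd v g w) = 1 \<and> dd u g w \<bullet> dd v g w = 0"
  have "dd u g w \<bullet> dd u g w = 1" "dd v g w \<bullet> dd v g w = 1" using a by (simp_all add: power2_norm_eq_inner[symmetric])
  moreover have "2 * (cmod x)\<^sup>2 * Re (rho g w) = dd x g w \<bullet> dd x g w" for x
   unfolding dd_inner_conformal[OF diff[OF w_in] conf[OF w_in]] by (simp add: complex_mult_cnj cmod_power2)
  ultimately have b: "2 * (cmod u)\<^sup>2 * Re (rho g w) = 1" "2 * (cmod v)\<^sup>2 * Re (rho g w) = 1" by metis+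
  have b3: "Re (u * cnj v) = 0"
   using a dd_inner_conformal[OF diff[OF w_in] conf[OF w_in], of u v] rho_real(2)
   by (metis mult_eq_0_iff less_irrefl zero_neq_numeral)
  have e: "(cmod x)\<^sup>2 = 1 / (2 * Re (rho g w))" if "2 * (cmod x)\<^sup>2 * Re (rho g w) = 1" for x
   using that rho_real(2) by (simp add: field_simps)
  have uv: "(cmod u)\<^sup>2 = (cmod v)\<^sup>2" "v \<noteq> 0" using e[OF b(1)] e[OF b(2)] b(2) by (metis, force)
  \<comment> \<open>Since u cnj v is imaginary and |u| = |v|, its square is -(v cnj v)^2. Hence u^2
    + v^2 = 0: orthonormal vectors differ by a quarter turn.\<close>
  define t where "t = Im (u * cnj v)"
  have t: "u * cnj v = \<i> * of_real t" using b3 by (simp add: complex_eq_iff t_def)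
  have "t\<^sup>2 = (cmod (u * cnj v))\<^sup>2" unfolding t by (simp add: norm_mult)
  also have "\<dots> = (cmod v)\<^sup>2 * (cmod v)\<^sup>2" using uv(1) by (simp add: norm_mult power_mult_distrib)
  finally have "of_real (t\<^sup>2) = (v * cnj v)\<^sup>2" by (simp add: complex_norm_square[symmetric] power2_eq_square)
  moreover have "(u * cnj v)\<^sup>2 = - of_real (t\<^sup>2)" unfolding t by (simp add: power_mult_distrib)
  ultimately have "(u\<^sup>2 + v\<^sup>2) * (cnj v)\<^sup>2 = 0" by (simp add: power_mult_distrib algebra_simps)
  then have "u * u + v * v = 0" using uv(2) by (simp add: power2_eq_square)
  then have "v * v = - (u * u)" by (simp add: eq_neg_iff_add_eq_0 add.commute)
  moreover from this have "cnj v * cnj v = - (cnj u * cnj u)" by (metis complex_cnj_minus complex_cnj_mult)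
  moreover have "cvec (II g w x x) = (x * x) *s F2 + cnj (x * x) *s conj_vec F2" for x
   unfolding cvec_II h by (simp add: vec_eq_iff)
  ultimately have "cvec (II g w u u) + cvec (II g w v v) = 0" by (simp add: vec_eq_iff)
  then show "II g w u u + II g w v v = 0" using cvec_inject[of "II g w u u + II g w v v" 0] by (simp add: cvec_simps)
 qed
qed

end

lemma conf_minD:
 assumes "conf_min D g"
 shows "open D" "smooth_on D g" "w \<in> D \<Longrightarrow> norm (g w) = 1" "w \<in> D \<Longrightarrow> f_1 g w \<noteq> 0"
  "w \<in> D \<Longrightarrow> cdot (f_1 g w) (f_1 g w) = 0" "w \<in> D \<Longrightarrow> delb (f_1 g) w = - rho g w *s cvec (g w)"
 using assms by (simp_all add: conf_min_def)

lemma conf_min_conformal_point: "conf_min D g \<Longrightarrow> w \<in> D \<Longrightarrow> conformal_point D g w"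
 unfolding conformal_point_def conf_min_def by blast

lemma conf_min_f_2:
 assumes "conf_min D g" "w \<in> D"
 shows "f_2 g w = f_11 g w - (cdot (f_11 g w) (conj_vec (f_1 g w)) / rho g w) *s f_1 g w"
 using conformal_point.f_2_F2[OF conf_min_conformal_point[OF assms]]
  conformal_point.F2_def[OF conf_min_conformal_point[OF assms]] by simp

lemma conf_min_II:
 assumes "conf_min D g" "w \<in> D"
 shows "II g w u v = 2 *\<^sub>R Re_vec ((u * v) *s f_2 g w)"
proof -
 have "cvec (II g w u v) = (u * v) *s f_2 g w + cnj (u * v) *s conj_vec (f_2 g w)"
  unfolding conformal_point.cvec_II[OF conf_min_conformal_point[OF assms]]
   conformal_point.f_2_F2[OF conf_min_conformal_point[OF assms], symmetric] conf_minD(6)[OF assms]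
  by (simp add: vec_eq_iff)
 then have "Re_vec (cvec (II g w u v)) = Re_vec ((u * v) *s f_2 g w + cnj (u * v) *s conj_vec (f_2 g w))" by simp
 then show ?thesis by (simp add: Re_Im_vec_simps vec_eq_iff algebra_simps)
qed

lemma a_part_eq: "a_part g w = Re_vec (f_2 g w)" and b_part_eq: "b_part g w = - Im_vec (f_2 g w)"
 by (simp_all add: a_part_def b_part_def Re_vec_def Im_vec_def vec_eq_iff)

lemma f_2_ab: "f_2 g w = cvec (a_part g w) - \<i> *s cvec (b_part g w)"
 unfolding a_part_eq b_part_eq by (subst vec_eq_Re_Im[of "f_2 g w"]) (simp add: cvec_simps)

lemma local_cong:
 assumes D: "open D" and e: "\<And>x. x \<in> D \<Longrightarrow> g x = h x" and w: "w \<in> D"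
 shows f_1_cong: "f_1 g w = f_1 h w" and f_11_cong: "f_11 g w = f_11 h w"
  and II_cong: "II g w u v = II h w u v" and f_2_cong: "f_2 g w = f_2 h w"
  and delb_f_1_cong: "delb (f_1 g) w = delb (f_1 h) w" and rho_cong: "rho g w = rho h w"
proof -
 have 1: "f_1 g x = f_1 h x" if "x \<in> D" for x unfolding f_1_def by (rule del_cong[OF D that]) (simp add: e)
 then show "f_1 g w = f_1 h w" "rho g w = rho h w" using w by (simp_all add: rho_def)
 show "f_11 g w = f_11 h w" "delb (f_1 g) w = delb (f_1 h) w"
  unfolding f_11_def by (rule del_cong[OF D w 1], assumption)+
 have 2: "dd v g x = dd v h x" if "x \<in> D" for v x by (rule dd_cong[OF D that e])
 have "dd u (dd v g) w = dd u (dd v h) w" for u v by (rule dd_cong[OF D w 2])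
 then have 3: "II g w u v = II h w u v" for u v unfolding II_def using 2[OF w] e[OF w] by simp
 show "II g w u v = II h w u v" by (rule 3)
 show "f_2 g w = f_2 h w" unfolding f_2_def 3 ..
qed

lemma f_plus_cong:
 assumes D: "open D" and e: "\<And>x. x \<in> D \<Longrightarrow> g x = h x" and w: "w \<in> D"
 shows "f_plus g w = f_plus h w"
proof -
 have "f_1 g w = f_1 h w" "II g w u v = II h w u v" "f_2 g w = f_2 h w" "dd u g w = dd u h w" "g w = h w" for u v
  using local_cong[of D g h w] dd_cong[of D w g h] D e w by blast+
 then show ?thesis unfolding f_plus_def phi_def unit_N_def a_part_def b_part_def by simp
qed

lemma conf_min_cong:
 assumes D: "open D" and e: "\<And>x. x \<in> D \<Longrightarrow> g x = h x"
 shows "conf_min D g \<longleftrightarrow> conf_min D h"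
proof -
 have l: "f_1 g w = f_1 h w" "delb (f_1 g) w = delb (f_1 h) w" "rho g w = rho h w" if "w \<in> D" for w
  using local_cong[of D g h w] D e that by blast+
 have "smooth_on D g \<longleftrightarrow> smooth_on D h" using smooth_on_cong[of D g h] D e by blast
 moreover define P where "P k w \<longleftrightarrow> norm (k w) = 1 \<and> f_1 k w \<noteq> 0 \<and> cdot (f_1 k w) (f_1 k w) = 0 \<and>
  delb (f_1 k) w = - rho k w *s cvec (k w)" for k :: "complex \<Rightarrow> real^'a" and w
 have "P g w \<longleftrightarrow> P h w" if "w \<in> D" for w using l[OF that] e[OF that] by (simp add: P_def)
 ultimately show ?thesis unfolding conf_min_def P_def[symmetric] by blast
qed

lemma conf_min_local:
 assumes "\<And>w. w \<in> D \<Longrightarrow> \<exists>E. w \<in> E \<and> conf_min E g" "open D"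
 shows "conf_min D g" unfolding conf_min_def
proof (intro conjI ballI assms(2))
 show "smooth_on D g" by (rule smooth_on_local) (metis assms(1) conf_minD(1,2))
 fix w assume "w \<in> D"
 then obtain E where E: "w \<in> E" "conf_min E g" using assms by blast
 show "norm (g w) = 1" by (rule conf_minD(3)[OF E(2,1)])
 show "f_1 g w \<noteq> 0" by (rule conf_minD(4)[OF E(2,1)])
 show "cdot (f_1 g w) (f_1 g w) = 0" by (rule conf_minD(5)[OF E(2,1)])
 show "delb (f_1 g) w = - rho g w *s cvec (g w)" by (rule conf_minD(6)[OF E(2,1)])
qed

section \<open>Change of conformal coordinate\<close>

lemma dz_holomorphic:
 assumes "h field_differentiable (at w)"
 shows "dz h w = deriv h w" "dzb h w = 0"
 unfolding dz_def dzb_def by (simp_all add: dd_holomorphic[OF assms] mult.commute[of _ \<i>])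

context
 fixes D E g \<tau>
 assumes g: "conf_min D g" and E: "open E" and t: "\<tau> holomorphic_on E" "\<tau> ` E \<subseteq> D"
  and nz: "\<And>x. x \<in> E \<Longrightarrow> deriv \<tau> x \<noteq> 0"
begin

private lemma fd: "x \<in> E \<Longrightarrow> \<tau> field_differentiable (at x)" "x \<in> E \<Longrightarrow> deriv \<tau> field_differentiable (at x)"
 using t(1) holomorphic_deriv[OF t(1) E] E holomorphic_on_imp_differentiable_at by blast+

private lemma sm: "smooth_on D (cvec \<circ> g)" "smooth_on D (f_1 g)"
 unfolding f_1_def comp_def using smooth_on_cvec smooth_on_del conf_minD(1,2)[OF g] by blast+

private lemma td: "x \<in> E \<Longrightarrow> \<tau> x \<in> D" using t by blast

lemma f_1_compose: "x \<in> E \<Longrightarrow> f_1 (\<lambda>w. g (\<tau> w)) x = deriv \<tau> x *s f_1 g (\<tau> x)"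
 using del_compose(1)[OF fd(1) smooth_on_differentiable[OF sm(1) td]] by (simp add: f_1_def comp_def)

private lemma f_1_compose_diff:
 assumes x: "x \<in> E"
 shows "del (f_1 (\<lambda>w. g (\<tau> w))) x = deriv (deriv \<tau>) x *s f_1 g (\<tau> x) + (deriv \<tau> x)\<^sup>2 *s f_11 g (\<tau> x)"
  "delb (f_1 (\<lambda>w. g (\<tau> w))) x = (deriv \<tau> x * cnj (deriv \<tau> x)) *s delb (f_1 g) (\<tau> x)"
proof -
 note d1 = field_differentiable_imp_differentiable[OF fd(2)[OF x]]
 note d2 = dd_compose_holomorphic(2)[OF fd(1)[OF x] smooth_on_differentiable[OF sm(2) td[OF x]]]
 have "del (f_1 (\<lambda>w. g (\<tau> w))) x = del (\<lambda>x. deriv \<tau> x *s f_1 g (\<tau> x)) x"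
  "delb (f_1 (\<lambda>w. g (\<tau> w))) x = delb (\<lambda>x. deriv \<tau> x *s f_1 g (\<tau> x)) x"
  by (rule del_cong[OF E x f_1_compose], assumption)+
 then show "del (f_1 (\<lambda>w. g (\<tau> w))) x = deriv (deriv \<tau>) x *s f_1 g (\<tau> x) + (deriv \<tau> x)\<^sup>2 *s f_11 g (\<tau> x)"
  "delb (f_1 (\<lambda>w. g (\<tau> w))) x = (deriv \<tau> x * cnj (deriv \<tau> x)) *s delb (f_1 g) (\<tau> x)"
  unfolding del_smult[OF d1 d2] del_compose[OF fd(1)[OF x] smooth_on_differentiable[OF sm(2) td[OF x]]]
   dz_holomorphic[OF fd(2)[OF x]] f_11_def by (simp_all add: vec_eq_iff power2_eq_square)
qed

lemma f_11_compose: "x \<in> E \<Longrightarrow> f_11 (\<lambda>w. g (\<tau> w)) x = deriv (deriv \<tau>) x *s f_1 g (\<tau> x) + (deriv \<tau> x)\<^sup>2 *s f_11 g (\<tau> x)"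
 using f_1_compose_diff(1) by (simp add: f_11_def)

lemma rho_compose: "x \<in> E \<Longrightarrow> rho (\<lambda>w. g (\<tau> w)) x = deriv \<tau> x * cnj (deriv \<tau> x) * rho g (\<tau> x)"
 unfolding rho_def by (simp add: f_1_compose cdot_simps conj_vec_simps)

lemma conf_min_compose: "conf_min E (\<lambda>w. g (\<tau> w))" unfolding conf_min_def
proof (intro conjI ballI)
 show "open E" by (rule E)
 show "smooth_on E (\<lambda>w. g (\<tau> w))"
  by (rule smooth_on_compose_holomorphic[OF conf_minD(1)[OF g] E t conf_minD(2)[OF g]])
 fix x assume x: "x \<in> E"
 show "norm (g (\<tau> x)) = 1" by (rule conf_minD(3)[OF g td[OF x]])
 show "f_1 (\<lambda>w. g (\<tau> w)) x \<noteq> 0" using conf_minD(4)[OF g td[OF x]] nz[OF x] by (simp add: f_1_compose[OF x])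
 show "cdot (f_1 (\<lambda>w. g (\<tau> w)) x) (f_1 (\<lambda>w. g (\<tau> w)) x) = 0"
  using conf_minD(5)[OF g td[OF x]] by (simp add: f_1_compose[OF x] cdot_simps)
 show "delb (f_1 (\<lambda>w. g (\<tau> w))) x = - rho (\<lambda>w. g (\<tau> w)) x *s cvec (g (\<tau> x))"
  using conf_minD(6)[OF g td[OF x]] by (simp add: f_1_compose_diff(2)[OF x] rho_compose[OF x] vec_eq_iff)
qed

text \<open>The term with \<tau>'' in the second derivative is a multiple of \<open>f_1\<close>,
  hence tangential, and the projection removes it. So \<open>f_2\<close> transforms as a quadratic
  differential.\<close>

lemma f_2_compose:
 assumes x: "x \<in> E"
 shows "f_2 (\<lambda>w. g (\<tau> w)) x = (deriv \<tau> x)\<^sup>2 *s f_2 g (\<tau> x)"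
proof -
 have "rho g (\<tau> x) \<noteq> 0" unfolding rho_def by (rule cdot_self_conj_pos(3)[OF conf_minD(4)[OF g td[OF x]]])
 then show ?thesis
  unfolding conf_min_f_2[OF conf_min_compose x] conf_min_f_2[OF g td[OF x]] f_11_compose[OF x] f_1_compose[OF x] rho_compose[OF x]
  using nz[OF x] by (simp add: cdot_simps conj_vec_simps vec_eq_iff field_simps power2_eq_square rho_def)
qed

end

section \<open>Charts\<close>

lemma chartD:
 assumes "chart S U z"
 shows "openin (top_of_set S) U" "open (z ` U)" "inj_on z U" "U \<subseteq> S"
  "continuous_on U z" "continuous_on (z ` U) (inv_into U z)"
  "q \<in> U \<Longrightarrow> inv_into U z (z q) = q" "x \<in> z ` U \<Longrightarrow> z (inv_into U z x) = x"
  "x \<in> z ` U \<Longrightarrow> inv_into U z x \<in> U"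
proof -
 show *: "openin (top_of_set S) U" "open (z ` U)" using assms by (auto simp: chart_def)
 have h: "homeomorphism U (z ` U) z (inv_into U z)" using assms by (simp add: chart_def)
 show "inj_on z U" using h unfolding homeomorphism_def by (metis inj_on_inverseI)
 show "U \<subseteq> S" using * openin_imp_subset by blast
 show "continuous_on U z" "continuous_on (z ` U) (inv_into U z)"
  "q \<in> U \<Longrightarrow> inv_into U z (z q) = q" "x \<in> z ` U \<Longrightarrow> z (inv_into U z x) = x"
  using h by (auto simp: homeomorphism_def)
 show "x \<in> z ` U \<Longrightarrow> inv_into U z x \<in> U" by (rule inv_into_into)
qed

lemma chart_image_open:
 assumes "chart S U z" "openin (top_of_set S) V" "V \<subseteq> U"
 shows "open (z ` V)"
proof -
 have h: "homeomorphism U (z ` U) z (inv_into U z)" using assms by (simp add: chart_def)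
 have "openin (top_of_set U) V" using assms(2,3) chartD(4)[OF assms(1)] openin_subset_trans by blast
 then have "openin (top_of_set (z ` U)) (z ` V)" using homeomorphism_imp_open_map[OF h] by blast
 then show ?thesis using chartD(2)[OF assms(1)] openin_open_trans by blast
qed

lemma chart_preimage_openin:
 assumes "chart S U z" "open E" "E \<subseteq> z ` U"
 shows "openin (top_of_set S) (inv_into U z ` E)"
proof -
 have "homeomorphism U (z ` U) z (inv_into U z)" using assms(1) by (simp add: chart_def)
 then have h: "homeomorphism (z ` U) U (inv_into U z) z" using homeomorphism_sym by blast
 have "openin (top_of_set (z ` U)) E" using assms(2,3) by (simp add: openin_open_eq chartD(2)[OF assms(1)])
 then have "openin (top_of_set U) (inv_into U z ` E)" using homeomorphism_imp_open_map[OF h] by blast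
 then show ?thesis using chartD(1)[OF assms(1)] openin_trans by blast
qed

lemma inv_into_subset:
 assumes "inj_on z U" "V \<subseteq> U" "x \<in> z ` V"
 shows "inv_into V z x = inv_into U z x"
 using assms by (metis f_inv_into_f image_mono inj_onD inv_into_f_f inv_into_into subsetD)

lemma chart_subset:
 assumes "chart S U z" "openin (top_of_set S) V" "V \<subseteq> U"
 shows "chart S V z" unfolding chart_def
proof (intro conjI)
 show "open (z ` V)" by (rule chart_image_open[OF assms])
 have h: "homeomorphism U (z ` U) z (inv_into U z)" using assms by (simp add: chart_def)
 have "homeomorphism V (z ` V) z (inv_into U z)"
  by (rule homeomorphism_of_subsets[OF h]) (use assms(3) chartD(7)[OF assms(1)] in force)+
 then show "homeomorphism V (z ` V) z (inv_into V z)"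
  by (rule homeomorphism_cong) (use inv_into_subset[OF chartD(3)[OF assms(1)] assms(3)] in auto)
qed (rule assms)

lemma complex_coordinate_subset:
 assumes "complex_coordinate S \<A> U z" "openin (top_of_set S) V" "V \<subseteq> U"
 shows "complex_coordinate S \<A> V z" unfolding complex_coordinate_def
proof (intro conjI ballI, safe)
 have c: "chart S U z" using assms(1) by (simp add: complex_coordinate_def)
 show "chart S V z" by (rule chart_subset[OF c assms(2,3)])
 fix W w assume "(W, w) \<in> \<A>"
 then have cc: "chart_compatible U z W w" using assms(1) by (auto simp: complex_coordinate_def)
 show "chart_compatible V z W w" unfolding chart_compatible_def
 proof
  have "(w \<circ> inv_into U z) holomorphic_on z ` (V \<inter> W)"
   using cc assms(3) unfolding chart_compatible_def by (auto elim!: holomorphic_on_subset)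
  moreover have "(w \<circ> inv_into U z) x = (w \<circ> inv_into V z) x" if "x \<in> z ` (V \<inter> W)" for x
   using inv_into_subset[OF chartD(3)[OF c] assms(3), of x] that by auto
  ultimately show "(w \<circ> inv_into V z) holomorphic_on z ` (V \<inter> W)"
   using holomorphic_cong by (metis (no_types, lifting))
  show "(z \<circ> inv_into W w) holomorphic_on w ` (V \<inter> W)"
   using cc assms(3) unfolding chart_compatible_def by (auto elim!: holomorphic_on_subset)
 qed
qed

lemma local_expr_subset:
 assumes "chart S U z" "V \<subseteq> U" "x \<in> z ` V"
 shows "local_expr f V z x = local_expr f U z x"
 using inv_into_subset[OF chartD(3)[OF assms(1)] assms(2,3)] by (simp add: local_expr_def)

lemma local_expr_chart: "chart S U z \<Longrightarrow> q \<in> U \<Longrightarrow> local_expr f U z (z q) = f q"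
 by (simp add: local_expr_def chartD)

lemma holomorphic_on_local:
 assumes "\<And>x. x \<in> D \<Longrightarrow> \<exists>E. open E \<and> x \<in> E \<and> f holomorphic_on E"
 shows "f holomorphic_on D" unfolding holomorphic_on_def
 using assms field_differentiable_at_within holomorphic_on_imp_differentiable_at by blast

text \<open>By definition, members of the maximal atlas are compatible only with the charts of \<A>.
  Near each point the transition map is therefore factored through a chart of \<A>.\<close>

lemma transition_holomorphic:
 assumes rs: "riemann_surface S \<A>" and U: "complex_coordinate S \<A> U z" and V: "complex_coordinate S \<A> V w"
 shows "(z \<circ> inv_into V w) holomorphic_on (w ` (U \<inter> V))"
proof (rule holomorphic_on_local)
 fix x assume "x \<in> w ` (U \<inter> V)"
 then obtain q where q: "q \<in> U" "q \<in> V" "x = w q" by blast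
 have cU: "chart S U z" and cV: "chart S V w" using U V by (auto simp: complex_coordinate_def)
 then have "q \<in> S" using chartD(4) q by blast
 then obtain W u where W: "(W, u) \<in> \<A>" "q \<in> W" using rs unfolding riemann_surface_def by blast
 have cW: "chart S W u" using rs W unfolding riemann_surface_def by blast
 let ?T = "U \<inter> V \<inter> W"
 have "openin (top_of_set S) ?T" using chartD(1) cU cV cW by blast
 then have "open (w ` ?T)" by (intro chart_image_open[OF cV]) auto
 moreover have "x \<in> w ` ?T" using q W by blast
 moreover have "(z \<circ> inv_into V w) holomorphic_on w ` ?T"
 proof -
  have a: "(u \<circ> inv_into V w) holomorphic_on w ` ?T"
   using V W unfolding complex_coordinate_def chart_compatible_def by (auto elim!: holomorphic_on_subset)
  have b: "(z \<circ> inv_into W u) holomorphic_on u ` ?T"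
   using U W unfolding complex_coordinate_def chart_compatible_def by (auto elim!: holomorphic_on_subset)
  have "(u \<circ> inv_into V w) ` (w ` ?T) \<subseteq> u ` ?T" using chartD(7)[OF cV] by auto
  from holomorphic_on_compose_gen[OF a b this]
  have "((z \<circ> inv_into W u) \<circ> (u \<circ> inv_into V w)) holomorphic_on w ` ?T" .
  moreover have "((z \<circ> inv_into W u) \<circ> (u \<circ> inv_into V w)) y = (z \<circ> inv_into V w) y" if "y \<in> w ` ?T" for y
   using that chartD(7)[OF cV] chartD(7)[OF cW] by auto
  ultimately show ?thesis using holomorphic_cong[OF refl] by (metis (no_types, lifting))
 qed
 ultimately show "\<exists>E. open E \<and> x \<in> E \<and> (z \<circ> inv_into V w) holomorphic_on E" by blast
qed

lemma transition_properties:
 assumes rs: "riemann_surface S \<A>" and U: "complex_coordinate S \<A> U z" and V: "complex_coordinate S \<A> V w"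
 defines "\<tau> \<equiv> z \<circ> inv_into V w" and "E \<equiv> w ` (U \<inter> V)"
 shows "open E" "\<tau> holomorphic_on E" "\<tau> ` E \<subseteq> z ` (U \<inter> V)" "\<tau> ` E \<subseteq> z ` U" "\<And>x. x \<in> E \<Longrightarrow> deriv \<tau> x \<noteq> 0"
  "\<And>x. x \<in> E \<Longrightarrow> local_expr f V w x = local_expr f U z (\<tau> x)"
  "\<And>q. q \<in> U \<Longrightarrow> q \<in> V \<Longrightarrow> \<tau> (w q) = z q"
proof -
 have cU: "chart S U z" and cV: "chart S V w" using U V by (auto simp: complex_coordinate_def)
 show oE: "open E" unfolding E_def by (rule chart_image_open[OF cV]) (use chartD(1) cU cV in auto)
 show h: "\<tau> holomorphic_on E" unfolding E_def \<tau>_def by (rule transition_holomorphic[OF rs U V])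
 show t: "\<tau> (w q) = z q" if "q \<in> U" "q \<in> V" for q using that chartD(7)[OF cV] by (simp add: \<tau>_def)
 then show "\<tau> ` E \<subseteq> z ` (U \<inter> V)" "\<tau> ` E \<subseteq> z ` U" by (auto simp: E_def)
 show "local_expr f V w x = local_expr f U z (\<tau> x)" if "x \<in> E" for x
  using that t local_expr_chart[OF cU, where f = f] local_expr_chart[OF cV, where f = f] by (auto simp: E_def)
 have "inj_on \<tau> E" unfolding E_def by (rule inj_onI) (auto simp: t dest: inj_onD[OF chartD(3)[OF cU]])
 then show "deriv \<tau> x \<noteq> 0" if "x \<in> E" for x using holomorphic_injective_imp_regular[OF h oE] that by blast
qed

text \<open>Applied with a primitive of a fourth root, which normalises (f_2, f_2), and with
  multiplication by \<i>, which changes the sign of \<open>f_2\<close>.\<close>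

lemma complex_coordinate_compose:
 assumes rs: "riemann_surface S \<A>" and U: "complex_coordinate S \<A> U z"
  and h: "\<phi> holomorphic_on z ` U" and inj: "inj_on \<phi> (z ` U)"
 shows "complex_coordinate S \<A> U (\<phi> \<circ> z)"
  and "x \<in> z ` U \<Longrightarrow> local_expr f U z x = local_expr f U (\<phi> \<circ> z) (\<phi> x)"
proof -
 have cU: "chart S U z" using U by (auto simp: complex_coordinate_def)
 obtain \<psi> where \<psi>: "\<psi> holomorphic_on \<phi> ` z ` U" "\<And>x. x \<in> z ` U \<Longrightarrow> \<psi> (\<phi> x) = x"
  using holomorphic_has_inverse[OF h chartD(2)[OF cU] inj] by metis
 have inv: "inv_into U (\<phi> \<circ> z) (\<phi> (z q)) = q" if "q \<in> U" for q
  using inv_into_f_f[OF comp_inj_on[OF chartD(3)[OF cU] inj] that] by simp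
 have o: "open (\<phi> ` z ` U)" by (rule open_mapping_thm3[OF h chartD(2)[OF cU] inj])
 have "homeomorphism U ((\<phi> \<circ> z) ` U) (\<phi> \<circ> z) (inv_into U (\<phi> \<circ> z))" unfolding homeomorphism_def
 proof (intro conjI ballI)
  show "continuous_on U (\<phi> \<circ> z)"
   by (rule continuous_on_compose[OF chartD(5)[OF cU] holomorphic_on_imp_continuous_on[OF h]])
  have "continuous_on (\<phi> ` z ` U) (inv_into U z \<circ> \<psi>)"
   by (rule continuous_on_compose[OF holomorphic_on_imp_continuous_on[OF \<psi>(1)]])
     (rule continuous_on_subset[OF chartD(6)[OF cU]], use \<psi>(2) in auto)
  moreover have "(inv_into U z \<circ> \<psi>) y = inv_into U (\<phi> \<circ> z) y" if "y \<in> \<phi> ` z ` U" for y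
   using that inv \<psi>(2) chartD(7)[OF cU] by auto
  ultimately show "continuous_on ((\<phi> \<circ> z) ` U) (inv_into U (\<phi> \<circ> z))"
   unfolding image_comp[symmetric] using continuous_on_cong[OF refl, of "\<phi> ` z ` U" "inv_into U z \<circ> \<psi>"] by blast
 qed (use inv in \<open>auto simp: image_iff\<close>)
 then have c: "chart S U (\<phi> \<circ> z)" using o chartD(1)[OF cU] by (auto simp: chart_def image_comp)
 have "chart_compatible U (\<phi> \<circ> z) W w" if W: "(W, w) \<in> \<A>" for W w unfolding chart_compatible_def
 proof
  have cW: "chart S W w" using rs W unfolding riemann_surface_def by blast
  have cc: "chart_compatible U z W w" using U W unfolding complex_coordinate_def by blast
  have "((w \<circ> inv_into U z) \<circ> \<psi>) holomorphic_on \<phi> ` z ` (U \<inter> W)" using cc \<psi> unfolding chart_compatible_def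
   by (intro holomorphic_on_compose_gen[of \<psi> _ _ "z ` (U \<inter> W)"]) (auto elim!: holomorphic_on_subset)
  moreover have "((w \<circ> inv_into U z) \<circ> \<psi>) y = (w \<circ> inv_into U (\<phi> \<circ> z)) y" if "y \<in> \<phi> ` z ` (U \<inter> W)" for y
   using that inv \<psi>(2) chartD(7)[OF cU] by auto
  ultimately show "(w \<circ> inv_into U (\<phi> \<circ> z)) holomorphic_on (\<phi> \<circ> z) ` (U \<inter> W)"
   unfolding image_comp[symmetric] using holomorphic_cong[OF refl, of "\<phi> ` z ` (U \<inter> W)"] by blast
  have "(\<phi> \<circ> (z \<circ> inv_into W w)) holomorphic_on w ` (U \<inter> W)" using cc unfolding chart_compatible_def
   by (intro holomorphic_on_compose_gen[OF _ h]) (auto simp: chartD(7)[OF cW])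
  then show "((\<phi> \<circ> z) \<circ> inv_into W w) holomorphic_on w ` (U \<inter> W)" by (simp add: comp_assoc)
 qed
 then show "complex_coordinate S \<A> U (\<phi> \<circ> z)" using c unfolding complex_coordinate_def by blast
 show "local_expr f U z x = local_expr f U (\<phi> \<circ> z) (\<phi> x)" if "x \<in> z ` U"
  using that inv chartD(7)[OF cU] by (auto simp: local_expr_def)
qed

lemma atlas_complex_coordinate:
 "riemann_surface S \<A> \<Longrightarrow> (U, z) \<in> \<A> \<Longrightarrow> complex_coordinate S \<A> U z"
 unfolding riemann_surface_def complex_coordinate_def by blast

lemma complex_coordinate_chart: "complex_coordinate S \<A> U z \<Longrightarrow> chart S U z"
 by (simp add: complex_coordinate_def)

lemma minimal_immersion_conf_min:
 fixes f :: "'a::t2_space \<Rightarrow> real^'n"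
 assumes "minimal_immersion S \<A> f" "complex_coordinate S \<A> U z"
 shows "conf_min (z ` U) (local_expr f U z)"
proof -
 note c = complex_coordinate_chart[OF assms(2)]
 let ?g = "local_expr f U z"
 have sm: "smooth_on (z ` U) ?g" and
  p: "\<And>w. w \<in> z ` U \<Longrightarrow> inj (frechet_derivative ?g (at w)) \<and> conformal_at ?g w \<and> mean_curvature_zero_at ?g w"
  using assms unfolding minimal_immersion_def by blast+
 have d: "?g differentiable (at w)" if "w \<in> z ` U" for w using smooth_on_differentiable[OF sm that] .
 have u: "norm (?g w) = 1" if "w \<in> z ` U" for w
 proof -
  have "?g w \<in> f ` S" using chartD(4)[OF c] chartD(9)[OF c that] by (auto simp: local_expr_def)
  then show ?thesis using assms(1) by (auto simp: minimal_immersion_def)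
 qed
 have cf: "cdot (f_1 ?g w) (f_1 ?g w) = 0" if "w \<in> z ` U" for w using p[OF that] conformal_at_iff[OF d[OF that]] by blast
 have im: "f_1 ?g w \<noteq> 0" if "w \<in> z ` U" for w using p[OF that] inj_derivative_iff[OF d cf] that by blast
 have cp: "conformal_point (z ` U) ?g w" if "w \<in> z ` U" for w
  unfolding conformal_point_def using chartD(2)[OF c] sm u cf im that by blast
 show ?thesis unfolding conf_min_def
  using chartD(2)[OF c] sm u cf im conformal_point.mean_curvature_zero_iff[OF cp] p by blast
qed

lemma conf_min_minimal_immersion:
 fixes f :: "'a::t2_space \<Rightarrow> real^'n"
 assumes "\<And>U z. complex_coordinate S \<A> U z \<Longrightarrow> conf_min (z ` U) (local_expr f U z)" "f ` S \<subseteq> sphere 0 1"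
 shows "minimal_immersion S \<A> f" unfolding minimal_immersion_def
proof (intro conjI allI impI ballI assms(2))
 fix U z assume c: "complex_coordinate S \<A> U z"
 note g = assms(1)[OF c]
 show "smooth_on (z ` U) (local_expr f U z)" using conf_minD(2)[OF g] .
 fix w assume w: "w \<in> z ` U"
 note d = smooth_on_differentiable[OF conf_minD(2)[OF g] w]
 show "inj (frechet_derivative (local_expr f U z) (at w))"
  using inj_derivative_iff[OF d conf_minD(5)[OF g w]] conf_minD(4)[OF g w] by blast
 show "conformal_at (local_expr f U z) w" using conformal_at_iff[OF d] conf_minD(5)[OF g w] by blast
 show "mean_curvature_zero_at (local_expr f U z) w"
  using conformal_point.mean_curvature_zero_iff[OF conf_min_conformal_point[OF g w]] conf_minD(6)[OF g w] by blast
qed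

section \<open>The cross product of five vectors\<close>

lemma exhaust_6:
 fixes x :: 6
 shows "x = 1 \<or> x = 2 \<or> x = 3 \<or> x = 4 \<or> x = 5 \<or> x = 6"
proof (induct x)
 case (of_int z)
 then have "z = 0 \<or> z = 1 \<or> z = 2 \<or> z = 3 \<or> z = 4 \<or> z = 5" by fastforce
 then show ?case by auto
qed

lemma forall_6: "(\<forall>i::6. P i) \<longleftrightarrow> P 1 \<and> P 2 \<and> P 3 \<and> P 4 \<and> P 5 \<and> P 6" by (metis exhaust_6)

lemma UNIV_6: "UNIV = {1, 2, 3, 4, 5, 6::6}" using exhaust_6 by auto

lemma sum_6: "sum f (UNIV::6 set) = f 1 + f 2 + f 3 + f 4 + f 5 + f 6"
 unfolding UNIV_6 by (simp add: ac_simps)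

lemma vector_6:
 "(vector [a,b,c,d,e,f] :: 'a::zero^6) $ 1 = a" "(vector [a,b,c,d,e,f] :: 'a::zero^6) $ 2 = b"
 "(vector [a,b,c,d,e,f] :: 'a::zero^6) $ 3 = c" "(vector [a,b,c,d,e,f] :: 'a::zero^6) $ 4 = d"
 "(vector [a,b,c,d,e,f] :: 'a::zero^6) $ 5 = e" "(vector [a,b,c,d,e,f] :: 'a::zero^6) $ 6 = f"
 by (simp_all add: vector_def)

lemma vector_4:
 "(vector [a,b,c,d] :: 'a::zero^4) $ 1 = a" "(vector [a,b,c,d] :: 'a::zero^4) $ 2 = b"
 "(vector [a,b,c,d] :: 'a::zero^4) $ 3 = c" "(vector [a,b,c,d] :: 'a::zero^4) $ 4 = d"
 by (simp_all add: vector_def)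

definition cross6 :: "real^6 \<Rightarrow> real^6 \<Rightarrow> real^6 \<Rightarrow> real^6 \<Rightarrow> real^6 \<Rightarrow> real^6" where
 "cross6 p q r s t = (\<chi> i. det (vector [p, q, r, s, t, axis i 1] :: real^6^6))"

text \<open>Isolates the sixth row in the shape in which linearity of \<open>det\<close> in a single
  row is stated.\<close>

lemma vector_6_upd:
 "(vector [p, q, r, s, t, n] :: real^6^6) = (\<chi> i. if i = 6 then n else (vector [p, q, r, s, t, 0] :: real^6^6) $ i)"
 by (simp add: vec_eq_iff[where 'a = "real^6"] forall_6 vector_6)

lemma inner_cross6: "n \<bullet> cross6 p q r s t = det (vector [p, q, r, s, t, n] :: real^6^6)"
proof -
 define L where "L n = det (vector [p, q, r, s, t, n] :: real^6^6)" for n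
 have "L (x + y) = L x + L y" for x y
  using det_row_add[of 6 "\<lambda>_. x" "\<lambda>_. y" "\<lambda>i. (vector [p, q, r, s, t, 0] :: real^6^6) $ i"]
  unfolding L_def vector_6_upd[of _ _ _ _ _ "x + y"] vector_6_upd[of _ _ _ _ _ x] vector_6_upd[of _ _ _ _ _ y] .
 moreover have "L (k *\<^sub>R x) = k *\<^sub>R L x" for k x
 proof -
  have "k *\<^sub>R x = k *s x" by (simp add: vec_eq_iff)
  then show ?thesis unfolding L_def vector_6_upd[of _ _ _ _ _ "k *\<^sub>R x"] vector_6_upd[of _ _ _ _ _ x]
   using det_row_mul[of 6 k "\<lambda>_. x" "\<lambda>i. (vector [p, q, r, s, t, 0] :: real^6^6) $ i"]
   by (simp only: real_scaleR_def)
 qed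
 ultimately have L: "linear L" by (intro linearI)
 have "n = (\<Sum>i\<in>UNIV. (n $ i) *\<^sub>R axis i 1)" by (simp add: basis_expansion flip: scalar_mult_eq_scaleR)
 then have "L n = (\<Sum>i\<in>UNIV. (n $ i) *\<^sub>R L (axis i 1))"
  by (metis (no_types, lifting) L linear_sum linear_scale sum.cong)
 then show ?thesis by (simp add: L_def inner_vec_def cross6_def)
qed

lemma cross6_orth:
 "p \<bullet> cross6 p q r s t = 0" "q \<bullet> cross6 p q r s t = 0" "r \<bullet> cross6 p q r s t = 0"
 "s \<bullet> cross6 p q r s t = 0" "t \<bullet> cross6 p q r s t = 0" unfolding inner_cross6
 by (rule det_identical_rows[of 1 6] det_identical_rows[of 2 6] det_identical_rows[of 3 6]
    det_identical_rows[of 4 6] det_identical_rows[of 5 6], simp, simp add: row_def vector_6)+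

text \<open>Together with a nonzero n orthogonal to all five, the vectors are the rows of a matrix
  with trivial kernel, and its determinant is the product of n with the cross product.\<close>

lemma cross6_nonzero:
 assumes "sorted_wrt (\<lambda>u v. u \<bullet> v = 0) [p, q, r, s, t]" "0 \<notin> set [p, q, r, s, t]"
 shows "cross6 p q r s t \<noteq> 0"
proof -
 have "dim {p, q, r, s, t} \<le> card {p, q, r, s, t}" by (rule dim_le_card') simp
 also have "\<dots> \<le> 5" using card_length[of "[p, q, r, s, t]"] by simp
 finally have "dim {p, q, r, s, t} < DIM(real^6)" by simp
 then obtain n where n: "n \<noteq> 0" "\<And>y. y \<in> span {p, q, r, s, t} \<Longrightarrow> orthogonal n y"
  using orthogonal_to_subspace_exists by blast
 have no: "n \<bullet> x = 0" if "x \<in> {p, q, r, s, t}" for x using n(2)[OF span_base[OF that]] by (simp add: orthogonal_def)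
 let ?M = "vector [p, q, r, s, t, n] :: real^6^6"
 have "y = 0" if "?M *v y = 0" for y
 proof -
  have "?M $ i \<bullet> y = 0" for i using that by (simp add: vec_eq_iff matrix_vector_mul_component)
  then have "p \<bullet> y = 0" "q \<bullet> y = 0" "r \<bullet> y = 0" "s \<bullet> y = 0" "t \<bullet> y = 0" "n \<bullet> y = 0" by (metis vector_6)+
  then show "y = 0"
   by (intro orthogonal_frame_zero[of "[n, p, q, r, s, t]"]) (use assms n no in \<open>auto simp: inner_commute\<close>)
 qed
 then have "\<exists>B. B ** ?M = mat 1" using matrix_left_invertible_ker by blast
 then have "det ?M \<noteq> 0" by (metis det_mul det_I mult_zero_right zero_neq_one)
 then show ?thesis using inner_cross6[of n p q r s t] by auto
qed

lemma smooth_on_vec_lambda: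
 fixes h :: "'n::finite \<Rightarrow> complex \<Rightarrow> real"
 assumes "open D" "\<And>i. smooth_on D (h i)"
 shows "smooth_on D (\<lambda>w. \<chi> i. h i w)"
proof -
 have "smooth_on D (\<lambda>w. \<Sum>i\<in>UNIV. h i w *\<^sub>R axis i (1::real))"
  by (intro smooth_on_sum smooth_on_scaleR smooth_on_const assms)
 moreover have "(\<Sum>i\<in>UNIV. h i w *\<^sub>R axis i (1::real)) = (\<chi> i. h i w)" for w
  using basis_expansion[of "\<chi> i. h i w"] by (simp add: scalar_mult_eq_scaleR)
 ultimately show ?thesis by simp
qed

lemma smooth_on_vec_nth: "open D \<Longrightarrow> smooth_on D (g :: complex \<Rightarrow> real^'n) \<Longrightarrow> smooth_on D (\<lambda>w. g w $ i)"
 by (rule smooth_on_linear[OF _ bounded_linear_vec_nth])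

lemma smooth_on_det:
 fixes M :: "complex \<Rightarrow> real^'n^'n"
 assumes D: "open D" and M: "\<And>i j. smooth_on D (\<lambda>w. M w $ i $ j)"
 shows "smooth_on D (\<lambda>w. det (M w))" unfolding det_def
 by (intro smooth_on_sum D smooth_on_mult smooth_on_prod smooth_on_const M)

lemma smooth_on_cross6:
 assumes D: "open D" and "smooth_on D p" "smooth_on D q" "smooth_on D r" "smooth_on D s" "smooth_on D t"
 shows "smooth_on D (\<lambda>w. cross6 (p w) (q w) (r w) (s w) (t w))" unfolding cross6_def
proof (rule smooth_on_vec_lambda[OF D], rule smooth_on_det[OF D])
 fix k i j :: 6
 show "smooth_on D (\<lambda>w. (vector [p w, q w, r w, s w, t w, axis k 1] :: real^6^6) $ i $ j)"
  using exhaust_6[of i] by (auto simp: vector_6 intro!: smooth_on_vec_nth D assms smooth_on_const)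
qed

section \<open>The (+)transform\<close>

lemma cdot_cvec_left: "cdot (cvec x) y = Complex (x \<bullet> Re_vec y) (x \<bullet> Im_vec y)"
 by (subst vec_eq_Re_Im[of y]) (simp add: cdot_simps cdot_cvec complex_eq_iff)

text \<open>\<open>f_11\<close> and \<open>f_2\<close> differ by a multiple of the isotropic vector
  \<open>f_1\<close>, which is orthogonal to \<open>f_2\<close>. This gives the last equation, by
  which \<open>f_11\<close> can stand in for \<open>f_2\<close> in squares.\<close>

lemma conf_min_f_2_orth:
 assumes g: "conf_min D g" and w: "w \<in> D"
 shows "cdot (cvec (g w)) (f_2 g w) = 0" "cdot (f_1 g w) (f_2 g w) = 0" "cdot (conj_vec (f_1 g w)) (f_2 g w) = 0"
  "cdot (cvec (g w)) (f_1 g w) = 0" "rho g w \<noteq> 0" "rho g w = of_real (Re (rho g w))" "0 < Re (rho g w)"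
  "cdot (f_11 g w) (f_11 g w) = cdot (f_2 g w) (f_2 g w)"
proof -
 interpret conformal_point D g w by (rule conf_min_conformal_point[OF g w])
 have 1: "cdot (cvec (g w)) (f_1 g w) = 0" using g_f_1[OF w] by simp
 show r: "rho g w \<noteq> 0" by (rule rho_real)
 show "rho g w = of_real (Re (rho g w))" "0 < Re (rho g w)" by (rule rho_real)+
 show 0: "cdot (cvec (g w)) (f_2 g w) = 0" "cdot (f_1 g w) (f_2 g w) = 0" "cdot (conj_vec (f_1 g w)) (f_2 g w) = 0" "cdot (cvec (g w)) (f_1 g w) = 0"
  unfolding f_2_F2 F2_def using 1 g_f_11 f_1_f_11 conf[OF w] r
  by (simp_all add: cdot_simps cdot_commute[of "f_11 g w" "conj_vec (f_1 g w)"] rho_def[symmetric] cdot_commute[of "conj_vec (f_1 g w)" "f_1 g w"])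
 have "f_11 g w = f_2 g w + (cdot (f_11 g w) (conj_vec (f_1 g w)) / rho g w) *s f_1 g w"
  unfolding f_2_F2 F2_def by simp
 then obtain k where k: "f_11 g w = f_2 g w + k *s f_1 g w" by blast
 show "cdot (f_11 g w) (f_11 g w) = cdot (f_2 g w) (f_2 g w)"
  unfolding k using 0 conf[OF w] by (simp add: cdot_simps cdot_commute[of "f_2 g w" "f_1 g w"])
qed

lemma cdot_f_2_f_2: "cdot (f_2 g w) (f_2 g w) =
  Complex ((norm (a_part g w))\<^sup>2 - (norm (b_part g w))\<^sup>2) (- 2 * (a_part g w \<bullet> b_part g w))"
 unfolding f_2_ab power2_norm_eq_inner by (simp add: cdot_simps cdot_cvec complex_eq_iff inner_commute)

text \<open>On unit tangent vectors |v| is fixed and v^2 runs over a circle, so up to a common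
  factor a and b are conjugate half-diameters of the ellipse.\<close>

lemma curvature_ellipse_point:
 assumes g: "conf_min D g" and w: "w \<in> D"
 shows "II g w v v = (2 * Re (v * v)) *\<^sub>R a_part g w + (2 * Im (v * v)) *\<^sub>R b_part g w"
  and "norm (dd v g w) = 1 \<longleftrightarrow> 2 * (cmod v)\<^sup>2 * Re (rho g w) = 1"
proof -
 show "II g w v v = (2 * Re (v * v)) *\<^sub>R a_part g w + (2 * Im (v * v)) *\<^sub>R b_part g w"
  unfolding conf_min_II[OF g w] a_part_eq b_part_eq Re_Im_vec_simps by (simp add: vec_eq_iff algebra_simps)
 have "(norm (dd v g w))\<^sup>2 = 2 * (cmod v)\<^sup>2 * Re (rho g w)" unfolding power2_norm_eq_inner[of "dd v g w"]
   dd_inner_conformal[OF smooth_on_differentiable[OF conf_minD(2)[OF g] w] conf_minD(5)[OF g w]]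
  by (simp add: cmod_power2 power2_eq_square[of "Re v"] power2_eq_square[of "Im v"])
 then show "norm (dd v g w) = 1 \<longleftrightarrow> 2 * (cmod v)\<^sup>2 * Re (rho g w) = 1"
  by (metis norm_ge_zero one_power2 power2_eq_iff_nonneg zero_le_one)
qed

text \<open>If (f_2, f_2) = 0, then a and b are orthogonal and of equal length, which makes the
  ellipse a circle.\<close>

lemma noncircular_imp_f_2:
 assumes g: "conf_min D g" and w: "w \<in> D"
  and nc: "\<not> (\<exists>r. \<forall>y \<in> curvature_ellipse g w. norm y = r)"
 shows "cdot (f_2 g w) (f_2 g w) \<noteq> 0"
proof
 let ?a = "a_part g w" and ?b = "b_part g w"
 assume "cdot (f_2 g w) (f_2 g w) = 0"
 then have ab: "(norm ?a)\<^sup>2 = (norm ?b)\<^sup>2" "?a \<bullet> ?b = 0" unfolding cdot_f_2_f_2 by (simp_all add: complex_eq_iff)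
 have R: "0 < Re (rho g w)" by (rule conf_min_f_2_orth[OF g w])
 have "norm y = norm ?a / Re (rho g w)" if y: "y \<in> curvature_ellipse g w" for y
 proof -
  obtain v where v: "y = II g w v v" "norm (dd v g w) = 1" using y by (auto simp: curvature_ellipse_def)
  have c: "2 * (cmod v)\<^sup>2 * Re (rho g w) = 1" using v(2) curvature_ellipse_point(2)[OF g w] by blast
  have "(norm y)\<^sup>2 = 4 * ((Re (v * v))\<^sup>2 + (Im (v * v))\<^sup>2) * (norm ?a)\<^sup>2"
   unfolding v(1) curvature_ellipse_point(1)[OF g w] power2_norm_eq_inner
   using ab unfolding power2_norm_eq_inner
   by (simp add: inner_simps inner_commute[of ?b ?a] power2_eq_square algebra_simps)
  also have "(Re (v * v))\<^sup>2 + (Im (v * v))\<^sup>2 = ((cmod v)\<^sup>2)\<^sup>2"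
   unfolding cmod_power2[symmetric] by (simp add: norm_mult power_mult_distrib power2_eq_square)
  also have "(cmod v)\<^sup>2 = 1 / (2 * Re (rho g w))" using c R by (simp add: field_simps)
  finally have "(norm y)\<^sup>2 = (norm ?a / Re (rho g w))\<^sup>2" by (simp add: power_divide power_mult_distrib)
  then show ?thesis using R by (simp add: power2_eq_iff_nonneg)
 qed
 then show False using nc by blast
qed

lemma nondegenerate_imp_a:
 assumes g: "conf_min D g" and w: "w \<in> D" and d: "dim (curvature_ellipse g w) = 2"
 shows "a_part g w \<noteq> 0"
proof
 assume a: "a_part g w = 0"
 have "II g w v v = (2 * Im (v * v)) *\<^sub>R b_part g w" for v
  unfolding curvature_ellipse_point(1)[OF g w] a by simp
 moreover have "x *\<^sub>R b_part g w \<in> span {b_part g w}" for x by (simp add: span_base span_scale)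
 ultimately have "curvature_ellipse g w \<subseteq> span {b_part g w}"
  unfolding curvature_ellipse_def by (smt (verit) mem_Collect_eq subsetI)
 then have "dim (curvature_ellipse g w) \<le> dim {b_part g w}" by (rule dim_mono)
 also have "\<dots> \<le> 1" using dim_le_card'[of "{b_part g w}"] by simp
 finally show False using d by simp
qed

locale adapted6 =
 fixes D and g :: "complex \<Rightarrow> real^6"
 assumes cm: "conf_min D g" and ad: "\<And>w. w \<in> D \<Longrightarrow> cdot (f_2 g w) (f_2 g w) = -1"
  and a_nz: "\<And>w. w \<in> D \<Longrightarrow> a_part g w \<noteq> 0"
begin

lemma ab:
 assumes "w \<in> D"
 shows "(norm (b_part g w))\<^sup>2 = 1 + (norm (a_part g w))\<^sup>2" "a_part g w \<bullet> b_part g w = 0"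
  "0 < norm (a_part g w)" "1 < norm (b_part g w)"
proof -
 show 1: "(norm (b_part g w))\<^sup>2 = 1 + (norm (a_part g w))\<^sup>2" "a_part g w \<bullet> b_part g w = 0"
  using ad[OF assms] unfolding cdot_f_2_f_2 by (simp_all add: complex_eq_iff)
 show 2: "0 < norm (a_part g w)" using a_nz[OF assms] by simp
 then have "1\<^sup>2 < (norm (b_part g w))\<^sup>2" using 1 by simp
 then show "1 < norm (b_part g w)" by (rule power2_less_imp_less) simp
qed

lemma phi:
 assumes "w \<in> D"
 shows "sinh (phi g w) = norm (a_part g w)" "cosh (phi g w) = norm (b_part g w)"
proof -
 have "phi g w = arsinh (norm (a_part g w))" unfolding phi_def
 proof (rule the_equality)
  have "cosh (arsinh (norm (a_part g w))) = sqrt (1 + (norm (a_part g w))\<^sup>2)"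
   by (simp add: cosh_arsinh_real add.commute)
  also have "\<dots> = norm (b_part g w)" by (simp flip: ab(1)[OF assms])
  finally show "0 < arsinh (norm (a_part g w)) \<and> norm (a_part g w) = sinh (arsinh (norm (a_part g w))) \<and>
    norm (b_part g w) = cosh (arsinh (norm (a_part g w)))"
   using ab(3)[OF assms] by (simp add: sinh_arsinh_real)
 qed (use arsinh_sinh_real in metis)
 then show "sinh (phi g w) = norm (a_part g w)" by (simp add: sinh_arsinh_real)
 have "phi g w = arsinh (norm (a_part g w))" by fact
 then have "cosh (phi g w) = sqrt (1 + (norm (a_part g w))\<^sup>2)" by (simp add: cosh_arsinh_real add.commute)
 then show "cosh (phi g w) = norm (b_part g w)" by (simp flip: ab(1)[OF assms])
qed

lemma frame_orth:
 assumes "w \<in> D"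
 shows "sorted_wrt (\<lambda>u v. u \<bullet> v = 0) [g w, dd 1 g w, dd \<i> g w, a_part g w, b_part g w]"
  "0 \<notin> set [g w, dd 1 g w, dd \<i> g w, a_part g w, b_part g w]"
proof -
 note d = smooth_on_differentiable[OF conf_minD(2)[OF cm] assms]
 note o = conf_min_f_2_orth[OF cm assms]
 have v: "cvec (dd v g w) = v *s f_1 g w + cnj v *s conj_vec (f_1 g w)" for v by (rule f_1_real(3)[OF d])
 have "cdot (cvec (g w)) (conj_vec (f_1 g w)) = 0"
  using o(4) cdot_conj[of "cvec (g w)" "f_1 g w"] by (simp add: conj_vec_simps)
 then have "cdot (cvec (g w)) (cvec (dd v g w)) = 0" for v unfolding v using o by (simp add: cdot_simps)
 then have gv: "g w \<bullet> dd v g w = 0" for v unfolding cdot_cvec by simp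
 have "cdot (cvec (dd v g w)) (f_2 g w) = 0" for v unfolding v using o by (simp add: cdot_simps)
 then have vab: "dd v g w \<bullet> a_part g w = 0" "dd v g w \<bullet> b_part g w = 0" for v
  unfolding cdot_cvec_left a_part_eq b_part_eq by (simp_all add: complex_eq_iff)
 have gab: "g w \<bullet> a_part g w = 0" "g w \<bullet> b_part g w = 0"
  using o(1) unfolding cdot_cvec_left a_part_eq b_part_eq by (simp_all add: complex_eq_iff)
 have vv: "dd u g w \<bullet> dd v g w = 2 * Re (u * cnj v) * Re (rho g w)" for u v
  by (rule dd_inner_conformal[OF d conf_minD(5)[OF cm assms]])
 show "sorted_wrt (\<lambda>u v. u \<bullet> v = 0) [g w, dd 1 g w, dd \<i> g w, a_part g w, b_part g w]"
  using gv vab gab vv[of 1 \<i>] ab(2)[OF assms] by simp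
 have "dd 1 g w \<bullet> dd 1 g w \<noteq> 0" "dd \<i> g w \<bullet> dd \<i> g w \<noteq> 0" using vv o(7) by simp_all
 moreover have "norm (g w) = 1" by (rule conf_minD(3)[OF cm assms])
 ultimately show "0 \<notin> set [g w, dd 1 g w, dd \<i> g w, a_part g w, b_part g w]" using ab(3,4)[OF assms] by auto
qed

text \<open>The factors 2 match II(1, 1) = 2 a and II(1, \<i>) = 2 b, so that the product of this
  vector with n is the very determinant that orients \<open>unit_N\<close>.\<close>

definition normal where
 "normal w = cross6 (g w) (dd 1 g w) (dd \<i> g w) (2 *\<^sub>R a_part g w) (2 *\<^sub>R b_part g w)"

lemma normal:
 assumes "w \<in> D"
 shows "normal w \<noteq> 0" "normal w \<bullet> g w = 0" "normal w \<bullet> dd 1 g w = 0" "normal w \<bullet> dd \<i> g w = 0"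
  "normal w \<bullet> a_part g w = 0" "normal w \<bullet> b_part g w = 0"
proof -
 note o = cross6_orth[where p = "g w" and q = "dd 1 g w" and r = "dd \<i> g w" and s = "2 *\<^sub>R a_part g w"
   and t = "2 *\<^sub>R b_part g w", folded normal_def]
 show "normal w \<noteq> 0" unfolding normal_def by (rule cross6_nonzero) (use frame_orth[OF assms] in simp_all)
 show "normal w \<bullet> g w = 0" "normal w \<bullet> dd 1 g w = 0" "normal w \<bullet> dd \<i> g w = 0"
  "normal w \<bullet> a_part g w = 0" "normal w \<bullet> b_part g w = 0"
  using o by (simp_all add: inner_commute[of "normal w"])
qed

lemma orth_imp_multiple:
 assumes "w \<in> D" "n \<bullet> g w = 0" "n \<bullet> dd 1 g w = 0" "n \<bullet> dd \<i> g w = 0" "n \<bullet> a_part g w = 0" "n \<bullet> b_part g w = 0"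
 shows "n = (n \<bullet> normal w / (norm (normal w))\<^sup>2) *\<^sub>R normal w"
proof -
 have "n - (n \<bullet> normal w / (norm (normal w))\<^sup>2) *\<^sub>R normal w = 0"
  by (rule orthogonal_frame_zero[of "[normal w, g w, dd 1 g w, dd \<i> g w, a_part g w, b_part g w]"])
    (use frame_orth[OF assms(1)] normal[OF assms(1)] assms in
     \<open>auto simp: inner_diff_left power2_norm_eq_inner\<close>)
 then show ?thesis by simp
qed

lemma cdot_f_1_iff:
 assumes "w \<in> D"
 shows "cdot (cvec n) (f_1 g w) = 0 \<longleftrightarrow> n \<bullet> dd 1 g w = 0 \<and> n \<bullet> dd \<i> g w = 0"
  and "cdot (cvec n) (f_2 g w) = Complex (n \<bullet> a_part g w) (- (n \<bullet> b_part g w))"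
 unfolding f_1_real(1)[OF smooth_on_differentiable[OF conf_minD(2)[OF cm] assms]]
  apply (simp add: cdot_simps cdot_cvec complex_eq_iff) unfolding cdot_cvec_left a_part_eq b_part_eq by simp

text \<open>The orthogonality conditions put n on the line of \<open>normal\<close>, the norm fixes
  it up to sign, and the determinant condition reads 0 < n \<bullet>
  \<open>normal w\<close>.\<close>

lemma unit_N:
 assumes w: "w \<in> D"
 shows "unit_N g w = (1 / norm (normal w)) *\<^sub>R normal w" unfolding unit_N_def
proof (rule the_equality)
 have ii: "II g w 1 1 = 2 *\<^sub>R a_part g w" "II g w 1 \<i> = 2 *\<^sub>R b_part g w"
  unfolding conf_min_II[OF cm w] a_part_eq b_part_eq by (simp_all add: Re_Im_vec_simps)
 have c: "cdot (cvec n) (conj_vec y) = cnj (cdot (cvec n) y)" for n :: "real^6" and y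
  using cdot_conj[of "cvec n" y] by (simp add: conj_vec_simps)
 note nn = normal[OF w]
 let ?n = "(1 / norm (normal w)) *\<^sub>R normal w"
 have "?n \<bullet> normal w = norm (normal w)" using nn(1) by (simp add: power2_norm_eq_inner[symmetric] power2_eq_square)
 then show "norm ?n = 1 \<and> ?n \<bullet> g w = 0 \<and> cdot (cvec ?n) (f_1 g w) = 0 \<and> cdot (cvec ?n) (conj_vec (f_1 g w)) = 0 \<and>
   cdot (cvec ?n) (f_2 g w) = 0 \<and> cdot (cvec ?n) (conj_vec (f_2 g w)) = 0 \<and>
   det (vector [g w, dd 1 g w, dd \<i> g w, II g w 1 1, II g w 1 \<i>, ?n] :: real^6^6) > 0"
  unfolding ii inner_cross6[symmetric] normal_def[symmetric] c cdot_f_1_iff(2)[OF w]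
  using nn cdot_f_1_iff(1)[OF w, of ?n] by (simp add: complex_eq_iff)
 fix n
 assume n: "norm n = 1 \<and> n \<bullet> g w = 0 \<and> cdot (cvec n) (f_1 g w) = 0 \<and> cdot (cvec n) (conj_vec (f_1 g w)) = 0 \<and>
   cdot (cvec n) (f_2 g w) = 0 \<and> cdot (cvec n) (conj_vec (f_2 g w)) = 0 \<and>
   det (vector [g w, dd 1 g w, dd \<i> g w, II g w 1 1, II g w 1 \<i>, n] :: real^6^6) > 0"
 define k where "k = n \<bullet> normal w / (norm (normal w))\<^sup>2"
 have nk: "n = k *\<^sub>R normal w" unfolding k_def
  by (rule orth_imp_multiple[OF w]) (use n cdot_f_1_iff[OF w, of n] in \<open>auto simp: complex_eq_iff\<close>)
 have "n \<bullet> normal w > 0" using n unfolding ii inner_cross6[symmetric] normal_def[symmetric] by blast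
 then have "k > 0" using nn(1) by (simp add: k_def)
 moreover have "norm n = \<bar>k\<bar> * norm (normal w)" by (simp add: nk)
 ultimately have "k = 1 / norm (normal w)" using n nn(1) by (simp add: field_simps)
 then show "n = ?n" using nk by simp
qed

lemma unit_N_props:
 assumes w: "w \<in> D"
 shows "norm (unit_N g w) = 1" "unit_N g w \<bullet> g w = 0" "unit_N g w \<bullet> dd 1 g w = 0" "unit_N g w \<bullet> dd \<i> g w = 0"
  "unit_N g w \<bullet> a_part g w = 0" "unit_N g w \<bullet> b_part g w = 0"
 unfolding unit_N[OF w] using normal[OF w] by simp_all

lemma f_plus_eq:
 assumes w: "w \<in> D"
 shows "f_plus g w = - (1 / (norm (b_part g w))\<^sup>2) *\<^sub>R b_part g w + (norm (a_part g w) / norm (b_part g w)) *\<^sub>R unit_N g w"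
 unfolding f_plus_def tanh_def phi[OF w] by (simp add: power2_eq_square)

lemma norm_orth_comb: "u \<bullet> v = 0 \<Longrightarrow> (norm (x *\<^sub>R u + y *\<^sub>R v))\<^sup>2 = x\<^sup>2 * (norm u)\<^sup>2 + y\<^sup>2 * (norm v)\<^sup>2"
 for u v :: "real^6"
 unfolding power2_norm_eq_inner by (simp add: inner_add_left inner_add_right inner_commute[of v u] power2_eq_square)

lemma f_plus_props:
 assumes w: "w \<in> D"
 shows "norm (f_plus g w) = 1" "f_plus g w \<bullet> g w = 0" "cdot (cvec (f_plus g w)) (f_1 g w) = 0"
  "cdot (cvec (f_plus g w)) (f_2 g w) = \<i>" "0 < f_plus g w \<bullet> unit_N g w"
proof -
 note u = unit_N_props[OF w] and a = ab[OF w] and f = frame_orth[OF w]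
 have uu: "unit_N g w \<bullet> unit_N g w = 1" using u(1) by (simp add: power2_norm_eq_inner[symmetric])
 have b0: "norm (b_part g w) \<noteq> 0" using a by auto
 have "(norm (f_plus g w))\<^sup>2 = 1 / (norm (b_part g w))\<^sup>2 + (norm (a_part g w))\<^sup>2 / (norm (b_part g w))\<^sup>2"
  unfolding f_plus_eq[OF w] norm_orth_comb[OF u(6)[unfolded inner_commute[of "unit_N g w"]]] u(1)
  using b0 by (simp add: power2_eq_square)
 also have "\<dots> = 1"
 proof -
  have "0 < 1 + (norm (a_part g w))\<^sup>2" by (simp add: add_pos_nonneg)
  then show ?thesis unfolding a(1) by (simp add: add_divide_distrib[symmetric])
 qed
 finally show "norm (f_plus g w) = 1" by (simp add: power2_eq_1_iff) (metis norm_ge_zero neg_0_le_iff_le not_one_le_zero)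
 show "f_plus g w \<bullet> g w = 0" unfolding f_plus_eq[OF w] using u f by (simp add: inner_simps inner_commute)
 show "cdot (cvec (f_plus g w)) (f_1 g w) = 0"
  unfolding cdot_f_1_iff[OF w] f_plus_eq[OF w] using u f by (simp add: inner_simps inner_commute)
 have "f_plus g w \<bullet> a_part g w = 0" unfolding f_plus_eq[OF w] using u a by (simp add: inner_simps inner_commute)
 moreover have "f_plus g w \<bullet> b_part g w = -1"
  unfolding f_plus_eq[OF w] using u b0 by (simp add: inner_simps power2_norm_eq_inner[symmetric])
 ultimately show "cdot (cvec (f_plus g w)) (f_2 g w) = \<i>" unfolding cdot_f_1_iff[OF w] by (simp add: complex_eq_iff)
 show "0 < f_plus g w \<bullet> unit_N g w"
  unfolding f_plus_eq[OF w] using u uu a b0 by (simp add: inner_simps inner_commute[of "b_part g w" "unit_N g w"])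
qed

text \<open>The first conditions leave X with parts along a, b and N only. The pairing with
  \<open>f_2\<close> says X \<bullet> a = 0 and X \<bullet> b = -1, unit length gives the N-part up
  to sign, and the last hypothesis gives the sign.\<close>

lemma f_plus_unique:
 assumes w: "w \<in> D" and X: "norm X = 1" "X \<bullet> g w = 0" "cdot (cvec X) (f_1 g w) = 0"
  "cdot (cvec X) (f_2 g w) = \<i>" "0 < X \<bullet> unit_N g w"
 shows "X = f_plus g w"
proof -
 note u = unit_N_props[OF w] and a = ab[OF w] and f = frame_orth[OF w]
 have uu: "unit_N g w \<bullet> unit_N g w = 1" using u(1) by (simp add: power2_norm_eq_inner[symmetric])
 have b0: "norm (b_part g w) \<noteq> 0" using a by auto
 have Xab: "X \<bullet> a_part g w = 0" "X \<bullet> b_part g w = -1"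
  using X(4) unfolding cdot_f_1_iff[OF w] by (simp_all add: complex_eq_iff)
 define m where "m = X + (1 / (norm (b_part g w))\<^sup>2) *\<^sub>R b_part g w"
 have Xv: "X \<bullet> dd 1 g w = 0" "X \<bullet> dd \<i> g w = 0" using X(3) cdot_f_1_iff(1)[OF w] by blast+
 have bv: "b_part g w \<bullet> g w = 0" "b_part g w \<bullet> dd 1 g w = 0" "b_part g w \<bullet> dd \<i> g w = 0" "b_part g w \<bullet> a_part g w = 0"
  using f(1) by (simp_all add: inner_commute[of "b_part g w"])
 have "m \<bullet> g w = 0" "m \<bullet> dd 1 g w = 0" "m \<bullet> dd \<i> g w = 0" "m \<bullet> a_part g w = 0"
  unfolding m_def using X(2) Xv Xab bv by (simp_all add: inner_add_left)
 moreover have "m \<bullet> b_part g w = 0"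
  unfolding m_def using Xab b0 by (simp add: inner_add_left power2_norm_eq_inner)
 ultimately obtain k where k: "m = k *\<^sub>R normal w" using orth_imp_multiple[OF w, of m] by blast
 define t where "t = k * norm (normal w)"
 have mt: "m = t *\<^sub>R unit_N g w" unfolding k t_def unit_N[OF w] using normal(1)[OF w] by simp
 then have Xt: "X = - (1 / (norm (b_part g w))\<^sup>2) *\<^sub>R b_part g w + t *\<^sub>R unit_N g w" by (simp add: m_def algebra_simps)
 have "t > 0" using X(5) unfolding Xt using u uu by (simp add: inner_simps inner_commute[of "b_part g w" "unit_N g w"])
 have "1 = (norm X)\<^sup>2" using X by simp
 also have "\<dots> = 1 / (norm (b_part g w))\<^sup>2 + t\<^sup>2"
  unfolding Xt norm_orth_comb[OF u(6)[unfolded inner_commute[of "unit_N g w"]]] u(1)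
  using b0 by (simp add: power2_eq_square)
 finally have t2: "1 = 1 / (norm (b_part g w))\<^sup>2 + t\<^sup>2" .
 have "0 < 1 + (norm (a_part g w))\<^sup>2" by (simp add: add_pos_nonneg)
 then have "t\<^sup>2 = (norm (a_part g w) / norm (b_part g w))\<^sup>2"
  using t2 unfolding power_divide a(1) by (simp add: field_simps)
 then have "t = norm (a_part g w) / norm (b_part g w)" using \<open>t > 0\<close> a by (simp add: power2_eq_iff_nonneg)
 then show ?thesis unfolding Xt f_plus_eq[OF w] by simp
qed

lemma smooth_parts: "smooth_on D (f_1 g)" "smooth_on D (f_11 g)" "smooth_on D (rho g)" "smooth_on D (f_2 g)"
 "smooth_on D (a_part g)" "smooth_on D (b_part g)"
proof -
 note D = conf_minD(1)[OF cm]
 show f1: "smooth_on D (f_1 g)"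
  unfolding f_1_def comp_def using smooth_on_cvec smooth_on_del conf_minD(1,2)[OF cm] by blast
 then show f11: "smooth_on D (f_11 g)" unfolding f_11_def by (rule smooth_on_del[OF D])
 show r: "smooth_on D (rho g)" unfolding rho_def[abs_def] by (intro smooth_on_cdot D f1 smooth_on_conj_vec)
 have "smooth_on D (\<lambda>w. f_11 g w - (cdot (f_11 g w) (conj_vec (f_1 g w)) * of_real (inverse (Re (rho g w)))) *s f_1 g w)"
  using conf_min_f_2_orth(7)[OF cm]
  by (intro smooth_on_diff D f11 smooth_on_smult smooth_on_mult smooth_on_cdot smooth_on_conj_vec f1 smooth_on_of_real
    smooth_on_inverse smooth_on_Re r) force
 moreover have "f_11 g w - (cdot (f_11 g w) (conj_vec (f_1 g w)) * of_real (inverse (Re (rho g w)))) *s f_1 g w = f_2 g w"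
  if "w \<in> D" for w
 proof -
  have "of_real (inverse (Re (rho g w))) = inverse (rho g w)" using conf_min_f_2_orth(6)[OF cm that] by (metis of_real_inverse)
  then show ?thesis unfolding conf_min_f_2[OF cm that] by (simp add: divide_inverse)
 qed
 ultimately show f2: "smooth_on D (f_2 g)" using smooth_on_cong[OF D, of "f_2 g"] by (metis (no_types, lifting))
 show "smooth_on D (a_part g)" "smooth_on D (b_part g)" unfolding a_part_eq[abs_def] b_part_eq[abs_def]
  by (intro smooth_on_Re_vec smooth_on_minus smooth_on_Im_vec D f2)+
qed

text \<open>Smoothness is read off from a formula in which only the norms of a, b and
  \<open>normal\<close> occur in denominators or under roots; all three vectors are nowhere
  zero.\<close>

lemma smooth_f_plus: "smooth_on D (f_plus g)"
proof -
 note D = conf_minD(1)[OF cm] and s = conf_minD(2)[OF cm]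
 have N: "smooth_on D normal" unfolding normal_def[abs_def]
  by (intro smooth_on_cross6 D s smooth_on_dd smooth_on_scaleR smooth_on_const smooth_parts)
 have na: "smooth_on D (\<lambda>w. norm (a_part g w))" "smooth_on D (\<lambda>w. norm (b_part g w))" "smooth_on D (\<lambda>w. norm (normal w))"
  by (rule smooth_on_norm[OF D], (intro smooth_parts N), use ab normal(1) in force)+
 have "smooth_on D (\<lambda>w. (- (1 / (norm (b_part g w) * norm (b_part g w)))) *\<^sub>R b_part g w +
    (norm (a_part g w) / norm (b_part g w)) *\<^sub>R ((1 / norm (normal w)) *\<^sub>R normal w))"
  by (intro smooth_on_add D smooth_on_scaleR smooth_on_minus smooth_on_divide smooth_on_const smooth_on_mult na smooth_parts N)
    (use ab(4) normal(1) in force)+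
 then show ?thesis
  using smooth_on_cong[OF D, of "f_plus g" "\<lambda>w. (- (1 / (norm (b_part g w) * norm (b_part g w)))) *\<^sub>R b_part g w +
    (norm (a_part g w) / norm (b_part g w)) *\<^sub>R ((1 / norm (normal w)) *\<^sub>R normal w)"] f_plus_eq unit_N
  by (simp add: power2_eq_square)
qed

end

text \<open>A Gronwall argument without integration. Around a zero of h, on a ball whose radius
  times the bound of K is at most 1/2, the maximum of |h| is at most half of itself. So the zero set
  is open as well as closed.\<close>

lemma linear_differential_inequality_zero:
 fixes h :: "complex \<Rightarrow> 'e::real_normed_vector"
 assumes D: "open D" "connected D" and der: "\<And>w. w \<in> D \<Longrightarrow> (h has_derivative h' w) (at w)"
  and bd: "\<And>w v. w \<in> D \<Longrightarrow> norm (h' w v) \<le> K w * norm (h w) * norm v"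
  and K: "continuous_on D K" and w0: "w0 \<in> D" "h w0 = 0" and w: "w \<in> D"
 shows "h w = 0"
proof -
 have hc: "continuous_on D h"
  by (rule continuous_at_imp_continuous_on) (use der has_derivative_continuous in blast)
 let ?Z = "{w \<in> D. h w = 0}"
 have "openin (top_of_set D) ?Z"
 proof (subst openin_open_eq[OF D(1)], intro conjI)
  show "open ?Z" unfolding open_contains_cball
  proof
   fix w1 assume w1: "w1 \<in> ?Z"
   then obtain e where e: "e > 0" "cball w1 e \<subseteq> D" using D(1) open_contains_cball by blast
   have "compact (K ` cball w1 e)" using K e(2) compact_continuous_image continuous_on_subset compact_cball by metis
   then obtain M where M: "M > 0" "\<And>w. w \<in> cball w1 e \<Longrightarrow> \<bar>K w\<bar> \<le> M"
    using compact_imp_bounded bounded_pos by (metis imageI real_norm_def)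
   define d where "d = min e (1 / (2 * M))"
   have d: "d > 0" "d \<le> e" "M * d \<le> 1/2" using e M by (auto simp: d_def min_def field_simps)
   have sub: "cball w1 d \<subseteq> D" using d e by (meson order_trans subset_cball)
   have "continuous_on (cball w1 d) (\<lambda>w. norm (h w))" using hc sub continuous_on_subset continuous_on_norm by blast
   then obtain ws where ws: "ws \<in> cball w1 d" "\<And>w. w \<in> cball w1 d \<Longrightarrow> norm (h w) \<le> norm (h ws)"
    using continuous_attains_sup[of "cball w1 d" "\<lambda>w. norm (h w)"] d(1) by force
   have "norm (h ws - h w1) \<le> (M * norm (h ws)) * norm (ws - w1)"
   proof (rule differentiable_bound[of "cball w1 d" h h'])
    show "convex (cball w1 d)" by simp
    show "(h has_derivative h' x) (at x within cball w1 d)" if "x \<in> cball w1 d" for x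
     using der sub that has_derivative_at_withinI by blast
    show "onorm (h' x) \<le> M * norm (h ws)" if x: "x \<in> cball w1 d" for x
    proof (rule onorm_bound)
     show "0 \<le> M * norm (h ws)" using M by simp
     fix v
     have "norm (h' x v) \<le> K x * norm (h x) * norm v" using bd sub x by blast
     also have "\<dots> \<le> M * norm (h ws) * norm v"
     proof -
      have "K x \<le> M" using M(2)[of x] x d by auto
      then have "K x * norm (h x) \<le> M * norm (h ws)"
       using ws(2)[OF x] M(1) by (meson mult_mono less_imp_le norm_ge_zero)
      then show ?thesis by (simp add: mult_right_mono)
     qed
     finally show "norm (h' x v) \<le> M * norm (h ws) * norm v" .
    qed
   qed (use ws d in auto)
   also have "\<dots> \<le> (M * norm (h ws)) * d"
    using ws(1) M by (intro mult_left_mono) (auto simp: dist_norm norm_minus_commute)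
   also have "\<dots> \<le> norm (h ws) * (1/2)" using mult_left_mono[OF d(3), of "norm (h ws)"] by (simp add: algebra_simps)
   finally have "norm (h ws) \<le> norm (h ws) * (1/2)" using w1 by simp
   then have "h ws = 0" by simp
   then have "cball w1 d \<subseteq> ?Z" using ws(2) sub by force
   then show "\<exists>d>0. cball w1 d \<subseteq> ?Z" using d by blast
  qed
 qed auto
 moreover have "closedin (top_of_set D) ?Z" using continuous_closedin_preimage_constant[OF hc] by simp
 ultimately have "?Z = {} \<or> ?Z = D" using D(2) connected_clopen by blast
 then show ?thesis using w0 w by blast
qed

section \<open>Minimal surfaces and their (+)transforms\<close>

lemma conf_min_smooth:
 assumes g: "conf_min D g"
 shows "smooth_on D (\<lambda>w. cvec (g w))" "smooth_on D (f_1 g)" "smooth_on D (f_11 g)" "smooth_on D (rho g)"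
  "smooth_on D (\<lambda>w. conj_vec (f_1 g w))" "smooth_on D (\<lambda>w. conj_vec (f_11 g w))"
proof -
 note D = conf_minD(1)[OF g]
 show "smooth_on D (\<lambda>w. cvec (g w))" by (rule smooth_on_cvec[OF D conf_minD(2)[OF g]])
 then show f1: "smooth_on D (f_1 g)" unfolding f_1_def comp_def by (rule smooth_on_del[OF D])
 then show f11: "smooth_on D (f_11 g)" unfolding f_11_def by (rule smooth_on_del[OF D])
 show "smooth_on D (rho g)" unfolding rho_def[abs_def] by (intro smooth_on_cdot D f1 smooth_on_conj_vec)
 show "smooth_on D (\<lambda>w. conj_vec (f_1 g w))" "smooth_on D (\<lambda>w. conj_vec (f_11 g w))"
  by (intro smooth_on_conj_vec D f1 f11)+
qed

lemma f_1_def': "f_1 g w = del (\<lambda>w. cvec (g w)) w" by (simp add: f_1_def comp_def)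

lemma delb_cvec:
 fixes g :: "complex \<Rightarrow> real^'n"
 assumes "g differentiable (at w)"
 shows "delb (\<lambda>w. cvec (g w)) w = conj_vec (f_1 g w)" using f_1_real(2)[OF assms] by (simp add: comp_def)

context
 fixes D g w
 assumes g: "conf_min D g" and w: "w \<in> D"
begin

lemma conf_min_conj_rho: "cnj (rho g w) = rho g w"
 using conf_min_f_2_orth(6)[OF g w] by (metis complex_cnj_complex_of_real)

lemma conf_min_pairings:
 "cdot (cvec (g w)) (cvec (g w)) = 1" "cdot (cvec (g w)) (f_1 g w) = 0" "cdot (cvec (g w)) (conj_vec (f_1 g w)) = 0"
 "cdot (f_1 g w) (f_1 g w) = 0" "cdot (f_1 g w) (conj_vec (f_1 g w)) = rho g w" "cdot (cvec (g w)) (f_11 g w) = 0"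
 "cdot (f_1 g w) (f_11 g w) = 0" "cdot (cvec (g w)) (conj_vec (f_11 g w)) = 0"
 "cdot (conj_vec (f_1 g w)) (conj_vec (f_1 g w)) = 0" "cdot (conj_vec (f_1 g w)) (conj_vec (f_11 g w)) = 0"
proof -
 interpret conformal_point D g w by (rule conf_min_conformal_point[OF g w])
 show "cdot (cvec (g w)) (cvec (g w)) = 1" "cdot (cvec (g w)) (f_1 g w) = 0" "cdot (cvec (g w)) (conj_vec (f_1 g w)) = 0"
  "cdot (f_1 g w) (f_1 g w) = 0" "cdot (f_1 g w) (conj_vec (f_1 g w)) = rho g w" "cdot (cvec (g w)) (f_11 g w) = 0"
  "cdot (f_1 g w) (f_11 g w) = 0"
  using gg[OF w] g_f_1[OF w] g_conj_f_1[OF w] conf[OF w] g_f_11 f_1_f_11 by (simp_all add: rho_def)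
 show "cdot (cvec (g w)) (conj_vec (f_11 g w)) = 0"
 "cdot (conj_vec (f_1 g w)) (conj_vec (f_1 g w)) = 0" "cdot (conj_vec (f_1 g w)) (conj_vec (f_11 g w)) = 0"
  using cdot_conj[of "cvec (g w)" "f_11 g w"] cdot_conj[of "f_1 g w" "f_1 g w"] cdot_conj[of "f_1 g w" "f_11 g w"] g_f_11 f_1_f_11 conf[OF w]
  by (simp_all add: conj_vec_simps)
qed

lemma conf_min_del_conj_f_1: "del (\<lambda>w. conj_vec (f_1 g w)) w = - rho g w *s cvec (g w)"
 unfolding del_conj[OF smooth_on_differentiable[OF conf_min_smooth(2)[OF g] w]] conf_minD(6)[OF g w]
 by (simp add: conj_vec_simps conf_min_conj_rho)

lemma conf_min_dz_rho: "dz (rho g) w = cdot (f_11 g w) (conj_vec (f_1 g w))"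
proof -
 have "dz (rho g) w = cdot (del (f_1 g) w) (conj_vec (f_1 g w)) + cdot (f_1 g w) (del (\<lambda>w. conj_vec (f_1 g w)) w)"
  unfolding rho_def[abs_def]
  by (rule dz_cdot(1)[OF smooth_on_differentiable[OF conf_min_smooth(2)[OF g] w] smooth_on_differentiable[OF conf_min_smooth(5)[OF g] w]])
 also have "cdot (f_1 g w) (del (\<lambda>w. conj_vec (f_1 g w)) w) = 0"
  unfolding conf_min_del_conj_f_1 cdot_simps cdot_commute[of "f_1 g w" "cvec (g w)"] conf_min_pairings by simp
 finally show ?thesis by (simp add: f_11_def)
qed

text \<open>The harmonic map equation differentiated once more, after exchanging the two
  derivatives.\<close>

lemma conf_min_delb_f_11: "delb (f_11 g) w = - dz (rho g) w *s cvec (g w) - rho g w *s f_1 g w"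
proof -
 note D = conf_minD(1)[OF g]
 have "delb (f_11 g) w = del (delb (f_1 g)) w"
  unfolding f_11_def by (rule del_delb_commute[OF D w conf_min_smooth(2)[OF g]])
 also have "\<dots> = del (\<lambda>w. (- rho g w) *s cvec (g w)) w" by (rule del_cong[OF D w conf_minD(6)[OF g]])
 also have "\<dots> = dz (\<lambda>w. - rho g w) w *s cvec (g w) + (- rho g w) *s f_1 g w" unfolding f_1_def'
  by (rule del_smult; rule smooth_on_differentiable[OF _ w])
    (intro smooth_on_minus D conf_min_smooth[OF g])+
 also have "dz (\<lambda>w. - rho g w) w = dz (\<lambda>w. (-1) * rho g w) w" by simp
 also have "\<dots> = - dz (rho g) w"
  using dz_mult(1)[of "\<lambda>_. -1" w "rho g"] smooth_on_differentiable[OF conf_min_smooth(4)[OF g] w] by (simp add: dz_const)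
 finally show ?thesis by (simp add: vec_eq_iff)
qed

lemma conf_min_del_conj_f_11: "del (\<lambda>w. conj_vec (f_11 g w)) w = - cnj (dz (rho g) w) *s cvec (g w) - rho g w *s conj_vec (f_1 g w)"
 unfolding del_conj[OF smooth_on_differentiable[OF conf_min_smooth(3)[OF g] w]] conf_min_delb_f_11
 by (simp add: conj_vec_simps conf_min_conj_rho)

lemma conf_min_dzb_rho: "dzb (rho g) w = cdot (f_1 g w) (conj_vec (f_11 g w))"
proof -
 have "delb (\<lambda>w. conj_vec (f_1 g w)) w = conj_vec (f_11 g w)"
  unfolding del_conj[OF smooth_on_differentiable[OF conf_min_smooth(2)[OF g] w]] f_11_def ..
 then have e: "cdot (f_1 g w) (delb (\<lambda>w. conj_vec (f_1 g w)) w) = cdot (f_1 g w) (conj_vec (f_11 g w))" by simp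
 have "dzb (rho g) w = cdot (delb (f_1 g) w) (conj_vec (f_1 g w)) + cdot (f_1 g w) (delb (\<lambda>w. conj_vec (f_1 g w)) w)"
  unfolding rho_def[abs_def]
  by (rule dz_cdot(2)[OF smooth_on_differentiable[OF conf_min_smooth(2)[OF g] w] smooth_on_differentiable[OF conf_min_smooth(5)[OF g] w]])
 then show ?thesis unfolding e conf_minD(6)[OF g w] cdot_simps conf_min_pairings by simp
qed

end

definition f_11_sq :: "(complex \<Rightarrow> real^'n) \<Rightarrow> complex \<Rightarrow> complex" where
 "f_11_sq g w = cdot (f_11 g w) (conj_vec (f_11 g w))"

text \<open>A form of the Gauss equation: |f_11|^2 is a function of the metric alone. Two minimal
  surfaces with the same \<open>rho\<close> share it, which is the source of the symmetry between f
  and X.\<close>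

lemma conf_min_f_11_sq:
 assumes g: "conf_min D g" and w: "w \<in> D"
 shows "f_11_sq g w = dz (dzb (rho g)) w + (rho g w)\<^sup>2"
proof -
 note D = conf_minD(1)[OF g]
 have "dz (dzb (rho g)) w = dz (\<lambda>w. cdot (f_1 g w) (conj_vec (f_11 g w))) w"
  by (rule dz_cong[OF D w conf_min_dzb_rho[OF g]])
 also have "\<dots> = f_11_sq g w - (rho g w)\<^sup>2"
  unfolding dz_cdot(1)[OF smooth_on_differentiable[OF conf_min_smooth(2)[OF g] w] smooth_on_differentiable[OF conf_min_smooth(6)[OF g] w]]
   conf_min_del_conj_f_11[OF g w] f_11_sq_def
  by (simp add: cdot_simps conf_min_pairings[OF g w] cdot_commute[of "f_1 g w" "cvec (g w)"] f_11_def power2_eq_square)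
 finally show ?thesis by simp
qed

lemma conf_min_f_2_sq:
 assumes g: "conf_min D g" and w: "w \<in> D"
 shows "cdot (f_2 g w) (conj_vec (f_2 g w)) = f_11_sq g w - dz (rho g) w * cnj (dz (rho g) w) / rho g w"
  and "cdot (f_2 g w) (conj_vec (f_2 g w)) = of_real ((norm (a_part g w))\<^sup>2 + (norm (b_part g w))\<^sup>2)"
proof -
 have e: "f_2 g w = f_11 g w - (dz (rho g) w / rho g w) *s f_1 g w"
  unfolding conf_min_f_2[OF g w] conf_min_dz_rho[OF g w] ..
 have z: "cdot (f_11 g w) (conj_vec (f_1 g w)) = dz (rho g) w" "cdot (f_1 g w) (conj_vec (f_11 g w)) = cnj (dz (rho g) w)"
  using conf_min_dz_rho[OF g w] cdot_conj[of "f_11 g w" "conj_vec (f_1 g w)"]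
  by (simp_all add: conj_vec_simps cdot_commute[of "conj_vec (f_11 g w)"])
 show "cdot (f_2 g w) (conj_vec (f_2 g w)) = f_11_sq g w - dz (rho g) w * cnj (dz (rho g) w) / rho g w"
  unfolding e using conf_min_f_2_orth(5)[OF g w]
  by (simp add: cdot_simps conj_vec_simps f_11_sq_def z conf_min_pairings[OF g w] conf_min_conj_rho[OF g w] field_simps)
 show "cdot (f_2 g w) (conj_vec (f_2 g w)) = of_real ((norm (a_part g w))\<^sup>2 + (norm (b_part g w))\<^sup>2)"
  unfolding cdot_self_conj a_part_eq b_part_eq by simp
qed

section \<open>Structure equations of a surface and its transform\<close>

locale pair6 = adapted6 D g for D and g :: "complex \<Rightarrow> real^6" +
 fixes X :: "complex \<Rightarrow> real^6"
 assumes smooth_X: "smooth_on D X"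
  and XX: "\<And>w. w \<in> D \<Longrightarrow> cdot (cvec (X w)) (cvec (X w)) = 1"
  and gX: "\<And>w. w \<in> D \<Longrightarrow> cdot (cvec (g w)) (cvec (X w)) = 0"
  and f_1_X: "\<And>w. w \<in> D \<Longrightarrow> cdot (f_1 g w) (cvec (X w)) = 0"
  and f_11_X: "\<And>w. w \<in> D \<Longrightarrow> cdot (f_11 g w) (cvec (X w)) = \<i>"
begin

lemma D: "open D" by (rule conf_minD(1)[OF cm])

text \<open>This is |a|^2 + |b|^2 = 1 + 2 |a|^2, which exceeds 1 because the ellipse is
  non-degenerate.\<close>

definition c where "c w = cdot (f_2 g w) (conj_vec (f_2 g w))"
text \<open>An isotropic vector orthogonal to f, X, \<open>f_1\<close>, its conjugate and the
  conjugate of \<open>f_11\<close>. Its only nonzero pairing with the basis used in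
  \<open>nondegenerate\<close> is - \<i> (c - 1), with \<open>f_11\<close>, so up to scale it is the
  dual vector of \<open>f_11\<close>.\<close>

definition n where "n w = cvec (X w) - \<i> *s conj_vec (f_2 g w)"
text \<open>The coefficient of \<open>n\<close> in \<open>f_1 X\<close>: what remains of
  \<open>f_1 X\<close> after its part along the conjugate of \<open>f_1\<close> is paired with
  \<open>f_11\<close> and divided by the pairing of \<open>n\<close> with
  \<open>f_11\<close>.\<close>

definition mu where "mu w = cdot (f_1 X w + (\<i> / rho g w) *s conj_vec (f_1 g w)) (f_11 g w) / (- \<i> * (c w - 1))"


lemma smX: "smooth_on D (\<lambda>w. cvec (X w))" "smooth_on D (f_1 X)" "smooth_on D (f_11 X)" "smooth_on D (\<lambda>w. conj_vec (f_1 X w))"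
proof -
 show "smooth_on D (\<lambda>w. cvec (X w))" by (rule smooth_on_cvec[OF D smooth_X])
 then show f1: "smooth_on D (f_1 X)" unfolding f_1_def comp_def by (rule smooth_on_del[OF D])
 then show f11: "smooth_on D (f_11 X)" unfolding f_11_def by (rule smooth_on_del[OF D])
 show "smooth_on D (\<lambda>w. conj_vec (f_1 X w))" by (intro smooth_on_conj_vec D f1)
qed

lemmas smg = conf_min_smooth[OF cm]

lemma delb_f_1_X_real: "w \<in> D \<Longrightarrow> conj_vec (delb (f_1 X) w) = delb (f_1 X) w"
proof -
 assume w: "w \<in> D"
 have "delb (f_1 X) w = del (delb (cvec \<circ> X)) w"
  unfolding f_1_def by (rule del_delb_commute[OF D w]) (use smX(1) in \<open>simp add: comp_def\<close>)
 also have "\<dots> = del (\<lambda>x. conj_vec (f_1 X x)) w"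
  by (rule del_cong[OF D w f_1_real(2)[OF smooth_on_differentiable[OF smooth_X]]])
 also have "\<dots> = conj_vec (delb (f_1 X) w)" by (rule del_conj(1)[OF smooth_on_differentiable[OF smX(2) w]])
 finally show ?thesis ..
qed

context
 fixes w assumes w: "w \<in> D"
begin

lemma c_gt_1: "c w = of_real (Re (c w))" "1 < Re (c w)" "c w - 1 \<noteq> 0" "cnj (c w) = c w"
proof -
 have "c w = of_real (1 + 2 * (norm (a_part g w))\<^sup>2)"
  unfolding c_def conf_min_f_2_sq(2)[OF cm w] using ab(1)[OF w] by simp
 moreover have "0 < (norm (a_part g w))\<^sup>2" using ab(3)[OF w] by simp
 ultimately show 1: "c w = of_real (Re (c w))" "1 < Re (c w)" by simp_all
 then show "c w - 1 \<noteq> 0" by (auto simp: complex_eq_iff)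
 show "cnj (c w) = c w" using 1(1) by (metis complex_cnj_complex_of_real)
qed

lemma f_2_eq: "f_2 g w = f_11 g w - (dz (rho g) w / rho g w) *s f_1 g w"
 unfolding conf_min_f_2[OF cm w] conf_min_dz_rho[OF cm w] ..

lemma r_nz: "rho g w \<noteq> 0" and r_cnj: "cnj (rho g w) = rho g w"
 by (rule conf_min_f_2_orth(5)[OF cm w], rule conf_min_conj_rho[OF cm w])

lemma pairings1:
 "cdot (f_11 g w) (f_11 g w) = -1" "cdot (conj_vec (f_11 g w)) (conj_vec (f_11 g w)) = -1"
 "cdot (conj_vec (f_1 g w)) (cvec (X w)) = 0" "cdot (conj_vec (f_11 g w)) (cvec (X w)) = - \<i>"
 "cdot (f_11 g w) (conj_vec (f_1 g w)) = dz (rho g) w" "cdot (f_1 g w) (conj_vec (f_11 g w)) = cnj (dz (rho g) w)"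
proof -
 show 1: "cdot (f_11 g w) (f_11 g w) = -1" using conf_min_f_2_orth(8)[OF cm w] ad[OF w] by simp
 show "cdot (conj_vec (f_11 g w)) (conj_vec (f_11 g w)) = -1" unfolding cdot_conj 1 by simp
 show "cdot (conj_vec (f_1 g w)) (cvec (X w)) = 0" "cdot (conj_vec (f_11 g w)) (cvec (X w)) = - \<i>"
  using cdot_conj[of "f_1 g w" "cvec (X w)"] cdot_conj[of "f_11 g w" "cvec (X w)"] f_1_X[OF w] f_11_X[OF w]
  by (simp_all add: conj_vec_simps)
 show "cdot (f_11 g w) (conj_vec (f_1 g w)) = dz (rho g) w" "cdot (f_1 g w) (conj_vec (f_11 g w)) = cnj (dz (rho g) w)"
  using conf_min_dz_rho[OF cm w] cdot_conj[of "f_11 g w" "conj_vec (f_1 g w)"]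
  by (simp_all add: conj_vec_simps cdot_commute[of "conj_vec (f_11 g w)"])
qed

lemmas P1 = conf_min_pairings[OF cm w] pairings1 XX[OF w] gX[OF w] f_1_X[OF w] f_11_X[OF w]
lemmas P1' = P1 P1[THEN trans[OF cdot_commute]]

lemma c_eq: "c w = f_11_sq g w - dz (rho g) w * cnj (dz (rho g) w) / rho g w"
 unfolding c_def conf_min_f_2_sq(1)[OF cm w] ..

lemma n_eq: "n w = cvec (X w) - \<i> *s conj_vec (f_11 g w) + (\<i> * (cnj (dz (rho g) w) / rho g w)) *s conj_vec (f_1 g w)"
 unfolding n_def f_2_eq by (simp add: conj_vec_simps r_cnj vec_eq_iff algebra_simps)

lemma conj_n_eq: "conj_vec (n w) = cvec (X w) + \<i> *s f_11 g w - (\<i> * (dz (rho g) w / rho g w)) *s f_1 g w"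
 unfolding n_eq by (simp add: conj_vec_simps r_cnj vec_eq_iff algebra_simps)

lemma n_pairings:
 "cdot (n w) (cvec (g w)) = 0" "cdot (n w) (cvec (X w)) = 0" "cdot (n w) (f_1 g w) = 0"
 "cdot (n w) (conj_vec (f_1 g w)) = 0" "cdot (n w) (conj_vec (f_11 g w)) = 0"
 "cdot (n w) (f_11 g w) = - \<i> * (c w - 1)" using r_nz unfolding n_eq
 by (simp_all add: cdot_simps P1' c_eq f_11_sq_def cdot_commute[of "conj_vec (f_11 g w)" "f_11 g w"] field_simps)

lemma n_n: "cdot (n w) (n w) = 0" "cdot (n w) (conj_vec (n w)) = c w - 1"
 by (subst (2) n_eq, simp add: cdot_simps n_pairings) (simp add: conj_n_eq cdot_simps n_pairings)

lemma conj_n_pairings: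
 "cdot (conj_vec (n w)) (cvec (g w)) = 0" "cdot (conj_vec (n w)) (cvec (X w)) = 0" "cdot (conj_vec (n w)) (f_1 g w) = 0"
 "cdot (conj_vec (n w)) (conj_vec (f_1 g w)) = 0" "cdot (conj_vec (n w)) (f_11 g w) = 0"
 "cdot (conj_vec (n w)) (conj_vec (f_11 g w)) = \<i> * (c w - 1)"
 using n_pairings unfolding cdot_conj_left by (simp_all add: conj_vec_simps c_gt_1(4))

text \<open>The six vectors span \<complex>^6. X supplies the direction missing from the frame f,
  tangent plane, a, b: its part m orthogonal to b satisfies m \<bullet> X = 1 - 1/|b|^2 > 0.\<close>

lemma nondegenerate:
 assumes "cdot y (cvec (g w)) = 0" "cdot y (cvec (X w)) = 0" "cdot y (f_1 g w) = 0"
  "cdot y (conj_vec (f_1 g w)) = 0" "cdot y (f_11 g w) = 0" "cdot y (conj_vec (f_11 g w)) = 0"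
 shows "y = 0"
proof -
 note d = smooth_on_differentiable[OF conf_minD(2)[OF cm] w]
 have yv: "cdot y (cvec (dd v g w)) = 0" for v
  unfolding f_1_real(3)[OF d] using assms by (simp add: cdot_simps)
 have y2: "cdot y (f_2 g w) = 0" "cdot y (conj_vec (f_2 g w)) = 0"
  unfolding f_2_eq using assms by (simp_all add: cdot_simps conj_vec_simps)
 have "cvec (a_part g w) = (1/2) *s (f_2 g w + conj_vec (f_2 g w))" "cvec (b_part g w) = (\<i>/2) *s (f_2 g w - conj_vec (f_2 g w))"
  unfolding f_2_ab[of g w] by (simp_all add: conj_vec_simps vec_eq_iff)
 then have yab: "cdot y (cvec (a_part g w)) = 0" "cdot y (cvec (b_part g w)) = 0" using y2 by (simp_all add: cdot_simps)
 define m where "m = X w + (1 / (norm (b_part g w))\<^sup>2) *\<^sub>R b_part g w"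
 have ym: "cdot y (cvec m) = 0" unfolding m_def using assms yab by (simp add: cvec_simps cdot_simps)
 have Xf2: "cdot (cvec (X w)) (f_2 g w) = \<i>" unfolding f_2_eq by (simp add: cdot_simps P1')
 then have Xab: "X w \<bullet> a_part g w = 0" "X w \<bullet> b_part g w = -1"
  unfolding cdot_f_1_iff(2)[OF w] by (simp_all add: complex_eq_iff)
 have Xg: "X w \<bullet> g w = 0" using gX[OF w] unfolding cdot_cvec by (simp add: inner_commute)
 have "cdot (cvec (X w)) (f_1 g w) = 0" using P1' by simp
 then have Xv: "X w \<bullet> dd 1 g w = 0" "X w \<bullet> dd \<i> g w = 0" using cdot_f_1_iff(1)[OF w] by blast+
 have XX': "X w \<bullet> X w = 1" using XX[OF w] unfolding cdot_cvec by simp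
 note f = frame_orth[OF w] and a = ab[OF w]
 have b0: "norm (b_part g w) \<noteq> 0" using a by auto
 have bv: "b_part g w \<bullet> g w = 0" "b_part g w \<bullet> dd 1 g w = 0" "b_part g w \<bullet> dd \<i> g w = 0" "b_part g w \<bullet> a_part g w = 0"
  using f(1) by (simp_all add: inner_commute[of "b_part g w"])
 have mo: "m \<bullet> g w = 0" "m \<bullet> dd 1 g w = 0" "m \<bullet> dd \<i> g w = 0" "m \<bullet> a_part g w = 0"
  unfolding m_def using Xg Xv Xab bv by (simp_all add: inner_add_left)
 have mb: "m \<bullet> b_part g w = 0"
  unfolding m_def using Xab b0 by (simp add: inner_add_left power2_norm_eq_inner)
 have "m \<bullet> X w = 1 - 1 / (norm (b_part g w))\<^sup>2"
  unfolding m_def using XX' Xab by (simp add: inner_add_left inner_commute[of "b_part g w"])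
 moreover have "(norm (b_part g w))\<^sup>2 > 1" using a(4) by (simp add: power2_eq_square less_1_mult)
 ultimately have "m \<bullet> X w > 0" by (simp add: divide_less_eq_1)
 then have m0: "m \<noteq> 0" by auto
 show ?thesis
  by (rule orthogonal_frame_zero_complex[of "[m, g w, dd 1 g w, dd \<i> g w, a_part g w, b_part g w]"])
    (use f m0 mo mb ym yv yab assms(1) in auto)
qed

text \<open>Each line is one of the defining relations of X, or its conjugate, differentiated
  once.\<close>

lemma pairings2:
 "cdot (f_1 X w) (cvec (g w)) = 0" "cdot (f_1 X w) (cvec (X w)) = 0" "cdot (f_1 X w) (f_1 g w) = - \<i>"
 "cdot (f_1 X w) (conj_vec (f_1 g w)) = 0" "cdot (f_1 X w) (conj_vec (f_11 g w)) = 0"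
proof -
 have dX: "delb (\<lambda>w. cvec (X w)) w = conj_vec (f_1 X w)" by (rule delb_cvec[OF smooth_on_differentiable[OF smooth_X w]])
 show "cdot (f_1 X w) (cvec (g w)) = 0"
  using cdot_const_deriv(1)[OF D w gX smg(1) smX(1)] by (simp add: f_1_def'[symmetric] P1' cdot_commute[of "f_1 X w"])
 show "cdot (f_1 X w) (cvec (X w)) = 0"
  using cdot_const_deriv(1)[OF D w XX smX(1) smX(1)] by (simp add: f_1_def'[symmetric] cdot_commute[of "cvec (X w)"])
 show "cdot (f_1 X w) (f_1 g w) = - \<i>" using cdot_const_deriv(1)[OF D w f_1_X smg(2) smX(1)]
  by (simp add: f_1_def'[symmetric] f_11_def[symmetric] P1' cdot_commute[of "f_1 X w"] eq_neg_iff_add_eq_0 add.commute)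
 have "cdot (f_1 g w) (conj_vec (f_1 X w)) = 0"
  using cdot_const_deriv(2)[OF D w f_1_X smg(2) smX(1)] conf_minD(6)[OF cm w] by (simp add: dX cdot_simps P1')
 then show "cdot (f_1 X w) (conj_vec (f_1 g w)) = 0"
  using cdot_conj[of "f_1 g w" "conj_vec (f_1 X w)"] by (simp add: conj_vec_simps cdot_commute[of "f_1 X w"])
 have "cdot (conj_vec (f_11 g x)) (cvec (X x)) = - \<i>" if "x \<in> D" for x
  using cdot_conj[of "f_11 g x" "cvec (X x)"] f_11_X[OF that] by (simp add: conj_vec_simps)
 from cdot_const_deriv(1)[OF D w this smg(6) smX(1)]
 show "cdot (f_1 X w) (conj_vec (f_11 g w)) = 0"
  by (simp add: conf_min_del_conj_f_11[OF cm w] f_1_def'[symmetric] cdot_simps P1' cdot_commute[of "f_1 X w"])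
qed

text \<open>The part along the conjugate of \<open>f_1\<close> is forced by (f_1 X, f_1) = - \<i>;
  what is left pairs only with \<open>f_11\<close> and so is a multiple of \<open>n\<close>. As
  \<open>n\<close> and the conjugate of \<open>f_1\<close> span an isotropic plane, X is
  conformal.\<close>

lemma f_1_X_eq: "f_1 X w = mu w *s n w - (\<i> / rho g w) *s conj_vec (f_1 g w)"
proof -
 have "f_1 X w + (\<i> / rho g w) *s conj_vec (f_1 g w) - mu w *s n w = 0" by (rule nondegenerate)
    (use r_nz c_gt_1(3) in \<open>simp_all add: cdot_simps n_pairings pairings2 P1' mu_def\<close>)
 then show ?thesis by (simp add: algebra_simps)
qed

lemma f_1_X_f_1_X: "cdot (f_1 X w) (f_1 X w) = 0"
 "cdot (f_1 X w) (conj_vec (f_1 X w)) = 1 / rho g w + mu w * cnj (mu w) * (c w - 1)" unfolding f_1_X_eq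
 by (simp_all add: cdot_simps conj_vec_simps n_n n_pairings P1' conj_n_pairings r_cnj r_nz cdot_commute[of "conj_vec (f_1 g w)" "n w"]
   cdot_commute[of "conj_vec (f_1 g w)" "conj_vec (n w)"] cdot_commute[of "f_1 g w" "n w"])

end

end

section \<open>Symmetry of f and X when \<open>\<gamma>\<^sup>+ = 0\<close>\<close>

locale pair6_gamma = pair6 +
 assumes gamma: "\<And>w. w \<in> D \<Longrightarrow> cdot (f_11 g w) (f_1 X w) = 0"
begin

context
 fixes w assumes w: "w \<in> D"
begin

lemmas P2 = P1[OF w] pairings2[OF w] gamma[OF w]
lemmas Q = P2 P2[THEN trans[OF cdot_commute]]

lemma mu_c: "mu w * (c w - 1) = - dz (rho g) w / rho g w"
proof -
 have "mu w = (\<i> / rho g w * dz (rho g) w) / (- \<i> * (c w - 1))" by (simp add: mu_def cdot_simps Q)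
 moreover have "(\<i> / r * s) / (- \<i> * k) * k = - s / r" if "k \<noteq> 0" for r s k :: complex
  using that by (cases "r = 0") (simp_all add: field_simps)
 ultimately show ?thesis using c_gt_1(3)[OF w] by metis
qed

lemma pairings3:
 "cdot (del (f_11 g) w) (cvec (g w)) = 0" "cdot (del (f_11 g) w) (cvec (X w)) = 0" "cdot (del (f_11 g) w) (f_1 g w) = 1"
 "cdot (del (f_11 g) w) (conj_vec (f_1 g w)) = dz (dz (rho g)) w" "cdot (del (f_11 g) w) (f_11 g w) = 0"
 "cdot (del (f_11 g) w) (conj_vec (f_11 g w)) = dz (f_11_sq g) w + rho g w * dz (rho g) w"
proof -
 have "cdot (f_1 g w) (f_11 g w) + cdot (cvec (g w)) (del (f_11 g) w) = 0"
  using cdot_const_deriv(1)[of D w "\<lambda>w. cvec (g w)" "f_11 g" 0] D w conf_min_pairings(6)[OF cm] smg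
  by (simp add: f_1_def'[symmetric])
 then show "cdot (del (f_11 g) w) (cvec (g w)) = 0" by (simp add: Q cdot_commute[of "del (f_11 g) w"])
 have "cdot (del (f_11 g) w) (cvec (X w)) + cdot (f_11 g w) (f_1 X w) = 0"
  using cdot_const_deriv(1)[of D w "f_11 g" "\<lambda>w. cvec (X w)" \<i>] D w f_11_X smg smX
  by (simp add: f_1_def'[symmetric])
 then show "cdot (del (f_11 g) w) (cvec (X w)) = 0" by (simp add: Q)
 have "cdot (f_11 g w) (f_11 g w) + cdot (f_1 g w) (del (f_11 g) w) = 0"
  using cdot_const_deriv(1)[of D w "f_1 g" "f_11 g" 0] D w conf_min_pairings(7)[OF cm] smg
  by (simp add: f_11_def[symmetric])
 then show "cdot (del (f_11 g) w) (f_1 g w) = 1" by (simp add: Q cdot_commute[of "del (f_11 g) w"])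
 have "dz (dz (rho g)) w = dz (\<lambda>w. cdot (f_11 g w) (conj_vec (f_1 g w))) w"
  by (rule dz_cong[OF D w conf_min_dz_rho[OF cm]])
 also have "\<dots> = cdot (del (f_11 g) w) (conj_vec (f_1 g w)) + cdot (f_11 g w) (del (\<lambda>w. conj_vec (f_1 g w)) w)"
  by (rule dz_cdot(1)[OF smooth_on_differentiable[OF smg(3) w] smooth_on_differentiable[OF smg(5) w]])
 finally show "cdot (del (f_11 g) w) (conj_vec (f_1 g w)) = dz (dz (rho g)) w"
  unfolding conf_min_del_conj_f_1[OF cm w] by (simp add: cdot_simps Q)
 have "cdot (del (f_11 g) w) (f_11 g w) + cdot (f_11 g w) (del (f_11 g) w) = 0"
  using cdot_const_deriv(1)[of D w "f_11 g" "f_11 g" "-1"] D w pairings1(1) smg by simp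
 then show "cdot (del (f_11 g) w) (f_11 g w) = 0" by (simp add: cdot_commute[of "f_11 g w"])
 have "dz (f_11_sq g) w = cdot (del (f_11 g) w) (conj_vec (f_11 g w)) + cdot (f_11 g w) (del (\<lambda>w. conj_vec (f_11 g w)) w)"
  unfolding f_11_sq_def[abs_def]
  by (rule dz_cdot(1)[OF smooth_on_differentiable[OF smg(3) w] smooth_on_differentiable[OF smg(6) w]])
 then show "cdot (del (f_11 g) w) (conj_vec (f_11 g w)) = dz (f_11_sq g) w + rho g w * dz (rho g) w"
  unfolding conf_min_del_conj_f_11[OF cm w] by (simp add: cdot_simps Q)
qed

lemma conj_f_1_X: "conj_vec (f_1 X w) = cnj (mu w) *s conj_vec (n w) + (\<i> / rho g w) *s f_1 g w"
 unfolding f_1_X_eq[OF w] by (simp add: conj_vec_simps r_cnj[OF w] vec_eq_iff)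

text \<open>The two values of \<open>(\<partial>\<^sub>z\<^sub>b f\<^sub>1\<^sup>+, f\<^sub>1\<^sub>1)\<close>, one from \<open>(f\<^sub>1\<^sup>+, conj f\<^sub>1\<^sub>1) = 0\<close> and one from \<open>\<gamma>\<^sup>+ = 0\<close>, force
 both metrics to agree.\<close>

lemma rho_X: "rho X w = rho g w"
proof -
 have "cdot (conj_vec (f_1 X x)) (f_11 g x) = 0" if "x \<in> D" for x
  using cdot_conj[of "f_1 X x" "conj_vec (f_11 g x)"] pairings2(5)[OF that] by (simp add: conj_vec_simps)
 then have "cdot (del (\<lambda>w. conj_vec (f_1 X w)) w) (f_11 g w) + cdot (conj_vec (f_1 X w)) (del (f_11 g) w) = 0"
  using cdot_const_deriv(1)[of D w "\<lambda>w. conj_vec (f_1 X w)" "f_11 g" 0] D w smX smg by simp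
 then have 1: "cdot (delb (f_1 X) w) (f_11 g w) = - cdot (conj_vec (f_1 X w)) (del (f_11 g) w)"
  unfolding del_conj[OF smooth_on_differentiable[OF smX(2) w]] delb_f_1_X_real[OF w] by (simp add: eq_neg_iff_add_eq_0)
 have 2: "cdot (conj_vec (n w)) (del (f_11 g) w) = - \<i> * (dz (rho g) w / rho g w)"
  unfolding conj_n_eq[OF w] using pairings3 by (simp add: cdot_simps cdot_commute[of _ "del (f_11 g) w"])
 have "cdot (conj_vec (f_1 X w)) (del (f_11 g) w) = \<i> * (1 / rho g w + mu w * cnj (mu w) * (c w - 1))"
 proof -
  have "cdot (conj_vec (f_1 X w)) (del (f_11 g) w) = cnj (mu w) * (- \<i> * (dz (rho g) w / rho g w)) + \<i> / rho g w"
   unfolding conj_f_1_X using pairings3 2 by (simp add: cdot_simps cdot_commute[of _ "del (f_11 g) w"])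
  also have "dz (rho g) w / rho g w = - (mu w * (c w - 1))" using mu_c by simp
  finally show ?thesis by (simp add: algebra_simps)
 qed
 then have 3: "cdot (delb (f_1 X) w) (f_11 g w) = - \<i> * rho X w"
  unfolding 1 rho_def[of X] f_1_X_f_1_X(2)[OF w] by simp
 have "cdot (delb (f_11 g) w) (f_1 X w) + cdot (f_11 g w) (delb (f_1 X) w) = 0"
  using cdot_const_deriv(2)[of D w "f_11 g" "f_1 X" 0] D w gamma smX smg by simp
 then have "cdot (delb (f_1 X) w) (f_11 g w) = - \<i> * rho g w"
  unfolding conf_min_delb_f_11[OF cm w] cdot_commute[of "delb (f_1 X) w"]
  by (simp add: cdot_simps Q eq_neg_iff_add_eq_0 add.commute) (simp only: mult.commute[of _ "\<i>"])
 then show ?thesis using 3 by simp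
qed

lemma delb_f_1_X_f_11: "cdot (delb (f_1 X) w) (f_11 g w) = - \<i> * rho g w"
proof -
 have "cdot (delb (f_11 g) w) (f_1 X w) + cdot (f_11 g w) (delb (f_1 X) w) = 0"
  using cdot_const_deriv(2)[of D w "f_11 g" "f_1 X" 0] D w gamma smX smg by simp
 then show ?thesis unfolding conf_min_delb_f_11[OF cm w] cdot_commute[of "delb (f_1 X) w"]
  by (simp add: cdot_simps Q eq_neg_iff_add_eq_0 add.commute) (simp only: mult.commute[of _ "\<i>"])
qed

text \<open>Both sides have the same pairings with the basis used in \<open>nondegenerate\<close>;
  those with the two conjugate vectors follow from the others because the Laplacian of X is
  real.\<close>

lemma delb_f_1_X: "delb (f_1 X) w = - rho X w *s cvec (X w)"
proof -
 have dX: "delb (\<lambda>w. cvec (X w)) w = conj_vec (f_1 X w)" by (rule delb_cvec[OF smooth_on_differentiable[OF smooth_X w]])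
 have dg: "delb (\<lambda>w. cvec (g w)) w = conj_vec (f_1 g w)" by (rule delb_cvec[OF smooth_on_differentiable[OF conf_minD(2)[OF cm] w]])
 note re = delb_f_1_X_real[OF w]
 have 1: "cdot (delb (f_1 X) w) (cvec (g w)) = 0"
  using cdot_const_deriv(2)[of D w "f_1 X" "\<lambda>w. cvec (g w)" 0] D w pairings2(1) smX smg dg by (simp add: Q)
 have "cdot (delb (f_1 X) w) (cvec (X w)) + cdot (f_1 X w) (conj_vec (f_1 X w)) = 0"
  using cdot_const_deriv(2)[of D w "f_1 X" "\<lambda>w. cvec (X w)" 0] D w pairings2(2) smX dX by simp
 then have 2: "cdot (delb (f_1 X) w) (cvec (X w)) = - rho g w"
  using rho_X unfolding rho_def[of X] by (simp add: eq_neg_iff_add_eq_0)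
 have "cdot (delb (f_1 X) w) (f_1 g w) + cdot (f_1 X w) (- rho g w *s cvec (g w)) = 0"
  using cdot_const_deriv(2)[of D w "f_1 X" "f_1 g" "-\<i>"] D w pairings2(3) smX smg conf_minD(6)[OF cm w] by simp
 then have 3: "cdot (delb (f_1 X) w) (f_1 g w) = 0" by (simp add: cdot_simps Q)
 have 4: "cdot (delb (f_1 X) w) (conj_vec (f_1 g w)) = 0"
  using cdot_conj[of "delb (f_1 X) w" "f_1 g w"] 3 re by simp
 note 5 = delb_f_1_X_f_11
 have 6: "cdot (delb (f_1 X) w) (conj_vec (f_11 g w)) = \<i> * rho g w"
  using cdot_conj[of "delb (f_1 X) w" "f_11 g w"] 5 re r_cnj[OF w] by simp
 have "delb (f_1 X) w + rho g w *s cvec (X w) = 0"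
  by (rule nondegenerate[OF w]) (simp_all add: cdot_simps 1 2 3 4 5 6 Q)
 then show ?thesis unfolding rho_X by (simp add: eq_neg_iff_add_eq_0)
qed

lemma pairings4:
 "cdot (f_11 X w) (cvec (g w)) = \<i>" "cdot (f_11 X w) (cvec (X w)) = 0" "cdot (f_11 X w) (f_1 g w) = 0"
 "cdot (f_11 X w) (conj_vec (f_1 g w)) = 0" "cdot (f_11 X w) (conj_vec (f_11 g w)) = 0" "cdot (f_11 X w) (f_11 X w) = -1"
proof -
 have "cdot (f_11 X w) (cvec (g w)) + cdot (f_1 X w) (f_1 g w) = 0"
  using cdot_const_deriv(1)[of D w "f_1 X" "\<lambda>w. cvec (g w)" 0] D w pairings2(1) smX smg
  by (simp add: f_1_def'[symmetric] f_11_def[symmetric])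
 then show 1: "cdot (f_11 X w) (cvec (g w)) = \<i>" by (simp add: Q)
 have "cdot (f_11 X w) (cvec (X w)) + cdot (f_1 X w) (f_1 X w) = 0"
  using cdot_const_deriv(1)[of D w "f_1 X" "\<lambda>w. cvec (X w)" 0] D w pairings2(2) smX
  by (simp add: f_1_def'[symmetric] f_11_def[symmetric])
 then show 2: "cdot (f_11 X w) (cvec (X w)) = 0" by (simp add: f_1_X_f_1_X(1)[OF w])
 have "cdot (f_11 X w) (f_1 g w) + cdot (f_1 X w) (f_11 g w) = 0"
  using cdot_const_deriv(1)[of D w "f_1 X" "f_1 g" "-\<i>"] D w pairings2(3) smX smg
  by (simp add: f_11_def[symmetric])
 then show 3: "cdot (f_11 X w) (f_1 g w) = 0" by (simp add: Q)
 have "cdot (f_11 X w) (conj_vec (f_1 g w)) + cdot (f_1 X w) (- rho g w *s cvec (g w)) = 0"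
  using cdot_const_deriv(1)[of D w "f_1 X" "\<lambda>w. conj_vec (f_1 g w)" 0] D w pairings2(4) smX smg conf_min_del_conj_f_1[OF cm w]
  by (simp add: f_11_def[symmetric])
 then show 4: "cdot (f_11 X w) (conj_vec (f_1 g w)) = 0" by (simp add: cdot_simps Q)
 have "cdot (f_11 X w) (conj_vec (f_11 g w)) + cdot (f_1 X w) (- cnj (dz (rho g) w) *s cvec (g w) - rho g w *s conj_vec (f_1 g w)) = 0"
  using cdot_const_deriv(1)[of D w "f_1 X" "\<lambda>w. conj_vec (f_11 g w)" 0] D w pairings2(5) smX smg conf_min_del_conj_f_11[OF cm w]
  by (simp add: f_11_def[symmetric])
 then show 5: "cdot (f_11 X w) (conj_vec (f_11 g w)) = 0" by (simp add: cdot_simps Q)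
 \<comment> \<open>The component along \<open>n\<close> stays undetermined, but \<open>n\<close> is
   isotropic and orthogonal to f, so it does not enter the square.\<close>
 define k where "k = cdot (f_11 X w) (f_11 g w) / (- \<i> * (c w - 1))"
 have "f_11 X w - \<i> *s cvec (g w) - k *s n w = 0" by (rule nondegenerate[OF w])
    (use c_gt_1(3)[OF w] in \<open>simp_all add: cdot_simps 1 2 3 4 5 Q n_pairings[OF w] k_def\<close>)
 then have "f_11 X w = \<i> *s cvec (g w) + k *s n w" by (simp add: algebra_simps)
 then show "cdot (f_11 X w) (f_11 X w) = -1"
  by (simp add: cdot_simps n_n[OF w] n_pairings[OF w] Q cdot_commute[of "cvec (g w)" "n w"])
qed

text \<open>The coefficient of the conjugate of \<open>n\<close> in the third derivative: a pairing
  with the conjugate of \<open>f_11\<close>, divided by that of the conjugate of \<open>n\<close>,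
  which is \<i> (c - 1). It involves the metric only and is therefore common to f and X.\<close>

definition "third_coeff = (dz (f_11_sq g) w + rho g w * dz (rho g) w) / (\<i> * (c w - 1))"

end

lemma conf_min_X: "conf_min D X" unfolding conf_min_def
proof (intro conjI ballI D smooth_X)
 fix w assume w: "w \<in> D"
 have "X w \<bullet> X w = 1" using XX[OF w] unfolding cdot_cvec by simp
 then show "norm (X w) = 1" by (simp add: norm_eq_sqrt_inner)
 show "f_1 X w \<noteq> 0" using pairings2(3)[OF w] by (auto simp: cdot_simps)
qed (auto simp: f_1_X_f_1_X(1) delb_f_1_X)

text \<open>The pairings are already computed. The remaining point is that the ellipse of X is
  non-degenerate, which holds because |f_2|^2 is a function of the common metric and exceeds
  1.\<close>

lemma swap: "pair6_gamma D X g"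
proof -
 have rho': "rho X w = rho g w" if "w \<in> D" for w by (rule rho_X[OF that])
 have "dzb (rho X) w = dzb (rho g) w" if "w \<in> D" for w by (rule dz_cong(2)[OF D that rho'])
 then have dd': "dz (dzb (rho X)) w = dz (dzb (rho g)) w" if "w \<in> D" for w by (rule dz_cong(1)[OF D that])
 have sq: "f_11_sq X w = f_11_sq g w" if "w \<in> D" for w
  unfolding conf_min_f_11_sq[OF conf_min_X that] conf_min_f_11_sq[OF cm that] rho'[OF that] dd'[OF that] ..
 show ?thesis
 proof
  show cmX: "conf_min D X" by (rule conf_min_X)
  fix w assume w: "w \<in> D"
  show f22: "cdot (f_2 X w) (f_2 X w) = -1"
   using conf_min_f_2_orth(8)[OF conf_min_X w] pairings4(6)[OF w] by simp
  have "dz (rho X) w = dz (rho g) w" by (rule dz_cong(1)[OF D w rho'])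
  then have "cdot (f_2 X w) (conj_vec (f_2 X w)) = c w"
   unfolding conf_min_f_2_sq(1)[OF conf_min_X w] c_eq[OF w] rho'[OF w] sq[OF w] by simp
  then have "1 < (norm (a_part X w))\<^sup>2 + (norm (b_part X w))\<^sup>2"
   using c_gt_1(2)[OF w] unfolding conf_min_f_2_sq(2)[OF conf_min_X w] by (metis Re_complex_of_real)
  moreover have "(norm (b_part X w))\<^sup>2 = 1 + (norm (a_part X w))\<^sup>2"
   using f22 unfolding cdot_f_2_f_2 by (simp add: complex_eq_iff)
  ultimately show "a_part X w \<noteq> 0" by auto
  show "cdot (cvec (g w)) (cvec (g w)) = 1" by (rule conf_min_pairings(1)[OF cm w])
  show "cdot (cvec (X w)) (cvec (g w)) = 0" using gX[OF w] by (simp add: cdot_commute)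
  show "cdot (f_1 X w) (cvec (g w)) = 0" by (rule pairings2(1)[OF w])
  show "cdot (f_11 X w) (cvec (g w)) = \<i>" by (rule pairings4(1)[OF w])
  show "cdot (f_11 X w) (f_1 g w) = 0" by (rule pairings4(3)[OF w])
 qed (rule conf_minD(2)[OF cm])
qed

lemma swap_eqs:
 assumes w: "w \<in> D"
 shows "rho X w = rho g w" "dz (rho X) w = dz (rho g) w" "dz (dz (rho X)) w = dz (dz (rho g)) w"
  "dz (f_11_sq X) w = dz (f_11_sq g) w" "pair6.c X w = c w"
proof -
 have rho': "rho X w = rho g w" if "w \<in> D" for w by (rule rho_X[OF that])
 have dz': "dz (rho X) w = dz (rho g) w" if "w \<in> D" for w by (rule dz_cong(1)[OF D that rho'])
 have "dzb (rho X) w = dzb (rho g) w" if "w \<in> D" for w by (rule dz_cong(2)[OF D that rho'])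
 then have dd': "dz (dzb (rho X)) w = dz (dzb (rho g)) w" if "w \<in> D" for w by (rule dz_cong(1)[OF D that])
 have sq: "f_11_sq X w = f_11_sq g w" if "w \<in> D" for w
  unfolding conf_min_f_11_sq[OF conf_min_X that] conf_min_f_11_sq[OF cm that] rho'[OF that] dd'[OF that] ..
 interpret S: pair6_gamma D X g by (rule swap)
 show "rho X w = rho g w" "dz (rho X) w = dz (rho g) w" using w rho' dz' by auto
 show "dz (dz (rho X)) w = dz (dz (rho g)) w" by (rule dz_cong(1)[OF D w dz'])
 show "dz (f_11_sq X) w = dz (f_11_sq g) w" by (rule dz_cong(1)[OF D w sq])
 show "S.c w = c w" unfolding S.c_eq[OF w] c_eq[OF w] rho'[OF w] dz'[OF w] sq[OF w] ..
qed

text \<open>An expansion in \<open>f_1 X\<close>, its conjugate and the conjugate of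
  \<open>n\<close>, whose pairings with the basis are known. The coefficient \<i> of
  \<open>f_1 X\<close> comes from pairing with \<open>f_1\<close>: differentiating (f_1, f_11) = 0
  gives -(f_11, f_11) = 1.\<close>

lemma third_derivative:
 assumes w: "w \<in> D"
 shows "del (f_11 g) w = \<i> *s f_1 X w - (\<i> * dz (dz (rho g)) w) *s conj_vec (f_1 X w)
   + third_coeff w *s (cvec (X w) + \<i> *s f_11 g w - (\<i> * (dz (rho g) w / rho g w)) *s f_1 g w)"
proof -
 note q = Q[OF w]
 have cY: "cdot (conj_vec (f_1 X w)) (cvec (g w)) = 0" "cdot (conj_vec (f_1 X w)) (cvec (X w)) = 0"
  "cdot (conj_vec (f_1 X w)) (f_1 g w) = 0" "cdot (conj_vec (f_1 X w)) (conj_vec (f_1 g w)) = \<i>"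
  "cdot (conj_vec (f_1 X w)) (f_11 g w) = 0" "cdot (conj_vec (f_1 X w)) (conj_vec (f_11 g w)) = 0"
  unfolding cdot_conj_left by (simp_all add: conj_vec_simps q)
 have "del (f_11 g) w - (\<i> *s f_1 X w - (\<i> * dz (dz (rho g)) w) *s conj_vec (f_1 X w) + third_coeff w *s conj_vec (n w)) = 0"
  (is "?y = 0")
 proof (rule nondegenerate[OF w])
  have ii: "z + \<i> * z * \<i> = 0" for z by (simp add: algebra_simps)
  show "cdot ?y (conj_vec (f_1 g w)) = 0"
   by (simp add: cdot_simps pairings3[OF w] q cY conj_n_pairings[OF w] ii)
 qed (use c_gt_1(3)[OF w] in \<open>simp_all add: cdot_simps pairings3[OF w] q cY conj_n_pairings[OF w] third_coeff_def[OF w]\<close>)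
 then show ?thesis unfolding conj_n_eq[OF w] by simp
qed

text \<open>The right side of \<open>third_derivative\<close> mixes f and X, with coefficients that
  are common to both by \<open>swap_eqs\<close>. Adding the equation with exchanged roles leaves an
  expression in f + X.\<close>

lemma third_derivative_sum:
 assumes w: "w \<in> D"
 shows "del (f_11 g) w + del (f_11 X) w = \<i> *s (f_1 g w + f_1 X w) - (\<i> * dz (dz (rho g)) w) *s conj_vec (f_1 g w + f_1 X w)
   + third_coeff w *s (cvec (g w + X w) + \<i> *s (f_11 g w + f_11 X w) - (\<i> * (dz (rho g) w / rho g w)) *s (f_1 g w + f_1 X w))"
proof -
 interpret S: pair6_gamma D X g by (rule swap)
 have "S.third_coeff w = third_coeff w"
  unfolding S.third_coeff_def[OF w] third_coeff_def[OF w] swap_eqs[OF w] ..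
 then show ?thesis unfolding third_derivative[OF w] S.third_derivative[OF w] swap_eqs[OF w]
  by (simp add: cvec_simps conj_vec_simps vec_eq_iff algebra_simps)
qed

text \<open>The products of y with f + X and with its first and second \<partial>-derivatives
  satisfy a first order linear system, so vanishing at one point spreads over D. The conjugate of
  \<open>s1\<close> occurs in the system, which is why it is only real linear and is treated through
  an estimate.\<close>

lemma sum_orth_propagate:
 assumes con: "connected D" and w0: "w0 \<in> D" and w: "w \<in> D"
  and y: "(g w0 + X w0) \<bullet> y = 0" "cdot (f_1 g w0 + f_1 X w0) (cvec y) = 0" "cdot (f_11 g w0 + f_11 X w0) (cvec y) = 0"
 shows "(g w + X w) \<bullet> y = 0"
proof -
 define s0 s1 s2 where "s0 w = cdot (cvec (g w + X w)) (cvec y)" "s1 w = cdot (f_1 g w + f_1 X w) (cvec y)"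
  "s2 w = cdot (f_11 g w + f_11 X w) (cvec y)" for w
 have sm: "smooth_on D s0" "smooth_on D s1" "smooth_on D s2" unfolding s0_s1_s2_def[abs_def] cvec_simps
  by (intro smooth_on_cdot smooth_on_add D smg smX smooth_on_const)+
 define h where "h w = (s0 w, s1 w, s2 w)" for w
 \<comment> \<open>One summand for each of the three components, bounding its two Wirtinger
   derivatives together.\<close>
 define K where "K w = 2 + (1 + cmod (rho g w)) + (1 + cmod (dz (dz (rho g)) w) + cmod (third_coeff w) * (2 + cmod (dz (rho g) w / rho g w))
   + cmod (dz (rho g) w) + cmod (rho g w))" for w
 have dx: "dz s0 x = s1 x" "dzb s0 x = cnj (s1 x)" "dz s1 x = s2 x" "dzb s1 x = - rho g x * s0 x"
  "dz s2 x = \<i> * s1 x - \<i> * dz (dz (rho g)) x * cnj (s1 x) + third_coeff x * (s0 x + \<i> * s2 x - \<i> * (dz (rho g) x / rho g x) * s1 x)"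
  "dzb s2 x = - dz (rho g) x * s0 x - rho g x * s1 x" if x: "x \<in> D" for x
 proof -
  have d: "(\<lambda>w. cvec (g w)) differentiable (at x)" "(\<lambda>w. cvec (X w)) differentiable (at x)"
   "f_1 g differentiable (at x)" "f_1 X differentiable (at x)" "f_11 g differentiable (at x)" "f_11 X differentiable (at x)"
   by (rule smooth_on_differentiable[OF _ x], (intro smg smX))+
  have k: "dz (\<lambda>w. cdot (u w) (cvec y)) x = cdot (del u x) (cvec y)" "dzb (\<lambda>w. cdot (u w) (cvec y)) x = cdot (delb u x) (cvec y)"
   if "u differentiable (at x)" for u
   using dz_cdot[OF that differentiable_const, of "cvec y"] by (simp_all add: del_const cdot_simps)
  have "del (\<lambda>w. cvec (g w + X w)) x = f_1 g x + f_1 X x" "delb (\<lambda>w. cvec (g w + X w)) x = conj_vec (f_1 g x + f_1 X x)"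
   unfolding cvec_simps del_add[OF d(1,2)] f_1_def'
   using delb_cvec[OF smooth_on_differentiable[OF smooth_X x]] delb_cvec[OF smooth_on_differentiable[OF conf_minD(2)[OF cm] x]]
   by (simp_all add: f_1_def' conj_vec_simps)
  moreover have "(\<lambda>w. cvec (g w + X w)) differentiable (at x)" unfolding cvec_simps by (rule differentiable_add[OF d(1,2)])
  moreover have "cdot (conj_vec (f_1 g x + f_1 X x)) (cvec y) = cnj (s1 x)"
   unfolding s0_s1_s2_def cdot_conj_left by (simp add: conj_vec_simps)
  ultimately show "dz s0 x = s1 x" "dzb s0 x = cnj (s1 x)"
   unfolding s0_s1_s2_def[abs_def] using k by simp_all
  have e1: "del (\<lambda>w. f_1 g w + f_1 X w) x = f_11 g x + f_11 X x" "delb (\<lambda>w. f_1 g w + f_1 X w) x = - rho g x *s cvec (g x + X x)"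
   unfolding del_add[OF d(3,4)] f_11_def conf_minD(6)[OF cm x] delb_f_1_X[OF x] rho_X[OF x]
   by (simp_all add: cvec_simps vec_eq_iff algebra_simps)
  show "dz s1 x = s2 x" "dzb s1 x = - rho g x * s0 x"
   unfolding s0_s1_s2_def[abs_def] k[OF differentiable_add[OF d(3,4)]] e1 by (simp_all add: cdot_simps)
  have e2: "delb (\<lambda>w. f_11 g w + f_11 X w) x = - dz (rho g) x *s cvec (g x + X x) - rho g x *s (f_1 g x + f_1 X x)"
   unfolding del_add[OF d(5,6)] conf_min_delb_f_11[OF cm x] conf_min_delb_f_11[OF conf_min_X x] swap_eqs[OF x]
   by (simp add: cvec_simps vec_eq_iff algebra_simps)
  have e3: "cdot (conj_vec (f_1 g x + f_1 X x)) (cvec y) = cnj (s1 x)"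
   unfolding s0_s1_s2_def cdot_conj_left by (simp add: conj_vec_simps)
  show "dzb s2 x = - dz (rho g) x * s0 x - rho g x * s1 x"
   unfolding s0_s1_s2_def[abs_def] k[OF differentiable_add[OF d(5,6)]] e2 by (simp add: cdot_simps algebra_simps)
  show "dz s2 x = \<i> * s1 x - \<i> * dz (dz (rho g)) x * cnj (s1 x) + third_coeff x * (s0 x + \<i> * s2 x - \<i> * (dz (rho g) x / rho g x) * s1 x)"
   unfolding s0_s1_s2_def(3)[abs_def] k[OF differentiable_add[OF d(5,6)]] del_add(1)[OF d(5,6)] third_derivative_sum[OF x]
   unfolding cdot_simps(1-4,7) e3 unfolding s0_s1_s2_def cdot_simps ..
 qed
 have "h w = 0"
 proof (rule linear_differential_inequality_zero[OF D con])
  fix x assume x: "x \<in> D"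
  show "(h has_derivative (\<lambda>v. (v * dz s0 x + cnj v * dzb s0 x, v * dz s1 x + cnj v * dzb s1 x, v * dz s2 x + cnj v * dzb s2 x))) (at x)"
   unfolding h_def[abs_def]
   by (intro has_derivative_Pair has_derivative_dz smooth_on_differentiable[OF _ x] sm)
  fix v
  let ?N = "norm (h x)"
  have le: "cmod (s0 x) \<le> ?N" "cmod (s1 x) \<le> ?N" "cmod (s2 x) \<le> ?N" unfolding h_def
   by (rule norm_fst_le, rule order_trans[OF norm_fst_le norm_snd_le], rule order_trans[OF norm_snd_le norm_snd_le])
  have tri: "cmod (v * p + cnj v * q) \<le> cmod v * (cmod p + cmod q)" for p q
   using norm_triangle_ineq[of "v * p" "cnj v * q"] by (simp add: norm_mult distrib_left)
  have mN: "cmod (k * z) \<le> cmod k * ?N" if "cmod z \<le> ?N" for k z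
   using that by (simp add: norm_mult mult_left_mono)
  have b0: "cmod (dz s0 x) + cmod (dzb s0 x) \<le> 2 * ?N" unfolding dx[OF x] using le by simp
  have b1: "cmod (dz s1 x) + cmod (dzb s1 x) \<le> (1 + cmod (rho g x)) * ?N"
   unfolding dx[OF x] using le mN[OF le(1), of "rho g x"] by (simp add: distrib_right)
  have "cmod (s0 x + \<i> * s2 x - \<i> * (dz (rho g) x / rho g x) * s1 x) \<le> cmod (s0 x) + cmod (\<i> * s2 x) + cmod (\<i> * (dz (rho g) x / rho g x) * s1 x)"
   by (meson norm_triangle_ineq norm_triangle_ineq4 order_trans add_right_mono)
  also have "\<dots> \<le> (2 + cmod (dz (rho g) x / rho g x)) * ?N"
  proof -
   have "cmod (\<i> * q) = cmod q" for q by (simp add: norm_mult)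
   moreover have "cmod (\<i> * (dz (rho g) x / rho g x) * s1 x) \<le> cmod (\<i> * (dz (rho g) x / rho g x)) * ?N"
    by (rule mN[OF le(2)])
   ultimately have "cmod (\<i> * (dz (rho g) x / rho g x) * s1 x) \<le> cmod (dz (rho g) x / rho g x) * ?N"
    "cmod (\<i> * s2 x) = cmod (s2 x)" by (metis, metis)
   then show ?thesis using le unfolding distrib_right by linarith
  qed
  finally have t3: "cmod (third_coeff x * (s0 x + \<i> * s2 x - \<i> * (dz (rho g) x / rho g x) * s1 x)) \<le>
    cmod (third_coeff x) * (2 + cmod (dz (rho g) x / rho g x)) * ?N"
   unfolding norm_mult mult.assoc by (intro mult_left_mono) auto
  have "cmod (dz s2 x) \<le> cmod (\<i> * s1 x) + cmod (\<i> * dz (dz (rho g)) x * cnj (s1 x)) +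
    cmod (third_coeff x * (s0 x + \<i> * s2 x - \<i> * (dz (rho g) x / rho g x) * s1 x))"
   unfolding dx[OF x] by (meson norm_triangle_ineq norm_triangle_ineq4 order_trans add_right_mono)
  also have "\<dots> \<le> ?N + cmod (dz (dz (rho g)) x) * ?N + cmod (third_coeff x) * (2 + cmod (dz (rho g) x / rho g x)) * ?N"
   using le t3 mN[of "cnj (s1 x)" "\<i> * dz (dz (rho g)) x"] by (intro add_mono) (simp_all add: norm_mult)
  finally have b2a: "cmod (dz s2 x) \<le> ?N + cmod (dz (dz (rho g)) x) * ?N + cmod (third_coeff x) * (2 + cmod (dz (rho g) x / rho g x)) * ?N" .
  have "cmod (dzb s2 x) \<le> cmod (dz (rho g) x * s0 x) + cmod (rho g x * s1 x)"
   unfolding dx[OF x] using norm_triangle_ineq4[of "- dz (rho g) x * s0 x" "rho g x * s1 x"] by simp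
  also have "\<dots> \<le> cmod (dz (rho g) x) * ?N + cmod (rho g x) * ?N" by (intro add_mono mN le)
  finally have b2: "cmod (dz s2 x) + cmod (dzb s2 x) \<le> (1 + cmod (dz (dz (rho g)) x) + cmod (third_coeff x) * (2 + cmod (dz (rho g) x / rho g x))
   + cmod (dz (rho g) x) + cmod (rho g x)) * ?N" using b2a by (simp add: distrib_right)
  have "norm (v * dz s0 x + cnj v * dzb s0 x, v * dz s1 x + cnj v * dzb s1 x, v * dz s2 x + cnj v * dzb s2 x)
    \<le> cmod (v * dz s0 x + cnj v * dzb s0 x) + (cmod (v * dz s1 x + cnj v * dzb s1 x) + cmod (v * dz s2 x + cnj v * dzb s2 x))"
   by (rule order_trans[OF norm_Pair_le add_left_mono[OF norm_Pair_le]])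
  also have "\<dots> \<le> cmod v * (cmod (dz s0 x) + cmod (dzb s0 x)) + (cmod v * (cmod (dz s1 x) + cmod (dzb s1 x)) + cmod v * (cmod (dz s2 x) + cmod (dzb s2 x)))"
   by (intro add_mono tri)
  also have "\<dots> = cmod v * ((cmod (dz s0 x) + cmod (dzb s0 x)) + (cmod (dz s1 x) + cmod (dzb s1 x)) + (cmod (dz s2 x) + cmod (dzb s2 x)))"
   by (simp add: algebra_simps)
  also have "\<dots> \<le> cmod v * (K x * ?N)"
  proof -
   have add3: "a + b + e \<le> (p + q + r) * ?N" if "a \<le> p * ?N" "b \<le> q * ?N" "e \<le> r * ?N" for a b e p q r :: real
    using that unfolding distrib_right by linarith
   show ?thesis unfolding K_def by (intro mult_left_mono add3 b0 b1 b2 norm_ge_zero)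
  qed
  finally show "norm (v * dz s0 x + cnj v * dzb s0 x, v * dz s1 x + cnj v * dzb s1 x, v * dz s2 x + cnj v * dzb s2 x) \<le> K x * ?N * norm v"
   by (simp add: mult.commute)
 next
  have cont: "continuous_on D (rho g)" "continuous_on D (dz (rho g))" "continuous_on D (dz (dz (rho g)))"
   "continuous_on D (dz (f_11_sq g))" unfolding f_11_sq_def[abs_def]
   by (rule smooth_on_continuous_on, (intro smooth_on_dz smooth_on_cdot D smg))+
  have cc: "continuous_on D c" unfolding c_def[abs_def]
   by (rule smooth_on_continuous_on, (intro smooth_on_cdot smooth_on_conj_vec D smooth_parts))
  have "continuous_on D (\<lambda>w. (dz (f_11_sq g) w + rho g w * dz (rho g) w) / (\<i> * (c w - 1)))"
   using c_gt_1(3) by (intro continuous_intros cont cc) auto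
  then have "continuous_on D third_coeff"
   using continuous_on_cong[OF refl, of D third_coeff] third_coeff_def by (metis (no_types, lifting))
  moreover have "continuous_on D (\<lambda>x. dz (rho g) x / rho g x)" using r_nz by (intro continuous_intros cont) auto
  ultimately show "continuous_on D K"
   unfolding K_def[abs_def] by (intro continuous_on_add continuous_on_mult continuous_on_norm continuous_on_const cont)
  show "h w0 = 0" using y unfolding h_def s0_s1_s2_def cdot_cvec by (simp add: zero_prod_def)
 qed (use w0 w in auto)
 then show ?thesis unfolding h_def s0_s1_s2_def cdot_cvec by (simp add: zero_prod_def)
qed

end

section \<open>Reflections\<close>

lemma normal_part_subspace:
 assumes "subspace V"
 shows "\<And>v. v \<in> V \<Longrightarrow> normal_part V x \<bullet> v = 0" "x - normal_part V x \<in> V"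
proof -
 have sp: "span V = V" using assms by (simp add: span_eq_iff)
 obtain y z where yz: "y \<in> span V" "\<And>w. w \<in> span V \<Longrightarrow> orthogonal z w" "x = y + z"
  using orthogonal_subspace_decomp_exists by metis
 have "normal_part V x = z"
 proof (rule normal_part_eqI)
  show "z \<bullet> w = 0" if "w \<in> V" for w using yz(2) that sp by (simp add: orthogonal_def)
  show "x - z \<in> span V" using yz(1,3) by simp
 qed
 then show "\<And>v. v \<in> V \<Longrightarrow> normal_part V x \<bullet> v = 0" "x - normal_part V x \<in> V"
  using yz sp by (auto simp: orthogonal_def)
qed

text \<open>Provides the two properties of a reflection on which
  \<open>symmetric_image_gamma\<close> rests.\<close>

lemma reflection_across_linear:
 assumes V: "subspace V"
 shows "linear (reflection_across V)" "reflection_across V x \<bullet> y = x \<bullet> reflection_across V y"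
proof -
 note n = normal_part_subspace[OF V]
 have sp: "span V = V" using V by (simp add: span_eq_iff)
 have add: "normal_part V (x + y) = normal_part V x + normal_part V y" for x y
 proof (rule normal_part_eqI)
  have "x + y - (normal_part V x + normal_part V y) = (x - normal_part V x) + (y - normal_part V y)" by simp
  then show "x + y - (normal_part V x + normal_part V y) \<in> span V" using n(2) V sp subspace_add by metis
 qed (simp add: inner_add_left n(1))
 have scale: "normal_part V (r *\<^sub>R x) = r *\<^sub>R normal_part V x" for r x
 proof (rule normal_part_eqI)
  have "r *\<^sub>R x - r *\<^sub>R normal_part V x = r *\<^sub>R (x - normal_part V x)" by (simp add: scaleR_diff_right)
  then show "r *\<^sub>R x - r *\<^sub>R normal_part V x \<in> span V" using n(2) V sp subspace_scale by metis
 qed (simp add: n(1))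
 show "linear (reflection_across V)"
  by (rule linearI) (simp_all add: reflection_across_def add scale scaleR_diff_right scaleR_add_right)
 have "x \<bullet> normal_part V y = normal_part V x \<bullet> normal_part V y" for x y
 proof -
  have "normal_part V y \<bullet> (x - normal_part V x) = 0" by (rule n(1)[OF n(2)])
  then show ?thesis by (simp add: inner_diff_right inner_commute)
 qed
 then have "normal_part V x \<bullet> y = x \<bullet> normal_part V y" by (metis inner_commute)
 then show "reflection_across V x \<bullet> y = x \<bullet> reflection_across V y"
  by (simp add: reflection_across_def inner_diff_left inner_diff_right)
qed

text \<open>The complex linear extension of a real linear map.\<close>

definition clin :: "(real^'n \<Rightarrow> real^'m) \<Rightarrow> complex^'n \<Rightarrow> complex^'m" where
 "clin R x = cvec (R (Re_vec x)) + \<i> *s cvec (R (Im_vec x))"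

lemma clin:
 assumes R: "linear R"
 shows "clin R (x + y) = clin R x + clin R y" "clin R (k *s x) = k *s clin R x" "clin R (cvec a) = cvec (R a)"
 unfolding clin_def Re_Im_vec_simps linear_add[OF R] linear_diff[OF R] linear_scale[OF R] linear_0[OF R] cvec_simps
 by (simp_all add: vec_eq_iff complex_eq_iff algebra_simps)

lemma cdot_clin:
 assumes "\<And>x y. R x \<bullet> y = x \<bullet> R' y"
 shows "cdot (clin R x) y = cdot x (clin R' y)"
proof -
 have "cdot (clin R (cvec a + \<i> *s cvec b)) (cvec a' + \<i> *s cvec b') = cdot (cvec a + \<i> *s cvec b) (clin R' (cvec a' + \<i> *s cvec b'))" for a b a' b'
  unfolding clin_def by (simp add: Re_Im_vec_simps cdot_simps cdot_cvec assms)
 from this[of "Re_vec x" "Im_vec x" "Re_vec y" "Im_vec y"] show ?thesis unfolding vec_eq_Re_Im[symmetric] .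
qed

lemma f_1_clin:
 assumes R: "linear R" and D: "open D" "w \<in> D" and e: "\<And>x. x \<in> D \<Longrightarrow> X x = R (g x)" and g: "g differentiable (at w)"
 shows "f_1 X w = clin R (f_1 g w)"
proof -
 have "f_1 X w = del (\<lambda>x. clin R (cvec (g x))) w"
  unfolding f_1_def by (rule del_cong[OF D]) (simp add: e clin(3)[OF R])
 also have "\<dots> = clin R (del (\<lambda>x. cvec (g x)) w)" by (rule del_clinear[OF clin(1,2)[OF R]])
    (use bounded_linear.has_derivative[OF bounded_linear_cvec has_derivative_dd[OF g]] differentiableI in blast)
 finally show ?thesis by (simp add: f_1_def')
qed

text \<open>Here (f_1, R f_1) is the constant - \<i>. Differentiating it gives two terms which
  self-adjointness makes equal, so twice (f_11, R f_1) vanishes.\<close>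

lemma (in pair6) symmetric_image_gamma:
 assumes R: "linear R" and sa: "\<And>x y. R x \<bullet> y = x \<bullet> R y" and e: "\<And>x. x \<in> D \<Longrightarrow> X x = R (g x)" and w: "w \<in> D"
 shows "cdot (f_11 g w) (f_1 X w) = 0"
proof -
 have d: "g differentiable (at x)" if "x \<in> D" for x using smooth_on_differentiable[OF conf_minD(2)[OF cm] that] .
 have X1: "f_1 X x = clin R (f_1 g x)" if "x \<in> D" for x
  using f_1_clin[OF R D that, of X g] e d[OF that] by blast
 have bl: "bounded_linear (clin R)"
  unfolding linear_conv_bounded_linear[symmetric] by (intro linearI) (simp_all add: clin[OF R] scaleR_smult)
 have sm: "smooth_on D (\<lambda>x. clin R (f_1 g x))" by (rule smooth_on_linear[OF D bl smg(2)])
 have "cdot (f_1 g x) (clin R (f_1 g x)) = - \<i>" if "x \<in> D" for x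
  using pairings2(3)[OF that] X1[OF that] by (simp add: cdot_commute)
 then have "cdot (f_11 g w) (clin R (f_1 g w)) + cdot (f_1 g w) (del (\<lambda>x. clin R (f_1 g x)) w) = 0"
  using cdot_const_deriv(1)[of D w "f_1 g" "\<lambda>x. clin R (f_1 g x)" "-\<i>"] D w smg(2) sm by (simp add: f_11_def[symmetric])
 moreover have "del (\<lambda>x. clin R (f_1 g x)) w = clin R (f_11 g w)"
  unfolding f_11_def by (rule del_clinear[OF clin(1,2)[OF R] smooth_on_differentiable[OF smg(2) w]])
 moreover have "cdot (f_1 g w) (clin R (f_11 g w)) = cdot (f_11 g w) (clin R (f_1 g w))"
  by (metis cdot_clin cdot_commute sa)
 ultimately show ?thesis unfolding X1[OF w] by simp
qed

section \<open>The global setting\<close>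

lemma adapted_coordinate_subset:
 fixes f :: "'a::t2_space \<Rightarrow> real^'n"
 assumes a: "adapted_coordinate S \<A> f U z" and V: "openin (top_of_set S) V" "V \<subseteq> U"
 shows "adapted_coordinate S \<A> f V z" unfolding adapted_coordinate_def
proof (intro conjI ballI)
 have c: "complex_coordinate S \<A> U z" using a by (simp add: adapted_coordinate_def)
 then show c': "complex_coordinate S \<A> V z" by (rule complex_coordinate_subset[OF _ V])
 fix w assume w: "w \<in> z ` V"
 have "f_2 (local_expr f V z) w = f_2 (local_expr f U z) w"
  using f_2_cong[of "z ` V" "local_expr f V z" "local_expr f U z" w] chartD(2)[OF complex_coordinate_chart[OF c']]
   local_expr_subset[OF complex_coordinate_chart[OF c] V(2), of _ f] w by blast
 then show "cdot (f_2 (local_expr f V z) w) (f_2 (local_expr f V z) w) = -1"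
  using a w V(2) unfolding adapted_coordinate_def by auto
qed

text \<open>Coordinate discs inside any neighbourhood: their connectedness is needed for uniqueness
  arguments, and their convexity for logarithms and primitives.\<close>

lemma chart_ball:
 assumes c: "chart S U z" and p: "p \<in> U" and T: "openin (top_of_set S) T" "p \<in> T"
 obtains V r where "openin (top_of_set S) V" "V \<subseteq> U" "V \<subseteq> T" "p \<in> V" "r > 0" "z ` V = ball (z p) r"
proof -
 have "openin (top_of_set S) (U \<inter> T)" using chartD(1)[OF c] T(1) by blast
 then have "open (z ` (U \<inter> T))" by (intro chart_image_open[OF c]) auto
 then obtain r where r: "r > 0" "ball (z p) r \<subseteq> z ` (U \<inter> T)" using p T(2) openE by blast
 let ?V = "inv_into U z ` ball (z p) r"
 have zU: "ball (z p) r \<subseteq> z ` U" using r(2) by blast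
 have "openin (top_of_set S) ?V" by (rule chart_preimage_openin[OF c open_ball zU])
 moreover have "?V \<subseteq> U \<inter> T"
 proof
  fix q assume "q \<in> ?V"
  then obtain x where x: "x \<in> ball (z p) r" "q = inv_into U z x" by blast
  then obtain q' where "q' \<in> U \<inter> T" "x = z q'" using r(2) by blast
  then show "q \<in> U \<inter> T" using x chartD(7)[OF c] by auto
 qed
 moreover have "p \<in> ?V" using chartD(7)[OF c p] r(1) by (metis centre_in_ball imageI)
 moreover have "z ` ?V = ball (z p) r"
 proof -
  have "z (inv_into U z x) = x" if "x \<in> ball (z p) r" for x using chartD(8)[OF c] zU that by blast
  then show ?thesis by (auto simp: image_image)
 qed
 ultimately show ?thesis using that r(1) by blast
qed

locale surface =
 fixes S :: "'a::t2_space set" and \<A> :: "('a set \<times> ('a \<Rightarrow> complex)) set" and f :: "'a \<Rightarrow> real^6"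
 assumes rs: "riemann_surface S \<A>" and mi: "minimal_immersion S \<A> f"
  and ne: "nondegenerate_noncircular_ellipse S \<A> f"
begin

lemma connected_S: "connected S" and S_nonempty: "S \<noteq> {}" using rs by (simp_all add: riemann_surface_def)

lemma adapted6:
 assumes "adapted_coordinate S \<A> f U z"
 shows "adapted6 (z ` U) (local_expr f U z)"
proof
 have c: "complex_coordinate S \<A> U z" using assms by (simp add: adapted_coordinate_def)
 show cm: "conf_min (z ` U) (local_expr f U z)" by (rule minimal_immersion_conf_min[OF mi c])
 fix w assume w: "w \<in> z ` U"
 show "cdot (f_2 (local_expr f U z) w) (f_2 (local_expr f U z) w) = -1"
  using assms w unfolding adapted_coordinate_def by blast
 show "a_part (local_expr f U z) w \<noteq> 0"
  by (rule nondegenerate_imp_a[OF cm w]) (use ne c w in \<open>unfold nondegenerate_noncircular_ellipse_def, blast\<close>)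
qed

text \<open>The adapted coordinates that induce the given F. For nonempty U at most one of z and
  \<i> z is of this kind, because the latter changes the sign of b.\<close>

definition plus_chart :: "('a \<Rightarrow> real^6) \<Rightarrow> 'a set \<Rightarrow> ('a \<Rightarrow> complex) \<Rightarrow> bool" where
 "plus_chart F U z \<longleftrightarrow> adapted_coordinate S \<A> f U z \<and> (\<forall>q\<in>U. F q = f_plus (local_expr f U z) (z q))"

lemma plus_chartD:
 assumes "plus_chart F U z"
 shows "adapted_coordinate S \<A> f U z" "complex_coordinate S \<A> U z" "chart S U z"
  "w \<in> z ` U \<Longrightarrow> local_expr F U z w = f_plus (local_expr f U z) w"
  "adapted6 (z ` U) (local_expr f U z)"
proof -
 show a: "adapted_coordinate S \<A> f U z" using assms by (simp add: plus_chart_def)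
 then show "complex_coordinate S \<A> U z" by (simp add: adapted_coordinate_def)
 then show c: "chart S U z" by (rule complex_coordinate_chart)
 show "local_expr F U z w = f_plus (local_expr f U z) w" if "w \<in> z ` U"
  using that assms local_expr_chart[OF c, where f = F] by (auto simp: plus_chart_def)
 show "adapted6 (z ` U) (local_expr f U z)" by (rule adapted6[OF a])
qed

lemma plus_chart_subset:
 assumes p: "plus_chart F U z" and V: "openin (top_of_set S) V" "V \<subseteq> U"
 shows "plus_chart F V z"
proof -
 have "f_plus (local_expr f V z) w = f_plus (local_expr f U z) w" if "w \<in> z ` V" for w
  using f_plus_cong[of "z ` V" "local_expr f V z" "local_expr f U z" w]
   chart_image_open[OF plus_chartD(3)[OF p] V] local_expr_subset[OF plus_chartD(3)[OF p] V(2), of _ f] that by blast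
 then show ?thesis
  using p adapted_coordinate_subset[OF plus_chartD(1)[OF p] V] V(2) unfolding plus_chart_def by auto
qed

lemma plus_transform_chart:
 assumes F: "is_plus_transform S \<A> f F" and p: "p \<in> S" "openin (top_of_set S) T" "p \<in> T"
 obtains U z r where "plus_chart F U z" "p \<in> U" "U \<subseteq> T" "r > 0" "z ` U = ball (z p) r"
proof -
 obtain U z where U: "p \<in> U" "plus_chart F U z"
  using F p(1) unfolding is_plus_transform_def plus_chart_def by blast
 obtain V r where "openin (top_of_set S) V" "V \<subseteq> U" "V \<subseteq> T" "p \<in> V" "r > 0" "z ` V = ball (z p) r"
  using chart_ball[OF plus_chartD(3)[OF U(2)] U(1) p(2,3)] .
 then show ?thesis using that plus_chart_subset[OF U(2)] by blast
qed

lemma f_plus_pair6: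
 assumes "adapted6 D g"
 shows "pair6 D g (f_plus g)"
proof -
 interpret adapted6 D g by fact
 show ?thesis
 proof
  show "smooth_on D (f_plus g)" by (rule smooth_f_plus)
  fix w assume w: "w \<in> D"
  note p = f_plus_props[OF w]
  show "cdot (cvec (f_plus g w)) (cvec (f_plus g w)) = 1" using p(1) by (simp add: cdot_cvec power2_norm_eq_inner[symmetric])
  show "cdot (cvec (g w)) (cvec (f_plus g w)) = 0" using p(2) by (simp add: cdot_cvec inner_commute)
  show 1: "cdot (f_1 g w) (cvec (f_plus g w)) = 0" using p(3) by (simp add: cdot_commute)
  have "f_11 g w = f_2 g w + (cdot (f_11 g w) (conj_vec (f_1 g w)) / rho g w) *s f_1 g w"
   unfolding conf_min_f_2[OF cm w] by simp
  then have "cdot (f_11 g w) (cvec (f_plus g w)) = cdot (f_2 g w) (cvec (f_plus g w))"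
   using 1 by (metis (no_types, lifting) add.right_neutral cdot_simps(1,7) mult_zero_right)
  then show "cdot (f_11 g w) (cvec (f_plus g w)) = \<i>" using p(4) by (simp add: cdot_commute)
 qed
qed

lemma pair6_cong:
 assumes "pair6 D g X" "\<And>w. w \<in> D \<Longrightarrow> X w = Y w"
 shows "pair6 D g Y"
proof -
 interpret pair6 D g X by fact
 show ?thesis by unfold_locales
    (use smooth_X smooth_on_cong[of D X Y] D assms(2) XX gX f_1_X f_11_X in \<open>metis\<close>)+
qed

lemma plus_chart_pair6:
 assumes "plus_chart F U z"
 shows "pair6 (z ` U) (local_expr f U z) (local_expr F U z)"
 by (rule pair6_cong[OF f_plus_pair6[OF plus_chartD(5)[OF assms]]]) (simp add: plus_chartD(4)[OF assms])

lemma gamma_plus_zero_iff: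
 "gamma_plus_zero S \<A> f F \<longleftrightarrow> (\<forall>U z. plus_chart F U z \<longrightarrow>
   (\<forall>w\<in>z ` U. cdot (f_11 (local_expr f U z) w) (f_1 (local_expr F U z) w) = 0))"
proof -
 have "gamma_plus (local_expr f U z) w = cdot (f_11 (local_expr f U z) w) (f_1 (local_expr F U z) w)"
  if "plus_chart F U z" "w \<in> z ` U" for U z w
 proof -
  have "f_1 (local_expr F U z) w = f_1 (f_plus (local_expr f U z)) w"
   using f_1_cong[of "z ` U" "local_expr F U z" "f_plus (local_expr f U z)" w] chartD(2)[OF plus_chartD(3)[OF that(1)]]
    plus_chartD(4)[OF that(1)] that(2) by blast
  then show ?thesis by (simp add: gamma_plus_def f_11_def)
 qed
 then show ?thesis unfolding gamma_plus_zero_def plus_chart_def[symmetric] by metis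
qed

lemma symmetric_image_gamma_plus_zero:
 assumes R: "linear R" and sa: "\<And>x y. R x \<bullet> y = x \<bullet> R y" and e: "\<And>p. p \<in> S \<Longrightarrow> F p = R (f p)"
 shows "gamma_plus_zero S \<A> f F" unfolding gamma_plus_zero_iff
proof (intro allI impI ballI)
 fix U z w assume p: "plus_chart F U z" and w: "w \<in> z ` U"
 interpret pair6 "z ` U" "local_expr f U z" "local_expr F U z" by (rule plus_chart_pair6[OF p])
 have "local_expr F U z x = R (local_expr f U z x)" if "x \<in> z ` U" for x
  using that e chartD(4,9)[OF plus_chartD(3)[OF p]] by (auto simp: local_expr_def)
 then show "cdot (f_11 (local_expr f U z) w) (f_1 (local_expr F U z) w) = 0"
  using symmetric_image_gamma[OF R sa _ w] by blast
qed

lemma reflection_imp_gamma_plus_zero: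
 assumes "is_great_sphere_reflection_of S F f"
 shows "gamma_plus_zero S \<A> f F"
proof -
 obtain V where "subspace V" "\<And>p. p \<in> S \<Longrightarrow> F p = reflection_across V (f p)"
  using assms unfolding is_great_sphere_reflection_of_def by blast
 then show ?thesis using symmetric_image_gamma_plus_zero reflection_across_linear by blast
qed

end

section \<open>From \<open>\<gamma>\<^sup>+ = 0\<close> to the reflection\<close>

context surface
begin

context
 fixes F
 assumes F: "is_plus_transform S \<A> f F" and gz: "gamma_plus_zero S \<A> f F"
begin

lemma plus_chart_pair6_gamma:
 assumes "plus_chart F U z"
 shows "pair6_gamma (z ` U) (local_expr f U z) (local_expr F U z)"
 unfolding pair6_gamma_def pair6_gamma_axioms_def
 using plus_chart_pair6[OF assms] gz assms unfolding gamma_plus_zero_iff by blast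

text \<open>Unique continuation inside one chart: vanishing on an open subset kills the derivatives
  there as well, which gives the initial values for \<open>sum_orth_propagate\<close>.\<close>

lemma sum_orth_plus_chart:
 assumes pc: "plus_chart F U z" and con: "connected (z ` U)" and p: "p \<in> U"
  and T: "openin (top_of_set S) T" "p \<in> T" "\<And>q. q \<in> T \<Longrightarrow> (f q + F q) \<bullet> y = 0" and q: "q \<in> U"
 shows "(f q + F q) \<bullet> y = 0"
proof -
 let ?g = "local_expr f U z" and ?X = "local_expr F U z"
 interpret pair6_gamma "z ` U" ?g ?X by (rule plus_chart_pair6_gamma[OF pc])
 note c = plus_chartD(3)[OF pc]
 have fg: "?g (z q) = f q" "?X (z q) = F q" if "q \<in> U" for q
  using local_expr_chart[OF c that, where f = f] local_expr_chart[OF c that, where f = F] by simp_all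
 define E where "E = z ` (U \<inter> T)"
 have E: "open E" "z p \<in> E" "E \<subseteq> z ` U"
  unfolding E_def using chart_image_open[OF c] chartD(1)[OF c] T(1,2) p by auto
 have zpD: "z p \<in> z ` U" using p by blast
 have s0: "cdot (cvec (?g w + ?X w)) (cvec y) = 0" if "w \<in> E" for w
  using that T(3) fg by (auto simp: E_def cdot_cvec)
 have sm: "smooth_on E (\<lambda>w. cvec (?g w))" "smooth_on E (\<lambda>w. cvec (?X w))" "smooth_on E (f_1 ?g)" "smooth_on E (f_1 ?X)"
  "smooth_on E (f_11 ?g)" "smooth_on E (f_11 ?X)" using smg smX E(3) smooth_on_subset by blast+
 have d: "u differentiable (at w)" if "smooth_on E u" "w \<in> E" for u :: "complex \<Rightarrow> complex^6" and w
  using smooth_on_differentiable that by blast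
 have s1: "cdot (f_1 ?g w + f_1 ?X w) (cvec y) = 0" if w: "w \<in> E" for w
 proof -
  have "cdot (del (\<lambda>w. cvec (?g w) + cvec (?X w)) w) (cvec y) + cdot (cvec (?g w) + cvec (?X w)) (del (\<lambda>_. cvec y) w) = 0"
   using cdot_const_deriv(1)[of E w "\<lambda>w. cvec (?g w) + cvec (?X w)" "\<lambda>_. cvec y" 0] E(1) w s0
    smooth_on_add[OF E(1) sm(1,2)] smooth_on_const[of E "cvec y"] by (simp add: cvec_simps)
  then show ?thesis
   unfolding del_add(1)[OF d[OF sm(1) w] d[OF sm(2) w]] f_1_def' by (simp add: del_const cdot_simps)
 qed
 have s2: "cdot (f_11 ?g w + f_11 ?X w) (cvec y) = 0" if w: "w \<in> E" for w
 proof -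
  have "cdot (del (\<lambda>w. f_1 ?g w + f_1 ?X w) w) (cvec y) + cdot (f_1 ?g w + f_1 ?X w) (del (\<lambda>_. cvec y) w) = 0"
   using cdot_const_deriv(1)[of E w "\<lambda>w. f_1 ?g w + f_1 ?X w" "\<lambda>_. cvec y" 0] E(1) w s1
    smooth_on_add[OF E(1) sm(3,4)] smooth_on_const[of E "cvec y"] by simp
  then show ?thesis
   unfolding del_add(1)[OF d[OF sm(3) w] d[OF sm(4) w]] f_11_def by (simp add: del_const cdot_simps)
 qed
 have "(?g (z p) + ?X (z p)) \<bullet> y = 0" using s0[OF E(2)] by (simp add: cdot_cvec)
 from sum_orth_propagate[OF con zpD _ this s1[OF E(2)] s2[OF E(2)], of "z q"] q
 have "(?g (z q) + ?X (z q)) \<bullet> y = 0" by blast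
 then show ?thesis unfolding fg[OF q] .
qed

lemma plus_transform_values:
 assumes "p \<in> S"
 shows "norm (f p) = 1" "norm (F p) = 1" "f p \<bullet> F p = 0"
proof -
 obtain U z r where U: "plus_chart F U z" "p \<in> U" "U \<subseteq> S" "r > 0" "z ` U = ball (z p) r"
  by (rule plus_transform_chart[OF F assms openin_subtopology_self assms])
 let ?g = "local_expr f U z" and ?X = "local_expr F U z"
 interpret pair6 "z ` U" ?g ?X by (rule plus_chart_pair6[OF U(1)])
 note c = plus_chartD(3)[OF U(1)]
 have fg: "?g (z p) = f p" "?X (z p) = F p"
  using local_expr_chart[OF c U(2), where f = f] local_expr_chart[OF c U(2), where f = F] by simp_all
 have zp: "z p \<in> z ` U" using U by blast
 show "norm (f p) = 1" using conf_minD(3)[OF cm zp] unfolding fg .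
 have "complex_of_real (F p \<bullet> F p) = 1" using XX[OF zp] unfolding fg cdot_cvec .
 then have "F p \<bullet> F p = 1" by (metis of_real_eq_1_iff)
 then show "norm (F p) = 1" by (metis norm_eq_1)
 have "complex_of_real (f p \<bullet> F p) = 0" using gX[OF zp] unfolding fg cdot_cvec .
 then show "f p \<bullet> F p = 0" by (metis of_real_eq_0_iff)
qed

text \<open>With q fixed, f q - F q is orthogonal at q itself to f + F and to its first two
  derivatives, since the pairings are symmetric in f and F and cancel. The orthogonality then
  spreads over the connected S.\<close>

lemma sum_orth_diff:
 assumes p: "p \<in> S" and q: "q \<in> S"
 shows "(f p + F p) \<bullet> (f q - F q) = 0"
proof -
 define y where "y = f q - F q"
 \<comment> \<open>The property asks for a whole neighbourhood, so that derivatives vanish too and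
   one chart can be followed by the next.\<close>
 define P where "P p \<longleftrightarrow> (\<exists>T. openin (top_of_set S) T \<and> p \<in> T \<and> (\<forall>x\<in>T. (f x + F x) \<bullet> y = 0))" for p
 have "P p"
 proof (rule connected_induction_simple[OF connected_S q p])
  show "P q"
  proof -
   obtain U z r where U: "plus_chart F U z" "q \<in> U" "U \<subseteq> S" "r > 0" "z ` U = ball (z q) r"
    by (rule plus_transform_chart[OF F q openin_subtopology_self q])
   let ?g = "local_expr f U z" and ?X = "local_expr F U z"
   interpret pair6_gamma "z ` U" ?g ?X by (rule plus_chart_pair6_gamma[OF U(1)])
   note c = plus_chartD(3)[OF U(1)]
   have fg: "?g (z x) = f x" "?X (z x) = F x" if "x \<in> U" for x
    using local_expr_chart[OF c that, where f = f] local_expr_chart[OF c that, where f = F] by simp_all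
   have zq: "z q \<in> z ` U" using U by blast
   have con: "connected (z ` U)" unfolding U(5) by simp
   have y: "cvec y = cvec (?g (z q)) - cvec (?X (z q))" using fg[OF U(2)] by (simp add: y_def cvec_simps)
   note Qq = Q[OF zq] pairings4[OF zq]
   have "(f x + F x) \<bullet> y = 0" if x: "x \<in> U" for x
   proof -
    have "(?g (z x) + ?X (z x)) \<bullet> y = 0"
    proof (rule sum_orth_propagate[OF con zq])
     have "cdot (cvec (?g (z q) + ?X (z q))) (cvec y) = 0"
      unfolding y cvec_simps by (simp add: cdot_simps Qq)
     then have "complex_of_real ((?g (z q) + ?X (z q)) \<bullet> y) = 0" unfolding cdot_cvec .
     then show "(?g (z q) + ?X (z q)) \<bullet> y = 0" by (metis of_real_eq_0_iff)
     show "z x \<in> z ` U" using x by blast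
     show "cdot (f_1 ?g (z q) + f_1 ?X (z q)) (cvec y) = 0" unfolding y by (simp add: cdot_simps Qq)
     show "cdot (f_11 ?g (z q) + f_11 ?X (z q)) (cvec y) = 0" unfolding y by (simp add: cdot_simps Qq)
    qed
    then show ?thesis using fg[OF x] by simp
   qed
   then show "P q" unfolding P_def using chartD(1)[OF c] U(2) by blast
  qed
  fix a assume a: "a \<in> S"
  obtain U z r where U: "plus_chart F U z" "a \<in> U" "U \<subseteq> S" "r > 0" "z ` U = ball (z a) r"
   by (rule plus_transform_chart[OF F a openin_subtopology_self a])
  have oU: "openin (top_of_set S) U" by (rule chartD(1)[OF plus_chartD(3)[OF U(1)]])
  have con: "connected (z ` U)" unfolding U(5) by simp
  have "P y'" if "x \<in> U" "y' \<in> U" "P x" for x y'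
  proof -
   obtain T where "openin (top_of_set S) T" "x \<in> T" "\<And>q. q \<in> T \<Longrightarrow> (f q + F q) \<bullet> y = 0" using \<open>P x\<close> unfolding P_def by blast
   from sum_orth_plus_chart[OF U(1) con that(1) this]
   have "\<forall>q\<in>U. (f q + F q) \<bullet> y = 0" by blast
   then show ?thesis unfolding P_def using oU that by blast
  qed
  then show "\<exists>T. openin (top_of_set S) T \<and> a \<in> T \<and> (\<forall>x\<in>T. \<forall>y\<in>T. P x \<longrightarrow> P y)" using oU U(2) by blast
 qed
 then show ?thesis unfolding P_def y_def by blast
qed

lemma gamma_plus_zero_imp_reflection: "is_great_sphere_reflection_of S F f"
proof -
 define V where "V = span {f p + F p | p. p \<in> S}"
 have V: "subspace V" by (simp add: V_def)
 have orth: "(f q - F q) \<bullet> v = 0" if "q \<in> S" "v \<in> V" for q v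
 proof -
  have "orthogonal (f q - F q) v" using that(2) unfolding V_def
   by (rule orthogonal_to_span) (use sum_orth_diff that(1) in \<open>auto simp: orthogonal_def inner_commute\<close>)
  then show ?thesis by (simp add: orthogonal_def)
 qed
 have inV: "f p + F p \<in> V" if "p \<in> S" for p unfolding V_def by (rule span_base) (use that in blast)
 have refl: "F p = reflection_across V (f p)" if p: "p \<in> S" for p
 proof -
  have "normal_part V (f p) = (1/2) *\<^sub>R (f p - F p)"
  proof (rule normal_part_eqI)
   show "(1/2) *\<^sub>R (f p - F p) \<bullet> v = 0" if "v \<in> V" for v using orth[OF p that] by simp
   have "f p - (1/2) *\<^sub>R (f p - F p) = (1/2) *\<^sub>R (f p + F p)" by (simp add: vec_eq_iff field_simps)
   then show "f p - (1/2) *\<^sub>R (f p - F p) \<in> span V" using inV[OF p] by (simp add: span_scale span_base)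
  qed
  then show ?thesis by (simp add: reflection_across_def)
 qed
 \<comment> \<open>At any point f and F are orthogonal unit vectors, so neither f + F nor f - F
   vanishes; hence V is nonzero and proper.\<close>
 obtain p where p: "p \<in> S" using S_nonempty by blast
 note v = plus_transform_values[OF p]
 have v': "f p \<bullet> f p = 1" "F p \<bullet> F p = 1" using v by (simp_all add: power2_norm_eq_inner[symmetric])
 have "(f p + F p) \<bullet> f p = 1" using v v' by (simp add: inner_add_left inner_commute[of "F p" "f p"])
 then have "f p + F p \<noteq> 0" by auto
 then have "V \<noteq> {0}" using inV[OF p] by auto
 then have d0: "0 < dim V" using V by (metis dim_eq_0 gr0I subset_singletonD empty_iff subspace_0)
 have "dim V \<noteq> DIM(real^6)"
 proof
  assume "dim V = DIM(real^6)"
  then have "V = UNIV" using V dim_eq_full by (metis span_eq_iff)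
  then have "(f p - F p) \<bullet> f p = 0" using orth[OF p] by blast
  then show False using v v' by (simp add: inner_diff_left inner_commute[of "F p" "f p"])
 qed
 then have "dim V < DIM(real^6)" using dim_subset_UNIV[of V] by linarith
 then show ?thesis unfolding is_great_sphere_reflection_of_def using V d0 refl by blast
qed

end

end

section \<open>Change of coordinate\<close>

lemma linear_det_row: "linear (\<lambda>x. det ((\<chi> i. if i = k then x else R i) :: real^'n^'n))"
proof (rule linearI)
 show "det ((\<chi> i. if i = k then x + y else R i) :: real^'n^'n) = det (\<chi> i. if i = k then x else R i) + det (\<chi> i. if i = k then y else R i)" for x y
  using det_row_add[of k "\<lambda>_. x" "\<lambda>_. y" R] .
 fix c :: real and x :: "real^'n"
 have "c *\<^sub>R x = c *s x" by (simp add: vec_eq_iff)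
 then show "det ((\<chi> i. if i = k then c *\<^sub>R x else R i) :: real^'n^'n) = c *\<^sub>R det (\<chi> i. if i = k then x else R i)"
  using det_row_mul[of k c "\<lambda>_. x" R] by (simp only: real_scaleR_def)
qed

lemma alternating_rotation:
 fixes W :: "'v::real_vector \<Rightarrow> 'v \<Rightarrow> real"
 assumes l: "\<And>y. linear (\<lambda>x. W x y)" "\<And>x. linear (W x)" and alt: "\<And>x. W x x = 0"
 shows "W (\<alpha> *\<^sub>R p + \<beta> *\<^sub>R q) (\<alpha> *\<^sub>R q - \<beta> *\<^sub>R p) = (\<alpha>\<^sup>2 + \<beta>\<^sup>2) * W p q"
proof -
 have b: "W (x + y) v = W x v + W y v" "W (c *\<^sub>R x) v = c * W x v" "W v (x + y) = W v x + W v y"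
  "W v (x - y) = W v x - W v y" "W v (c *\<^sub>R x) = c * W v x" for x y v c
  using linear_add[OF l(1)] linear_scale[OF l(1)] linear_add[OF l(2)] linear_diff[OF l(2)] linear_scale[OF l(2)] by simp_all
 have "W q p = - W p q" using alt[of "p + q"] alt[of p] alt[of q] by (simp add: b)
 then show ?thesis by (simp add: b alt power2_eq_square algebra_simps)
qed

text \<open>A change of coordinate acts on the two tangent rows, and on the rows a and b, by a
  rotation with scaling. On an alternating pair this multiplies the determinant by a sum of
  squares.\<close>

lemma det6_rotation:
 "det (vector [g, \<alpha> *\<^sub>R p + \<beta> *\<^sub>R q, \<alpha> *\<^sub>R q - \<beta> *\<^sub>R p, \<gamma> *\<^sub>R a + \<delta> *\<^sub>R b, \<gamma> *\<^sub>R b - \<delta> *\<^sub>R a, n] :: real^6^6)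
  = (\<alpha>\<^sup>2 + \<beta>\<^sup>2) * (\<gamma>\<^sup>2 + \<delta>\<^sup>2) * det (vector [g, p, q, a, b, n] :: real^6^6)"
proof -
 have r: "(vector [g, p, q, a, b, n] :: real^6^6) = (\<chi> i. if i = 2 then p else (vector [g, 0, q, a, b, n] :: real^6^6) $ i)"
  "(vector [g, p, q, a, b, n] :: real^6^6) = (\<chi> i. if i = 3 then q else (vector [g, p, 0, a, b, n] :: real^6^6) $ i)"
  "(vector [g, p, q, a, b, n] :: real^6^6) = (\<chi> i. if i = 4 then a else (vector [g, p, q, 0, b, n] :: real^6^6) $ i)"
  "(vector [g, p, q, a, b, n] :: real^6^6) = (\<chi> i. if i = 5 then b else (vector [g, p, q, a, 0, n] :: real^6^6) $ i)"
  for g p q a b n :: "real^6" by (simp_all add: vec_eq_iff[where 'a = "real^6"] forall_6 vector_6)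
 have l2: "linear (\<lambda>p. det (vector [g, p, q, a, b, n] :: real^6^6))" for g q a b n :: "real^6"
  by (rule linear_det_row[of 2 "\<lambda>i. (vector [g, 0, q, a, b, n] :: real^6^6) $ i", folded r(1)])
 have l3: "linear (\<lambda>q. det (vector [g, p, q, a, b, n] :: real^6^6))" for g p a b n :: "real^6"
  by (rule linear_det_row[of 3 "\<lambda>i. (vector [g, p, 0, a, b, n] :: real^6^6) $ i", folded r(2)])
 have l4: "linear (\<lambda>a. det (vector [g, p, q, a, b, n] :: real^6^6))" for g p q b n :: "real^6"
  by (rule linear_det_row[of 4 "\<lambda>i. (vector [g, p, q, 0, b, n] :: real^6^6) $ i", folded r(3)])
 have l5: "linear (\<lambda>b. det (vector [g, p, q, a, b, n] :: real^6^6))" for g p q a n :: "real^6"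
  by (rule linear_det_row[of 5 "\<lambda>i. (vector [g, p, q, a, 0, n] :: real^6^6) $ i", folded r(4)])
 have alt: "det (vector [g, p, p, a, b, n] :: real^6^6) = 0" "det (vector [g, p, q, a, a, n] :: real^6^6) = 0" for g p q a b n :: "real^6"
  by (rule det_identical_rows[of 2 3], simp, simp add: row_def vector_6)
    (rule det_identical_rows[of 4 5], simp, simp add: row_def vector_6)
 show ?thesis
  unfolding alternating_rotation[of "\<lambda>p q. det (vector [g, p, q, \<gamma> *\<^sub>R a + \<delta> *\<^sub>R b, \<gamma> *\<^sub>R b - \<delta> *\<^sub>R a, n] :: real^6^6)", OF l2 l3 alt(1)]
   alternating_rotation[of "\<lambda>a b. det (vector [g, p, q, a, b, n] :: real^6^6)", OF l4 l5 alt(2)] by simp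
qed

text \<open>The derivative of \<tau> acts on the tangent frame, and its square on a and b, by
  complex multiplication, which preserves orientation. So N does not depend on the
  coordinate.\<close>

lemma unit_N_compose:
 assumes g: "adapted6 D g" and h: "adapted6 E (\<lambda>w. g (\<tau> w))" and t: "\<tau> holomorphic_on E" "\<tau> ` E \<subseteq> D"
  and nz: "\<And>x. x \<in> E \<Longrightarrow> deriv \<tau> x \<noteq> 0" and w: "w \<in> E"
 shows "unit_N (\<lambda>w. g (\<tau> w)) w = unit_N g (\<tau> w)"
proof -
 interpret G: adapted6 D g by fact
 interpret H: adapted6 E "\<lambda>w. g (\<tau> w)" by fact
 have E: "open E" by (rule conf_minD(1)[OF H.cm])
 have tw: "\<tau> w \<in> D" using t w by blast
 have dg: "g differentiable (at (\<tau> w))" by (rule smooth_on_differentiable[OF conf_minD(2)[OF G.cm] tw])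
 have "\<tau> field_differentiable (at w)" using t(1) E w holomorphic_on_imp_differentiable_at by blast
 then have dh: "dd v (\<lambda>w. g (\<tau> w)) w = dd (deriv \<tau> w * v) g (\<tau> w)" for v
  by (rule dd_compose_holomorphic(1)[where g = g and \<tau> = \<tau>, OF _ dg])
 define \<alpha> \<beta> \<gamma> \<delta> where "\<alpha> = Re (deriv \<tau> w)" "\<beta> = Im (deriv \<tau> w)" "\<gamma> = Re ((deriv \<tau> w)\<^sup>2)" "\<delta> = Im ((deriv \<tau> w)\<^sup>2)"
 note defs = this
 let ?p = "dd 1 g (\<tau> w)" and ?q = "dd \<i> g (\<tau> w)" and ?a = "a_part g (\<tau> w)" and ?b = "b_part g (\<tau> w)"
 have 1: "dd 1 (\<lambda>w. g (\<tau> w)) w = \<alpha> *\<^sub>R ?p + \<beta> *\<^sub>R ?q" "dd \<i> (\<lambda>w. g (\<tau> w)) w = \<alpha> *\<^sub>R ?q - \<beta> *\<^sub>R ?p"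
  unfolding dh dd_linear[OF dg, of "deriv \<tau> w * 1"] dd_linear[OF dg, of "deriv \<tau> w * \<i>"] by (simp_all add: defs)
 have 2: "a_part (\<lambda>w. g (\<tau> w)) w = \<gamma> *\<^sub>R ?a + \<delta> *\<^sub>R ?b" "b_part (\<lambda>w. g (\<tau> w)) w = \<gamma> *\<^sub>R ?b - \<delta> *\<^sub>R ?a"
 proof -
  have "f_2 (\<lambda>w. g (\<tau> w)) w = (deriv \<tau> w)\<^sup>2 *s f_2 g (\<tau> w)" by (rule f_2_compose[OF G.cm E t _ w]) (rule nz)
  then show "a_part (\<lambda>w. g (\<tau> w)) w = \<gamma> *\<^sub>R ?a + \<delta> *\<^sub>R ?b" "b_part (\<lambda>w. g (\<tau> w)) w = \<gamma> *\<^sub>R ?b - \<delta> *\<^sub>R ?a"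
   unfolding a_part_eq b_part_eq by (simp_all add: Re_Im_vec_simps defs algebra_simps)
 qed
 have ab2: "2 *\<^sub>R (\<gamma> *\<^sub>R ?a + \<delta> *\<^sub>R ?b) = \<gamma> *\<^sub>R (2 *\<^sub>R ?a) + \<delta> *\<^sub>R (2 *\<^sub>R ?b)"
  "2 *\<^sub>R (\<gamma> *\<^sub>R ?b - \<delta> *\<^sub>R ?a) = \<gamma> *\<^sub>R (2 *\<^sub>R ?b) - \<delta> *\<^sub>R (2 *\<^sub>R ?a)" by (simp_all add: algebra_simps)
 define k where "k = (\<alpha>\<^sup>2 + \<beta>\<^sup>2) * (\<gamma>\<^sup>2 + \<delta>\<^sup>2)"
 have "n \<bullet> H.normal w = n \<bullet> (k *\<^sub>R G.normal (\<tau> w))" for n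
  unfolding H.normal_def G.normal_def inner_scaleR_right inner_cross6 1 2 ab2 det6_rotation k_def by simp
 then have "H.normal w = k *\<^sub>R G.normal (\<tau> w)" by (metis vector_eq_rdot inner_commute)
 moreover have "k > 0"
 proof -
  have "\<alpha>\<^sup>2 + \<beta>\<^sup>2 = (cmod (deriv \<tau> w))\<^sup>2" "\<gamma>\<^sup>2 + \<delta>\<^sup>2 = (cmod ((deriv \<tau> w)\<^sup>2))\<^sup>2"
   unfolding defs by (simp_all only: cmod_power2)
  then show ?thesis using nz[OF w] by (simp add: k_def)
 qed
 ultimately show ?thesis unfolding G.unit_N[OF tw] H.unit_N[OF w] by simp
qed

section \<open>Transition between adapted coordinates, and their existence\<close>

context surface
begin

text \<open>The fourth power is 1 because (f_2, f_2) transforms as a quartic differential and has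
  the coefficient -1 in both coordinates.\<close>

lemma adapted_transition:
 assumes U: "adapted_coordinate S \<A> f U z" and V: "adapted_coordinate S \<A> f V w" and q: "q \<in> U" "q \<in> V"
 defines "\<tau> \<equiv> z \<circ> inv_into V w"
 shows "unit_N (local_expr f V w) (w q) = unit_N (local_expr f U z) (z q)"
  and "f_2 (local_expr f V w) (w q) = (deriv \<tau> (w q))\<^sup>2 *s f_2 (local_expr f U z) (z q)"
  and "(deriv \<tau> (w q))^4 = 1"
proof -
 have cU: "complex_coordinate S \<A> U z" and cV: "complex_coordinate S \<A> V w" using U V by (auto simp: adapted_coordinate_def)
 note t = transition_properties[OF rs cU cV, folded \<tau>_def]
 let ?E = "w ` (U \<inter> V)"
 have sub: "?E \<subseteq> w ` V" by blast
 have wq: "w q \<in> ?E" using q by blast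
 have tq: "\<tau> (w q) = z q" by (rule t(7)[OF q])
 note aU = adapted6[OF U]
 have "adapted_coordinate S \<A> f (U \<inter> V) w"
  by (rule adapted_coordinate_subset[OF V]) (use chartD(1) complex_coordinate_chart cU cV in blast)+
 then have a1: "adapted6 ?E (local_expr f (U \<inter> V) w)" by (rule adapted6)
 have e: "local_expr f (U \<inter> V) w x = local_expr f U z (\<tau> x)" "local_expr f V w x = local_expr f U z (\<tau> x)" if "x \<in> ?E" for x
 proof -
  show "local_expr f V w x = local_expr f U z (\<tau> x)" by (rule t(6)[OF that])
  then show "local_expr f (U \<inter> V) w x = local_expr f U z (\<tau> x)"
   using local_expr_subset[OF complex_coordinate_chart[OF cV], of "U \<inter> V" x f] that by simp
 qed
 have a2: "adapted6 ?E (\<lambda>x. local_expr f U z (\<tau> x))"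
 proof
  show "conf_min ?E (\<lambda>x. local_expr f U z (\<tau> x))"
   by (rule conf_min_compose[OF adapted6.cm[OF aU] t(1,2,4)]) (rule t(5))
  fix x assume x: "x \<in> ?E"
  have "f_2 (\<lambda>x. local_expr f U z (\<tau> x)) x = f_2 (local_expr f (U \<inter> V) w) x"
   using f_2_cong[of ?E "\<lambda>x. local_expr f U z (\<tau> x)" "local_expr f (U \<inter> V) w" x] t(1) e x by metis
  then show "cdot (f_2 (\<lambda>x. local_expr f U z (\<tau> x)) x) (f_2 (\<lambda>x. local_expr f U z (\<tau> x)) x) = -1"
   "a_part (\<lambda>x. local_expr f U z (\<tau> x)) x \<noteq> 0"
   unfolding a_part_eq using adapted6.ad[OF a1 x] adapted6.a_nz[OF a1 x] unfolding a_part_eq by simp_all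
 qed
 have l: "f_1 (local_expr f V w) (w q) = f_1 (\<lambda>x. local_expr f U z (\<tau> x)) (w q)"
  "II (local_expr f V w) (w q) u v = II (\<lambda>x. local_expr f U z (\<tau> x)) (w q) u v"
  "f_2 (local_expr f V w) (w q) = f_2 (\<lambda>x. local_expr f U z (\<tau> x)) (w q)"
  "dd v (local_expr f V w) (w q) = dd v (\<lambda>x. local_expr f U z (\<tau> x)) (w q)" for u v
  using local_cong[of ?E "local_expr f V w" "\<lambda>x. local_expr f U z (\<tau> x)" "w q"]
   dd_cong[of ?E "w q" "local_expr f V w" "\<lambda>x. local_expr f U z (\<tau> x)"] t(1) e(2) wq by blast+
 have "unit_N (local_expr f V w) (w q) = unit_N (\<lambda>x. local_expr f U z (\<tau> x)) (w q)"
  unfolding unit_N_def l e(2)[OF wq] ..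
 also have "\<dots> = unit_N (local_expr f U z) (\<tau> (w q))"
  by (rule unit_N_compose[OF aU a2 t(2,4) _ wq]) (rule t(5))
 finally show "unit_N (local_expr f V w) (w q) = unit_N (local_expr f U z) (z q)" unfolding tq .
 show f2: "f_2 (local_expr f V w) (w q) = (deriv \<tau> (w q))\<^sup>2 *s f_2 (local_expr f U z) (z q)"
 proof -
  have "f_2 (\<lambda>x. local_expr f U z (\<tau> x)) (w q) = (deriv \<tau> (w q))\<^sup>2 *s f_2 (local_expr f U z) (\<tau> (w q))"
   by (rule f_2_compose[OF adapted6.cm[OF aU] t(1,2,4) _ wq]) (rule t(5))
  then show ?thesis unfolding l tq .
 qed
 have "cdot (f_2 (local_expr f V w) (w q)) (f_2 (local_expr f V w) (w q)) = -1"
  "cdot (f_2 (local_expr f U z) (z q)) (f_2 (local_expr f U z) (z q)) = -1"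
  using U V q unfolding adapted_coordinate_def by blast+
 then show "(deriv \<tau> (w q))^4 = 1"
  unfolding f2 by (simp add: cdot_simps power2_eq_square power4_eq_xxxx mult.assoc)
qed

text \<open>The conjugate derivative of \<open>f_11\<close> lies in the span of f and
  \<open>f_1\<close>, and both are orthogonal to \<open>f_11\<close>. The function is the
  coefficient of a holomorphic quartic differential.\<close>

lemma holomorphic_f_11_sq:
 assumes "conf_min D g"
 shows "(\<lambda>w. cdot (f_11 g w) (f_11 g w)) holomorphic_on D"
proof (rule holomorphic_onI)
 fix w assume w: "w \<in> D"
 let ?q = "\<lambda>w. cdot (f_11 g w) (f_11 g w)"
 note d = smooth_on_differentiable[OF conf_min_smooth(3)[OF assms] w]
 have z: "dzb ?q w = 0" unfolding dz_cdot(2)[OF d d] conf_min_delb_f_11[OF assms w]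
  by (simp add: cdot_simps conf_min_pairings[OF assms w] conf_min_pairings[OF assms w, THEN trans[OF cdot_commute]])
 have "?q differentiable (at w)"
  by (rule smooth_on_differentiable[OF smooth_on_cdot[OF conf_minD(1)[OF assms] conf_min_smooth(3)[OF assms] conf_min_smooth(3)[OF assms]] w])
 from has_derivative_dz[OF this] have "(?q has_derivative (*) (dz ?q w)) (at w)"
  by (rule has_derivative_eq_rhs) (simp add: fun_eq_iff z)
 then show "?q field_differentiable (at w within D)"
  unfolding field_differentiable_def has_field_derivative_def using has_derivative_at_withinI by blast
qed

end

context surface
begin

text \<open>The new coordinate is a primitive of a fourth root of -(f_2, f_2). This function is
  holomorphic and has no zeros because the ellipse is nowhere a circle, so the root exists on a
  disc.\<close>

lemma adapted_coordinate_exists: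
 assumes p: "p \<in> S" and T: "openin (top_of_set S) T" "p \<in> T"
 obtains U z r where "adapted_coordinate S \<A> f U z" "p \<in> U" "U \<subseteq> T" "r > 0" "z ` U = ball (z p) r"
proof -
 obtain U0 z0 where U0: "(U0, z0) \<in> \<A>" "p \<in> U0" using p rs unfolding riemann_surface_def by blast
 have c0: "complex_coordinate S \<A> U0 z0" by (rule atlas_complex_coordinate[OF rs U0(1)])
 obtain U1 r1 where U1: "openin (top_of_set S) U1" "U1 \<subseteq> U0" "U1 \<subseteq> T" "p \<in> U1" "r1 > 0" "z0 ` U1 = ball (z0 p) r1"
  by (rule chart_ball[OF complex_coordinate_chart[OF c0] U0(2) T])
 have c1: "complex_coordinate S \<A> U1 z0" by (rule complex_coordinate_subset[OF c0 U1(1,2)])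
 let ?B = "ball (z0 p) r1" and ?g = "local_expr f U1 z0"
 have cm: "conf_min ?B ?g" using minimal_immersion_conf_min[OF mi c1] unfolding U1(6) .
 define q where "q w = - cdot (f_11 ?g w) (f_11 ?g w)" for w
 have qh: "q holomorphic_on ?B" unfolding q_def[abs_def] by (intro holomorphic_on_minus holomorphic_f_11_sq[OF cm])
 have q2: "q w = - cdot (f_2 ?g w) (f_2 ?g w)" if "w \<in> ?B" for w
  unfolding q_def using conf_min_f_2_orth(8)[OF cm that] by simp
 have qnz: "q w \<noteq> 0" if "w \<in> ?B" for w
 proof -
  have "\<not> (\<exists>r. \<forall>y \<in> curvature_ellipse ?g w. norm y = r)"
   using ne c1 that U1(6) unfolding nondegenerate_noncircular_ellipse_def by blast
  then show ?thesis using noncircular_imp_f_2[OF cm that] q2[OF that] by simp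
 qed
 obtain l where l: "l holomorphic_on ?B" "\<And>w. w \<in> ?B \<Longrightarrow> q w = exp (l w)"
  using contractible_imp_holomorphic_log[OF qh convex_imp_contractible[OF convex_ball]] qnz by blast
 define k where "k w = exp (l w / 4)" for w
 have kh: "k holomorphic_on ?B" unfolding k_def[abs_def] by (intro holomorphic_intros l) auto
 have k4: "k w ^ 4 = q w" if "w \<in> ?B" for w
  using exp_of_nat_mult[of 4 "l w / 4"] unfolding k_def l(2)[OF that] by simp
 obtain \<phi> where \<phi>: "\<And>x. x \<in> ?B \<Longrightarrow> (\<phi> has_field_derivative k x) (at x within ?B)"
  by (rule holomorphic_convex_primitive'[OF convex_ball open_ball kh], rule that, assumption)
 have dphi: "(\<phi> has_field_derivative k x) (at x)" if "x \<in> ?B" for x using \<phi>[OF that] at_within_open[OF that open_ball] by metis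
 have phh: "\<phi> holomorphic_on ?B" by (rule holomorphic_onI) (use \<phi> in \<open>unfold field_differentiable_def, blast\<close>)
 have dd: "deriv \<phi> x = k x" if "x \<in> ?B" for x by (rule DERIV_imp_deriv[OF dphi[OF that]])
 have cB: "z0 p \<in> ?B" using U1(5) by simp
 have "deriv \<phi> (z0 p) \<noteq> 0" unfolding dd[OF cB] by (simp add: k_def)
 \<comment> \<open>The primitive has nonzero derivative but may fail to be injective on the whole
   disc, so the disc is shrunk.\<close>
 then obtain r2 where r2: "r2 > 0" "ball (z0 p) r2 \<subseteq> ?B" "inj_on \<phi> (ball (z0 p) r2)"
  using has_complex_derivative_locally_injective[OF phh cB open_ball] by metis
 let ?B2 = "ball (z0 p) r2"
 define U2 where "U2 = inv_into U1 z0 ` ?B2"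
 note ch1 = complex_coordinate_chart[OF c1]
 have oU2: "openin (top_of_set S) U2" unfolding U2_def by (rule chart_preimage_openin[OF ch1 open_ball]) (use r2(2) U1(6) in simp)
 have U2: "U2 \<subseteq> U1" "p \<in> U2" "z0 ` U2 = ?B2"
 proof -
  show "U2 \<subseteq> U1" unfolding U2_def using chartD(9)[OF ch1] r2(2) U1(6) by blast
  have "inv_into U1 z0 (z0 p) \<in> U2" unfolding U2_def using r2(1) by (intro imageI) simp
  then show "p \<in> U2" using chartD(7)[OF ch1 U1(4)] by simp
  have "z0 (inv_into U1 z0 x) = x" if "x \<in> ?B2" for x using chartD(8)[OF ch1] U1(6) r2(2) that by blast
  then show "z0 ` U2 = ?B2" unfolding U2_def image_image by simp
 qed
 have c2: "complex_coordinate S \<A> U2 z0" by (rule complex_coordinate_subset[OF c1 oU2 U2(1)])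
 have ph2: "\<phi> holomorphic_on z0 ` U2" unfolding U2(3) using phh r2(2) holomorphic_on_subset by blast
 have inj2: "inj_on \<phi> (z0 ` U2)" unfolding U2(3) by (rule r2(3))
 note c3 = complex_coordinate_compose[OF rs c2 ph2 inj2]
 define z where "z = \<phi> \<circ> z0"
 have c3': "complex_coordinate S \<A> U2 z" unfolding z_def by (rule c3(1))
 have "adapted_coordinate S \<A> f U2 z" unfolding adapted_coordinate_def
 proof (intro conjI ballI c3')
  fix y assume "y \<in> z ` U2"
  then obtain x where x: "x \<in> ?B2" "y = \<phi> x" using U2(3) unfolding z_def by (metis (no_types, lifting) image_comp image_iff)
  then have xB: "x \<in> ?B" using r2(2) by blast
  let ?h = "local_expr f U2 z"
  have cmh: "conf_min (z ` U2) ?h" by (rule minimal_immersion_conf_min[OF mi c3'])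
  have sub: "\<phi> ` ?B2 \<subseteq> z ` U2" unfolding z_def image_comp[symmetric] U2(3) ..
  have e: "?g x' = ?h (\<phi> x')" if "x' \<in> ?B2" for x'
  proof -
   have "local_expr f U2 z0 x' = ?h (\<phi> x')" unfolding z_def by (rule c3(2)) (use that U2(3) in simp)
   then show ?thesis using local_expr_subset[OF ch1 U2(1), of x' f] that U2(3) by simp
  qed
  have nz: "deriv \<phi> x' \<noteq> 0" if "x' \<in> ?B2" for x'
  proof -
   have "x' \<in> ?B" using that r2(2) by blast
   then show ?thesis unfolding dd[OF \<open>x' \<in> ?B\<close>] by (simp add: k_def)
  qed
  have "f_2 ?g x = f_2 (\<lambda>x. ?h (\<phi> x)) x" using f_2_cong[of ?B2 ?g "\<lambda>x. ?h (\<phi> x)" x] e x by blast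
  also have "\<dots> = (deriv \<phi> x)\<^sup>2 *s f_2 ?h (\<phi> x)"
   by (rule f_2_compose[OF cmh open_ball holomorphic_on_subset[OF phh r2(2)] sub _ x(1)]) (rule nz)
  finally have f2e: "f_2 ?g x = (k x)\<^sup>2 *s f_2 ?h y" unfolding dd[OF xB] x(2) .
  have "q x = - (k x ^ 4 * cdot (f_2 ?h y) (f_2 ?h y))"
   unfolding q2[OF xB] f2e cdot_simps by (simp add: power2_eq_square power4_eq_xxxx mult.assoc)
  moreover have "a * (1 + b) = 0" if "a = - (a * b)" for a b :: complex
   using that by (simp add: distrib_left) (metis add.left_inverse)
  ultimately have "k x ^ 4 * (1 + cdot (f_2 ?h y) (f_2 ?h y)) = 0" unfolding k4[OF xB] by blast
  then have "1 + cdot (f_2 ?h y) (f_2 ?h y) = 0" using qnz[OF xB] unfolding k4[OF xB] by (metis mult_eq_0_iff)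
  then show "cdot (f_2 ?h y) (f_2 ?h y) = -1" by (simp add: add_eq_0_iff)
 qed
 moreover obtain U r where U: "openin (top_of_set S) U" "U \<subseteq> U2" "U \<subseteq> T" "p \<in> U" "r > 0" "z ` U = ball (z p) r"
  by (rule chart_ball[OF complex_coordinate_chart[OF c3'] U2(2) T])
 ultimately have "adapted_coordinate S \<A> f U z" using adapted_coordinate_subset[OF _ U(1,2)] by metis
 then show ?thesis by (rule that[OF _ U(4,3,5,6)])
qed

end

section \<open>Bipolar surfaces\<close>

lemma del_cbilinear:
 fixes P :: "complex^'a \<Rightarrow> complex^'b \<Rightarrow> complex^'c"
 assumes P: "\<And>x y z. P (x + y) z = P x z + P y z" "\<And>x y z. P x (y + z) = P x y + P x z"
  "\<And>c x y. P (c *s x) y = c *s P x y" "\<And>c x y. P x (c *s y) = c *s P x y"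
  and d: "u differentiable (at w)" "v differentiable (at w)"
 shows "del (\<lambda>w. P (u w) (v w)) w = P (del u w) (v w) + P (u w) (del v w)"
  and "delb (\<lambda>w. P (u w) (v w)) w = P (delb u w) (v w) + P (u w) (delb v w)"
proof -
 have "bilinear P" unfolding bilinear_def by (auto intro!: linearI simp: P scaleR_smult)
 then have "bounded_bilinear P" by (simp add: bilinear_conv_bounded_bilinear)
 from bounded_bilinear.FDERIV[OF this has_derivative_del[OF d(1)] has_derivative_del[OF d(2)]]
 have "((\<lambda>w. P (u w) (v w)) has_derivative (\<lambda>x. x *s (P (del u w) (v w) + P (u w) (del v w))
   + cnj x *s (P (delb u w) (v w) + P (u w) (delb v w)))) (at w)"
  by (rule has_derivative_eq_rhs) (simp add: fun_eq_iff P vec_eq_iff algebra_simps)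
 from del_delb_eqI[OF this] show "del (\<lambda>w. P (u w) (v w)) w = P (del u w) (v w) + P (u w) (del v w)"
  "delb (\<lambda>w. P (u w) (v w)) w = P (delb u w) (v w) + P (u w) (delb v w)" .
qed

definition cwedge :: "complex^4 \<Rightarrow> complex^4 \<Rightarrow> complex^6" where
 "cwedge u v = vector [u$1 * v$2 - u$2 * v$1, u$1 * v$3 - u$3 * v$1, u$1 * v$4 - u$4 * v$1,
            u$2 * v$3 - u$3 * v$2, u$2 * v$4 - u$4 * v$2, u$3 * v$4 - u$4 * v$3]"

text \<open>The Hodge star on the exterior square of \<open>\<real>\<^sup>4\<close>.\<close>

definition star :: "'a::ring_1^6 \<Rightarrow> 'a^6" where
 "star y = vector [y$6, - y$5, y$4, y$3, - y$2, y$1]"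

lemma vec6_eqI: "x$1 = y$1 \<Longrightarrow> x$2 = y$2 \<Longrightarrow> x$3 = y$3 \<Longrightarrow> x$4 = y$4 \<Longrightarrow> x$5 = y$5 \<Longrightarrow> x$6 = y$6 \<Longrightarrow> x = y"
 for x y :: "'a^6" unfolding vec_eq_iff forall_6 by blast

lemma cvec_wedge: "cvec (wedge u v) = cwedge (cvec u) (cvec v)"
 by (rule vec6_eqI) (simp_all add: cvec_def wedge_def cwedge_def vector_6)

lemma cvec_star: "cvec (star y) = star (cvec y)" by (rule vec6_eqI) (simp_all add: cvec_def star_def vector_6)

lemma cwedge_bilinear:
 "cwedge (x + y) z = cwedge x z + cwedge y z" "cwedge z (x + y) = cwedge z x + cwedge z y"
 "cwedge (c *s x) z = c *s cwedge x z" "cwedge z (c *s x) = c *s cwedge z x" "cwedge x x = 0"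
 by (rule vec6_eqI; simp add: cwedge_def vector_6 algebra_simps)+

lemma cdot_cwedge: "cdot (cwedge a b) (cwedge c d) = cdot a c * cdot b d - cdot a d * cdot b c"
 by (simp add: cdot_def sum_6 sum_4 cwedge_def vector_6 algebra_simps)

lemma inner_wedge: "wedge a b \<bullet> wedge c d = (a \<bullet> c) * (b \<bullet> d) - (a \<bullet> d) * (b \<bullet> c)"
 by (simp add: inner_vec_def sum_6 sum_4 wedge_def vector_6 algebra_simps)

lemma star_linear: "linear (star :: real^6 \<Rightarrow> real^6)"
 by (rule linearI; rule vec6_eqI; simp add: star_def vector_6)

lemma star_selfadjoint: "star x \<bullet> y = x \<bullet> star (y :: real^6)"
 by (simp add: inner_vec_def sum_6 star_def vector_6)

lemma star_star: "star (star y) = y" by (rule vec6_eqI) (simp_all add: star_def vector_6)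

text \<open>The product of x with the star of y is the coefficient of the 4-vector x \<and> y, which
  vanishes when the two bivectors share a factor.\<close>

lemma wedge_star:
 "wedge a b \<bullet> star (wedge a c) = 0" "wedge a b \<bullet> star (wedge c a) = 0"
 "wedge b a \<bullet> star (wedge a c) = 0" "wedge b a \<bullet> star (wedge c a) = 0"
 by (simp_all add: inner_vec_def sum_6 star_def wedge_def vector_6 algebra_simps)

lemma cwedge_star:
 "cdot (cwedge a b) (star (cwedge a c)) = 0" "cdot (cwedge a b) (star (cwedge c a)) = 0"
 "cdot (cwedge b a) (star (cwedge a c)) = 0" "cdot (cwedge b a) (star (cwedge c a)) = 0"
 by (simp_all add: cdot_def sum_6 star_def cwedge_def vector_6 algebra_simps)

locale bipolar_local =
 fixes D and G N :: "complex \<Rightarrow> real^4"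
 assumes cm: "conf_min D G" and smooth_N: "smooth_on D N"
  and NN: "\<And>w. w \<in> D \<Longrightarrow> N w \<bullet> N w = 1" and NG: "\<And>w. w \<in> D \<Longrightarrow> N w \<bullet> G w = 0"
  and NdG: "\<And>w v. w \<in> D \<Longrightarrow> N w \<bullet> dd v G w = 0"
begin

lemma D: "open D" by (rule conf_minD(1)[OF cm])

lemmas smG = conf_min_smooth[OF cm]

lemma smN: "smooth_on D (\<lambda>w. cvec (N w))" "smooth_on D (f_1 N)" "smooth_on D (f_11 N)"
proof -
 show "smooth_on D (\<lambda>w. cvec (N w))" by (rule smooth_on_cvec[OF D smooth_N])
 then show f1: "smooth_on D (f_1 N)" unfolding f_1_def comp_def by (rule smooth_on_del[OF D])
 then show f11: "smooth_on D (f_11 N)" unfolding f_11_def by (rule smooth_on_del[OF D])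
qed

lemma N_f_1: assumes "w \<in> D" shows "cdot (cvec (N w)) (f_1 G w) = 0" "cdot (cvec (N w)) (conj_vec (f_1 G w)) = 0"
proof -
 show "cdot (cvec (N w)) (f_1 G w) = 0"
  unfolding f_1_real(1)[OF smooth_on_differentiable[OF conf_minD(2)[OF cm] assms]]
  using NdG[OF assms] by (simp add: cdot_simps cdot_cvec)
 then show "cdot (cvec (N w)) (conj_vec (f_1 G w)) = 0"
  using cdot_conj[of "cvec (N w)" "f_1 G w"] by (simp add: conj_vec_simps)
qed

context
 fixes w assumes w: "w \<in> D"
begin

text \<open>The coefficient of the Hopf differential of G.\<close>

definition "hopf = cdot (cvec (N w)) (f_11 G w)"

lemma nondegenerate:
 assumes "cdot y (cvec (G w)) = 0" "cdot y (f_1 G w) = 0" "cdot y (conj_vec (f_1 G w)) = 0" "cdot y (cvec (N w)) = 0"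
 shows "y = 0"
proof -
 note d = smooth_on_differentiable[OF conf_minD(2)[OF cm] w]
 have yv: "cdot y (cvec (dd v G w)) = 0" for v
  unfolding f_1_real(3)[OF d] using assms by (simp add: cdot_simps)
 have vv: "dd u G w \<bullet> dd v G w = 2 * Re (u * cnj v) * Re (rho G w)" for u v
  by (rule dd_inner_conformal[OF d conf_minD(5)[OF cm w]])
 have "cdot (cvec (G w)) (cvec (dd v G w)) = 0" for v
  unfolding f_1_real(3)[OF d] by (simp add: cdot_simps conf_min_pairings[OF cm w])
 then have gv: "G w \<bullet> dd v G w = 0" for v unfolding cdot_cvec by simp
 have nz: "dd 1 G w \<bullet> dd 1 G w \<noteq> 0" "dd \<i> G w \<bullet> dd \<i> G w \<noteq> 0" "dd 1 G w \<bullet> dd \<i> G w = 0"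
  using vv conf_min_f_2_orth(7)[OF cm w] by simp_all
 have G0: "norm (G w) = 1" by (rule conf_minD(3)[OF cm w])
 show ?thesis by (rule orthogonal_frame_zero_complex[of "[N w, G w, dd 1 G w, dd \<i> G w]"])
    (use NG[OF w] NdG[OF w] NN[OF w] gv nz G0 assms yv in auto)
qed

lemma pairingsN:
 "cdot (f_1 N w) (cvec (G w)) = 0" "cdot (f_1 N w) (cvec (N w)) = 0" "cdot (f_1 N w) (f_1 G w) = - hopf"
 "cdot (f_1 N w) (conj_vec (f_1 G w)) = 0"
proof -
 have NG': "cdot (cvec (N w)) (cvec (G w)) = 0" if "w \<in> D" for w using NG[OF that] by (simp add: cdot_cvec)
 have NN': "cdot (cvec (N w)) (cvec (N w)) = 1" if "w \<in> D" for w using NN[OF that] by (simp add: cdot_cvec)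
 have "cdot (f_1 N w) (cvec (G w)) + cdot (cvec (N w)) (f_1 G w) = 0"
  using cdot_const_deriv(1)[of D w "\<lambda>w. cvec (N w)" "\<lambda>w. cvec (G w)" 0] D w NG' smN smG by (simp add: f_1_def'[symmetric])
 then show 1: "cdot (f_1 N w) (cvec (G w)) = 0" using N_f_1[OF w] by simp
 have "cdot (f_1 N w) (cvec (N w)) + cdot (cvec (N w)) (f_1 N w) = 0"
  using cdot_const_deriv(1)[of D w "\<lambda>w. cvec (N w)" "\<lambda>w. cvec (N w)" 1] D w NN' smN by (simp add: f_1_def'[symmetric])
 then show "cdot (f_1 N w) (cvec (N w)) = 0" by (simp add: cdot_commute[of "cvec (N w)"])
 have "cdot (f_1 N w) (f_1 G w) + cdot (cvec (N w)) (f_11 G w) = 0"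
  using cdot_const_deriv(1)[of D w "\<lambda>w. cvec (N w)" "f_1 G" 0] D w N_f_1 smN smG by (simp add: f_1_def'[symmetric] f_11_def[symmetric])
 then show "cdot (f_1 N w) (f_1 G w) = - hopf" by (simp add: hopf_def eq_neg_iff_add_eq_0)
 have "cdot (f_1 N w) (conj_vec (f_1 G w)) + cdot (cvec (N w)) (- rho G w *s cvec (G w)) = 0"
  using cdot_const_deriv(1)[of D w "\<lambda>w. cvec (N w)" "\<lambda>w. conj_vec (f_1 G w)" 0] D w N_f_1 smN smG conf_min_del_conj_f_1[OF cm w]
  by (simp add: f_1_def'[symmetric])
 then show "cdot (f_1 N w) (conj_vec (f_1 G w)) = 0" using NG'[OF w] by (simp add: cdot_simps)
qed

lemma base_pairings:
 "cdot (cvec (N w)) (cvec (N w)) = 1" "cdot (cvec (N w)) (cvec (G w)) = 0" "cdot (cvec (N w)) (f_1 G w) = 0"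
 "cdot (cvec (N w)) (conj_vec (f_1 G w)) = 0"
 using NN[OF w] NG[OF w] N_f_1[OF w] by (simp_all add: cdot_cvec)

lemmas B0 = base_pairings conf_min_pairings[OF cm w]
lemmas B = B0 B0[THEN trans[OF cdot_commute]]

lemma r_nz: "rho G w \<noteq> 0" by (rule conf_min_f_2_orth(5)[OF cm w])

text \<open>The Weingarten equation: by minimality the derivative of the normal has no component
  along \<open>f_1 G\<close>.\<close>

lemma f_1_N: "f_1 N w = (- hopf / rho G w) *s conj_vec (f_1 G w)"
proof -
 have "f_1 N w - (- hopf / rho G w) *s conj_vec (f_1 G w) = 0"
  by (rule nondegenerate) (use r_nz in \<open>simp_all add: cdot_simps pairingsN B\<close>)
 then show ?thesis unfolding right_minus_eq .
qed

lemma f_11_G: "f_11 G w = (cdot (f_11 G w) (conj_vec (f_1 G w)) / rho G w) *s f_1 G w + hopf *s cvec (N w)"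
proof -
 have "f_11 G w - ((cdot (f_11 G w) (conj_vec (f_1 G w)) / rho G w) *s f_1 G w + hopf *s cvec (N w)) = 0"
  by (rule nondegenerate) (use r_nz in \<open>simp_all add: cdot_simps B hopf_def cdot_commute[of "f_11 G w" "cvec (N w)"]\<close>)
 then show ?thesis by (simp add: algebra_simps)
qed

end

text \<open>The components along N and \<open>f_1 G\<close> vanish, by differentiating the relations
  of \<open>f_1 N\<close> with N and with the conjugate of \<open>f_1 G\<close>. So in the second
  derivative of G \<and> N every term keeps a factor G or N, except the one in f_1 \<and> conj
  f_1.\<close>

lemma f_11_N:
 assumes w: "w \<in> D"
 obtains \<alpha> \<beta> where "f_11 N w = \<alpha> *s conj_vec (f_1 G w) + \<beta> *s cvec (G w)"
proof -
 note b = B[OF w] and r = r_nz[OF w] and p = pairingsN[OF w]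
 have "cdot (f_11 N w) (cvec (N w)) + cdot (f_1 N w) (f_1 N w) = 0"
  using cdot_const_deriv(1)[of D w "f_1 N" "\<lambda>w. cvec (N w)" 0] D w pairingsN(2) smN by (simp add: f_1_def'[symmetric] f_11_def[symmetric])
 moreover have "cdot (f_1 N w) (f_1 N w) = 0" unfolding f_1_N[OF w] by (simp add: cdot_simps b)
 ultimately have 1: "cdot (f_11 N w) (cvec (N w)) = 0" by simp
 have "cdot (f_11 N w) (conj_vec (f_1 G w)) + cdot (f_1 N w) (- rho G w *s cvec (G w)) = 0"
  using cdot_const_deriv(1)[of D w "f_1 N" "\<lambda>w. conj_vec (f_1 G w)" 0] D w pairingsN(4) smN smG conf_min_del_conj_f_1[OF cm w]
  by (simp add: f_11_def[symmetric])
 then have 2: "cdot (f_11 N w) (conj_vec (f_1 G w)) = 0" using p by (simp add: cdot_simps)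
 have "f_11 N w - ((cdot (f_11 N w) (f_1 G w) / rho G w) *s conj_vec (f_1 G w) + cdot (f_11 N w) (cvec (G w)) *s cvec (G w)) = 0"
  by (rule nondegenerate[OF w]) (use r in \<open>simp_all add: cdot_simps b 1 2\<close>)
 then have "f_11 N w = (cdot (f_11 N w) (f_1 G w) / rho G w) *s conj_vec (f_1 G w) + cdot (f_11 N w) (cvec (G w)) *s cvec (G w)" by simp
 then show ?thesis by (rule that)
qed

definition W where "W w = wedge (G w) (N w)"

lemma f_1_W: "w \<in> D \<Longrightarrow> f_1 W w = cwedge (f_1 G w) (cvec (N w)) + cwedge (cvec (G w)) (f_1 N w)"
 unfolding f_1_def'[of W] W_def cvec_wedge f_1_def'[of G] f_1_def'[of N]
 by (rule del_cbilinear(1)[OF cwedge_bilinear(1,2,3,4)]; rule smooth_on_differentiable, (rule smG smN)?)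

lemma f_11_W:
 assumes w: "w \<in> D"
 shows "f_11 W w = cwedge (f_11 G w) (cvec (N w)) + 2 *s cwedge (f_1 G w) (f_1 N w) + cwedge (cvec (G w)) (f_11 N w)"
proof -
 have d: "f_1 G differentiable (at w)" "(\<lambda>w. cvec (N w)) differentiable (at w)" "(\<lambda>w. cvec (G w)) differentiable (at w)" "f_1 N differentiable (at w)"
  by (rule smooth_on_differentiable[OF _ w], (rule smG smN))+
 have bl: "bounded_bilinear cwedge"
  unfolding bilinear_conv_bounded_bilinear[symmetric] bilinear_def by (auto intro!: linearI simp: cwedge_bilinear scaleR_smult)
 have d2: "(\<lambda>w. cwedge (f_1 G w) (cvec (N w))) differentiable (at w)" "(\<lambda>w. cwedge (cvec (G w)) (f_1 N w)) differentiable (at w)"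
  by (rule smooth_on_differentiable[OF smooth_on_bilinear[OF D bl] w], (rule smG smN)+)+
 have "f_11 W w = del (\<lambda>w. cwedge (f_1 G w) (cvec (N w)) + cwedge (cvec (G w)) (f_1 N w)) w"
  unfolding f_11_def by (rule del_cong[OF D w f_1_W])
 also have "\<dots> = (cwedge (f_11 G w) (cvec (N w)) + cwedge (f_1 G w) (f_1 N w)) + (cwedge (f_1 G w) (f_1 N w) + cwedge (cvec (G w)) (f_11 N w))"
  unfolding del_add(1)[OF d2] del_cbilinear(1)[of cwedge, OF cwedge_bilinear(1,2,3,4) d(1,2)] del_cbilinear(1)[of cwedge, OF cwedge_bilinear(1,2,3,4) d(3,4)]
  by (simp add: f_11_def f_1_def')
 finally show ?thesis by (simp add: vec_eq_iff)
qed

text \<open>Bivectors that share a factor with G \<and> N are orthogonal to its star, so only the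
  part of the second derivative along f_1 \<and> conj f_1 pairs with it. The same part alone
  contributes to the square of the second derivative, and both sides are -4 h^2 with h the Hopf
  coefficient.\<close>

lemma W_star:
 assumes w: "w \<in> D"
 shows "norm (star (W w)) = 1" "star (W w) \<bullet> W w = 0" "cdot (star (cvec (W w))) (f_1 W w) = 0"
  "(cdot (star (cvec (W w))) (f_11 W w))\<^sup>2 = cdot (f_11 W w) (f_11 W w)"
proof -
 note b = B[OF w] and r = r_nz[OF w]
 have GG: "G w \<bullet> G w = 1" using conf_minD(3)[OF cm w] by (simp add: power2_norm_eq_inner[symmetric])
 have "star (W w) \<bullet> star (W w) = 1"
  unfolding star_selfadjoint star_star unfolding W_def inner_wedge using GG NN[OF w] NG[OF w] by (simp add: inner_commute)
 then show n: "norm (star (W w)) = 1" by (simp add: norm_eq_1)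
 show "star (W w) \<bullet> W w = 0" unfolding W_def by (metis inner_commute wedge_star(1))
 show "cdot (star (cvec (W w))) (f_1 W w) = 0"
  unfolding f_1_W[OF w] W_def cvec_wedge by (simp add: cdot_simps cwedge_star cdot_commute[of "star _"])
 define p cp h where "p = f_1 G w" "cp = conj_vec (f_1 G w)" "h = hopf w"
 obtain \<alpha> \<beta> where N2: "f_11 N w = \<alpha> *s cp + \<beta> *s cvec (G w)" unfolding p_cp_h_def by (rule f_11_N[OF w])
 obtain \<kappa> where G2: "f_11 G w = \<kappa> *s p + h *s cvec (N w)" using f_11_G[OF w] unfolding p_cp_h_def by blast
 have N1: "f_1 N w = (- h / rho G w) *s cp" using f_1_N[OF w] unfolding p_cp_h_def .
 have F: "f_11 W w = \<kappa> *s cwedge p (cvec (N w)) + (- 2 * h / rho G w) *s cwedge p cp + \<alpha> *s cwedge (cvec (G w)) cp"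
  unfolding f_11_W[OF w] N2 G2 N1 p_cp_h_def(1)[symmetric] cwedge_bilinear by (simp add: vec_eq_iff)
 have pp: "cdot p p = 0" "cdot p cp = rho G w" "cdot cp p = rho G w" "cdot cp cp = 0" using b by (simp_all add: p_cp_h_def)
 have pn: "cdot p (cvec (N w)) = 0" "cdot (cvec (N w)) p = 0" "cdot cp (cvec (N w)) = 0" "cdot (cvec (N w)) cp = 0"
  "cdot p (cvec (G w)) = 0" "cdot (cvec (G w)) p = 0" "cdot cp (cvec (G w)) = 0" "cdot (cvec (G w)) cp = 0" using b by (simp_all add: p_cp_h_def)
 have FF: "cdot (f_11 W w) (f_11 W w) = - 4 * h\<^sup>2"
  unfolding F using r by (simp add: cdot_simps cdot_cwedge pp pn b power2_eq_square)
 define v where "v = cdot (star (cvec (W w))) (cwedge p cp)"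
 have Fs: "cdot (star (cvec (W w))) (f_11 W w) = (- 2 * h / rho G w) * v"
  unfolding F v_def unfolding W_def cvec_wedge by (simp add: cdot_simps cwedge_star cdot_commute[of "star _"])
 \<comment> \<open>The star of G \<and> N is, up to sign, the unit bivector of the tangent plane. As
   x \<and> y = -2 \<i> f_1 \<and> conj f_1, this determines v up to sign.\<close>
 have "v\<^sup>2 = - (rho G w)\<^sup>2"
 proof -
  note d = smooth_on_differentiable[OF conf_minD(2)[OF cm] w]
  define x y where "x = dd 1 G w" "y = dd \<i> G w"
  define L where "L = 2 * Re (rho G w)"
  have xy: "x \<bullet> x = L" "y \<bullet> y = L" "x \<bullet> y = 0"
   unfolding x_y_def L_def dd_inner_conformal[OF d conf_minD(5)[OF cm w]] by simp_all
  have L: "L > 0" using conf_min_f_2_orth(7)[OF cm w] by (simp add: L_def)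
  have cx: "cvec x = p + cp" "cvec y = \<i> *s p + (- \<i>) *s cp"
   using f_1_real(3)[OF d, of 1] f_1_real(3)[OF d, of \<i>] by (simp_all add: x_y_def p_cp_h_def)
  have "cwedge (cvec x) (cvec y) = (- 2 * \<i>) *s cwedge p cp"
  proof -
   have "cwedge cp p = - cwedge p cp" by (rule vec6_eqI; simp add: cwedge_def vector_6)
   then show ?thesis unfolding cx cwedge_bilinear by (simp add: vec_eq_iff)
  qed
  then have "cdot (star (cvec (W w))) (cvec (wedge x y)) = (- 2 * \<i>) * v" unfolding cvec_wedge v_def by (simp add: cdot_simps)
  then have vi: "of_real (star (W w) \<bullet> wedge x y) = (- 2 * \<i>) * v" unfolding cvec_star[symmetric] cdot_cvec .
  have cgv: "G w \<bullet> x = 0" "G w \<bullet> y = 0"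
  proof -
   have "cdot (cvec (G w)) (cvec x) = 0" "cdot (cvec (G w)) (cvec y) = 0" unfolding cx by (simp_all add: cdot_simps pn)
   then show "G w \<bullet> x = 0" "G w \<bullet> y = 0" unfolding cdot_cvec by simp_all
  qed
  have nv: "N w \<bullet> x = 0" "N w \<bullet> y = 0" unfolding x_y_def using NdG[OF w] by simp_all
  have xy': "y \<bullet> x = 0" "x \<bullet> G w = 0" "y \<bullet> G w = 0" "x \<bullet> N w = 0" "y \<bullet> N w = 0" "G w \<bullet> N w = 0"
   using xy cgv nv NG[OF w] by (simp_all add: inner_commute)
  note ips = xy xy' cgv nv GG NN[OF w] NG[OF w]
  define t where "t = (star (W w) \<bullet> wedge x y) / L\<^sup>2"
  have nz: "wedge a b \<noteq> 0" if "wedge a b \<bullet> wedge a b \<noteq> 0" for a b using that by auto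
  \<comment> \<open>In this orthogonal basis of the exterior square only x \<and> y shares no factor
    with G \<and> N, so the star is a multiple of it.\<close>
  have "star (W w) - t *\<^sub>R wedge x y = 0"
  proof (rule orthogonal_frame_zero[of "[wedge x y, W w, wedge (G w) x, wedge (G w) y, wedge (N w) x, wedge (N w) y]"])
   show "sorted_wrt (\<lambda>u v. u \<bullet> v = 0) [wedge x y, W w, wedge (G w) x, wedge (G w) y, wedge (N w) x, wedge (N w) y]"
    unfolding W_def by (simp add: inner_wedge ips)
   show "0 \<notin> set [wedge x y, W w, wedge (G w) x, wedge (G w) y, wedge (N w) x, wedge (N w) y]"
   proof -
    have "wedge x y \<noteq> 0" "W w \<noteq> 0" "wedge (G w) x \<noteq> 0" "wedge (G w) y \<noteq> 0" "wedge (N w) x \<noteq> 0" "wedge (N w) y \<noteq> 0"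
     unfolding W_def by (rule nz, use L in \<open>simp add: inner_wedge ips\<close>)+
    then show ?thesis by auto
   qed
   have wxy: "wedge x y \<bullet> wedge x y = L\<^sup>2" by (simp add: inner_wedge ips power2_eq_square)
   have s: "star (W w) \<bullet> W w = 0" "star (W w) \<bullet> wedge (G w) c = 0" "star (W w) \<bullet> wedge (N w) c = 0" for c
    unfolding W_def by (metis inner_commute wedge_star)+
   have xyW: "wedge x y \<bullet> W w = 0" "wedge x y \<bullet> wedge (G w) c = 0" "wedge x y \<bullet> wedge (N w) c = 0" for c
    unfolding W_def by (simp_all add: inner_wedge ips)
   fix u assume "u \<in> set [wedge x y, W w, wedge (G w) x, wedge (G w) y, wedge (N w) x, wedge (N w) y]"
   then show "(star (W w) - t *\<^sub>R wedge x y) \<bullet> u = 0"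
    using L by (auto simp: inner_diff_left s t_def wxy xyW power2_eq_square)
  qed simp
  then have st: "star (W w) = t *\<^sub>R wedge x y" by simp
  have wxy: "wedge x y \<bullet> wedge x y = L\<^sup>2" by (simp add: inner_wedge ips power2_eq_square)
  have "1 = star (W w) \<bullet> star (W w)" using n by (simp add: norm_eq_1)
  then have "t\<^sup>2 * L\<^sup>2 = 1" unfolding st by (simp add: wxy power2_eq_square)
  moreover have "(star (W w) \<bullet> wedge x y)\<^sup>2 = (t\<^sup>2 * L\<^sup>2) * L\<^sup>2" unfolding st by (simp add: wxy power2_eq_square)
  ultimately have "(star (W w) \<bullet> wedge x y)\<^sup>2 = L\<^sup>2" by simp
  then have "((- 2 * \<i>) * v)\<^sup>2 = of_real (L\<^sup>2)" unfolding vi[symmetric] by (simp flip: of_real_power)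
  moreover have "of_real (L\<^sup>2) = 4 * (rho G w)\<^sup>2"
   using conf_min_f_2_orth(6)[OF cm w] unfolding L_def by (metis (no_types, lifting) of_real_mult of_real_numeral of_real_power power_mult_distrib numeral_eq_one_iff power2_eq_square mult_numeral_1 num_double numeral_times_numeral)
  ultimately have "- v\<^sup>2 = (rho G w)\<^sup>2" by (simp add: power_mult_distrib)
  then show ?thesis by (metis minus_minus)
 qed
 then show "(cdot (star (cvec (W w))) (f_11 W w))\<^sup>2 = cdot (f_11 W w) (f_11 W w)"
  unfolding Fs FF using r by (simp add: power_mult_distrib power_divide)
qed

end

text \<open>On a sheet z \<circ> \<pi> is a coordinate: in a chart of C it is holomorphic because
  \<pi> is, and injective because \<pi> is so on the sheet; hence its inverse is holomorphic
  too.\<close>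

lemma covering_lift_coordinate:
 assumes rs: "riemann_surface C \<B>" and hm: "holomorphic_map C \<B> S \<A> \<pi>"
  and h: "homeomorphism W T \<pi> q" and W: "openin (top_of_set C) W"
  and U: "complex_coordinate S \<A> U z" and UT: "U \<subseteq> T"
 shows "complex_coordinate C \<B> (q ` U) (z \<circ> \<pi>)" "(z \<circ> \<pi>) ` (q ` U) = z ` U"
  "\<And>x. x \<in> z ` U \<Longrightarrow> inv_into (q ` U) (z \<circ> \<pi>) x = q (inv_into U z x)"
proof -
 have cU: "chart S U z" by (rule complex_coordinate_chart[OF U])
 have pq: "\<pi> (q p) = p" if "p \<in> T" for p using h that by (simp add: homeomorphism_def)
 have qW: "q ` U \<subseteq> W" using h UT by (auto simp: homeomorphism_def)
 have pq': "\<pi> (q p) = p" if "p \<in> U" for p using pq UT that by blast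
 show im: "(z \<circ> \<pi>) ` (q ` U) = z ` U" unfolding image_comp by (rule image_cong) (simp_all add: pq')
 have inj: "inj_on (z \<circ> \<pi>) (q ` U)"
 proof (rule inj_onI, elim imageE)
  fix x y a b assume "(z \<circ> \<pi>) x = (z \<circ> \<pi>) y" "x = q a" "y = q b" "a \<in> U" "b \<in> U"
  then show "x = y" using pq' inj_onD[OF chartD(3)[OF cU], of a b] by simp
 qed
 show inv: "inv_into (q ` U) (z \<circ> \<pi>) x = q (inv_into U z x)" if "x \<in> z ` U" for x
 proof -
  have "(z \<circ> \<pi>) (q (inv_into U z x)) = x" using pq'[OF chartD(9)[OF cU that]] chartD(8)[OF cU that] by simp
  then show ?thesis using inv_into_f_f[OF inj imageI[OF chartD(9)[OF cU that]]] by simp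
 qed
 have "\<pi> ` W = T" using h by (simp add: homeomorphism_def)
 then have TS: "T \<subseteq> S" using hm openin_imp_subset[OF W] unfolding holomorphic_map_def by blast
 have oU: "openin (top_of_set T) U" by (rule openin_subset_trans[OF chartD(1)[OF cU] UT TS])
 have oq: "openin (top_of_set C) (q ` U)"
  using homeomorphism_imp_open_map[OF homeomorphism_symD[OF h] oU] W openin_trans by blast
 have hU: "homeomorphism (q ` U) U \<pi> q"
  by (rule homeomorphism_of_subsets[OF h qW UT]) (simp add: image_image pq')
 have hz: "homeomorphism U (z ` U) z (inv_into U z)" using cU by (simp add: chart_def)
 have "homeomorphism (q ` U) (z ` U) (z \<circ> \<pi>) (q \<circ> inv_into U z)" by (rule homeomorphism_compose[OF hU hz])
 then have "homeomorphism (q ` U) (z ` U) (z \<circ> \<pi>) (inv_into (q ` U) (z \<circ> \<pi>))"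
  by (rule homeomorphism_cong) (use inv in auto)
 then have ch: "chart C (q ` U) (z \<circ> \<pi>)" unfolding chart_def im using oq chartD(2)[OF cU] by blast
 have "chart_compatible (q ` U) (z \<circ> \<pi>) V v" if V: "(V, v) \<in> \<B>" for V v
 proof -
  have V': "complex_coordinate C \<B> V v" by (rule atlas_complex_coordinate[OF rs V])
  have cV: "chart C V v" by (rule complex_coordinate_chart[OF V'])
  define E where "E = v ` (q ` U \<inter> V)"
  define H where "H = z \<circ> \<pi> \<circ> inv_into V v"
  have oE: "open E" unfolding E_def by (rule chart_image_open[OF cV]) (use oq chartD(1)[OF cV] in auto)
  have "H holomorphic_on (v ` (V \<inter> \<pi> -` U))" using hm V' U unfolding holomorphic_map_def H_def by blast
  then have hH: "H holomorphic_on E" by (rule holomorphic_on_subset) (auto simp: E_def pq')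
  have Hv: "H (v x) = (z \<circ> \<pi>) x" if "x \<in> V" for x using that chartD(7)[OF cV] by (simp add: H_def)
  have injH: "inj_on H E"
  proof (rule inj_onI, unfold E_def, elim imageE)
   fix x y a b assume "H x = H y" "x = v a" "y = v b" "a \<in> q ` U \<inter> V" "b \<in> q ` U \<inter> V"
   then show "x = y" using Hv inj_onD[OF inj, of a b] by simp
  qed
  obtain \<psi> where \<psi>: "\<psi> holomorphic_on H ` E" "\<And>x. x \<in> E \<Longrightarrow> \<psi> (H x) = x"
   by (rule holomorphic_has_inverse[OF hH oE injH]) blast
  have HE: "H ` E = (z \<circ> \<pi>) ` (q ` U \<inter> V)"
   unfolding E_def image_image by (rule image_cong) (simp_all add: Hv)
  have "\<psi> y = (v \<circ> inv_into (q ` U) (z \<circ> \<pi>)) y" if y: "y \<in> (z \<circ> \<pi>) ` (q ` U \<inter> V)" for y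
  proof -
   obtain x where x': "y = (z \<circ> \<pi>) x" "x \<in> q ` U \<inter> V" using y by (rule imageE)
   then have x: "x \<in> q ` U" "x \<in> V" "y = (z \<circ> \<pi>) x" by simp_all
   have "v x \<in> E" unfolding E_def using x by blast
   from \<psi>(2)[OF this] have "\<psi> y = v x" unfolding Hv[OF x(2)] x(3) .
   then show ?thesis using inv_into_f_f[OF inj x(1)] x(3) by simp
  qed
  then have "(v \<circ> inv_into (q ` U) (z \<circ> \<pi>)) holomorphic_on (z \<circ> \<pi>) ` (q ` U \<inter> V)"
   using \<psi>(1) unfolding HE by (rule holomorphic_transform[rotated])
  moreover have "(z \<circ> \<pi> \<circ> inv_into V v) holomorphic_on v ` (q ` U \<inter> V)" using hH unfolding H_def E_def .
  ultimately show ?thesis unfolding chart_compatible_def by blast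
 qed
 then show "complex_coordinate C \<B> (q ` U) (z \<circ> \<pi>)" using ch unfolding complex_coordinate_def by blast
qed

text \<open>Without an N-part X would be a multiple of b with X \<bullet> b = \<plusminus>1, hence
  of length 1/|b| < 1.\<close>

lemma (in adapted6) candidate_unit_N:
 assumes w: "w \<in> D" and X: "norm X = 1" "X \<bullet> g w = 0" "cdot (cvec X) (f_1 g w) = 0"
  "(cdot (cvec X) (f_2 g w))\<^sup>2 = -1"
 shows "cdot (cvec X) (f_2 g w) = \<i> \<or> cdot (cvec X) (f_2 g w) = - \<i>" "X \<bullet> unit_N g w \<noteq> 0"
proof -
 let ?b = "b_part g w"
 have "(cdot (cvec X) (f_2 g w))\<^sup>2 = \<i>\<^sup>2" using X(4) by simp
 then show i: "cdot (cvec X) (f_2 g w) = \<i> \<or> cdot (cvec X) (f_2 g w) = - \<i>" unfolding power2_eq_iff .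
 show "X \<bullet> unit_N g w \<noteq> 0"
 proof
  assume "X \<bullet> unit_N g w = 0"
  then have 0: "X \<bullet> normal w = 0" using normal(1)[OF w] unfolding unit_N[OF w] by simp
  have Xa: "X \<bullet> a_part g w = 0" and Xb: "\<bar>X \<bullet> ?b\<bar> = 1"
   using i unfolding cdot_f_1_iff(2)[OF w] by (auto simp: complex_eq_iff)
  have b: "norm ?b > 1" by (rule ab(4)[OF w])
  then have b0: "?b \<noteq> 0" by auto
  have o: "sorted_wrt (\<lambda>u v. u \<bullet> v = 0) [g w, dd 1 g w, dd \<i> g w, a_part g w, ?b]" by (rule frame_orth(1)[OF w])
  have bo: "?b \<bullet> g w = 0" "?b \<bullet> dd 1 g w = 0" "?b \<bullet> dd \<i> g w = 0" "?b \<bullet> a_part g w = 0" "?b \<bullet> normal w = 0"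
   using o normal(6)[OF w] by (simp_all add: inner_commute)
  have Xd: "X \<bullet> dd 1 g w = 0" "X \<bullet> dd \<i> g w = 0" using X(3)[unfolded cdot_f_1_iff(1)[OF w]] by simp_all
  define Y where "Y = X - ((X \<bullet> ?b) / (norm ?b)\<^sup>2) *\<^sub>R ?b"
  have "Y = (Y \<bullet> normal w / (norm (normal w))\<^sup>2) *\<^sub>R normal w" by (rule orth_imp_multiple[OF w])
    (use b0 in \<open>simp_all add: Y_def inner_diff_left bo Xd Xa X(2) power2_norm_eq_inner\<close>)
  moreover have "Y \<bullet> normal w = 0" using 0 by (simp add: Y_def inner_diff_left bo)
  ultimately have "Y = 0" by simp
  then have "X = ((X \<bullet> ?b) / (norm ?b)\<^sup>2) *\<^sub>R ?b" by (simp add: Y_def)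
  then have "norm X = \<bar>(X \<bullet> ?b) / (norm ?b)\<^sup>2\<bar> * norm ?b" by (metis norm_scaleR)
  then have "norm X = 1 / norm ?b" using Xb b by (simp add: abs_divide power2_eq_square)
  then show False using X(1) b by simp
 qed
qed

lemma f_11_clin:
 assumes R: "linear R" and D: "open D" "w \<in> D" and e: "\<And>x. x \<in> D \<Longrightarrow> X x = R (g x)" and g: "smooth_on D g"
 shows "f_11 X w = clin R (f_11 g w)"
proof -
 have sm: "smooth_on D (f_1 g)" unfolding f_1_def comp_def by (intro smooth_on_del smooth_on_cvec D g)
 have "f_11 X w = del (\<lambda>w. clin R (f_1 g w)) w"
  unfolding f_11_def by (rule del_cong[OF D]) (rule f_1_clin[OF R D(1) _ e smooth_on_differentiable[OF g]])
 also have "\<dots> = clin R (f_11 g w)"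
  unfolding f_11_def by (rule del_clinear(1)[OF clin(1,2)[OF R] smooth_on_differentiable[OF sm D(2)]])
 finally show ?thesis .
qed

lemma cdot_clin_orthogonal:
 assumes A: "orthogonal_transformation A"
 shows "cdot (clin A x) (clin A y) = cdot x y"
proof -
 have l: "linear A" using A by (rule orthogonal_transformation_linear)
 have 1: "A u \<bullet> v = u \<bullet> adjoint A v" for u v using adjoint_works[OF l, of u v] by (simp add: inner_commute)
 have "adjoint A (A u) = u" for u
  by (rule vector_eq_rdot[THEN iffD1, rule_format]) (use 1[of _ "A u"] A in \<open>metis inner_commute orthogonal_transformation_def\<close>)
 then have "clin (adjoint A) (clin A y) = y"
 proof -
  assume a: "\<And>u. adjoint A (A u) = u"
  note l' = adjoint_linear[OF l]
  have "clin (adjoint A) (clin A y) = cvec (Re_vec y) + \<i> *s cvec (Im_vec y)"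
   unfolding clin_def[of A] clin(1)[OF l'] clin(2)[OF l'] clin(3)[OF l'] a ..
  then show ?thesis using vec_eq_Re_Im by metis
 qed
 then show ?thesis using cdot_clin[of A "adjoint A" x "clin A y", OF 1] by simp
qed

context surface
begin

text \<open>A candidate meets the characterisation of the transform up to two signs. That of its
  N-part is independent of the coordinate, hence constant on S, and is absorbed in \<epsilon>. The
  sign in (F0, f_2) = \<plusminus>\<i> is corrected by passing from z to \<i> z.\<close>

lemma plus_transform_from_candidate:
 assumes cont: "\<And>U z. adapted_coordinate S \<A> f U z \<Longrightarrow> continuous_on U F0"
  and X: "\<And>U z q. adapted_coordinate S \<A> f U z \<Longrightarrow> q \<in> U \<Longrightarrow> norm (F0 q) = 1 \<and> F0 q \<bullet> f q = 0 \<and>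
   cdot (cvec (F0 q)) (f_1 (local_expr f U z) (z q)) = 0 \<and> (cdot (cvec (F0 q)) (f_2 (local_expr f U z) (z q)))\<^sup>2 = -1"
 obtains \<epsilon> :: real where "is_plus_transform S \<A> f (\<lambda>p. \<epsilon> *\<^sub>R F0 p)"
proof -
 define s where "s U z q = F0 q \<bullet> unit_N (local_expr f U z) (z q)" for U z q
 have ac: "chart S U z" "complex_coordinate S \<A> U z" if "adapted_coordinate S \<A> f U z" for U z
  using that by (auto simp: adapted_coordinate_def complex_coordinate_def)
 have lf: "local_expr f U z (z q) = f q" if "adapted_coordinate S \<A> f U z" "q \<in> U" for U z q
  by (rule local_expr_chart[OF ac(1)[OF that(1)] that(2)])
 have s_nz: "s U z q \<noteq> 0" and k: "cdot (cvec (F0 q)) (f_2 (local_expr f U z) (z q)) \<in> {\<i>, - \<i>}"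
  if a: "adapted_coordinate S \<A> f U z" and q: "q \<in> U" for U z q
 proof -
  note c = adapted6.candidate_unit_N[OF adapted6[OF a] imageI[OF q], of "F0 q"]
  show "s U z q \<noteq> 0" unfolding s_def by (rule c(2)) (use X[OF a q] lf[OF a q] in auto)
  have "cdot (cvec (F0 q)) (f_2 (local_expr f U z) (z q)) = \<i> \<or> cdot (cvec (F0 q)) (f_2 (local_expr f U z) (z q)) = - \<i>"
   by (rule c(1)) (use X[OF a q] lf[OF a q] in auto)
  then show "cdot (cvec (F0 q)) (f_2 (local_expr f U z) (z q)) \<in> {\<i>, - \<i>}" by simp
 qed
 have s_indep: "s U z q = s V w q" if "adapted_coordinate S \<A> f U z" "adapted_coordinate S \<A> f V w" "q \<in> U" "q \<in> V" for U z V w q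
  unfolding s_def adapted_transition(1)[OF that] ..
 define P where "P \<epsilon> = {q. \<exists>U z. adapted_coordinate S \<A> f U z \<and> q \<in> U \<and> 0 < \<epsilon> * s U z q}" for \<epsilon>
 have oP: "openin (top_of_set S) (P \<epsilon>)" for \<epsilon>
 proof (subst openin_subopen, intro ballI)
  fix q assume "q \<in> P \<epsilon>"
  then obtain U z where a: "adapted_coordinate S \<A> f U z" and q: "q \<in> U" "0 < \<epsilon> * s U z q" unfolding P_def by blast
  \<comment> \<open>Continuity of N is obtained by solving the formula for \<open>f_plus\<close>,
    which is known to be smooth, for N.\<close>
  have "continuous_on (z ` U) (unit_N (local_expr f U z))"
  proof -
   interpret adapted6 "z ` U" "local_expr f U z" by (rule adapted6[OF a])
   have fp: "continuous_on (z ` U) (f_plus (local_expr f U z))" by (rule smooth_on_continuous_on[OF smooth_f_plus])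
   have ca: "continuous_on (z ` U) (\<lambda>w. norm (a_part (local_expr f U z) w))"
    by (rule continuous_on_norm[OF smooth_on_continuous_on[OF smooth_parts(5)]])
   have cb: "continuous_on (z ` U) (b_part (local_expr f U z))" by (rule smooth_on_continuous_on[OF smooth_parts(6)])
   have nz: "norm (a_part (local_expr f U z) w) \<noteq> 0" "(norm (b_part (local_expr f U z) w))\<^sup>2 \<noteq> 0" if "w \<in> z ` U" for w
    using ab(3,4)[OF that] by auto
   let ?b = "b_part (local_expr f U z)" and ?a = "a_part (local_expr f U z)"
   have "continuous_on (z ` U) (\<lambda>w. (norm (?b w) / norm (?a w)) *\<^sub>R (f_plus (local_expr f U z) w + (1 / (norm (?b w))\<^sup>2) *\<^sub>R ?b w))"
    by (intro continuous_on_scaleR continuous_on_add continuous_on_divide continuous_on_const continuous_on_power continuous_on_norm ca cb fp ballI nz)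
   then show ?thesis
   proof (rule continuous_on_eq)
    fix w assume w: "w \<in> z ` U"
    show "(norm (?b w) / norm (?a w)) *\<^sub>R (f_plus (local_expr f U z) w + (1 / (norm (?b w))\<^sup>2) *\<^sub>R ?b w) = unit_N (local_expr f U z) w"
     unfolding f_plus_eq[OF w] using nz[OF w] by simp
   qed
  qed
  from continuous_on_compose[OF chartD(5)[OF ac(1)[OF a]] this]
  have "continuous_on U (\<lambda>q. unit_N (local_expr f U z) (z q))" by (simp add: comp_def)
  then have "continuous_on U (\<lambda>q. \<epsilon> * s U z q)" unfolding s_def by (intro continuous_intros cont[OF a])
  then have "openin (top_of_set U) (U \<inter> (\<lambda>q. \<epsilon> * s U z q) -` {0<..})" by (rule continuous_openin_preimage_gen) simp
  then have "openin (top_of_set S) (U \<inter> (\<lambda>q. \<epsilon> * s U z q) -` {0<..})"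
   using openin_trans chartD(1)[OF ac(1)[OF a]] by blast
  moreover have "U \<inter> (\<lambda>q. \<epsilon> * s U z q) -` {0<..} \<subseteq> P \<epsilon>" using a by (auto simp: P_def)
  moreover have "q \<in> U \<inter> (\<lambda>q. \<epsilon> * s U z q) -` {0<..}" using q by simp
  ultimately show "\<exists>T. openin (top_of_set S) T \<and> q \<in> T \<and> T \<subseteq> P \<epsilon>" by blast
 qed
 have cover: "S \<subseteq> P 1 \<union> P (-1)"
 proof
  fix p assume p: "p \<in> S"
  obtain U z r where a: "adapted_coordinate S \<A> f U z" "p \<in> U"
   by (rule adapted_coordinate_exists[OF p openin_subtopology_self]) (use p in auto)
  then have "0 < 1 * s U z p \<or> 0 < (-1) * s U z p" using s_nz[OF a] by auto
  then show "p \<in> P 1 \<union> P (-1)" using a unfolding P_def by blast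
 qed
 have "P 1 \<inter> P (-1) = {}"
 proof (rule equals0I)
  fix q assume "q \<in> P 1 \<inter> P (-1)"
  then obtain U z V w where "adapted_coordinate S \<A> f U z" "adapted_coordinate S \<A> f V w" "q \<in> U" "q \<in> V"
   "0 < s U z q" "0 < - s V w q" unfolding P_def by auto
  then show False using s_indep[of U z V w q] by simp
 qed
 then have "P 1 = {} \<or> P (-1) = {}" using connected_S oP cover unfolding connected_openin by blast
 then obtain \<epsilon> :: real where \<epsilon>: "\<epsilon> = 1 \<or> \<epsilon> = -1" "S \<subseteq> P \<epsilon>" using cover by blast
 have pos: "0 < \<epsilon> * s U z q" if a: "adapted_coordinate S \<A> f U z" and q: "q \<in> U" for U z q
 proof -
  have "q \<in> P \<epsilon>" using \<epsilon>(2) chartD(4)[OF ac(1)[OF a]] q by blast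
  then obtain V w where "adapted_coordinate S \<A> f V w" "q \<in> V" "0 < \<epsilon> * s V w q" unfolding P_def by blast
  then show ?thesis using s_indep[OF a, of V w q] q by simp
 qed
 have good: "\<epsilon> *\<^sub>R F0 q = f_plus (local_expr f U z) (z q)"
  if a: "adapted_coordinate S \<A> f U z" and q: "q \<in> U" and i: "cdot (cvec (F0 q)) (f_2 (local_expr f U z) (z q)) = \<epsilon> *\<^sub>R \<i>" for U z q
 proof (rule adapted6.f_plus_unique[OF adapted6[OF a] imageI[OF q]])
  show "0 < \<epsilon> *\<^sub>R F0 q \<bullet> unit_N (local_expr f U z) (z q)" using pos[OF a q] by (simp add: s_def)
 qed (use X[OF a q] lf[OF a q] i \<epsilon>(1) in \<open>auto simp: cvec_simps cdot_simps\<close>)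
 show ?thesis
 proof (rule that[of \<epsilon>], unfold is_plus_transform_def, rule ballI)
  fix p assume p: "p \<in> S"
  obtain U z r where a: "adapted_coordinate S \<A> f U z" "p \<in> U" "z ` U = ball (z p) r"
   by (rule adapted_coordinate_exists[OF p openin_subtopology_self]) (use p in auto)
  let ?g = "local_expr f U z"
  define k where "k x = cdot (cvec (F0 (inv_into U z x))) (f_2 ?g x)" for x
  have kz: "k (z q) = cdot (cvec (F0 q)) (f_2 ?g (z q))" if "q \<in> U" for q
   unfolding k_def chartD(7)[OF ac(1)[OF a(1)] that] ..
  have cF: "continuous_on (z ` U) (F0 \<circ> inv_into U z)"
   by (rule continuous_on_compose[OF chartD(6)[OF ac(1)[OF a(1)]]])
    (rule continuous_on_subset[OF cont[OF a(1)] image_subsetI[OF chartD(9)[OF ac(1)[OF a(1)]]]])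
  have "bounded_linear (cvec :: real^6 \<Rightarrow> complex^6)"
   unfolding linear_conv_bounded_linear[symmetric] by (rule linearI) (simp_all add: cvec_simps scaleR_smult)
  then have "continuous_on (z ` U) (\<lambda>x. cvec (F0 (inv_into U z x)))"
   by (rule bounded_linear.continuous_on[OF _ cF[unfolded comp_def]])
  then have "continuous_on (z ` U) k" unfolding k_def
   by (rule bounded_bilinear.continuous_on[OF bounded_bilinear_cdot])
    (rule smooth_on_continuous_on[OF adapted6.smooth_parts(4)[OF adapted6[OF a(1)]]])
  moreover have "finite (k ` z ` U)"
  proof (rule finite_subset[of _ "{\<i>, - \<i>}"])
   have "k (z q) \<in> {\<i>, - \<i>}" if "q \<in> U" for q unfolding kz[OF that] by (rule k[OF a(1) that])
   then show "k ` z ` U \<subseteq> {\<i>, - \<i>}" by blast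
  qed simp
  moreover have "connected (z ` U)" unfolding a(3) by simp
  ultimately have "k constant_on (z ` U)" by (intro continuous_finite_range_constant)
  then obtain k0 where k1: "\<And>x. x \<in> z ` U \<Longrightarrow> k x = k0" unfolding constant_on_def by blast
  have k0: "cdot (cvec (F0 q)) (f_2 ?g (z q)) = k0" if "q \<in> U" for q
   using k1[OF imageI[OF that]] unfolding kz[OF that] .
  have kk: "k0 = \<epsilon> *\<^sub>R \<i> \<or> k0 = - (\<epsilon> *\<^sub>R \<i>)" using k[OF a(1,2)] \<epsilon>(1) unfolding k0[OF a(2)] by auto
  show "\<exists>U z. p \<in> U \<and> adapted_coordinate S \<A> f U z \<and> (\<forall>q\<in>U. \<epsilon> *\<^sub>R F0 q = f_plus (local_expr f U z) (z q))"
  proof (cases "k0 = \<epsilon> *\<^sub>R \<i>")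
   case True
   show ?thesis by (intro exI[of _ U] exI[of _ z] conjI a ballI good) (simp_all add: k0 True)
  next
   case False
   \<comment> \<open>The quarter turn multiplies the quadratic differential \<open>f_2\<close> by -1
     and leaves (f_2, f_2) unchanged.\<close>
   define \<phi> where "\<phi> x = \<i> * x" for x
   have h: "\<phi> holomorphic_on z ` U" and inj: "inj_on \<phi> (z ` U)"
    unfolding \<phi>_def by (intro holomorphic_intros) (simp add: inj_on_def)
   note cc = complex_coordinate_compose[OF rs ac(2)[OF a(1)] h inj]
   let ?h = "local_expr f U (\<phi> \<circ> z)"
   have d: "deriv \<phi> x = \<i>" for x unfolding \<phi>_def by (rule DERIV_imp_deriv) (auto intro!: derivative_eq_intros)
   have f2: "f_2 ?h (\<phi> x) = - f_2 ?g x" if x: "x \<in> z ` U" for x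
   proof -
    have o: "open (z ` U)" by (rule chartD(2)[OF ac(1)[OF a(1)]])
    have "f_2 ?g x = f_2 (\<lambda>w. ?h (\<phi> w)) x" by (rule f_2_cong[OF o cc(2) x])
    also have "\<dots> = (deriv \<phi> x)\<^sup>2 *s f_2 ?h (\<phi> x)"
     by (rule f_2_compose[OF minimal_immersion_conf_min[OF mi cc(1)] o h _ _ x]) (auto simp: d)
    finally show ?thesis by (simp add: d vec_eq_iff)
   qed
   have a': "adapted_coordinate S \<A> f U (\<phi> \<circ> z)" unfolding adapted_coordinate_def
   proof (intro conjI ballI cc(1))
    fix w assume "w \<in> (\<phi> \<circ> z) ` U"
    then obtain q where q: "w = (\<phi> \<circ> z) q" "q \<in> U" by (rule imageE)
    define x where "x = z q"
    have x: "x \<in> z ` U" "w = \<phi> x" using q by (simp_all add: x_def)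
    show "cdot (f_2 ?h w) (f_2 ?h w) = -1"
     unfolding x(2) f2[OF x(1)] using adapted6.ad[OF adapted6[OF a(1)] x(1)] by (simp add: cdot_simps)
   qed
   have "cdot (cvec (F0 q)) (f_2 ?h ((\<phi> \<circ> z) q)) = \<epsilon> *\<^sub>R \<i>" if "q \<in> U" for q
    unfolding comp_apply f2[OF imageI[OF that]] using k0[OF that] kk False by (auto simp: cdot_simps)
   then show ?thesis by (intro exI[of _ U] exI[of _ "\<phi> \<circ> z"] conjI a a' ballI good) simp_all
  qed
 qed
qed

lemma bipolar_imp_plus_transform:
 assumes "is_bipolar_surface S \<A> f"
 shows "\<exists>F. is_plus_transform S \<A> f F \<and> gamma_plus_zero S \<A> f F" using assms unfolding is_bipolar_surface_def
proof (elim exE conjE)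
 fix C :: "('a \<times> (real^4) \<times> (real^4)) set" and \<B> \<pi> G1 G2 A
 assume rsC: "riemann_surface C \<B>" and cov: "covering_space C \<pi> S" and hm: "holomorphic_map C \<B> S \<A> \<pi>"
  and mi1: "minimal_immersion C \<B> G1" and un: "unit_normal_in_sphere C \<B> G1 G2"
  and oA: "orthogonal_transformation A" and fA: "\<forall>p\<in>C. f (\<pi> p) = A (wedge (G1 p) (G2 p))"
 have l: "linear A" using oA by (rule orthogonal_transformation_linear)
 note l' = adjoint_linear[OF l]
 have adj: "A u \<bullet> v = u \<bullet> adjoint A v" for u v using adjoint_works[OF l, of u v] by (simp add: inner_commute)
 have adjA: "adjoint A (A u) = u" for u
  by (rule vector_eq_rdot[THEN iffD1, rule_format]) (use adj[of _ "A u"] oA in \<open>metis inner_commute orthogonal_transformation_def\<close>)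
 have AA: "A u \<bullet> A v = u \<bullet> v" for u v using oA by (simp add: orthogonal_transformation_def)
 \<comment> \<open>The Hodge star conjugated by A. The adjoint of A is its inverse, so R takes f to
   the image of the star of G1 \<and> G2 and is self-adjoint.\<close>
 define R where "R y = A (star (adjoint A y))" for y
 define F0 where "F0 p = R (f p)" for p
 have lR: "linear R"
  unfolding R_def using linear_compose[OF linear_compose[OF l' star_linear] l] by (simp add: comp_def)
 have sa: "R x \<bullet> y = x \<bullet> R y" for x y
  unfolding R_def adj star_selfadjoint using adj[of "star (adjoint A y)" x] by (simp add: inner_commute)
 have RA: "R (A y) = A (star y)" for y by (simp add: R_def adjA)
 have key: "norm (F0 q) = 1 \<and> F0 q \<bullet> f q = 0 \<and> cdot (cvec (F0 q)) (f_1 (local_expr f U z) (z q)) = 0 \<and>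
   (cdot (cvec (F0 q)) (f_2 (local_expr f U z) (z q)))\<^sup>2 = -1"
  if a: "adapted_coordinate S \<A> f U z" and q: "q \<in> U" for U z q
 proof -
  let ?g = "local_expr f U z"
  have ccU: "complex_coordinate S \<A> U z" using a by (simp add: adapted_coordinate_def)
  note cU = complex_coordinate_chart[OF ccU]
  have qS: "q \<in> S" using chartD(4)[OF cU] q by blast
  \<comment> \<open>Near q the covering is inverted on a sheet, so G1 and G2 become functions of the
    coordinate on S and the local computation applies.\<close>
  obtain x W T h where T: "q \<in> T" "openin (top_of_set S) T" and W: "openin (top_of_set C) W" and ho: "homeomorphism W T \<pi> h"
   by (rule covering_space_local_homeomorphism_alt[OF cov qS])
  define V where "V = U \<inter> T"
  have oV: "openin (top_of_set S) V" unfolding V_def by (rule openin_Int[OF chartD(1)[OF cU] T(2)])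
  have VU: "V \<subseteq> U" and VT: "V \<subseteq> T" by (simp_all add: V_def)
  have ccV: "complex_coordinate S \<A> V z" by (rule complex_coordinate_subset[OF ccU oV VU])
  note cV = complex_coordinate_chart[OF ccV]
  note L = covering_lift_coordinate[OF rsC hm ho W ccV VT]
  define D where "D = z ` V"
  have oD: "open D" unfolding D_def by (rule chartD(2)[OF cV])
  define \<gamma>1 where "\<gamma>1 = local_expr G1 (h ` V) (z \<circ> \<pi>)"
  define \<gamma>2 where "\<gamma>2 = local_expr G2 (h ` V) (z \<circ> \<pi>)"
  have u: "smooth_on D \<gamma>2 \<and> (\<forall>w\<in>D. norm (\<gamma>2 w) = 1 \<and> \<gamma>2 w \<bullet> \<gamma>1 w = 0 \<and> (\<forall>v. \<gamma>2 w \<bullet> dd v \<gamma>1 w = 0))"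
   using un L(1) unfolding unit_normal_in_sphere_def D_def \<gamma>1_def \<gamma>2_def L(2)[symmetric] by blast
  interpret B: bipolar_local D \<gamma>1 \<gamma>2
  proof
   show "conf_min D \<gamma>1" using minimal_immersion_conf_min[OF mi1 L(1)] unfolding L(2) D_def \<gamma>1_def .
  qed (use u in \<open>simp_all add: norm_eq_1\<close>)
  have gA: "?g x = A (B.W x)" if x: "x \<in> D" for x
  proof -
   define p where "p = inv_into V z x"
   have p: "p \<in> V" unfolding p_def by (rule chartD(9)[OF cV]) (use x D_def in simp)
   have "p \<in> T" using p VT by blast
   then have hp: "\<pi> (h p) = p" "h p \<in> W" using ho by (auto simp: homeomorphism_def)
   have "h p \<in> C" using hp(2) openin_imp_subset[OF W] by blast
   then have "f p = A (wedge (G1 (h p)) (G2 (h p)))" using fA hp(1) by force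
   moreover have "?g x = f p" using local_expr_subset[OF cU VU, of x f] x unfolding D_def p_def by (simp add: local_expr_def)
   moreover have "\<gamma>1 x = G1 (h p)" "\<gamma>2 x = G2 (h p)"
    using L(3)[of x] x unfolding \<gamma>1_def \<gamma>2_def D_def p_def by (simp_all add: local_expr_def)
   ultimately show ?thesis by (simp add: B.W_def)
  qed
  have cg: "conf_min (z ` U) ?g" by (rule minimal_immersion_conf_min[OF mi ccU])
  have DU: "D \<subseteq> z ` U" unfolding D_def using VU by blast
  have sW: "smooth_on D B.W"
  proof -
   have "smooth_on D (\<lambda>x. adjoint A (?g x))"
    by (rule smooth_on_linear[OF oD l'[unfolded linear_conv_bounded_linear] smooth_on_subset[OF conf_minD(2)[OF cg] DU]])
   moreover have "adjoint A (?g x) = B.W x" if "x \<in> D" for x unfolding gA[OF that] by (rule adjA)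
   ultimately show ?thesis using smooth_on_cong[OF oD, of "\<lambda>x. adjoint A (?g x)" B.W] by simp
  qed
  define x0 where "x0 = z q"
  have x0: "x0 \<in> D" unfolding x0_def D_def V_def using q T by blast
  then have x0U: "x0 \<in> z ` U" using DU by blast
  have fq: "f q = A (B.W x0)" using gA[OF x0] local_expr_chart[OF cU q, of f] by (simp add: x0_def)
  have Fq: "F0 q = A (star (B.W x0))" unfolding F0_def fq by (rule RA)
  have cF: "cvec (F0 q) = clin A (star (cvec (B.W x0)))" unfolding Fq clin(3)[OF l, symmetric] cvec_star ..
  have f1: "f_1 ?g x0 = clin A (f_1 B.W x0)" by (rule f_1_clin[OF l oD x0 gA smooth_on_differentiable[OF sW x0]])
  have f11: "f_11 ?g x0 = clin A (f_11 B.W x0)" by (rule f_11_clin[OF l oD x0 gA sW])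
  note ws = B.W_star[OF x0]
  have "norm (F0 q) = 1" unfolding Fq orthogonal_transformation_norm[OF oA] by (rule ws(1))
  moreover have "F0 q \<bullet> f q = 0" unfolding Fq fq AA by (rule ws(2))
  moreover have c1: "cdot (cvec (F0 q)) (f_1 ?g x0) = 0" unfolding cF f1 cdot_clin_orthogonal[OF oA] by (rule ws(3))
  moreover have "(cdot (cvec (F0 q)) (f_2 ?g x0))\<^sup>2 = -1"
  proof -
   have "cdot (cvec (F0 q)) (f_2 ?g x0) = cdot (cvec (F0 q)) (f_11 ?g x0)"
    unfolding conf_min_f_2[OF cg x0U] by (simp add: cdot_simps c1)
   then have "(cdot (cvec (F0 q)) (f_2 ?g x0))\<^sup>2 = (cdot (star (cvec (B.W x0))) (f_11 B.W x0))\<^sup>2"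
    unfolding cF f11 cdot_clin_orthogonal[OF oA] by simp
   also have "\<dots> = cdot (f_11 ?g x0) (f_11 ?g x0)" unfolding ws(4) f11 cdot_clin_orthogonal[OF oA] ..
   also have "\<dots> = -1" unfolding conf_min_f_2_orth(8)[OF cg x0U] by (rule adapted6.ad[OF adapted6[OF a] x0U])
   finally show ?thesis .
  qed
  ultimately show ?thesis unfolding x0_def by blast
 qed
 have cont: "continuous_on U F0" if a: "adapted_coordinate S \<A> f U z" for U z
 proof -
  have ccU: "complex_coordinate S \<A> U z" using a by (simp add: adapted_coordinate_def)
  note cU = complex_coordinate_chart[OF ccU]
  have "continuous_on U (local_expr f U z \<circ> z)"
   by (rule continuous_on_compose[OF chartD(5)[OF cU] smooth_on_continuous_on[OF conf_minD(2)[OF minimal_immersion_conf_min[OF mi ccU]]]])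
  then have "continuous_on U (\<lambda>q. R ((local_expr f U z \<circ> z) q))"
   by (rule bounded_linear.continuous_on[OF lR[unfolded linear_conv_bounded_linear]])
  then show ?thesis by (rule continuous_on_eq) (simp add: F0_def local_expr_chart[OF cU])
 qed
 obtain \<epsilon> :: real where e: "is_plus_transform S \<A> f (\<lambda>p. \<epsilon> *\<^sub>R F0 p)"
  by (rule plus_transform_from_candidate[of F0, OF cont key])
 have "gamma_plus_zero S \<A> f (\<lambda>p. \<epsilon> *\<^sub>R F0 p)" by (rule symmetric_image_gamma_plus_zero[of "\<lambda>y. \<epsilon> *\<^sub>R R y"])
   (simp_all add: F0_def sa linear_compose_scale_right[OF lR])
 with e show ?thesis by blast
qed

end

section \<open>Complexified quaternions\<close>

definition qmult :: "'a::comm_ring_1^4 \<Rightarrow> 'a^4 \<Rightarrow> 'a^4"  (infixr "\<star>" 75) where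
 "x \<star> y = vector [x$1 * y$1 - x$2 * y$2 - x$3 * y$3 - x$4 * y$4, x$1 * y$2 + x$2 * y$1 + x$3 * y$4 - x$4 * y$3,
   x$1 * y$3 - x$2 * y$4 + x$3 * y$1 + x$4 * y$2, x$1 * y$4 + x$2 * y$3 - x$3 * y$2 + x$4 * y$1]"

definition qone :: "'a::comm_ring_1^4" where "qone = vector [1, 0, 0, 0]"

definition qconj :: "'a::comm_ring_1^4 \<Rightarrow> 'a^4" where "qconj x = vector [x$1, - x$2, - x$3, - x$4]"

lemma vec4_eqI: "x$1 = y$1 \<Longrightarrow> x$2 = y$2 \<Longrightarrow> x$3 = y$3 \<Longrightarrow> x$4 = y$4 \<Longrightarrow> x = y"
 for x y :: "'a^4" by (simp add: vec_eq_iff forall_4)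

lemma qmult_nth:
 "(x \<star> y)$1 = x$1 * y$1 - x$2 * y$2 - x$3 * y$3 - x$4 * y$4"
 "(x \<star> y)$2 = x$1 * y$2 + x$2 * y$1 + x$3 * y$4 - x$4 * y$3"
 "(x \<star> y)$3 = x$1 * y$3 - x$2 * y$4 + x$3 * y$1 + x$4 * y$2"
 "(x \<star> y)$4 = x$1 * y$4 + x$2 * y$3 - x$3 * y$2 + x$4 * y$1" by (simp_all add: qmult_def vector_4)

lemma qone_nth: "qone$1 = 1" "qone$2 = 0" "qone$3 = 0" "qone$4 = 0" by (simp_all add: qone_def vector_4)

lemma qconj_nth: "(qconj x)$1 = x$1" "(qconj x)$2 = - x$2" "(qconj x)$3 = - x$3" "(qconj x)$4 = - x$4"
 by (simp_all add: qconj_def vector_4)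

lemma qmult_assoc: "(x \<star> y) \<star> z = x \<star> y \<star> z" by (rule vec4_eqI) (simp_all add: qmult_nth algebra_simps)

lemma qmult_bilinear:
 "(x + y) \<star> z = x \<star> z + y \<star> z" "z \<star> (x + y) = z \<star> x + z \<star> y"
 "(c *s x) \<star> y = c *s (x \<star> y)" "x \<star> (c *s y) = c *s (x \<star> y)"
 "(x - y) \<star> z = x \<star> z - y \<star> z" "z \<star> (x - y) = z \<star> x - z \<star> y"
 "(- x) \<star> y = - (x \<star> y)" "x \<star> (- y) = - (x \<star> y)" "0 \<star> x = 0" "x \<star> 0 = 0"
 by (rule vec4_eqI; simp add: qmult_nth algebra_simps)+

lemma qmult_one: "qone \<star> x = x" "x \<star> qone = x" by (rule vec4_eqI; simp add: qmult_nth qone_nth)+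

lemma cvec_qmult: "cvec (x \<star> y) = cvec x \<star> cvec y" by (rule vec4_eqI) (simp_all add: cvec_def qmult_nth)

lemma conj_vec_qmult: "conj_vec (x \<star> y) = conj_vec x \<star> conj_vec y"
 by (rule vec4_eqI) (simp_all add: conj_vec_def qmult_nth)

lemma cdot_4: "cdot x y = x$1 * y$1 + x$2 * y$2 + x$3 * y$3 + x$4 * y$4" for x y :: "complex^4"
 by (simp add: cdot_def sum_4)

lemma qmult_imaginary:
 fixes x y z :: "complex^4"
 assumes "x$1 = 0" "y$1 = 0"
 shows "x \<star> y = - (y \<star> x) - (2 * cdot x y) *s qone" "x \<star> x = - cdot x x *s qone"
  "x \<star> y \<star> z = - (y \<star> x \<star> z) - (2 * cdot x y) *s z" "x \<star> x \<star> z = - cdot x x *s z"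
proof -
 show 1: "x \<star> y = - (y \<star> x) - (2 * cdot x y) *s qone" and 2: "x \<star> x = - cdot x x *s qone"
  by (rule vec4_eqI; simp add: qmult_nth qone_nth cdot_4 assms algebra_simps)+
 have "x \<star> y \<star> z = (x \<star> y) \<star> z" by (simp add: qmult_assoc)
 also have "\<dots> = - (y \<star> x \<star> z) - (2 * cdot x y) *s z" by (simp add: 1 qmult_bilinear qmult_one qmult_assoc)
 finally show "x \<star> y \<star> z = - (y \<star> x \<star> z) - (2 * cdot x y) *s z" .
 have "x \<star> x \<star> z = (x \<star> x) \<star> z" by (simp add: qmult_assoc)
 also have "\<dots> = - cdot x x *s z" by (simp only: 2 qmult_bilinear qmult_one)
 finally show "x \<star> x \<star> z = - cdot x x *s z" .
qed

lemma cdot_qmult: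
 fixes x y g :: "complex^4"
 shows "cdot (g \<star> x) (g \<star> y) = cdot g g * cdot x y" "cdot (x \<star> g) (y \<star> g) = cdot g g * cdot x y"
  "cdot (g \<star> x) y = cdot x (qconj g \<star> y)" "cdot (x \<star> g) y = cdot x (y \<star> qconj g)"
  "cdot x qone = x$1" "cdot qone x = x$1"
 by (simp_all add: cdot_4 qmult_nth qconj_nth qone_nth algebra_simps)

lemma qconj_mult:
 fixes g x :: "complex^4"
 shows "qconj g \<star> g \<star> x = cdot g g *s x" "g \<star> qconj g \<star> x = cdot g g *s x"
  "qconj g \<star> g = cdot g g *s qone" "g \<star> qconj g = cdot g g *s qone"
  "x$1 = 0 \<Longrightarrow> qconj x = - x" by (rule vec4_eqI; simp add: cdot_4 qmult_nth qconj_nth qone_nth algebra_simps)+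

lemma cdot_qmult_imaginary:
 fixes x y :: "complex^4"
 assumes "x$1 = 0" "y$1 = 0"
 shows "cdot (x \<star> y) x = 0" "cdot (x \<star> y) y = 0" "cdot x (x \<star> y) = 0" "cdot y (x \<star> y) = 0" "(x \<star> y)$1 = - cdot x y"
  "cdot (x \<star> y) z = - cdot y (x \<star> z)" by (simp_all add: cdot_4 qmult_nth assms algebra_simps)

text \<open>x, p and x \<star> p form an orthogonal frame of the imaginary quaternions. The identity
  in the proof expands y in it, with the Gram determinant of x and p as a factor. For complex p the
  condition (p, p) \<noteq> 0 takes the place of p \<noteq> 0.\<close>

lemma imaginary_frame_zero:
 fixes x y p :: "complex^4"
 assumes im: "x$1 = 0" "p$1 = 0" "y$1 = 0"
  and xx: "cdot x x = 1" "cdot x p = 0" "cdot p p \<noteq> 0"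
  and y: "cdot y x = 0" "cdot y p = 0" "cdot y (x \<star> p) = 0"
 shows "y = 0"
proof -
 have "(cdot x x * cdot p p - (cdot x p)\<^sup>2) *s y = cdot y x *s (cdot p p *s x - cdot x p *s p)
   + cdot y p *s (cdot x x *s p - cdot x p *s x) + cdot y (x \<star> p) *s (x \<star> p + cdot x p *s qone)"
  by (rule vec4_eqI; simp add: cdot_4 qmult_nth qone_nth im power2_eq_square algebra_simps)
 then have "cdot p p *s y = 0" unfolding xx y by simp
 then show ?thesis using xx(3) by (simp add: vec_eq_iff)
qed

lemma imaginary_frame_expansion:
 fixes x y p :: "complex^4"
 assumes im: "x$1 = 0" "p$1 = 0" "y$1 = 0"
  and xx: "cdot x x = 1" "cdot x p = 0" "cdot p p \<noteq> 0"
 shows "y = cdot y x *s x + (cdot y p / cdot p p) *s p + (cdot y (x \<star> p) / cdot p p) *s (x \<star> p)"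
proof -
 have q: "(x \<star> p)$1 = 0" "cdot (x \<star> p) (x \<star> p) = cdot p p" "cdot p x = 0"
  using cdot_qmult_imaginary(5)[OF im(1,2)] xx by (simp_all add: cdot_qmult(1) cdot_commute[of p x])
 have "y - (cdot y x *s x + (cdot y p / cdot p p) *s p + (cdot y (x \<star> p) / cdot p p) *s (x \<star> p)) = 0"
  by (rule imaginary_frame_zero[OF im(1,2) _ xx])
   (use xx in \<open>simp_all add: im q cdot_simps cdot_qmult_imaginary(1-4)[OF im(1,2)]\<close>)
 then show ?thesis unfolding right_minus_eq .
qed

text \<open>A quaternion commuting with two orthogonal imaginary ones is a scalar.\<close>

lemma intertwiners_proportional:
 fixes x p G Z :: "complex^4"
 assumes im: "x$1 = 0" "p$1 = 0" and xx: "cdot x x = 1" "cdot x p = 0" "cdot p p \<noteq> 0" and GG: "cdot G G = 1"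
  and G: "G \<star> x = t \<star> G" "G \<star> p = s \<star> G" and Z: "Z \<star> x = t \<star> Z" "Z \<star> p = s \<star> Z"
 shows "Z = cdot Z G *s G"
proof -
 define Y where "Y = qconj G \<star> Z"
 have "qconj G \<star> t = x \<star> qconj G" if "G \<star> x = t \<star> G" for t x
 proof -
  have "qconj G \<star> (G \<star> x) \<star> qconj G = qconj G \<star> (t \<star> G) \<star> qconj G" unfolding that ..
  then show ?thesis by (simp add: qmult_assoc qconj_mult GG qmult_one)
 qed
 then have c: "qconj G \<star> t \<star> z = x \<star> qconj G \<star> z" if "G \<star> x = t \<star> G" for t x z
  using that by (metis qmult_assoc)
 have Yx: "Y \<star> x = x \<star> Y" and Yp: "Y \<star> p = p \<star> Y"
  unfolding Y_def by (simp_all add: qmult_assoc Z c[OF G(1)] c[OF G(2)])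
 \<comment> \<open>Y is orthogonal to every commutator with a, because it commutes with a. Up to
   scalars x, p and x \<star> p are such commutators, which leaves Y a scalar.\<close>
 have comm: "cdot Y (a \<star> b) = cdot Y (b \<star> a)" if "Y \<star> a = a \<star> Y" "a$1 = 0" for a b
 proof -
  have "cdot (a \<star> b) Y = - cdot b (a \<star> Y)" using that(2) by (simp add: cdot_qmult(3) qconj_mult(5) qmult_bilinear cdot_simps)
  moreover have "cdot (b \<star> a) Y = - cdot b (Y \<star> a)" using that(2) by (simp add: cdot_qmult(4) qconj_mult(5) qmult_bilinear cdot_simps)
  ultimately show ?thesis using that(1) by (simp add: cdot_commute[of Y])
 qed
 have xp: "p \<star> x = - (x \<star> p)" using qmult_imaginary(1)[OF im(2,1)] xx(2) by (simp add: cdot_commute[of p x])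
 have "cdot Y (x \<star> p) = cdot Y (p \<star> x)" by (rule comm[OF Yx im(1)])
 then have 1: "cdot Y (x \<star> p) = 0" by (simp add: xp cdot_simps)
 have "cdot Y (x \<star> x \<star> p) = cdot Y ((x \<star> p) \<star> x)" by (rule comm[OF Yx im(1)])
 also have "(x \<star> p) \<star> x = - (x \<star> x \<star> p)" by (simp add: qmult_assoc xp qmult_bilinear)
 finally have 2: "cdot Y p = 0" by (simp add: qmult_imaginary(4)[OF im(1,1)] xx cdot_simps)
 have "cdot Y (p \<star> p \<star> x) = cdot Y ((p \<star> x) \<star> p)" by (rule comm[OF Yp im(2)])
 also have "(p \<star> x) \<star> p = - (p \<star> p \<star> x)"
 proof -
  have px: "x \<star> p = - (p \<star> x)" by (simp add: xp)
  show ?thesis by (simp only: qmult_assoc px qmult_bilinear)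
 qed
 finally have "cdot p p * cdot Y x = 0" by (auto simp: qmult_imaginary(4)[OF im(2,2)] cdot_simps)
 then have 3: "cdot Y x = 0" using xx by simp
 have "Y - Y$1 *s qone = 0" by (rule imaginary_frame_zero[OF im _ xx])
   (simp_all add: qone_nth cdot_simps 1 2 3 cdot_qmult im cdot_qmult_imaginary(5)[OF im] xx)
 then have Y: "Y = Y$1 *s qone" unfolding right_minus_eq .
 have "Z = G \<star> Y" unfolding Y_def by (simp add: qconj_mult GG)
 then have ZG: "Z = Y$1 *s G" using Y by (metis qmult_bilinear(4) qmult_one(2))
 then have "cdot Z G = Y$1" using GG by (simp add: cdot_simps)
 with ZG show ?thesis by simp
qed

text \<open>Four times the average of \<open>q' x q\<inverse>\<close> over \<open>q\<close> in the quaternion group generated by \<open>s\<close> and the direction of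
 \<open>u\<close>, where \<open>q'\<close> is the corresponding product of \<open>t\<close> and the direction of \<open>v\<close>; it projects onto the
 intertwiners.\<close>

definition intertwine where
 "intertwine s t u v n x = x - t \<star> x \<star> s - n *s (v \<star> (x - t \<star> x \<star> s) \<star> u)"

text \<open>s and t square to -1, the squares of u and v become -1 after multiplication by n, and u
  anticommutes with s as v does with t. So multiplication permutes the terms of the average, and on
  an intertwiner all four terms equal x.\<close>

lemma intertwine:
 fixes s t u v x :: "complex^4"
 assumes im: "s$1 = 0" "t$1 = 0" "u$1 = 0" "v$1 = 0" and 1: "cdot s s = 1" "cdot t t = 1" "cdot s u = 0" "cdot t v = 0"
  "n * cdot u u = 1" "n * cdot v v = 1"
 shows "intertwine s t u v n x \<star> s = t \<star> intertwine s t u v n x" "intertwine s t u v n x \<star> u = v \<star> intertwine s t u v n x"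
  "x \<star> s = t \<star> x \<Longrightarrow> x \<star> u = v \<star> x \<Longrightarrow> intertwine s t u v n x = 4 *s x"
proof -
 note sq = qmult_imaginary(4)[OF im(1,1)] qmult_imaginary(4)[OF im(2,2)] qmult_imaginary(4)[OF im(3,3)] qmult_imaginary(4)[OF im(4,4)]
  qmult_imaginary(2)[OF im(1,1)] qmult_imaginary(2)[OF im(2,2)] qmult_imaginary(2)[OF im(3,3)] qmult_imaginary(2)[OF im(4,4)]
 have us: "u \<star> s = - (s \<star> u)" "v \<star> t \<star> z = - (t \<star> v \<star> z)" for z
  using qmult_imaginary(1)[OF im(3,1)] qmult_imaginary(3)[OF im(4,2)] 1 by (simp_all add: cdot_commute[of u s] cdot_commute[of v t])
 note S = qmult_assoc qmult_bilinear sq us 1 qmult_one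
 define y where "y = x - t \<star> x \<star> s"
 have ys: "y \<star> s = t \<star> y" unfolding y_def by (simp add: S)
 have I: "intertwine s t u v n x = y - n *s (v \<star> y \<star> u)" unfolding intertwine_def y_def ..
 have ysz: "y \<star> s \<star> z = t \<star> y \<star> z" for z using ys by (metis qmult_assoc)
 show "intertwine s t u v n x \<star> s = t \<star> intertwine s t u v n x" unfolding I by (simp add: S ys ysz)
 show "intertwine s t u v n x \<star> u = v \<star> intertwine s t u v n x"
  unfolding I using 1(5,6) by (simp add: S vec_eq_iff algebra_simps)
 assume a: "x \<star> s = t \<star> x" "x \<star> u = v \<star> x"
 have y: "y = 2 *s x" unfolding y_def a(1) by (simp add: S vec_eq_iff)
 show "intertwine s t u v n x = 4 *s x" unfolding I y using 1(6) by (simp add: S a vec_eq_iff algebra_simps)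
qed

text \<open>The trace of the linear map x \<mapsto> \<open>intertwine s t u v n x\<close> is 4 + 4 n
  (s, u) (t, v) = 4, so the map cannot vanish on every basis vector.\<close>

lemma intertwine_nonzero:
 fixes s t u v :: "complex^4"
 assumes im: "s$1 = 0" "t$1 = 0" "u$1 = 0" "v$1 = 0" and o: "cdot s u = 0" "cdot t v = 0"
 shows "\<exists>i. intertwine s t u v n (axis i 1) \<noteq> 0"
proof (rule ccontr)
 assume "\<not> (\<exists>i. intertwine s t u v n (axis i 1) \<noteq> 0)"
 then have "(\<Sum>i\<in>UNIV. intertwine s t u v n (axis i 1) $ i) = 0" by simp
 moreover have "(\<Sum>i\<in>UNIV. intertwine s t u v n (axis i 1) $ i) = 4 + 4 * n * (cdot s u * cdot t v)"
  unfolding sum_4 intertwine_def by (simp add: qmult_nth im axis_def cdot_4 algebra_simps)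
 ultimately show False using o by simp
qed

lemma bounded_bilinear_qmult:
 "bounded_bilinear (qmult :: real^4 \<Rightarrow> real^4 \<Rightarrow> real^4)" "bounded_bilinear (qmult :: complex^4 \<Rightarrow> complex^4 \<Rightarrow> complex^4)"
proof -
 have "bilinear (qmult :: real^4 \<Rightarrow> real^4 \<Rightarrow> real^4)"
  unfolding bilinear_def by (auto intro!: linearI vec4_eqI simp: qmult_nth algebra_simps)
 then show "bounded_bilinear (qmult :: real^4 \<Rightarrow> real^4 \<Rightarrow> real^4)" by (simp add: bilinear_conv_bounded_bilinear)
 have "bilinear (qmult :: complex^4 \<Rightarrow> complex^4 \<Rightarrow> complex^4)"
  unfolding bilinear_def by (auto intro!: linearI simp: qmult_bilinear scaleR_smult)
 then show "bounded_bilinear (qmult :: complex^4 \<Rightarrow> complex^4 \<Rightarrow> complex^4)" by (simp add: bilinear_conv_bounded_bilinear)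
qed

section \<open>Harmonic maps into the unit sphere of imaginary quaternions\<close>

locale sphere_map =
 fixes D and s :: "complex \<Rightarrow> real^4" and k :: complex
 assumes D: "open D" and sm: "smooth_on D s" and im: "\<And>w. w \<in> D \<Longrightarrow> s w $ 1 = 0" and unit: "\<And>w. w \<in> D \<Longrightarrow> s w \<bullet> s w = 1"
  and iso: "\<And>w. w \<in> D \<Longrightarrow> cdot (f_1 s w) (f_1 s w) = k" and k: "k \<noteq> 0"
  and lap: "\<And>w. w \<in> D \<Longrightarrow> delb (f_1 s) w = - rho s w *s cvec (s w)"
begin

text \<open>For orthogonal imaginary s and \<open>f_1 s\<close> the product is the cross product.
  The components of \<open>f_11 s\<close> along s and \<open>f_1 s\<close> are determined by k, so
  this is the only free one.\<close>

definition K where "K w = cdot (f_11 s w) (cvec (s w) \<star> f_1 s w)"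

lemma smS: "smooth_on D (\<lambda>w. cvec (s w))" and smp: "smooth_on D (f_1 s)" and smpp: "smooth_on D (f_11 s)"
proof -
 show 1: "smooth_on D (\<lambda>w. cvec (s w))" by (rule smooth_on_cvec[OF D sm])
 then show 2: "smooth_on D (f_1 s)" unfolding f_1_def comp_def by (rule smooth_on_del[OF D])
 then show "smooth_on D (f_11 s)" unfolding f_11_def by (rule smooth_on_del[OF D])
qed

context
 fixes w assumes w: "w \<in> D"
begin

lemma imS: "cvec (s w) $ 1 = 0" and imp: "f_1 s w $ 1 = 0" and impp: "f_11 s w $ 1 = 0" and imcp: "conj_vec (f_1 s w) $ 1 = 0"
proof -
 have S: "cvec (s w) $ 1 = 0" if "w \<in> D" for w using im[OF that] by (simp add: cvec_def)
 have p: "f_1 s w $ 1 = 0" if "w \<in> D" for w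
  using cdot_const_deriv(1)[of D w "\<lambda>w. cvec (s w)" "\<lambda>w. qone" 0] D that S smS
  by (simp add: cdot_qmult smooth_on_const del_const cdot_simps f_1_def'[symmetric])
 show "f_11 s w $ 1 = 0" using cdot_const_deriv(1)[of D w "f_1 s" "\<lambda>w. qone" 0] D w p smp
  by (simp add: cdot_qmult smooth_on_const del_const cdot_simps f_11_def)
 show "cvec (s w) $ 1 = 0" "f_1 s w $ 1 = 0" "conj_vec (f_1 s w) $ 1 = 0" using S p w by (simp_all add: conj_vec_def)
qed

lemma SS: "cdot (cvec (s w)) (cvec (s w)) = 1" and Sp: "cdot (cvec (s w)) (f_1 s w) = 0" and Scp: "cdot (cvec (s w)) (conj_vec (f_1 s w)) = 0"
 and pps: "cdot (f_11 s w) (cvec (s w)) = - k" and ppp: "cdot (f_11 s w) (f_1 s w) = 0"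
proof -
 have SS: "cdot (cvec (s w)) (cvec (s w)) = 1" if "w \<in> D" for w using unit[OF that] by (simp add: cdot_cvec)
 have Sp: "cdot (cvec (s w)) (f_1 s w) = 0" if "w \<in> D" for w
  using cdot_const_deriv(1)[of D w "\<lambda>w. cvec (s w)" "\<lambda>w. cvec (s w)" 1] D that SS smS
  by (simp add: f_1_def'[symmetric] cdot_commute[of "f_1 s w"])
 have "cdot (f_1 s w) (f_1 s w) + cdot (cvec (s w)) (f_11 s w) = 0"
  using cdot_const_deriv(1)[of D w "\<lambda>w. cvec (s w)" "f_1 s" 0] D w Sp smS smp by (simp add: f_1_def'[symmetric] f_11_def)
 then show "cdot (f_11 s w) (cvec (s w)) = - k" using iso[OF w] by (simp add: cdot_commute[of "f_11 s w"] eq_neg_iff_add_eq_0 add.commute)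
 show "cdot (f_11 s w) (f_1 s w) = 0"
  using cdot_const_deriv(1)[of D w "f_1 s" "f_1 s" k] D w iso smp by (simp add: f_11_def cdot_commute[of "f_1 s w"])
 show "cdot (cvec (s w)) (cvec (s w)) = 1" "cdot (cvec (s w)) (f_1 s w) = 0" by (rule SS[OF w], rule Sp[OF w])
 then show "cdot (cvec (s w)) (conj_vec (f_1 s w)) = 0"
  using cdot_conj[of "cvec (s w)" "f_1 s w"] by (simp add: conj_vec_simps)
qed

lemma pk: "cdot (f_1 s w) (f_1 s w) \<noteq> 0" using iso[OF w] k by simp

lemma f_11_eq: "f_11 s w = - k *s cvec (s w) + (K w / k) *s (cvec (s w) \<star> f_1 s w)"
 using imaginary_frame_expansion[OF imS imp impp SS Sp pk] by (simp add: pps ppp iso[OF w] K_def)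

lemma frame: "(cvec (s w) \<star> f_1 s w) $ 1 = 0" "cdot (cvec (s w)) (cvec (s w) \<star> f_1 s w) = 0"
 "cdot (f_1 s w) (cvec (s w) \<star> f_1 s w) = 0" "cdot (cvec (s w) \<star> f_1 s w) (f_1 s w) = 0" "cdot (cvec (s w) \<star> f_1 s w) (cvec (s w)) = 0"
 "cdot (cvec (s w) \<star> f_1 s w) (cvec (s w) \<star> f_1 s w) = k"
 "cdot (cvec (s w) \<star> f_1 s w) (conj_vec (cvec (s w) \<star> f_1 s w)) = rho s w"
 using cdot_qmult_imaginary(1-5)[OF imS imp] Sp SS iso[OF w] by (simp_all add: cdot_qmult(1) conj_vec_qmult conj_vec_simps rho_def)

lemma K_sq: "cdot (f_11 s w) (f_11 s w) = k\<^sup>2 + (K w)\<^sup>2 / k"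
 unfolding f_11_eq using k by (simp add: cdot_simps SS frame power2_eq_square)

lemma dz_rho: "dz (rho s) w = (K w / k) * cdot (cvec (s w) \<star> f_1 s w) (conj_vec (f_1 s w))"
proof -
 have d: "f_1 s differentiable (at w)" "(\<lambda>w. conj_vec (f_1 s w)) differentiable (at w)"
  by (rule smooth_on_differentiable[OF _ w], (rule smp smooth_on_conj_vec[OF D smp]))+
 have "dz (rho s) w = dz (\<lambda>w. cdot (f_1 s w) (conj_vec (f_1 s w))) w" by (simp add: rho_def[abs_def])
 also have "\<dots> = cdot (f_11 s w) (conj_vec (f_1 s w)) + cdot (f_1 s w) (conj_vec (delb (f_1 s) w))"
  unfolding dz_cdot(1)[OF d] del_conj(1)[OF d(1)] f_11_def ..
 also have "\<dots> = (K w / k) * cdot (cvec (s w) \<star> f_1 s w) (conj_vec (f_1 s w))"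
  unfolding lap[OF w] f_11_eq by (simp add: cdot_simps conj_vec_simps Scp Sp cdot_commute[of "f_1 s w" "cvec (s w)"])
 finally show ?thesis .
qed

lemma rho_pos: "rho s w \<noteq> 0" "Im (rho s w) = 0" "0 < Re (rho s w)" "cnj (rho s w) = rho s w" "rho s w = of_real (Re (rho s w))"
proof -
 have "f_1 s w \<noteq> 0" using pk by (auto simp: cdot_simps)
 then show "rho s w \<noteq> 0" "0 < Re (rho s w)" unfolding rho_def by (rule cdot_self_conj_pos(3), rule cdot_self_conj_pos(1))
 show "Im (rho s w) = 0" unfolding rho_def by (rule cdot_self_conj_pos(2))
 then show "cnj (rho s w) = rho s w" "rho s w = of_real (Re (rho s w))" by (simp_all add: complex_eq_iff)
qed

end

end

text \<open>Two harmonic maps into the unit sphere of imaginary quaternions with opposite Hopf differentials, and in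
 the same relation to the conformal structure. A unit quaternion \<open>G\<close> with \<open>G s = t G\<close> intertwining
 \<open>s s'\<close> and \<open>- \<i> t'\<close> satisfies \<open>\<partial>G = G \<theta>\<close>, \<open>\<theta> = -(\<i> s' + s s')/2\<close>.\<close>

locale quat_pair = s: sphere_map D s "- \<i>" + t: sphere_map D t \<i> for D s t +
 assumes rho_eq: "\<And>w. w \<in> D \<Longrightarrow> rho s w = rho t w" and K_eq: "\<And>w. w \<in> D \<Longrightarrow> s.K w = - t.K w"
  and K_nz: "\<And>w. w \<in> D \<Longrightarrow> s.K w \<noteq> 0"
begin

text \<open>A lift has to intertwine the complex vectors s \<star> s' and - \<i> t'. Their real
  parts u and v replace them, so that averaging produces a real quaternion.\<close>

definition u where "u w = Re_vec (cvec (s w) \<star> f_1 s w)"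
definition v where "v w = Im_vec (f_1 t w)"
text \<open>The average of a constant quaternion; the factor is 1/(u, u) = 1/(v, v) by
  \<open>uv_frame\<close>. Where it does not vanish, its normalisation is a lift that depends
  smoothly on w.\<close>

definition sect where "sect G w = intertwine (s w) (t w) (u w) (v w) (2 / Re (rho s w)) G"
definition lift_at where "lift_at w G \<longleftrightarrow> G \<bullet> G = 1 \<and> G \<star> s w = t w \<star> G \<and>
 \<i> *s (cvec G \<star> cvec (s w) \<star> f_1 s w) = f_1 t w \<star> cvec G"

context
 fixes w assumes w: "w \<in> D"
begin

text \<open>The metrics agree, hence so do their derivatives, and \<open>dz_rho\<close> writes each
  of these as K / k times the quantity in question. The factor is the same for s and t and nonzero,
  so it cancels.\<close>

lemma delta: "cdot (cvec (s w) \<star> f_1 s w) (conj_vec (f_1 s w)) = cdot (cvec (t w) \<star> f_1 t w) (conj_vec (f_1 t w))"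
proof -
 have "dz (rho s) w = dz (rho t) w" by (rule dz_cong(1)[OF s.D w rho_eq])
 then show ?thesis using K_nz[OF w] K_eq[OF w] unfolding s.dz_rho[OF w] t.dz_rho[OF w] by simp
qed

lemma cvec_u: "cvec (u w) = (1/2) *s (cvec (s w) \<star> f_1 s w + conj_vec (cvec (s w) \<star> f_1 s w))"
 and cvec_v: "cvec (v w) = (1/2) *s ((- \<i>) *s f_1 t w + conj_vec ((- \<i>) *s f_1 t w))"
 by (simp_all add: u_def v_def cvec_def Re_vec_def Im_vec_def conj_vec_def vec_eq_iff complex_eq_iff)

abbreviation "Q \<equiv> cvec (s w) \<star> f_1 s w"
abbreviation "Y \<equiv> (- \<i>) *s f_1 t w"

lemma Y_frame: "Y $ 1 = 0" "cdot (cvec (t w)) Y = 0" "cdot Y Y = - \<i>" "cdot Y (conj_vec Y) = rho s w" "cdot (conj_vec Y) (conj_vec Y) = \<i>"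
 using t.imp[OF w] t.Sp[OF w] t.iso[OF w] rho_eq[OF w] cdot_conj[of Y Y]
 by (simp_all add: cdot_simps conj_vec_simps rho_def cdot_conj)

lemma Q_conj: "cdot (conj_vec Q) (conj_vec Q) = \<i>" using cdot_conj[of Q Q] s.frame(6)[OF w] by simp

lemma uv_frame: "cvec (u w) $ 1 = 0" "cvec (v w) $ 1 = 0" "cdot (cvec (s w)) (cvec (u w)) = 0" "cdot (cvec (t w)) (cvec (v w)) = 0"
 "cdot (cvec (u w)) (cvec (u w)) = rho s w / 2" "cdot (cvec (v w)) (cvec (v w)) = rho s w / 2"
 "cdot Q (cvec (u w)) = (- \<i> + rho s w) / 2" "cdot Y (cvec (v w)) = (- \<i> + rho s w) / 2"
proof -
 have c: "cdot (cvec (s w)) (conj_vec Q) = 0" using cdot_conj[of "cvec (s w)" Q] s.frame(2)[OF w] by (simp add: conj_vec_simps)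
 have d: "cdot (cvec (t w)) (conj_vec Y) = 0" using cdot_conj[of "cvec (t w)" Y] Y_frame(2) by (simp add: conj_vec_simps)
 show "cvec (u w) $ 1 = 0" "cvec (v w) $ 1 = 0" unfolding cvec_u cvec_v using s.frame(1)[OF w] Y_frame(1) by (simp_all add: conj_vec_def)
 show "cdot (cvec (s w)) (cvec (u w)) = 0" "cdot (cvec (t w)) (cvec (v w)) = 0"
  unfolding cvec_u cvec_v by (simp_all only: cdot_simps c d s.frame(2)[OF w] Y_frame(2)[unfolded cdot_simps]) (use Y_frame(2) d in \<open>simp_all add: cdot_simps\<close>)
 show "cdot Q (cvec (u w)) = (- \<i> + rho s w) / 2"
  unfolding cvec_u by (simp only: cdot_simps s.frame(6,7)[OF w]) simp
 show y: "cdot Y (cvec (v w)) = (- \<i> + rho s w) / 2"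
  unfolding cvec_v cdot_simps(2,8) using Y_frame(3,4) by (simp add: cdot_simps)
 show "cdot (cvec (u w)) (cvec (u w)) = rho s w / 2"
  unfolding cvec_u by (simp only: cdot_simps s.frame(6,7)[OF w] Q_conj cdot_commute[of "conj_vec Q" Q]) (simp add: add_divide_distrib diff_divide_distrib)
 have gen: "cdot ((1/2) *s (a + b)) ((1/2) *s (a + b)) = (1/4) * (cdot a a + 2 * cdot a b + cdot b b)" for a b :: "complex^4"
  by (simp add: cdot_simps cdot_commute[of b a] algebra_simps)
 show "cdot (cvec (v w)) (cvec (v w)) = rho s w / 2" unfolding cvec_v gen Y_frame(3-5) by simp
qed

text \<open>The two complex vectors have the same products with the respective frames u, s \<star> u
  and v, t \<star> v, hence the same coefficients. So a real quaternion that carries s, u to t, v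
  also intertwines the complex vectors.\<close>

lemma Q_expansion: "\<exists>\<alpha> \<beta>. Q = \<alpha> *s cvec (u w) + \<beta> *s (cvec (s w) \<star> cvec (u w)) \<and> Y = \<alpha> *s cvec (v w) + \<beta> *s (cvec (t w) \<star> cvec (v w))"
proof -
 note r = s.rho_pos(1)[OF w]
 have nz: "cdot (cvec (u w)) (cvec (u w)) \<noteq> 0" "cdot (cvec (v w)) (cvec (v w)) \<noteq> 0" using r by (simp_all add: uv_frame)
 have "cdot Q (cvec (s w) \<star> conj_vec Q) = - cdot Q (conj_vec (f_1 s w))"
  by (simp add: conj_vec_qmult conj_vec_simps qmult_imaginary(4)[OF s.imS[OF w] s.imS[OF w]] s.SS[OF w] cdot_simps)
 then have Qs: "cdot Q (cvec (s w) \<star> cvec (u w)) = - cdot Q (conj_vec (f_1 s w)) / 2"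
  unfolding cvec_u by (simp add: qmult_bilinear cdot_simps cdot_qmult_imaginary(4)[OF s.imS[OF w] s.frame(1)[OF w]])
 have "cdot Y (cvec (t w) \<star> conj_vec Y) = - cdot (cvec (t w) \<star> f_1 t w) (conj_vec (f_1 t w))"
  by (simp add: conj_vec_simps qmult_bilinear cdot_simps cdot_qmult_imaginary(6)[OF t.imS[OF w] t.imp[OF w]])
 then have Yt: "cdot Y (cvec (t w) \<star> cvec (v w)) = - cdot Q (conj_vec (f_1 s w)) / 2"
 proof -
  assume a: "cdot Y (cvec (t w) \<star> conj_vec Y) = - cdot (cvec (t w) \<star> f_1 t w) (conj_vec (f_1 t w))"
  have "cdot Y (cvec (t w) \<star> cvec (v w)) = (1/2) * (cdot Y (cvec (t w) \<star> Y) + cdot Y (cvec (t w) \<star> conj_vec Y))"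
   unfolding cvec_v by (simp only: qmult_bilinear(2,4) cdot_simps(2,8))
  then show ?thesis unfolding a cdot_qmult_imaginary(4)[OF t.imS[OF w] Y_frame(1)] delta by simp
 qed
 have "Q = cdot Q (cvec (s w)) *s cvec (s w) + (cdot Q (cvec (u w)) / cdot (cvec (u w)) (cvec (u w))) *s cvec (u w)
   + (cdot Q (cvec (s w) \<star> cvec (u w)) / cdot (cvec (u w)) (cvec (u w))) *s (cvec (s w) \<star> cvec (u w))"
  by (rule imaginary_frame_expansion[OF s.imS[OF w] uv_frame(1) s.frame(1)[OF w] s.SS[OF w] uv_frame(3) nz(1)])
 moreover have "Y = cdot Y (cvec (t w)) *s cvec (t w) + (cdot Y (cvec (v w)) / cdot (cvec (v w)) (cvec (v w))) *s cvec (v w)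
   + (cdot Y (cvec (t w) \<star> cvec (v w)) / cdot (cvec (v w)) (cvec (v w))) *s (cvec (t w) \<star> cvec (v w))"
  by (rule imaginary_frame_expansion[OF t.imS[OF w] uv_frame(2) Y_frame(1) t.SS[OF w] uv_frame(4) nz(2)])
 moreover have "cdot Y (cvec (t w)) = 0" unfolding cdot_commute[of Y] by (rule Y_frame(2))
 ultimately show ?thesis unfolding Qs Yt uv_frame(5-8) s.frame(5)[OF w] by (metis add.left_neutral vector_smult_lzero)
qed

lemma real_iff: "G \<star> s w = t w \<star> G \<Longrightarrow> G \<star> u w = v w \<star> G \<longleftrightarrow> \<i> *s (cvec G \<star> Q) = f_1 t w \<star> cvec G"
proof
 assume a: "G \<star> s w = t w \<star> G" and b: "G \<star> u w = v w \<star> G"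
 have a': "cvec G \<star> cvec (s w) = cvec (t w) \<star> cvec G" and b': "cvec G \<star> cvec (u w) = cvec (v w) \<star> cvec G"
  unfolding cvec_qmult[symmetric] a b by simp_all
 obtain \<alpha> \<beta> where Q: "Q = \<alpha> *s cvec (u w) + \<beta> *s (cvec (s w) \<star> cvec (u w))" and Y: "Y = \<alpha> *s cvec (v w) + \<beta> *s (cvec (t w) \<star> cvec (v w))"
  using Q_expansion by blast
 have a2: "cvec G \<star> cvec (s w) \<star> x = cvec (t w) \<star> cvec G \<star> x" for x using a' by (metis qmult_assoc)
 have "cvec G \<star> Q = Y \<star> cvec G" unfolding Q Y by (simp add: qmult_bilinear a2 b' qmult_assoc)
 then show "\<i> *s (cvec G \<star> Q) = f_1 t w \<star> cvec G" by (simp add: qmult_bilinear)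
next
 assume a: "\<i> *s (cvec G \<star> Q) = f_1 t w \<star> cvec G"
 have 1: "cvec G \<star> Q = Y \<star> cvec G" unfolding qmult_bilinear(3) a[symmetric] by simp
 have 2: "cvec G \<star> conj_vec Q = conj_vec Y \<star> cvec G" using arg_cong[OF 1, of conj_vec] by (simp only: conj_vec_qmult conj_vec_simps(7))
 have "cvec G \<star> cvec (u w) = cvec (v w) \<star> cvec G"
  unfolding cvec_u cvec_v by (simp only: qmult_bilinear(1-4) 1 2)
 then show "G \<star> u w = v w \<star> G" unfolding cvec_qmult[symmetric] cvec_inject .
qed

lemma cvec_sect: "cvec (sect G w) = intertwine (cvec (s w)) (cvec (t w)) (cvec (u w)) (cvec (v w)) (2 / rho s w) (cvec G)"
proof -
 have "cvec (c *s x) = of_real c *s cvec x" for c and x :: "real^4" by (simp add: cvec_def vec_eq_iff)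
 then show ?thesis
  unfolding sect_def intertwine_def using s.rho_pos(5)[OF w] by (simp add: cvec_simps cvec_qmult)
qed

lemma intertwine_hyps:
 "2 / rho s w * cdot (cvec (u w)) (cvec (u w)) = 1" "2 / rho s w * cdot (cvec (v w)) (cvec (v w)) = 1"
 using s.rho_pos(1)[OF w] by (simp_all add: uv_frame)

lemmas I = intertwine[OF s.imS[OF w] t.imS[OF w] uv_frame(1,2) s.SS[OF w] t.SS[OF w] uv_frame(3,4) intertwine_hyps]

lemma sect_lift: assumes "sect G w \<noteq> 0" shows "lift_at w ((1 / norm (sect G w)) *\<^sub>R sect G w)"
proof -
 have "sect G w \<star> s w = t w \<star> sect G w" "sect G w \<star> u w = v w \<star> sect G w"
  using I(1,2)[of "cvec G"] unfolding cvec_sect[symmetric] cvec_qmult[symmetric] cvec_inject by blast+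
 moreover have "(r *\<^sub>R x) \<star> y = r *\<^sub>R (x \<star> y)" "x \<star> (r *\<^sub>R y) = r *\<^sub>R (x \<star> y)" for r and x y :: "real^4"
  by (rule vec4_eqI; simp add: qmult_nth algebra_simps)+
 ultimately have 1: "((1 / norm (sect G w)) *\<^sub>R sect G w) \<star> s w = t w \<star> ((1 / norm (sect G w)) *\<^sub>R sect G w)"
  and 2: "((1 / norm (sect G w)) *\<^sub>R sect G w) \<star> u w = v w \<star> ((1 / norm (sect G w)) *\<^sub>R sect G w)" by simp_all
 have "norm ((1 / norm (sect G w)) *\<^sub>R sect G w) = 1" using assms by simp
 then show ?thesis unfolding lift_at_def norm_eq_1 using 1 real_iff[OF 1, THEN iffD1, OF 2] by blast
qed

lemma lift_sect: assumes "lift_at w G" shows "sect G w = 4 *\<^sub>R G"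
proof -
 have a: "G \<star> s w = t w \<star> G" and b: "G \<star> u w = v w \<star> G" using assms real_iff unfolding lift_at_def by blast+
 have "cvec (sect G w) = 4 *s cvec G"
  unfolding cvec_sect by (rule I(3)) (simp_all add: cvec_qmult[symmetric] a b)
 also have "\<dots> = cvec (4 *\<^sub>R G)" by (simp add: cvec_simps)
 finally show ?thesis unfolding cvec_inject .
qed

lemma lift_exists: "\<exists>G. lift_at w G"
proof -
 obtain i where "intertwine (cvec (s w)) (cvec (t w)) (cvec (u w)) (cvec (v w)) (2 / rho s w) (axis i 1) \<noteq> 0"
  using intertwine_nonzero[OF s.imS[OF w] t.imS[OF w] uv_frame(1,2,3,4)] by blast
 moreover have "axis i 1 = cvec (axis i 1)" by (simp add: cvec_def axis_def vec_eq_iff)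
 ultimately have "cvec (sect (axis i 1) w) \<noteq> 0" unfolding cvec_sect by simp
 then have "sect (axis i 1) w \<noteq> 0" by (auto simp: cvec_simps)
 then show ?thesis using sect_lift by blast
qed

text \<open>The proportionality factor is real because both quaternions are, and its square is 1
  because both are units.\<close>

lemma lift_unique: assumes "lift_at w G" "lift_at w H" shows "H = G \<or> H = - G"
proof -
 have c: "cvec G \<star> Q = Y \<star> cvec G" if "lift_at w G" for G
 proof -
  have "\<i> *s (cvec G \<star> Q) = f_1 t w \<star> cvec G" using that by (simp add: lift_at_def)
  then show ?thesis unfolding qmult_bilinear(3) by (metis (no_types) vector_smult_assoc complex_i_mult_minus i_squared minus_mult_left minus_minus vector_smult_lid)
 qed
 have d: "cvec G \<star> cvec (s w) = cvec (t w) \<star> cvec G" if "lift_at w G" for G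
  using that by (simp add: lift_at_def cvec_qmult[symmetric])
 have n: "cdot Q Q \<noteq> 0" unfolding s.frame(6)[OF w] by simp
 have GG: "G \<bullet> G = 1" "H \<bullet> H = 1" using assms by (simp_all add: lift_at_def)
 have "cvec H = cdot (cvec H) (cvec G) *s cvec G"
  by (rule intertwiners_proportional[OF s.imS[OF w] s.frame(1)[OF w] s.SS[OF w] s.frame(2)[OF w] n _ d[OF assms(1)] c[OF assms(1)] d[OF assms(2)] c[OF assms(2)]])
   (simp add: cdot_cvec GG)
 then have "cvec H = cvec ((H \<bullet> G) *\<^sub>R G)" by (simp add: cdot_cvec cvec_simps)
 then have H: "H = (H \<bullet> G) *\<^sub>R G" unfolding cvec_inject .
 then have "1 = (H \<bullet> G) * (H \<bullet> G)" using GG by (metis inner_scaleR_left inner_scaleR_right mult.right_neutral)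
 then have "H \<bullet> G = 1 \<or> H \<bullet> G = -1" using square_eq_1_iff by metis
 then show ?thesis using H by (metis scaleR_minus1_left scaleR_one)
qed

end

lemma smooth_sect: "smooth_on D (sect G)"
proof -
 have su: "smooth_on D u" unfolding u_def
  by (rule smooth_on_Re_vec[OF s.D smooth_on_bilinear[OF s.D bounded_bilinear_qmult(2) s.smS s.smp]])
 have sv: "smooth_on D v" unfolding v_def by (rule smooth_on_Im_vec[OF s.D t.smp])
 have "smooth_on D (\<lambda>w. Re (rho s w))" unfolding rho_def
  by (rule smooth_on_Re[OF s.D smooth_on_cdot[OF s.D s.smp smooth_on_conj_vec[OF s.D s.smp]]])
 then have sr: "smooth_on D (\<lambda>w. 2 / Re (rho s w))"
  by (rule smooth_on_divide[OF s.D smooth_on_const]) (use s.rho_pos(3) in force)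
 note b = smooth_on_bilinear[OF s.D bounded_bilinear_qmult(1)]
 have y: "smooth_on D (\<lambda>w. G - t w \<star> G \<star> s w)"
  by (rule smooth_on_diff[OF s.D smooth_on_const b[OF t.sm b[OF smooth_on_const s.sm]]])
 have "smooth_on D (\<lambda>w. (G - t w \<star> G \<star> s w) - (2 / Re (rho s w)) *\<^sub>R (v w \<star> (G - t w \<star> G \<star> s w) \<star> u w))"
  by (rule smooth_on_diff[OF s.D y smooth_on_scaleR[OF s.D sr b[OF sv b[OF y su]]]])
 moreover have "r *s x = r *\<^sub>R x" for r and x :: "real^4" by (simp add: vec_eq_iff)
 ultimately show ?thesis unfolding sect_def[abs_def] intertwine_def by simp
qed

theorem lift_minimal:
 assumes E: "open E" "E \<subseteq> D" and G: "smooth_on E G" and lift: "\<And>w. w \<in> E \<Longrightarrow> lift_at w (G w)"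
 shows "conf_min E G" "bipolar_local E G (\<lambda>w. G w \<star> s w)" "w \<in> E \<Longrightarrow> cdot (cvec (G w \<star> s w)) (f_11 G w) \<noteq> 0"
proof -
 have sG: "smooth_on E (\<lambda>w. cvec (G w))" by (rule smooth_on_cvec[OF E(1) G])
 have sG1: "smooth_on E (f_1 G)" unfolding f_1_def comp_def by (rule smooth_on_del[OF E(1) sG])
 have sS: "smooth_on E (\<lambda>w. cvec (s w))" "smooth_on E (f_1 s)" "smooth_on E s"
  "smooth_on E (\<lambda>w. cvec (t w))" "smooth_on E (f_1 t)"
  by (rule smooth_on_subset[OF _ E(2)], rule s.smS s.smp s.sm t.smS t.smp)+
 note qb = smooth_on_bilinear[OF E(1) bounded_bilinear_qmult(2)]
 \<comment> \<open>A particular solution of the two equations that arise by differentiating the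
   relations of a lift and dividing by G; it turns out to be the logarithmic derivative of
   G.\<close>
 define \<theta> where "\<theta> w = (- 1/2) *s (\<i> *s f_1 s w + cvec (s w) \<star> f_1 s w)" for w
 have s\<theta>: "smooth_on E \<theta>" unfolding \<theta>_def[abs_def]
  by (rule smooth_on_smult[OF E(1) smooth_on_const smooth_on_add[OF E(1) smooth_on_smult[OF E(1) smooth_on_const sS(2)] qb[OF sS(1,2)]]])
 have GG: "cdot (cvec (G w)) (cvec (G w)) = 1" if "w \<in> E" for w using lift[OF that] by (simp add: lift_at_def cdot_cvec)
 have L1: "cvec (G w) \<star> cvec (s w) = cvec (t w) \<star> cvec (G w)" if "w \<in> E" for w
  using lift[OF that] by (simp add: lift_at_def cvec_qmult[symmetric])
 have L2: "\<i> *s (cvec (G w) \<star> cvec (s w) \<star> f_1 s w) = f_1 t w \<star> cvec (G w)" if "w \<in> E" for w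
  using lift[OF that] by (simp add: lift_at_def)
 note dif = smooth_on_differentiable
 note qd = del_cbilinear[of "qmult :: complex^4 \<Rightarrow> complex^4 \<Rightarrow> complex^4", OF qmult_bilinear(1,2,3,4)]
 have sq: "(- 1/2) *s (a :: complex^4) = - ((1/2) *s a)" for a by (simp add: vec_eq_iff)
 have f1G: "f_1 G w = cvec (G w) \<star> \<theta> w" and \<theta>: "\<theta> w $ 1 = 0" "cdot (\<theta> w) (\<theta> w) = 0" "cdot (cvec (s w)) (\<theta> w) = 0"
   "cdot (f_1 s w) (\<theta> w) = - (1/2)" if w: "w \<in> E" for w
 proof -
  have wD: "w \<in> D" using w E by blast
  define Z0 S T p q where defs: "Z0 = cvec (G w)" "S = cvec (s w)" "T = cvec (t w)" "p = f_1 s w" "q = f_1 t w"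
  define s2 t2 dG K where defs2: "s2 = f_11 s w" "t2 = f_11 t w" "dG = f_1 G w" "K = s.K w"
  note fr = s.frame[OF wD, folded defs]
  note im = s.imS[OF wD, folded defs] s.imp[OF wD, folded defs]
  note ps = s.SS[OF wD, folded defs] s.Sp[OF wD, folded defs] s.iso[OF wD, folded defs]
  have th: "\<theta> w = (- 1/2) *s (\<i> *s p + S \<star> p)" by (simp add: \<theta>_def defs)
  show 1: "\<theta> w $ 1 = 0" unfolding th using im fr(1) by simp
  show "cdot (\<theta> w) (\<theta> w) = 0" unfolding th by (simp add: cdot_simps fr ps algebra_simps)
  show "cdot (cvec (s w)) (\<theta> w) = 0" unfolding th defs(2)[symmetric] by (simp add: cdot_simps fr ps)
  show "cdot (f_1 s w) (\<theta> w) = - (1/2)" unfolding th defs(4)[symmetric] by (simp add: cdot_simps fr ps)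
  have s2: "s2 = \<i> *s S + (\<i> * K) *s (S \<star> p)" unfolding defs defs2 s.f_11_eq[OF wD] by (simp add: vec_eq_iff)
  have t2: "t2 = (- \<i>) *s T + (\<i> * K) *s (T \<star> q)"
   unfolding defs defs2 t.f_11_eq[OF wD] K_eq[OF wD] by (simp add: vec_eq_iff)
  have SS: "S \<star> S = - qone" "S \<star> S \<star> z = - z" "p \<star> p = \<i> *s qone" "p \<star> p \<star> z = \<i> *s z" "p \<star> S = - (S \<star> p)" "p \<star> S \<star> z = - (S \<star> p \<star> z)" for z
   using qmult_imaginary(2,4)[OF im(1,1)] qmult_imaginary(2,4)[OF im(2,2)] qmult_imaginary(1,3)[OF im(2,1)] ps
   by (simp_all add: cdot_commute[of p S] sq vec_eq_iff)
  have l1: "T \<star> Z0 = Z0 \<star> S" and l2: "q \<star> Z0 = \<i> *s (Z0 \<star> S \<star> p)" using L1[OF w] L2[OF w] unfolding defs by simp_all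
  have l1': "T \<star> Z0 \<star> z = Z0 \<star> S \<star> z" and l2': "q \<star> Z0 \<star> z = \<i> *s (Z0 \<star> S \<star> p \<star> z)" for z
   using arg_cong[OF l1, of "\<lambda>x. x \<star> z"] arg_cong[OF l2, of "\<lambda>x. x \<star> z"] by (simp_all add: qmult_assoc qmult_bilinear)
  note d = dif[OF sG w] dif[OF sS(1) w] dif[OF sS(2) w] dif[OF sS(4) w] dif[OF sS(5) w] dif[OF qb[OF sS(1,2)] w]
  have "del (\<lambda>w. cvec (G w) \<star> cvec (s w)) w = del (\<lambda>w. cvec (t w) \<star> cvec (G w)) w" by (rule del_cong[OF E(1) w L1])
  then have e1: "dG \<star> S = q \<star> Z0 + T \<star> dG - Z0 \<star> p"
   unfolding qd(1)[OF d(1,2)] qd(1)[OF d(4,1)] by (simp add: defs defs2 f_1_def' algebra_simps)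
  have b2: "\<i> *s ((x + y) \<star> z) = \<i> *s (x \<star> z) + \<i> *s (y \<star> z)" "\<i> *s (x \<star> (y + z)) = \<i> *s (x \<star> y) + \<i> *s (x \<star> z)"
   "\<i> *s ((c *s x) \<star> y) = c *s (\<i> *s (x \<star> y))" "\<i> *s (x \<star> (c *s y)) = c *s (\<i> *s (x \<star> y))" for x y z :: "complex^4" and c
   by (simp_all add: qmult_bilinear vec_eq_iff algebra_simps)
  have "del (\<lambda>w. \<i> *s (cvec (G w) \<star> (cvec (s w) \<star> f_1 s w))) w = del (\<lambda>w. f_1 t w \<star> cvec (G w)) w" by (rule del_cong[OF E(1) w L2])
  then have "\<i> *s (dG \<star> S \<star> p) + \<i> *s (Z0 \<star> (p \<star> p + S \<star> s2)) = t2 \<star> Z0 + q \<star> dG"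
   unfolding del_cbilinear(1)[of "\<lambda>x y. \<i> *s (x \<star> y)", OF b2 d(1,6)] qd(1)[OF d(5,1)] qd(1)[OF d(2,3)] by (simp add: defs defs2 f_1_def' f_11_def)
  then have e2: "\<i> *s (dG \<star> S \<star> p) = t2 \<star> Z0 + q \<star> dG - \<i> *s (Z0 \<star> (p \<star> p + S \<star> s2))" by (simp add: algebra_simps)
  \<comment> \<open>The difference solves the homogeneous equations, so it is an intertwiner and
    hence a multiple of G; being also orthogonal to G, it is zero.\<close>
  define Z where "Z = dG - Z0 \<star> \<theta> w"
  note R = qmult_assoc qmult_bilinear SS l1 l2 l1' l2' qmult_one
  have Z1: "Z \<star> S = T \<star> Z" unfolding Z_def th by (simp add: R e1 vec_eq_iff algebra_simps)
  have Z2: "\<i> *s (Z \<star> S \<star> p) = q \<star> Z"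
   unfolding Z_def th qmult_bilinear vector_ssub_ldistrib e2 s2 t2 by (simp add: R vec_eq_iff algebra_simps)
  have iI: "Z \<star> S \<star> p = ((- \<i>) *s q) \<star> Z" if "\<i> *s (Z \<star> S \<star> p) = q \<star> Z" for Z
   unfolding qmult_bilinear(3) that[symmetric] by (simp add: vec_eq_iff)
  have "cdot dG Z0 + cdot Z0 dG = 0"
   using cdot_const_deriv(1)[of E w "\<lambda>w. cvec (G w)" "\<lambda>w. cvec (G w)" 1] E w GG sG by (simp add: f_1_def'[symmetric] defs defs2)
  then have "cdot dG Z0 = 0" by (simp add: cdot_commute[of Z0])
  moreover have "cdot (Z0 \<star> \<theta> w) Z0 = 0"
   using cdot_qmult(1)[of Z0 "\<theta> w" qone] 1 by (simp add: qmult_one cdot_qmult)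
  ultimately have ZZ: "cdot Z Z0 = 0" by (simp add: Z_def cdot_simps)
  have n: "cdot (S \<star> p) (S \<star> p) \<noteq> 0" unfolding fr(6) by simp
  have "Z = cdot Z Z0 *s Z0"
   by (rule intertwiners_proportional[OF im(1) fr(1) ps(1) fr(2) n GG[OF w, folded defs] l1[symmetric] iI[OF l2[symmetric]] Z1 iI[OF Z2]])
  then have "Z = 0" unfolding ZZ by simp
  then show "f_1 G w = cvec (G w) \<star> \<theta> w" by (simp add: Z_def defs defs2)
 qed
 have main: "f_1 G w \<noteq> 0 \<and> cdot (f_1 G w) (f_1 G w) = 0 \<and> delb (f_1 G) w = - rho G w *s cvec (G w)" if w: "w \<in> E" for w
 proof -
  have wD: "w \<in> D" using w E by blast
  define Z0 S p cp where defs: "Z0 = cvec (G w)" "S = cvec (s w)" "p = f_1 s w" "cp = conj_vec (f_1 s w)"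
  note fr = s.frame[OF wD, folded defs]
  note im = s.imS[OF wD, folded defs] s.imp[OF wD, folded defs] s.imcp[OF wD, folded defs]
  note ps = s.SS[OF wD, folded defs] s.Sp[OF wD, folded defs] s.iso[OF wD, folded defs] s.Scp[OF wD, folded defs]
  have pcp: "cdot cp p = rho s w" by (simp add: defs rho_def cdot_commute)
  have th: "\<theta> w = (- 1/2) *s (\<i> *s p + S \<star> p)" by (simp add: \<theta>_def defs)
  have cth: "conj_vec (\<theta> w) = (- 1/2) *s ((- \<i>) *s cp + S \<star> cp)"
   by (simp add: \<theta>_def defs conj_vec_simps conj_vec_qmult)
  have a: "cdot (f_1 G w) (Z0 \<star> p) = - (1/2)"
   unfolding f1G[OF w] defs(1) cdot_qmult(1) GG[OF w] using \<theta>(4)[OF w] by (simp add: cdot_commute[of "\<theta> w"] defs)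
  have b: "cdot (f_1 G x) (f_1 G x) = 0" if "x \<in> E" for x unfolding f1G[OF that] cdot_qmult(1) \<theta>(2)[OF that] by simp
  have SS: "S \<star> S = - qone" "S \<star> S \<star> z = - z" "cp \<star> S = - (S \<star> cp)" "cp \<star> S \<star> z = - (S \<star> cp \<star> z)" for z
   using qmult_imaginary(2,4)[OF im(1,1)] qmult_imaginary(1,3)[OF im(3,1)] ps
   by (simp_all add: cdot_commute[of cp S] vec_eq_iff)
  \<comment> \<open>Both p and its conjugate are tangent to the sphere at s, so the imaginary part
    of their product is a multiple of s.\<close>
  define y where "y = cp \<star> p + rho s w *s qone"
  have y1: "y $ 1 = 0" unfolding y_def using cdot_qmult_imaginary(5)[OF im(3,2)] by (simp add: qone_nth pcp)
  have yp: "cdot y p = 0" unfolding y_def using cdot_qmult_imaginary(2)[OF im(3,2)] im by (simp add: cdot_simps cdot_qmult)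
  have "cdot (cp \<star> p) (S \<star> p) = 0" using cdot_qmult(2)[of cp p S] ps(4) by (simp add: cdot_commute[of cp S])
  then have yq: "cdot y (S \<star> p) = 0" unfolding y_def using fr(1) by (simp add: cdot_simps cdot_qmult(6))
  define m where "m = cdot y S"
  have "y = m *s S"
   using imaginary_frame_expansion[OF im(1,2) y1 ps(1,2)] ps(3) unfolding yp yq m_def by simp
  then have cpp: "cp \<star> p = m *s S - rho s w *s qone" unfolding y_def by (simp add: algebra_simps)
  have dG: "delb (\<lambda>w. cvec (G w)) w = Z0 \<star> conj_vec (\<theta> w)"
   unfolding delb_cvec[OF dif[OF G w]] f1G[OF w] defs(1) by (simp add: conj_vec_qmult conj_vec_simps)
  have dS: "delb (\<lambda>w. cvec (s w)) w = cp" unfolding delb_cvec[OF dif[OF s.sm wD]] defs ..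
  have d\<theta>: "delb \<theta> w = (- 1/2) *s (\<i> *s (- rho s w *s S) + (cp \<star> p + S \<star> (- rho s w *s S)))"
  proof -
   note d = dif[OF sS(1) w] dif[OF sS(2) w] dif[OF qb[OF sS(1,2)] w]
   have di: "(\<lambda>w. \<i> *s f_1 s w) differentiable (at w)" by (rule dif[OF smooth_on_smult[OF E(1) smooth_on_const sS(2)] w])
   have l: "c *s (x + y) = c *s x + c *s y" "c *s (k *s x) = k *s (c *s x)" for c k and x y :: "complex^4" by (simp_all add: vec_eq_iff algebra_simps)
   have "delb \<theta> w = delb (\<lambda>w. (- 1/2) *s (\<i> *s f_1 s w + cvec (s w) \<star> f_1 s w)) w" by (simp add: \<theta>_def[abs_def])
   also have "\<dots> = (- 1/2) *s delb (\<lambda>w. \<i> *s f_1 s w + cvec (s w) \<star> f_1 s w) w"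
    by (rule del_clinear(2)[OF l dif[OF smooth_on_add[OF E(1) smooth_on_smult[OF E(1) smooth_on_const sS(2)] qb[OF sS(1,2)]] w]])
   also have "delb (\<lambda>w. \<i> *s f_1 s w + cvec (s w) \<star> f_1 s w) w = \<i> *s delb (f_1 s) w + (delb (\<lambda>w. cvec (s w)) w \<star> f_1 s w + cvec (s w) \<star> delb (f_1 s) w)"
    unfolding del_add(2)[OF di d(3)] qd(2)[OF d(1,2)] del_clinear(2)[of "\<lambda>x. \<i> *s x", OF l d(2)] ..
   finally show ?thesis unfolding dS s.lap[OF wD] by (simp add: defs)
  qed
  have "delb (f_1 G) w = delb (\<lambda>w. cvec (G w) \<star> \<theta> w) w" by (rule del_cong(2)[OF E(1) w f1G])
  also have "\<dots> = Z0 \<star> conj_vec (\<theta> w) \<star> \<theta> w + Z0 \<star> delb \<theta> w"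
   unfolding qd(2)[OF dif[OF sG w] dif[OF s\<theta> w]] dG by (simp add: defs qmult_assoc)
  also have "\<dots> = Z0 \<star> ((- (\<i> * m + rho s w) / 2) *s qone)"
   unfolding d\<theta> cth unfolding th qmult_bilinear(2)[symmetric]
   by (rule arg_cong[of _ _ "qmult Z0"]) (simp add: qmult_assoc qmult_bilinear SS cpp qmult_one vec_eq_iff field_simps)
  finally have k: "delb (f_1 G) w = (- (\<i> * m + rho s w) / 2) *s Z0" by (simp only: qmult_bilinear qmult_one)
  \<comment> \<open>The Laplacian of G is now a multiple of G; the factor is found by
    differentiating the orthogonality of \<open>f_1 G\<close> and G.\<close>
  have c0: "cdot (f_1 G x) (cvec (G x)) = 0" if "x \<in> E" for x
   unfolding f1G[OF that] using cdot_qmult(1)[of "cvec (G x)" "\<theta> x" qone] \<theta>(1)[OF that] by (simp add: qmult_one cdot_qmult)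
  have "cdot (delb (f_1 G) w) (cvec (G w)) + cdot (f_1 G w) (conj_vec (f_1 G w)) = 0"
   using cdot_const_deriv(2)[of E w "f_1 G" "\<lambda>w. cvec (G w)" 0] E w c0 sG sG1 by (simp add: delb_cvec[OF dif[OF G w]])
  then have "- (\<i> * m + rho s w) / 2 = - rho G w" using GG[OF w] unfolding k defs(1) by (simp add: cdot_simps rho_def eq_neg_iff_add_eq_0)
  then have "delb (f_1 G) w = - rho G w *s cvec (G w)" using k by (simp only: defs(1))
  moreover have "f_1 G w \<noteq> 0" using a by (auto simp: cdot_simps)
  ultimately show ?thesis using b[OF w] by blast
 qed
 have n1: "norm (G w) = 1" if "w \<in> E" for w using lift[OF that] by (simp add: lift_at_def norm_eq_1)
 show cm: "conf_min E G" unfolding conf_min_def using E(1) G main n1 by blast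
 have N: "cdot (cvec (G w \<star> s w)) (cvec (G w)) = 0" "cdot (cvec (G w \<star> s w)) (f_1 G w) = 0"
   "cdot (cvec (G w \<star> s w)) (cvec (G w \<star> s w)) = 1" if w: "w \<in> E" for w
 proof -
  have wD: "w \<in> D" using w E by blast
  show "cdot (cvec (G w \<star> s w)) (cvec (G w)) = 0"
   using cdot_qmult(1)[of "cvec (G w)" "cvec (s w)" qone] s.imS[OF wD] by (simp add: cvec_qmult qmult_one cdot_qmult)
  show "cdot (cvec (G w \<star> s w)) (f_1 G w) = 0" "cdot (cvec (G w \<star> s w)) (cvec (G w \<star> s w)) = 1"
   unfolding f1G[OF w] cvec_qmult cdot_qmult(1) \<theta>(3)[OF w] GG[OF w] s.SS[OF wD] by simp_all
 qed
 show "bipolar_local E G (\<lambda>w. G w \<star> s w)"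
 proof
  show "conf_min E G" by (rule cm)
  show "smooth_on E (\<lambda>w. G w \<star> s w)" by (rule smooth_on_bilinear[OF E(1) bounded_bilinear_qmult(1) G sS(3)])
  fix w v assume w: "w \<in> E"
  show "(G w \<star> s w) \<bullet> (G w \<star> s w) = 1" "(G w \<star> s w) \<bullet> G w = 0" using N[OF w] unfolding cdot_cvec by simp_all
  have "cdot (cvec (G w \<star> s w)) (conj_vec (f_1 G w)) = 0"
   using cdot_conj[of "cvec (G w \<star> s w)" "f_1 G w"] N(2)[OF w] by (simp add: conj_vec_simps)
  then have "cdot (cvec (G w \<star> s w)) (cvec (dd v G w)) = 0"
   unfolding f_1_real(3)[OF dif[OF G w]] by (simp add: cdot_simps N[OF w])
  then show "(G w \<star> s w) \<bullet> dd v G w = 0" unfolding cdot_cvec by simp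
 qed
 show "cdot (cvec (G w \<star> s w)) (f_11 G w) \<noteq> 0" if w: "w \<in> E"
 proof -
  \<comment> \<open>The product of N with \<open>f_11 G\<close> is minus that of the derivative of N
    with \<open>f_1 G\<close>, which comes out as 1/2: the Hopf differential of G has a constant
    nonzero coefficient.\<close>
  have "cdot (del (\<lambda>w. cvec (G w) \<star> cvec (s w)) w) (f_1 G w) + cdot (cvec (G w \<star> s w)) (f_11 G w) = 0"
   using cdot_const_deriv(1)[of E w "\<lambda>w. cvec (G w) \<star> cvec (s w)" "f_1 G" 0] E w N(2) sG1 qb[OF sG sS(1)]
   by (simp add: cvec_qmult f_11_def)
  moreover have "del (\<lambda>w. cvec (G w) \<star> cvec (s w)) w = cvec (G w) \<star> (\<theta> w \<star> cvec (s w) + f_1 s w)"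
   unfolding qd(1)[OF dif[OF sG w] dif[OF sS(1) w]] f_1_def'[symmetric] f1G[OF w] by (simp add: qmult_assoc qmult_bilinear)
  moreover have "cdot (\<theta> w \<star> cvec (s w)) (\<theta> w) = 0"
   using cdot_qmult(1)[of "\<theta> w" "cvec (s w)" qone] \<theta>(2)[OF w] by (simp add: qmult_one)
  ultimately show ?thesis unfolding f1G[OF w] by (auto simp: cdot_qmult(1) GG[OF w] cdot_simps \<theta>(4)[OF w])
 qed
qed

end

section \<open>The splitting defined by the reflection\<close>

lemma orthonormal_triple:
 fixes V :: "(real^6) set"
 assumes "subspace V" "dim V = 3"
 obtains a b c where "a \<in> V" "b \<in> V" "c \<in> V" "a \<bullet> a = 1" "b \<bullet> b = 1" "c \<bullet> c = 1" "a \<bullet> b = 0" "a \<bullet> c = 0" "b \<bullet> c = 0"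
proof -
 obtain B where B: "B \<subseteq> V" "pairwise orthogonal B" "\<And>x. x \<in> B \<Longrightarrow> norm x = 1" "card B = dim V"
  by (rule orthonormal_basis_subspace[OF assms(1)]) blast
 then obtain a b c where abc: "B = {a, b, c}" "a \<noteq> b" "b \<noteq> c" "a \<noteq> c" using assms(2) card_3_iff by metis
 have "a \<bullet> b = 0" "a \<bullet> c = 0" "b \<bullet> c = 0" using B(2) abc unfolding pairwise_def orthogonal_def by auto
 moreover have "a \<bullet> a = 1" "b \<bullet> b = 1" "c \<bullet> c = 1" using B(3) abc by (simp_all add: norm_eq_1)
 ultimately show ?thesis using that B(1) abc by blast
qed

lemma inner_6: "x \<bullet> y = x$1 * y$1 + x$2 * y$2 + x$3 * y$3 + x$4 * y$4 + x$5 * y$5 + x$6 * y$6" for x y :: "real^6"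
 by (simp add: inner_vec_def sum_6)

text \<open>R gives the coordinates in an orthonormal basis of which three vectors span V and three
  its complement; A is the inverse map.\<close>

lemma orthogonal_splitting:
 fixes V :: "(real^6) set"
 assumes V: "subspace V" "dim V = 3"
 obtains A R :: "real^6 \<Rightarrow> real^6" where "orthogonal_transformation A" "orthogonal_transformation R" "\<forall>y. A (R y) = y"
  "\<forall>y\<in>V. R y $ 4 = 0 \<and> R y $ 5 = 0 \<and> R y $ 6 = 0"
  "\<forall>y. (\<forall>v\<in>V. y \<bullet> v = 0) \<longrightarrow> R y $ 1 = 0 \<and> R y $ 2 = 0 \<and> R y $ 3 = 0"
proof -
 define W where "W = {y. \<forall>x\<in>V. orthogonal x y}"
 have sW: "subspace W" unfolding W_def by (auto simp: subspace_def orthogonal_def inner_add_right)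
 have "dim {y \<in> UNIV. \<forall>x\<in>V. orthogonal x y} + dim V = dim (UNIV :: (real^6) set)"
  by (rule dim_subspace_orthogonal_to_vectors[OF V(1)]) simp_all
 then have dW: "dim W = 3" using V(2) by (simp add: W_def)
 obtain a b c where v: "a \<in> V" "b \<in> V" "c \<in> V" and o1: "a \<bullet> a = 1" "b \<bullet> b = 1" "c \<bullet> c = 1" "a \<bullet> b = 0" "a \<bullet> c = 0" "b \<bullet> c = 0"
  by (rule orthonormal_triple[OF V])
 obtain d e h where w: "d \<in> W" "e \<in> W" "h \<in> W" and o2: "d \<bullet> d = 1" "e \<bullet> e = 1" "h \<bullet> h = 1" "d \<bullet> e = 0" "d \<bullet> h = 0" "e \<bullet> h = 0"
  by (rule orthonormal_triple[OF sW dW])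
 have vw: "x \<bullet> y = 0" if "x \<in> V" "y \<in> W" for x y using that by (auto simp: W_def orthogonal_def)
 note o3 = vw[OF v(1) w(1)] vw[OF v(1) w(2)] vw[OF v(1) w(3)] vw[OF v(2) w(1)] vw[OF v(2) w(2)] vw[OF v(2) w(3)]
  vw[OF v(3) w(1)] vw[OF v(3) w(2)] vw[OF v(3) w(3)]
 note os = o1 o2 o3 o1(4-6)[unfolded inner_commute[of a] inner_commute[of b c]] o2(4-6)[unfolded inner_commute[of d] inner_commute[of e h]] o3[THEN trans[OF inner_commute]]
 define A where "A x = x$1 *\<^sub>R a + x$2 *\<^sub>R b + x$3 *\<^sub>R c + x$4 *\<^sub>R d + x$5 *\<^sub>R e + x$6 *\<^sub>R h" for x :: "real^6"
 have oA: "orthogonal_transformation A" unfolding orthogonal_transformation_def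
 proof (intro conjI allI)
  show "linear A" by (rule linearI) (simp_all add: A_def algebra_simps)
  show "A x \<bullet> A y = x \<bullet> y" for x y
   unfolding A_def inner_6[of x y] by (simp add: inner_add_left inner_add_right os)
 qed
 have l: "linear A" using oA by (rule orthogonal_transformation_linear)
 define R where "R = inv A"
 have oO: "orthogonal_transformation R" unfolding R_def by (rule orthogonal_transformation_inv[OF oA])
 have AO: "A (R y) = y" for y unfolding R_def by (rule surj_f_inv_f[OF orthogonal_transformation_surj[OF oA]])
 have ax: "A (axis 1 1) = a" "A (axis 2 1) = b" "A (axis 3 1) = c" "A (axis 4 1) = d" "A (axis 5 1) = e" "A (axis 6 1) = h"
  by (simp_all add: A_def axis_def)
 have nth: "R y $ i = y \<bullet> A (axis i 1)" for y i
 proof -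
  have "R y $ i = R y \<bullet> axis i 1" by (simp add: inner_axis)
  also have "\<dots> = A (R y) \<bullet> A (axis i 1)" using oA by (simp add: orthogonal_transformation_def)
  finally show ?thesis unfolding AO .
 qed
 show ?thesis by (rule that[OF oA oO]) (use vw v w AO in \<open>simp_all add: nth ax\<close>)
qed

lemma cdot_split:
 assumes "linear L" "linear L'" "\<And>x y. L x \<bullet> L y + L' x \<bullet> L' y = (1/2) * (x \<bullet> y)"
 shows "cdot (clin L x) (clin L y) + cdot (clin L' x) (clin L' y) = (1/2) * cdot x y"
proof -
 have e: "of_real (u \<bullet> v) = 2 * (of_real (L u \<bullet> L v) + of_real (L' u \<bullet> L' v) :: complex)" for u v
  using arg_cong[OF assms(3)[of u v], of complex_of_real] by (simp add: algebra_simps)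
 have "cdot x y = cdot (cvec (Re_vec x) + \<i> *s cvec (Im_vec x)) (cvec (Re_vec y) + \<i> *s cvec (Im_vec y))"
  using vec_eq_Re_Im by metis
 also have "\<dots> = 2 * (cdot (clin L x) (clin L y) + cdot (clin L' x) (clin L' y))"
  unfolding clin_def by (simp add: cdot_simps cdot_cvec e algebra_simps)
 finally show ?thesis by simp
qed

lemma conj_clin: "linear L \<Longrightarrow> conj_vec (clin L x) = clin L (conj_vec x)"
 by (simp add: clin_def conj_vec_simps Re_Im_vec_simps cvec_simps linear_neg)

section \<open>The maps f + X and f - X\<close>

context pair6_gamma
begin

definition pp where "pp w = cdot (f_11 g w) (f_11 X w)"

text \<open>If it vanished, \<open>f_11 X\<close> would be \<i> f, of square norm 1, and by
  \<open>c_eq\<close> the value of c for X would be at most 1, contrary to the non-degenerate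
  ellipse.\<close>

lemma pp_nonzero:
 assumes w: "w \<in> D"
 shows "pp w \<noteq> 0"
proof
 assume 0: "pp w = 0"
 interpret sw: pair6_gamma D X g by (rule swap)
 note q = Q[OF w] pairings4[OF w]
 have "f_11 X w - \<i> *s cvec (g w) = 0" by (rule nondegenerate[OF w])
   (use 0 in \<open>simp_all add: cdot_simps q pp_def cdot_commute[of "f_11 X w" "f_11 g w"]\<close>)
 then have e: "f_11 X w = \<i> *s cvec (g w)" by simp
 have "f_11_sq X w = 1" unfolding f_11_sq_def e by (simp add: cdot_simps conj_vec_simps q)
 then have "sw.c w = 1 - dz (rho X) w * cnj (dz (rho X) w) / rho X w" unfolding sw.c_eq[OF w] by simp
 moreover have "dz (rho X) w * cnj (dz (rho X) w) / rho X w = of_real ((cmod (dz (rho X) w))\<^sup>2 / Re (rho X w))"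
  using conf_min_f_2_orth(6)[OF conf_min_X w] by (metis complex_norm_square of_real_divide)
 ultimately have "Re (sw.c w) = 1 - (cmod (dz (rho X) w))\<^sup>2 / Re (rho X w)" by simp
 moreover have "0 \<le> (cmod (dz (rho X) w))\<^sup>2 / Re (rho X w)" using conf_min_f_2_orth(7)[OF conf_min_X w] by simp
 ultimately show False using sw.c_gt_1(2)[OF w] by linarith
qed

context
 fixes \<eta> :: real assumes \<eta>: "\<eta> = 1 \<or> \<eta> = -1"
begin

definition comb where "comb w = g w + \<eta> *\<^sub>R X w"

lemma smooth_comb: "smooth_on D comb"
 unfolding comb_def[abs_def] by (rule smooth_on_add[OF D conf_minD(2)[OF cm] smooth_on_scaleR[OF D smooth_on_const smooth_X]])

lemma comb_deriv:
 assumes w: "w \<in> D"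
 shows "f_1 comb w = f_1 g w + of_real \<eta> *s f_1 X w" "f_11 comb w = f_11 g w + of_real \<eta> *s f_11 X w"
  "delb (f_1 comb) w = delb (f_1 g) w + of_real \<eta> *s delb (f_1 X) w"
proof -
 note d = smooth_on_differentiable
 have l: "of_real \<eta> *s (x + y) = of_real \<eta> *s x + of_real \<eta> *s y" "of_real \<eta> *s (k *s x) = k *s (of_real \<eta> *s x)" for k and x y :: "complex^6"
  by (simp_all add: vec_eq_iff algebra_simps)
 have s1: "smooth_on D (\<lambda>w. of_real \<eta> *s cvec (X w))" "smooth_on D (\<lambda>w. of_real \<eta> *s f_1 X w)"
  by (rule smooth_on_smult[OF D smooth_on_const], rule smX)+
 have sg: "smooth_on D (\<lambda>w. cvec (g w))" by (rule smooth_on_cvec[OF D conf_minD(2)[OF cm]])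
 have 1: "f_1 comb w = f_1 g w + of_real \<eta> *s f_1 X w" if w: "w \<in> D" for w
  unfolding f_1_def' comb_def cvec_simps del_add(1)[OF d[OF sg w] d[OF s1(1) w]] del_clinear(1)[OF l d[OF smX(1) w]] ..
 show "f_1 comb w = f_1 g w + of_real \<eta> *s f_1 X w" by (rule 1[OF w])
 note d' = d[OF smooth_parts(1) w] d[OF s1(2) w] d[OF smX(2) w]
 show "f_11 comb w = f_11 g w + of_real \<eta> *s f_11 X w"
 proof -
  have "f_11 comb w = del (\<lambda>w. f_1 g w + of_real \<eta> *s f_1 X w) w" unfolding f_11_def by (rule del_cong(1)[OF D w 1])
  then show ?thesis unfolding f_11_def del_add(1)[OF d'(1,2)] del_clinear(1)[OF l d'(3)] .
 qed
 show "delb (f_1 comb) w = delb (f_1 g) w + of_real \<eta> *s delb (f_1 X) w"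
 proof -
  have "delb (f_1 comb) w = delb (\<lambda>w. f_1 g w + of_real \<eta> *s f_1 X w) w" by (rule del_cong(2)[OF D w 1])
  then show ?thesis unfolding del_add(2)[OF d'(1,2)] del_clinear(2)[OF l d'(3)] .
 qed
qed

lemma comb_pairings:
 assumes w: "w \<in> D"
 shows "cdot (cvec (comb w)) (cvec (comb w)) = 2" "cdot (cvec (comb w)) (f_1 comb w) = 0"
  "cdot (f_1 comb w) (f_1 comb w) = - 2 * \<i> * \<eta>" "cdot (f_11 comb w) (cvec (comb w)) = 2 * \<i> * \<eta>"
  "cdot (f_11 comb w) (f_1 comb w) = 0" "cdot (f_11 comb w) (f_11 comb w) = - 2 + 2 * \<eta> * pp w"
  "cdot (f_1 comb w) (conj_vec (f_1 comb w)) = 2 * rho g w"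
  "delb (f_1 comb) w = - rho g w *s cvec (comb w)"
proof -
 note q = Q[OF w] pairings4[OF w] f_1_X_f_1_X(1)[OF w] pairings2[OF w] pairings2[OF w, THEN trans[OF cdot_commute]]
  pairings4[OF w, THEN trans[OF cdot_commute]] conf_min_pairings[OF conf_min_X w] conf_min_pairings[OF conf_min_X w, THEN trans[OF cdot_commute]]
 have e2: "of_real \<eta> * (of_real \<eta> * x) = (x :: complex)" "of_real \<eta> * of_real \<eta> = (1 :: complex)" for x using \<eta> by auto
 note cd = comb_deriv[OF w]
 show "cdot (cvec (comb w)) (cvec (comb w)) = 2" "cdot (cvec (comb w)) (f_1 comb w) = 0"
  "cdot (f_1 comb w) (f_1 comb w) = - 2 * \<i> * \<eta>" "cdot (f_11 comb w) (cvec (comb w)) = 2 * \<i> * \<eta>"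
  "cdot (f_11 comb w) (f_1 comb w) = 0"
  unfolding cd comb_def cvec_simps by (simp_all add: cdot_simps q e2 algebra_simps)
 show "cdot (f_11 comb w) (f_11 comb w) = - 2 + 2 * \<eta> * pp w"
  unfolding cd pp_def by (simp add: cdot_simps q e2 cdot_commute[of "f_11 X w" "f_11 g w"] algebra_simps)
 have "cdot (f_1 g w) (conj_vec (f_1 X w)) = cnj (cdot (conj_vec (f_1 g w)) (f_1 X w))" by (simp add: cdot_conj_left)
 then have gX': "cdot (f_1 g w) (conj_vec (f_1 X w)) = 0" using pairings2(4)[OF w] by (simp add: cdot_commute)
 have r: "cdot (f_1 g w) (conj_vec (f_1 g w)) = rho g w" "cdot (f_1 X w) (conj_vec (f_1 X w)) = rho g w"
  using rho_X[OF w] by (simp_all add: rho_def)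
 show "cdot (f_1 comb w) (conj_vec (f_1 comb w)) = 2 * rho g w"
  unfolding cd conj_vec_simps by (simp add: cdot_simps e2 gX' r pairings2(4)[OF w])
 show "delb (f_1 comb) w = - rho g w *s cvec (comb w)"
  unfolding cd conf_minD(6)[OF cm w] delb_f_1_X[OF w] rho_X[OF w] comb_def cvec_simps by (simp add: vec_eq_iff algebra_simps)
qed

lemma comb_rank:
 assumes w: "w \<in> D" and R: "\<And>w. w \<in> D \<Longrightarrow> comb w = (comb w \<bullet> a) *\<^sub>R a + (comb w \<bullet> b) *\<^sub>R b"
 shows False
proof -
 define L where "L y = (y \<bullet> a) *\<^sub>R a + (y \<bullet> b) *\<^sub>R b" for y
 have l: "linear L" by (rule linearI) (simp_all add: L_def algebra_simps inner_add_left)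
 have La: "L y \<bullet> z = (y \<bullet> a) * (z \<bullet> a) + (y \<bullet> b) * (z \<bullet> b)" for y z
  by (simp add: L_def inner_add_left inner_commute[of z])
 have cl: "cdot (clin L x) y = cdot x (cvec a) * cdot y (cvec a) + cdot x (cvec b) * cdot y (cvec b)" for x y
 proof -
  have c: "cdot x (cvec u) = of_real (Re_vec x \<bullet> u) + \<i> * of_real (Im_vec x \<bullet> u)" for x and u :: "real^6"
  proof -
   have "cdot x (cvec u) = cdot (cvec (Re_vec x) + \<i> *s cvec (Im_vec x)) (cvec u)" using vec_eq_Re_Im by metis
   then show ?thesis by (simp add: cdot_simps cdot_cvec)
  qed
  have "cdot (clin L x) y = cdot x (cvec a) * cdot (cvec a) y + cdot x (cvec b) * cdot (cvec b) y"
   unfolding clin_def L_def cvec_simps c[of x] by (simp add: cdot_simps algebra_simps)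
  then show ?thesis by (simp add: cdot_commute[of "cvec _" y])
 qed
 have f1: "f_1 comb w = clin L (f_1 comb w)"
  by (rule f_1_clin[OF l D w _ smooth_on_differentiable[OF smooth_comb w]]) (use R in \<open>simp add: L_def\<close>)
 have f11: "f_11 comb w = clin L (f_11 comb w)"
  by (rule f_11_clin[OF l D w _ smooth_comb]) (use R in \<open>simp add: L_def\<close>)
 have f0: "cvec (comb w) = clin L (cvec (comb w))" using R[OF w] clin(3)[OF l] by (simp add: L_def)
 note cp = comb_pairings(1-6)[OF w]
 define x1 x2 p1 p2 q1 q2 where xs: "x1 = cdot (cvec (comb w)) (cvec a)" "x2 = cdot (cvec (comb w)) (cvec b)"
  "p1 = cdot (f_1 comb w) (cvec a)" "p2 = cdot (f_1 comb w) (cvec b)" "q1 = cdot (f_11 comb w) (cvec a)" "q2 = cdot (f_11 comb w) (cvec b)"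
 have e: "x1 * x1 + x2 * x2 = 2" "x1 * p1 + x2 * p2 = 0" "p1 * p1 + p2 * p2 = - 2 * \<i> * \<eta>" "q1 * x1 + q2 * x2 = 2 * \<i> * \<eta>"
  "q1 * p1 + q2 * p2 = 0" "q1 * q1 + q2 * q2 = - 2 + 2 * \<eta> * pp w"
  using cp unfolding xs cl[symmetric] f0[symmetric] f1[symmetric] f11[symmetric] by simp_all
 \<comment> \<open>The Gram determinant of the map and its first two derivatives, zero because each
   has only two coordinates. By \<open>comb_pairings\<close> its value is -8 \<i> times
   \<open>pp w\<close>.\<close>
 have "(x1 * x1 + x2 * x2) * (p1 * p1 + p2 * p2) * (q1 * q1 + q2 * q2) + 2 * (x1 * p1 + x2 * p2) * (q1 * p1 + q2 * p2) * (q1 * x1 + q2 * x2)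
   - (q1 * x1 + q2 * x2)\<^sup>2 * (p1 * p1 + p2 * p2) - (x1 * p1 + x2 * p2)\<^sup>2 * (q1 * q1 + q2 * q2) - (q1 * p1 + q2 * p2)\<^sup>2 * (x1 * x1 + x2 * x2) = 0"
  by (simp add: power2_eq_square algebra_simps)
 then have "2 * (- 2 * \<i> * \<eta>) * (- 2 + 2 * \<eta> * pp w) - (2 * \<i> * \<eta>)\<^sup>2 * (- 2 * \<i> * \<eta>) = 0" unfolding e by simp
 then have "pp w = 0" using \<eta> by (auto simp: power2_eq_square algebra_simps)
 then show False using pp_nonzero[OF w] by simp
qed

text \<open>L and L' are the two halves of \<real>^6, scaled by 1/sqrt 2 because f + \<eta> X has
  square norm 2. The constant - \<i> \<eta> depends on \<eta> but the square of K does not, so the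
  two halves have opposite Hopf differentials and the same K up to sign.\<close>

lemma comb_sphere_map:
 fixes L L' :: "real^6 \<Rightarrow> real^4"
 assumes L: "linear L" "linear L'" "\<And>x y. L x \<bullet> L y + L' x \<bullet> L' y = (1/2) * (x \<bullet> y)" "\<And>y. L y $ 1 = 0"
  and L'0: "\<And>w. w \<in> D \<Longrightarrow> L' (comb w) = 0" and s: "\<And>w. w \<in> D \<Longrightarrow> s w = L (comb w)"
 shows "sphere_map D s (- \<i> * \<eta>)" "w \<in> D \<Longrightarrow> rho s w = rho g w" "w \<in> D \<Longrightarrow> (sphere_map.K s w)\<^sup>2 = - \<i> * pp w"
proof -
 have d: "comb differentiable (at w)" if "w \<in> D" for w by (rule smooth_on_differentiable[OF smooth_comb that])
 have f1: "f_1 s w = clin L (f_1 comb w)" if w: "w \<in> D" for w by (rule f_1_clin[OF L(1) D w s d[OF w]])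
 have f11: "f_11 s w = clin L (f_11 comb w)" if w: "w \<in> D" for w by (rule f_11_clin[OF L(1) D w s smooth_comb])
 have z1: "clin L' (f_1 comb w) = 0" if w: "w \<in> D" for w
  using f_1_clin[OF L(2) D w, of "\<lambda>_. 0" comb] L'0 d[OF w] by (simp add: f_1_def' del_const cvec_simps)
 have z11: "clin L' (f_11 comb w) = 0" if w: "w \<in> D" for w
 proof -
  have d0: "f_1 (\<lambda>_. 0 :: real^4) = (\<lambda>_. 0)" by (rule ext) (simp add: f_1_def' cvec_simps del_const)
  have "f_11 (\<lambda>_. 0) w = clin L' (f_11 comb w)"
   by (rule f_11_clin[OF L(2) D w _ smooth_comb]) (simp add: L'0)
  then show ?thesis by (simp add: f_11_def d0 del_const)
 qed
 have sp: "cdot (clin L x) (clin L y) = (1/2) * cdot x y" if "clin L' x = 0" for x y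
  using cdot_split[OF L(1,2,3), of x y] that by (simp add: cdot_simps)
 have rho: "rho s w = rho g w" if w: "w \<in> D" for w
  unfolding rho_def f1[OF w] conj_clin[OF L(1)] sp[OF z1[OF w]] comb_pairings(7)[OF w, unfolded rho_def] by simp
 show "rho s w = rho g w" if w: "w \<in> D" by (rule rho[OF w])
 have "smooth_on D (\<lambda>w. L (comb w))" by (rule smooth_on_linear[OF D L(1)[unfolded linear_conv_bounded_linear] smooth_comb])
 then have sm: "smooth_on D s" using smooth_on_cong[OF D, of s "\<lambda>w. L (comb w)"] s by simp
 show sp_map: "sphere_map D s (- \<i> * \<eta>)"
 proof
  show "- \<i> * \<eta> \<noteq> 0" using \<eta> by auto
  fix w assume w: "w \<in> D"
  show "s w $ 1 = 0" unfolding s[OF w] by (rule L(4))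
  have "comb w \<bullet> comb w = 2" using comb_pairings(1)[OF w] unfolding cdot_cvec by (metis of_real_eq_iff of_real_numeral)
  then show "s w \<bullet> s w = 1" unfolding s[OF w] using L(3)[of "comb w" "comb w"] L'0[OF w] by simp
  show "cdot (f_1 s w) (f_1 s w) = - \<i> * \<eta>" unfolding f1[OF w] sp[OF z1[OF w]] comb_pairings(3)[OF w] by simp
  have sc: "smooth_on D (f_1 comb)" unfolding f_1_def comp_def by (rule smooth_on_del[OF D smooth_on_cvec[OF D smooth_comb]])
  have "delb (f_1 s) w = delb (\<lambda>w. clin L (f_1 comb w)) w" by (rule del_cong(2)[OF D w f1])
  also have "\<dots> = clin L (delb (f_1 comb) w)" by (rule del_clinear(2)[OF clin(1,2)[OF L(1)] smooth_on_differentiable[OF sc w]])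
  also have "\<dots> = - rho s w *s cvec (s w)" unfolding comb_pairings(8)[OF w] clin(2,3)[OF L(1)] rho[OF w] s[OF w] ..
  finally show "delb (f_1 s) w = - rho s w *s cvec (s w)" .
 qed (rule D sm)+
 show "(sphere_map.K s w)\<^sup>2 = - \<i> * pp w" if w: "w \<in> D"
 proof -
  have "(1/2) * (- 2 + 2 * \<eta> * pp w) = (- \<i> * \<eta>)\<^sup>2 + (sphere_map.K s w)\<^sup>2 / (- \<i> * \<eta>)"
   using sphere_map.K_sq[OF sp_map w] unfolding f11[OF w] sp[OF z11[OF w]] comb_pairings(6)[OF w] .
  moreover define k where "k = - \<i> * complex_of_real \<eta>"
  moreover have kk: "k\<^sup>2 = -1" and k0: "k \<noteq> 0" and k\<eta>: "k * (of_real \<eta> * x) = - \<i> * x" for x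
   using \<eta> by (auto simp: k_def)
  moreover have "(1/2) * (- 2 + complex_of_real (2 * \<eta>) * pp w) = -1 + of_real \<eta> * pp w" by (simp add: algebra_simps)
  ultimately have "-1 + of_real \<eta> * pp w = -1 + (sphere_map.K s w)\<^sup>2 / k" by metis
  then have "of_real \<eta> * pp w = (sphere_map.K s w)\<^sup>2 / k" unfolding add_left_cancel .
  then have "(sphere_map.K s w)\<^sup>2 = k * (of_real \<eta> * pp w)" using k0 by simp
  then show ?thesis unfolding k\<eta> .
 qed
qed

end

end

lemma sphere_map_compose:
 assumes g: "open D" "smooth_on D g" and E: "open E" and t: "\<tau> holomorphic_on E" "\<tau> ` E \<subseteq> D" and x: "x \<in> E"
 shows "f_1 (\<lambda>w. g (\<tau> w)) x = deriv \<tau> x *s f_1 g (\<tau> x)"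
  and "f_11 (\<lambda>w. g (\<tau> w)) x = deriv (deriv \<tau>) x *s f_1 g (\<tau> x) + (deriv \<tau> x)\<^sup>2 *s f_11 g (\<tau> x)"
proof -
 have fd: "\<tau> field_differentiable (at x)" "deriv \<tau> field_differentiable (at x)" if "x \<in> E" for x
  using t(1) holomorphic_deriv[OF t(1) E] E holomorphic_on_imp_differentiable_at that by blast+
 have s0: "smooth_on D (\<lambda>w. cvec (g w))" by (rule smooth_on_cvec[OF g])
 have s1: "smooth_on D (f_1 g)" unfolding f_1_def comp_def by (rule smooth_on_del[OF g(1) s0])
 have td: "\<tau> x \<in> D" if "x \<in> E" for x using t that by blast
 have 1: "f_1 (\<lambda>w. g (\<tau> w)) x = deriv \<tau> x *s f_1 g (\<tau> x)" if x: "x \<in> E" for x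
  unfolding f_1_def' by (rule del_compose(1)[OF fd(1)[OF x] smooth_on_differentiable[OF s0 td[OF x]]])
 show "f_1 (\<lambda>w. g (\<tau> w)) x = deriv \<tau> x *s f_1 g (\<tau> x)" by (rule 1[OF x])
 note d = smooth_on_differentiable[OF s1 td[OF x]]
 have "f_11 (\<lambda>w. g (\<tau> w)) x = del (\<lambda>x. deriv \<tau> x *s f_1 g (\<tau> x)) x"
  unfolding f_11_def by (rule del_cong(1)[OF E x 1])
 then show "f_11 (\<lambda>w. g (\<tau> w)) x = deriv (deriv \<tau>) x *s f_1 g (\<tau> x) + (deriv \<tau> x)\<^sup>2 *s f_11 g (\<tau> x)"
  unfolding del_smult(1)[OF field_differentiable_imp_differentiable[OF fd(2)[OF x]] dd_compose_holomorphic(2)[OF fd(1)[OF x] d]]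
   del_compose(1)[OF fd(1)[OF x] d] dz_holomorphic(1)[OF fd(2)[OF x]] f_11_def
  by (simp add: vec_eq_iff power2_eq_square)
qed

text \<open>The term with \<tau>'' is orthogonal to s \<star> f_1, so K acquires the cube of
  \<tau>'; as the square of \<tau>' is 1, a single factor remains.\<close>

lemma sphere_map_K_compose:
 assumes sm: "sphere_map D g k" "sphere_map E' h k'" and E: "open E" "E \<subseteq> E'" and t: "\<tau> holomorphic_on E" "\<tau> ` E \<subseteq> D" and x: "x \<in> E" "(deriv \<tau> x)\<^sup>2 = 1"
  and h: "\<And>x. x \<in> E \<Longrightarrow> h x = g (\<tau> x)"
 shows "f_1 h x = deriv \<tau> x *s f_1 g (\<tau> x)" "sphere_map.K h x = deriv \<tau> x * sphere_map.K g (\<tau> x)"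
proof -
 interpret g: sphere_map D g k by fact
 interpret h: sphere_map E' h k' by fact
 have tx: "\<tau> x \<in> D" using t x by blast
 note c = sphere_map_compose[OF g.D g.sm E(1) t x(1)]
 have "f_1 h x = f_1 (\<lambda>w. g (\<tau> w)) x" by (rule f_1_cong[OF E(1) h x(1)])
 then have 1: "f_1 h x = deriv \<tau> x *s f_1 g (\<tau> x)" unfolding c(1) .
 then show "f_1 h x = deriv \<tau> x *s f_1 g (\<tau> x)" .
 have "f_11 h x = f_11 (\<lambda>w. g (\<tau> w)) x" by (rule f_11_cong[OF E(1) h x(1)])
 then have 2: "f_11 h x = deriv (deriv \<tau>) x *s f_1 g (\<tau> x) + f_11 g (\<tau> x)" unfolding c(2) x(2) by simp
 show "h.K x = deriv \<tau> x * g.K (\<tau> x)"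
  unfolding h.K_def g.K_def 1 2 h[OF x(1)] by (simp add: qmult_bilinear cdot_simps g.frame[OF tx])
qed

text \<open>K is cubic in the map, so composing with the antipodal map reverses its sign, while the
  metric and k are quadratic and stay.\<close>

lemma sphere_map_scale:
 assumes sm: "sphere_map D g k" and c: "c = 1 \<or> c = -1"
 shows "w \<in> D \<Longrightarrow> sphere_map.K (\<lambda>w. c *\<^sub>R g w) w = of_real c * sphere_map.K g w" "sphere_map D (\<lambda>w. c *\<^sub>R g w) k"
  "w \<in> D \<Longrightarrow> rho (\<lambda>w. c *\<^sub>R g w) w = rho g w"
proof -
 interpret g: sphere_map D g k by fact
 define L where "L y = c *\<^sub>R y" for y :: "real^4"
 have l: "linear L" by (rule linearI) (simp_all add: L_def algebra_simps)
 have cl: "clin L x = of_real c *s x" for x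
 proof -
  have "clin L x = of_real c *s (cvec (Re_vec x) + \<i> *s cvec (Im_vec x))"
   by (simp add: clin_def L_def cvec_simps vec_eq_iff algebra_simps)
  then show ?thesis using vec_eq_Re_Im by metis
 qed
 define h where "h w = c *\<^sub>R g w" for w
 have hL: "h x = L (g x)" for x by (simp add: h_def L_def)
 have 1: "f_1 h x = of_real c *s f_1 g x" if "x \<in> D" for x
  unfolding cl[symmetric] by (rule f_1_clin[OF l g.D that hL smooth_on_differentiable[OF g.sm that]])
 have 2: "f_11 h x = of_real c *s f_11 g x" if "x \<in> D" for x
  unfolding cl[symmetric] by (rule f_11_clin[OF l g.D that hL g.sm])
 have cc: "complex_of_real c * complex_of_real c = 1" "complex_of_real c * (complex_of_real c * y) = y" for y using c by auto
 have r: "rho h x = rho g x" if "x \<in> D" for x unfolding rho_def 1[OF that] by (simp add: conj_vec_simps cdot_simps cc)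
 have sm: "smooth_on D h" unfolding h_def[abs_def] by (rule smooth_on_scaleR[OF g.D smooth_on_const g.sm])
 have h: "sphere_map D h k"
 proof
  fix w assume w: "w \<in> D"
  show "h w $ 1 = 0" "h w \<bullet> h w = 1" "cdot (f_1 h w) (f_1 h w) = k"
   using g.im[OF w] g.unit[OF w] g.iso[OF w] c unfolding 1[OF w] by (auto simp: h_def cdot_simps)
  have l2: "of_real c *s (x + y) = of_real c *s x + of_real c *s y" "of_real c *s (b *s x) = b *s (of_real c *s x)" for b and x y :: "complex^4"
   by (simp_all add: vec_eq_iff algebra_simps)
  have "delb (f_1 h) w = delb (\<lambda>w. of_real c *s f_1 g w) w" by (rule del_cong(2)[OF g.D w 1])
  also have "\<dots> = of_real c *s delb (f_1 g) w" by (rule del_clinear(2)[OF l2 smooth_on_differentiable[OF g.smp w]])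
  finally show "delb (f_1 h) w = - rho h w *s cvec (h w)" unfolding g.lap[OF w] r[OF w] h_def cvec_simps by (simp add: vec_eq_iff)
 qed (rule g.D sm g.k)+
 then show "sphere_map D (\<lambda>w. c *\<^sub>R g w) k" by (simp add: h_def[abs_def])
 show "rho (\<lambda>w. c *\<^sub>R g w) w = rho g w" if w: "w \<in> D" using r[OF w] by (simp add: h_def[abs_def])
 show "sphere_map.K (\<lambda>w. c *\<^sub>R g w) w = of_real c * g.K w" if w: "w \<in> D"
 proof -
  have "sphere_map.K h w = of_real c * g.K w"
   unfolding sphere_map.K_def[OF h] g.K_def 1[OF w] 2[OF w] unfolding h_def cvec_simps by (simp add: qmult_bilinear cdot_simps cc)
  then show ?thesis by (simp add: h_def[abs_def])
 qed
qed

context surface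
begin

context
 fixes F
 assumes F: "is_plus_transform S \<A> f F" and gz: "gamma_plus_zero S \<A> f F"
begin

text \<open>A span of dimension at most 2 is described by one formula in two vectors, with 0 filling
  in for missing ones; \<open>comb_rank\<close> excludes it already on one chart.\<close>

lemma dim_span_comb:
 assumes \<eta>: "\<eta> = 1 \<or> \<eta> = -1"
 shows "3 \<le> dim (span {f p + \<eta> *\<^sub>R F p | p. p \<in> S})"
proof (rule ccontr)
 define V where "V = span {f p + \<eta> *\<^sub>R F p | p. p \<in> S}"
 assume "\<not> 3 \<le> dim (span {f p + \<eta> *\<^sub>R F p | p. p \<in> S})"
 then have dV: "dim V \<le> 2" by (simp add: V_def)
 have sV: "subspace V" by (simp add: V_def)
 obtain B where B: "pairwise orthogonal B" "\<And>x. x \<in> B \<Longrightarrow> norm x = 1" "independent B" "card B = dim V" "span B = V"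
  by (rule orthonormal_basis_subspace[OF sV]) blast
 have fB: "finite B" by (rule finiteI_independent[OF B(3)])
 have BB: "x \<bullet> x = 1" if "x \<in> B" for x using B(2)[OF that] by (simp add: norm_eq_1)
 have "\<exists>a b. \<forall>v\<in>B. v = (v \<bullet> a) *\<^sub>R a + (v \<bullet> b) *\<^sub>R b"
 proof -
  consider "card B = 0" | "card B = 1" | "card B = 2" using dV B(4) by linarith
  then show ?thesis
  proof cases
   case 1
   then show ?thesis using fB by simp
  next
   case 2
   then obtain v where "B = {v}" using card_1_singletonE by blast
   then have "\<forall>u\<in>B. u = (u \<bullet> v) *\<^sub>R v + (u \<bullet> 0) *\<^sub>R 0" using BB[of v] by simp
   then show ?thesis by blast
  next
   case 3
   then obtain v u where vu: "B = {v, u}" "v \<noteq> u" using card_2_iff by metis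
   have "v \<bullet> u = 0" "u \<bullet> v = 0" using B(1) vu unfolding pairwise_def orthogonal_def by auto
   then have "\<forall>x\<in>B. x = (x \<bullet> v) *\<^sub>R v + (x \<bullet> u) *\<^sub>R u" using BB[of v] BB[of u] vu(1) by simp
   then show ?thesis by blast
  qed
 qed
 then obtain a b where ab: "\<And>v. v \<in> B \<Longrightarrow> v = (v \<bullet> a) *\<^sub>R a + (v \<bullet> b) *\<^sub>R b" by blast
 define L where "L v = (v \<bullet> a) *\<^sub>R a + (v \<bullet> b) *\<^sub>R b" for v
 have l: "linear L" by (rule linearI) (simp_all add: L_def algebra_simps inner_add_left)
 have LV: "v = L v" if "v \<in> V" for v
  by (rule linear_eq_on_span[OF linear_id[unfolded id_def] l _ that[folded B(5)]]) (use ab in \<open>simp add: L_def\<close>)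
 obtain p where p: "p \<in> S" using S_nonempty by blast
 obtain U z r where U: "plus_chart F U z" "p \<in> U" "U \<subseteq> S" "r > 0" "z ` U = ball (z p) r"
  by (rule plus_transform_chart[OF F p openin_subtopology_self p])
 note c = plus_chartD(3)[OF U(1)]
 interpret pair6_gamma "z ` U" "local_expr f U z" "local_expr F U z" by (rule plus_chart_pair6_gamma[OF F gz U(1)])
 show False
 proof (rule comb_rank[OF \<eta> imageI[OF U(2)]])
  fix w assume "w \<in> z ` U"
  then obtain q where q: "w = z q" "q \<in> U" by blast
  have "comb \<eta> w = f q + \<eta> *\<^sub>R F q"
   using local_expr_chart[OF c q(2), where f = f] local_expr_chart[OF c q(2), where f = F] by (simp add: comb_def[OF \<eta>] q)
  then have "comb \<eta> w \<in> V" unfolding V_def using q U(3) by (auto intro: span_base)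
  then show "comb \<eta> w = (comb \<eta> w \<bullet> a) *\<^sub>R a + (comb \<eta> w \<bullet> b) *\<^sub>R b" using LV by (simp add: L_def)
 qed
qed

text \<open>The spans of f + F and of f - F are orthogonal in \<real>^6 and each has dimension at
  least 3, so the first has dimension exactly 3 and the second lies in its complement.\<close>

lemma splitting_exists:
 obtains A R :: "real^6 \<Rightarrow> real^6" where "orthogonal_transformation A" "orthogonal_transformation R" "\<forall>y. A (R y) = y"
  "\<forall>p\<in>S. R (f p + F p) $ 4 = 0 \<and> R (f p + F p) $ 5 = 0 \<and> R (f p + F p) $ 6 = 0"
  "\<forall>p\<in>S. R (f p - F p) $ 1 = 0 \<and> R (f p - F p) $ 2 = 0 \<and> R (f p - F p) $ 3 = 0"
proof -
 define V where "V = span {f p + F p | p. p \<in> S}"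
 have sV: "subspace V" by (simp add: V_def)
 have orth: "(f q - F q) \<bullet> v = 0" if "q \<in> S" "v \<in> V" for q v
 proof -
  have "orthogonal (f q - F q) v" using that(2) unfolding V_def
   by (rule orthogonal_to_span) (use sum_orth_diff[OF F gz _ that(1)] in \<open>auto simp: orthogonal_def inner_commute\<close>)
  then show ?thesis by (simp add: orthogonal_def)
 qed
 have 1: "3 \<le> dim V" using dim_span_comb[of 1] by (simp add: V_def)
 define W where "W = {y \<in> UNIV. \<forall>x\<in>V. orthogonal x y}"
 have sW: "subspace W" unfolding W_def by (auto simp: subspace_def orthogonal_def inner_add_right)
 have dW: "dim W + dim V = 6" unfolding W_def using dim_subspace_orthogonal_to_vectors[OF sV subspace_UNIV] by simp
 have "span {f p + (-1) *\<^sub>R F p | p. p \<in> S} \<subseteq> W"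
  by (rule span_minimal[OF _ sW]) (use orth in \<open>auto simp: W_def orthogonal_def inner_commute\<close>)
 then have "dim (span {f p + (-1) *\<^sub>R F p | p. p \<in> S}) \<le> dim W" by (rule dim_subset)
 then have dV: "dim V = 3" using dim_span_comb[of "-1"] 1 dW by simp
 obtain A R :: "real^6 \<Rightarrow> real^6" where AR: "orthogonal_transformation A" "orthogonal_transformation R" "\<forall>y. A (R y) = y"
  "\<forall>y\<in>V. R y $ 4 = 0 \<and> R y $ 5 = 0 \<and> R y $ 6 = 0"
  "\<forall>y. (\<forall>v\<in>V. y \<bullet> v = 0) \<longrightarrow> R y $ 1 = 0 \<and> R y $ 2 = 0 \<and> R y $ 3 = 0" by (rule orthogonal_splitting[OF sV dV])
 show ?thesis
 proof (rule that[OF AR(1,2,3)]; rule ballI)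
  fix p assume p: "p \<in> S"
  have "f p + F p \<in> V" unfolding V_def by (rule span_base) (use p in blast)
  then show "R (f p + F p) $ 4 = 0 \<and> R (f p + F p) $ 5 = 0 \<and> R (f p + F p) $ 6 = 0" by (rule AR(4)[rule_format])
  show "R (f p - F p) $ 1 = 0 \<and> R (f p - F p) $ 2 = 0 \<and> R (f p - F p) $ 3 = 0"
   by (rule AR(5)[rule_format]) (rule orth[OF p])
 qed
qed

end

end

context quat_pair
begin

text \<open>Near a point the lift coincides with the normalised section started from its own value
  there: both are lifts, and the positive product excludes the opposite sign.\<close>

lemma continuous_lift_smooth:
 assumes E: "open E" "E \<subseteq> D" and G: "continuous_on E G" and lift: "\<And>w. w \<in> E \<Longrightarrow> lift_at w (G w)"
 shows "smooth_on E G"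
proof (rule smooth_on_local)
 fix x0 assume x0: "x0 \<in> E"
 let ?s = "sect (G x0)"
 define E' where "E' = E \<inter> (\<lambda>x. G x \<bullet> ?s x) -` {0<..}"
 have ss: "smooth_on E ?s" by (rule smooth_on_subset[OF smooth_sect E(2)])
 have "continuous_on E (\<lambda>x. G x \<bullet> ?s x)" by (rule continuous_on_inner[OF G smooth_on_continuous_on[OF ss]])
 then have oE: "open E'" unfolding E'_def by (rule continuous_open_preimage[OF _ E(1)]) simp
 have "G x0 \<bullet> ?s x0 = 4" using lift[OF x0] lift_sect[of x0 "G x0"] x0 E(2) by (auto simp: lift_at_def)
 then have x0': "x0 \<in> E'" using x0 by (simp add: E'_def)
 have EE: "E' \<subseteq> E" by (auto simp: E'_def)
 have nz: "?s x \<noteq> 0" if "x \<in> E'" for x using that by (auto simp: E'_def)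
 have eq: "G x = (1 / norm (?s x)) *\<^sub>R ?s x" if x: "x \<in> E'" for x
 proof -
  have xE: "x \<in> E" and xD: "x \<in> D" using x EE E(2) by blast+
  have "(1 / norm (?s x)) *\<^sub>R ?s x = G x \<or> (1 / norm (?s x)) *\<^sub>R ?s x = - G x"
   by (rule lift_unique[OF xD lift[OF xE] sect_lift[OF xD nz[OF x]]])
  moreover have "0 < G x \<bullet> ((1 / norm (?s x)) *\<^sub>R ?s x)" using x nz[OF x] by (simp add: E'_def)
  moreover have "\<not> 0 < G x \<bullet> (- G x)" by (simp add: not_less)
  ultimately show ?thesis by metis
 qed
 have "smooth_on E' (\<lambda>x. (1 / norm (?s x)) *\<^sub>R ?s x)"
  by (rule smooth_on_scaleR[OF oE smooth_on_divide[OF oE smooth_on_const smooth_on_norm[OF oE]]])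
   (use smooth_on_subset[OF ss EE] nz in auto)
 then have "smooth_on E' G" using smooth_on_cong[OF oE, of G "\<lambda>x. (1 / norm (?s x)) *\<^sub>R ?s x"] eq by simp
 then show "\<exists>E'. open E' \<and> x0 \<in> E' \<and> smooth_on E' G" using oE x0' by blast
qed

end

section \<open>The two sphere maps of the splitting\<close>

locale split_surface = surface S \<A> f
 for S :: "'a::t2_space set" and \<A> :: "('a set \<times> ('a \<Rightarrow> complex)) set" and f :: "'a \<Rightarrow> real^6" +
 fixes F :: "'a \<Rightarrow> real^6" and A R :: "real^6 \<Rightarrow> real^6"
 assumes F: "is_plus_transform S \<A> f F" and gz: "gamma_plus_zero S \<A> f F"
  and oA: "orthogonal_transformation A" and oR: "orthogonal_transformation R" and AR: "\<And>y. A (R y) = y"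
  and RP: "\<And>p. p \<in> S \<Longrightarrow> R (f p + F p) $ 4 = 0 \<and> R (f p + F p) $ 5 = 0 \<and> R (f p + F p) $ 6 = 0"
  and RM: "\<And>p. p \<in> S \<Longrightarrow> R (f p - F p) $ 1 = 0 \<and> R (f p - F p) $ 2 = 0 \<and> R (f p - F p) $ 3 = 0"
begin

text \<open>The leading 0 turns three coordinates into an imaginary quaternion, and sqrt 2 / 2
  normalises f + F, whose square norm is 2.\<close>

definition L1 :: "real^6 \<Rightarrow> real^4" where "L1 y = (sqrt 2 / 2) *\<^sub>R vector [0, R y $ 1, R y $ 2, R y $ 3]"
definition L2 :: "real^6 \<Rightarrow> real^4" where "L2 y = (sqrt 2 / 2) *\<^sub>R vector [0, R y $ 4, R y $ 5, R y $ 6]"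
definition sg where "sg p = L1 (f p + 1 *\<^sub>R F p)"
definition td where "td p = L2 (f p + (-1) *\<^sub>R F p)"

lemma linear_R: "linear R" by (rule orthogonal_transformation_linear[OF oR])

lemma linear_L: "linear L1" "linear L2"
 by (rule linearI; rule vec4_eqI; simp add: L1_def L2_def vector_4 linear_add[OF linear_R] linear_scale[OF linear_R] algebra_simps)+

lemma L_split: "L1 x \<bullet> L1 y + L2 x \<bullet> L2 y = (1/2) * (x \<bullet> y)" "L2 x \<bullet> L2 y + L1 x \<bullet> L1 y = (1/2) * (x \<bullet> y)"
 "L1 y $ 1 = 0" "L2 y $ 1 = 0"
proof -
 have "x \<bullet> y = R x \<bullet> R y" using oR by (simp add: orthogonal_transformation_def)
 have s2: "sqrt 2 * (sqrt 2 * u) = 2 * u" for u :: real unfolding mult.assoc[symmetric] by simp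
 show "L1 x \<bullet> L1 y + L2 x \<bullet> L2 y = (1/2) * (x \<bullet> y)"
  unfolding \<open>x \<bullet> y = R x \<bullet> R y\<close> by (simp add: inner_6 L1_def L2_def inner_vec_def sum_4 vector_4 s2 algebra_simps)
 from this show "L2 x \<bullet> L2 y + L1 x \<bullet> L1 y = (1/2) * (x \<bullet> y)" by (simp add: add.commute)
 show "L1 y $ 1 = 0" "L2 y $ 1 = 0" by (simp_all add: L1_def L2_def vector_4)
qed

lemma L_zero: "p \<in> S \<Longrightarrow> L2 (f p + 1 *\<^sub>R F p) = 0" "p \<in> S \<Longrightarrow> L1 (f p + (-1) *\<^sub>R F p) = 0"
 using RP[of p] RM[of p] by (auto simp: L1_def L2_def vector_4 intro!: vec4_eqI)

context
 fixes U z assumes pc: "plus_chart F U z"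
begin

interpretation pair6_gamma "z ` U" "local_expr f U z" "local_expr F U z" by (rule plus_chart_pair6_gamma[OF F gz pc])

lemma comb_chart: "w \<in> z ` U \<Longrightarrow> \<exists>q\<in>S. comb \<eta> w = f q + \<eta> *\<^sub>R F q \<and> inv_into U z w = q" if "\<eta> = 1 \<or> \<eta> = -1"
proof -
 assume "w \<in> z ` U"
 then obtain q where q: "w = z q" "q \<in> U" by blast
 note c = plus_chartD(3)[OF pc]
 have "comb \<eta> w = f q + \<eta> *\<^sub>R F q"
  using local_expr_chart[OF c q(2), where f = f] local_expr_chart[OF c q(2), where f = F] by (simp add: comb_def[OF that] q)
 then show ?thesis using chartD(4)[OF c] chartD(7)[OF c q(2)] q by blast
qed

lemma sg_map: "sphere_map (z ` U) (local_expr sg U z) (- \<i>)"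
 and sg_rho: "w \<in> z ` U \<Longrightarrow> rho (local_expr sg U z) w = rho (local_expr f U z) w"
 and sg_K: "w \<in> z ` U \<Longrightarrow> (sphere_map.K (local_expr sg U z) w)\<^sup>2 = - \<i> * pp w"
proof -
 have e: "(1::real) = 1 \<or> (1::real) = -1" by simp
 have 1: "L2 (comb 1 w) = 0" if "w \<in> z ` U" for w using comb_chart[OF e that] L_zero(1) by force
 have 2: "local_expr sg U z w = L1 (comb 1 w)" if "w \<in> z ` U" for w
  using comb_chart[OF e that] by (auto simp: local_expr_def sg_def)
 note c = comb_sphere_map[OF e linear_L(1,2) L_split(1,3) 1 2]
 show "sphere_map (z ` U) (local_expr sg U z) (- \<i>)" using c(1) by simp
 show "w \<in> z ` U \<Longrightarrow> rho (local_expr sg U z) w = rho (local_expr f U z) w" by (rule c(2))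
 show "w \<in> z ` U \<Longrightarrow> (sphere_map.K (local_expr sg U z) w)\<^sup>2 = - \<i> * pp w" by (rule c(3))
qed

lemma td_map: "sphere_map (z ` U) (local_expr td U z) \<i>"
 and td_rho: "w \<in> z ` U \<Longrightarrow> rho (local_expr td U z) w = rho (local_expr f U z) w"
 and td_K: "w \<in> z ` U \<Longrightarrow> (sphere_map.K (local_expr td U z) w)\<^sup>2 = - \<i> * pp w"
proof -
 have e: "(-1::real) = 1 \<or> (-1::real) = -1" by simp
 have 1: "L1 (comb (-1) w) = 0" if "w \<in> z ` U" for w using comb_chart[OF e that] L_zero(2) by force
 have 2: "local_expr td U z w = L2 (comb (-1) w)" if "w \<in> z ` U" for w
  using comb_chart[OF e that] by (auto simp: local_expr_def td_def)
 note c = comb_sphere_map[OF e linear_L(2,1) L_split(2,4) 1 2]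
 show "sphere_map (z ` U) (local_expr td U z) \<i>" using c(1) by simp
 show "w \<in> z ` U \<Longrightarrow> rho (local_expr td U z) w = rho (local_expr f U z) w" by (rule c(2))
 show "w \<in> z ` U \<Longrightarrow> (sphere_map.K (local_expr td U z) w)\<^sup>2 = - \<i> * pp w" by (rule c(3))
qed

lemma K_sign:
 assumes "w \<in> z ` U"
 shows "sphere_map.K (local_expr td U z) w \<noteq> 0"
  "sphere_map.K (local_expr sg U z) w = sphere_map.K (local_expr td U z) w \<or> sphere_map.K (local_expr sg U z) w = - sphere_map.K (local_expr td U z) w"
 using sg_K[OF assms] td_K[OF assms] pp_nonzero[OF assms] power2_eq_iff[of "sphere_map.K (local_expr sg U z) w" "sphere_map.K (local_expr td U z) w"]
 by auto

end

text \<open>Here c is the derivative of the transition map. Both coordinates induce the same F, with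
  (F, f_2) = \<i> in each, and \<open>f_2\<close> changes by c^2; so of the fourth roots of unity
  only \<plusminus>1 are left.\<close>

lemma transition:
 assumes U: "plus_chart F U z" and V: "plus_chart F V w" and q: "q \<in> U" "q \<in> V"
 obtains c where "c\<^sup>2 = 1"
  "f_1 (local_expr sg V w) (w q) = c *s f_1 (local_expr sg U z) (z q)" "f_1 (local_expr td V w) (w q) = c *s f_1 (local_expr td U z) (z q)"
  "sphere_map.K (local_expr sg V w) (w q) = c * sphere_map.K (local_expr sg U z) (z q)"
  "sphere_map.K (local_expr td V w) (w q) = c * sphere_map.K (local_expr td U z) (z q)"
proof -
 define \<tau> where "\<tau> = z \<circ> inv_into V w"
 define E where "E = w ` (U \<inter> V)"
 note aU = plus_chartD(1)[OF U] and aV = plus_chartD(1)[OF V]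
 note cU = plus_chartD(2)[OF U] and cV = plus_chartD(2)[OF V]
 note tp = transition_properties[OF rs cU cV, folded \<tau>_def E_def]
 have x: "w q \<in> E" using q by (simp add: E_def)
 have tq: "\<tau> (w q) = z q" by (rule tp(7)[OF q])
 have E: "E \<subseteq> w ` V" by (auto simp: E_def)
 have fe: "f_plus (local_expr f U z) (z q) = F q" "f_plus (local_expr f V w) (w q) = F q"
  by (rule bspec[OF conjunct2[OF U[unfolded plus_chart_def]] q(1), symmetric], rule bspec[OF conjunct2[OF V[unfolded plus_chart_def]] q(2), symmetric])
 have "cdot (cvec (F q)) (f_2 (local_expr f U z) (z q)) = \<i>" "cdot (cvec (F q)) (f_2 (local_expr f V w) (w q)) = \<i>"
  using adapted6.f_plus_props(4)[OF adapted6[OF aU] imageI[OF q(1)]] adapted6.f_plus_props(4)[OF adapted6[OF aV] imageI[OF q(2)]] unfolding fe .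
 then have d2: "(deriv \<tau> (w q))\<^sup>2 = 1"
  unfolding adapted_transition(2)[OF aU aV q, folded \<tau>_def] by (simp add: cdot_simps)
 note k1 = sphere_map_K_compose[OF sg_map[OF U] sg_map[OF V] tp(1) E tp(2,4) x d2 tp(6), unfolded tq]
 note k2 = sphere_map_K_compose[OF td_map[OF U] td_map[OF V] tp(1) E tp(2,4) x d2 tp(6), unfolded tq]
 show ?thesis by (rule that[OF d2 k1(1) k2(1) k1(2) k2(2)])
qed

text \<open>The squares of the two K agree, so their quotient is \<plusminus>1 and locally constant.
  A change of coordinate multiplies both by the same c, so the sign is a function on the connected
  S.\<close>

lemma sign_exists:
 obtains e :: real where "e = 1 \<or> e = -1"
  "\<And>U z q. plus_chart F U z \<Longrightarrow> q \<in> U \<Longrightarrow> sphere_map.K (local_expr sg U z) (z q) = - of_real e * sphere_map.K (local_expr td U z) (z q)"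
proof -
 define P :: "real \<Rightarrow> 'a set" where "P e = {q. \<exists>U z. plus_chart F U z \<and> q \<in> U \<and>
  sphere_map.K (local_expr sg U z) (z q) = - of_real e * sphere_map.K (local_expr td U z) (z q)}" for e
 have indep: "sphere_map.K (local_expr sg V w) (w q) = - of_real e * sphere_map.K (local_expr td V w) (w q)"
  if qP: "q \<in> P e" and V: "plus_chart F V w" "q \<in> V" for e q V w
 proof -
  obtain U z where U: "plus_chart F U z" "q \<in> U"
   and k: "sphere_map.K (local_expr sg U z) (z q) = - of_real e * sphere_map.K (local_expr td U z) (z q)"
   using qP unfolding P_def by blast
  obtain c where c: "sphere_map.K (local_expr sg V w) (w q) = c * sphere_map.K (local_expr sg U z) (z q)"
   "sphere_map.K (local_expr td V w) (w q) = c * sphere_map.K (local_expr td U z) (z q)"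
   by (rule transition[OF U(1) V(1) U(2) V(2)])
  show ?thesis unfolding c k by simp
 qed
 have oP: "openin (top_of_set S) (P e)" for e
 proof (subst openin_subopen, intro ballI)
  fix p assume p: "p \<in> P e"
  have pS: "p \<in> S" using p chartD(4) plus_chartD(3) unfolding P_def by blast
  obtain U z r where U: "plus_chart F U z" "p \<in> U" "U \<subseteq> S" "r > 0" "z ` U = ball (z p) r"
   by (rule plus_transform_chart[OF F pS openin_subtopology_self pS])
  interpret s: sphere_map "z ` U" "local_expr sg U z" "- \<i>" by (rule sg_map[OF U(1)])
  interpret t: sphere_map "z ` U" "local_expr td U z" \<i> by (rule td_map[OF U(1)])
  have cK: "continuous_on (z ` U) s.K" "continuous_on (z ` U) t.K"
   unfolding s.K_def[abs_def] t.K_def[abs_def]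
   by (rule smooth_on_continuous_on[OF smooth_on_cdot[OF s.D s.smpp smooth_on_bilinear[OF s.D bounded_bilinear_qmult(2) s.smS s.smp]]],
     rule smooth_on_continuous_on[OF smooth_on_cdot[OF t.D t.smpp smooth_on_bilinear[OF t.D bounded_bilinear_qmult(2) t.smS t.smp]]])
  define k where "k x = s.K x / t.K x" for x
  have "continuous_on (z ` U) k" unfolding k_def by (rule continuous_on_divide[OF cK]) (use K_sign(1)[OF U(1)] in blast)
  moreover have "k x \<in> {1, -1}" if "x \<in> z ` U" for x using K_sign[OF U(1) that] by (auto simp: k_def)
  then have "finite (k ` z ` U)" by (intro finite_subset[of "k ` z ` U" "{1, -1}"]) blast+
  moreover have "connected (z ` U)" unfolding U(5) by simp
  ultimately have "k constant_on (z ` U)" by (intro continuous_finite_range_constant)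
  then obtain k0 where k0: "\<And>x. x \<in> z ` U \<Longrightarrow> k x = k0" unfolding constant_on_def by blast
  have kk: "s.K x = k0 * t.K x" if "x \<in> z ` U" for x using k0[OF that] K_sign(1)[OF U(1) that] by (auto simp: k_def)
  have "s.K (z p) = - of_real e * t.K (z p)" by (rule indep[OF p U(1,2)])
  then have "k0 * t.K (z p) = (- of_real e) * t.K (z p)" using kk[OF imageI[OF U(2)]] by simp
  then have "k0 = - of_real e" using K_sign(1)[OF U(1) imageI[OF U(2)]] by (simp only: mult_cancel_right) simp
  then have "U \<subseteq> P e" using kk U(1) unfolding P_def by blast
  then show "\<exists>T. openin (top_of_set S) T \<and> p \<in> T \<and> T \<subseteq> P e"
   using chartD(1)[OF plus_chartD(3)[OF U(1)]] U(2) by blast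
 qed
 have cover: "S \<subseteq> P 1 \<union> P (-1)"
 proof
  fix p assume p: "p \<in> S"
  obtain U z r where U: "plus_chart F U z" "p \<in> U" "U \<subseteq> S" "r > 0" "z ` U = ball (z p) r"
   by (rule plus_transform_chart[OF F p openin_subtopology_self p])
  show "p \<in> P 1 \<union> P (-1)" using K_sign(2)[OF U(1) imageI[OF U(2)]] U(1,2) unfolding P_def by auto
 qed
 have "P 1 \<inter> P (-1) = {}"
 proof (rule equals0I)
  fix q assume q: "q \<in> P 1 \<inter> P (-1)"
  then obtain U z where U: "plus_chart F U z" "q \<in> U" unfolding P_def by blast
  show False using indep[of q 1, OF _ U] indep[of q "-1", OF _ U] q K_sign(1)[OF U(1) imageI[OF U(2)]] by simp
 qed
 then have "P 1 = {} \<or> P (-1) = {}" using connected_S oP cover unfolding connected_openin by blast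
 then obtain e :: real where e: "e = 1 \<or> e = -1" "S \<subseteq> P e" using cover by blast
 show ?thesis
 proof (rule that[OF e(1)])
  fix U z q assume U: "plus_chart F U z" "q \<in> U"
  then have "q \<in> P e" using e(2) chartD(4)[OF plus_chartD(3)[OF U(1)]] by blast
  then show "sphere_map.K (local_expr sg U z) (z q) = - of_real e * sphere_map.K (local_expr td U z) (z q)" by (rule indep[OF _ U])
 qed
qed

end

section \<open>Coverings of Riemann surfaces\<close>

text \<open>Over a connected evenly covered set the sheets are connected, so each lies in the
  component or misses it. For the same reason the image of the component is open and closed, hence
  all of S.\<close>

lemma connected_component_covering:
 assumes cov: "covering_space C \<pi> S" and conS: "connected S" and c: "c \<in> C"
  and lc: "\<And>x T. x \<in> S \<Longrightarrow> openin (top_of_set S) T \<Longrightarrow> x \<in> T \<Longrightarrow> \<exists>T'. openin (top_of_set S) T' \<and> connected T' \<and> x \<in> T' \<and> T' \<subseteq> T"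
 shows "covering_space (connected_component_set C c) \<pi> S" "openin (top_of_set C) (connected_component_set C c)"
proof -
 define K where "K = connected_component_set C c"
 have KC: "K \<subseteq> C" and cK: "c \<in> K" using c by (simp_all add: K_def connected_component_subset)
 have absorb: "u \<subseteq> K" if "connected u" "u \<subseteq> C" "y \<in> u" "y \<in> K" for u y
 proof -
  have "connected_component_set C y = K" using that(4) unfolding K_def by (metis connected_component_eq)
  then show ?thesis using connected_component_maximal[OF that(3,1,2)] by simp
 qed
 have cont: "continuous_on C \<pi>" and im: "\<pi> ` C = S" using cov by (simp_all add: covering_space_def)
 have sheets: "\<exists>T v. x \<in> T \<and> openin (top_of_set S) T \<and> \<Union>v = C \<inter> \<pi> -` T \<and> pairwise disjnt v \<and>
   (\<forall>u\<in>v. openin (top_of_set C) u \<and> connected u \<and> (\<exists>q. homeomorphism u T \<pi> q))" if x: "x \<in> S" for x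
 proof -
  obtain T v where T: "x \<in> T" "openin (top_of_set S) T" and v: "\<Union>v = C \<inter> \<pi> -` T" "\<forall>u\<in>v. openin (top_of_set C) u"
   "pairwise disjnt v" "\<forall>u\<in>v. \<exists>q. homeomorphism u T \<pi> q" using cov x unfolding covering_space_def by metis
  obtain T' where T': "openin (top_of_set S) T'" "connected T'" "x \<in> T'" "T' \<subseteq> T" using lc[OF x T(2,1)] by blast
  have op: "openin (top_of_set C) (C \<inter> \<pi> -` T')" by (rule continuous_openin_preimage[OF cont _ T'(1)]) (use im in blast)
  define v' where "v' = (\<lambda>u. u \<inter> \<pi> -` T') ` v"
  have "\<Union>v' = \<Union>v \<inter> \<pi> -` T'" unfolding v'_def by blast
  then have 1: "\<Union>v' = C \<inter> \<pi> -` T'" unfolding v(1) using T'(4) by blast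
  have 2: "pairwise disjnt v'"
   unfolding v'_def pairwise_image by (rule pairwise_mono[OF v(3)]) (auto simp: disjnt_def)
  have 3: "openin (top_of_set C) w \<and> connected w \<and> (\<exists>q. homeomorphism w T' \<pi> q)" if wv: "w \<in> v'" for w
  proof -
   obtain u where u: "w = u \<inter> \<pi> -` T'" "u \<in> v" using wv unfolding v'_def by (rule imageE)
   note u = u(2,1)
   have uC: "u \<subseteq> C" using u(1) v(2) openin_imp_subset by blast
   obtain q where q: "homeomorphism u T \<pi> q" using v(4) u(1) by blast
   have "\<pi> ` u = T" using q by (simp add: homeomorphism_def)
   then have "\<pi> ` w = T'" using T'(4) unfolding u(2) by blast
   then have hw: "homeomorphism w T' \<pi> q" using homeomorphism_of_subsets[OF q _ T'(4), of w] u(2) by blast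
   then have "w = q ` T'" "continuous_on T' q" by (simp_all add: homeomorphism_def)
   then have "connected w" using connected_continuous_image[OF _ T'(2)] by simp
   moreover have "w = u \<inter> (C \<inter> \<pi> -` T')" unfolding u(2) using uC by blast
   then have "openin (top_of_set C) w" using openin_Int[OF bspec[OF v(2) u(1)] op] by simp
   ultimately show ?thesis using hw by blast
  qed
  show ?thesis by (intro exI[of _ T'] exI[of _ v'] conjI T'(1,3) 1 2 ballI 3)
 qed
 have openK: "openin (top_of_set C) K"
 proof (subst openin_subopen, intro ballI)
  fix y assume y: "y \<in> K"
  then have "\<pi> y \<in> S" using KC im by blast
  then obtain T v where T: "\<pi> y \<in> T" "\<Union>v = C \<inter> \<pi> -` T" "\<forall>u\<in>v. openin (top_of_set C) u \<and> connected u \<and> (\<exists>q. homeomorphism u T \<pi> q)"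
   using sheets by metis
  then obtain u where u: "u \<in> v" "y \<in> u" using y KC by blast
  then have "u \<subseteq> K" using absorb[of u y] T(3) openin_imp_subset y by metis
  then show "\<exists>T. openin (top_of_set C) T \<and> y \<in> T \<and> T \<subseteq> K" using u T(3) by blast
 qed
 then show "openin (top_of_set C) (connected_component_set C c)" unfolding K_def .
 have hit: "\<exists>T. x \<in> T \<and> openin (top_of_set S) T \<and> (T \<inter> \<pi> ` K \<noteq> {} \<longrightarrow> T \<subseteq> \<pi> ` K)" if xS: "x \<in> S" for x
 proof -
  obtain T v where T: "x \<in> T" "openin (top_of_set S) T" "\<Union>v = C \<inter> \<pi> -` T"
   "\<forall>u\<in>v. openin (top_of_set C) u \<and> connected u \<and> (\<exists>q. homeomorphism u T \<pi> q)" using sheets[OF xS] by metis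
  have "T \<subseteq> \<pi> ` K" if yK: "y \<in> K" "\<pi> y \<in> T" for y
  proof -
   obtain u where u: "u \<in> v" "y \<in> u" using T(3) yK KC by blast
   then have "u \<subseteq> K" using absorb[of u y] T(4) openin_imp_subset yK by metis
   moreover have "\<pi> ` u = T" using T(4) u(1) unfolding homeomorphism_def by blast
   ultimately show ?thesis by blast
  qed
  then show ?thesis using T(1,2) by blast
 qed
 have 1: "openin (top_of_set S) (\<pi> ` K)"
 proof (subst openin_subopen, intro ballI)
  fix x assume x: "x \<in> \<pi> ` K"
  then have "x \<in> S" using KC im by blast
  then show "\<exists>T. openin (top_of_set S) T \<and> x \<in> T \<and> T \<subseteq> \<pi> ` K" using hit[of x] x by blast
 qed
 have 2: "openin (top_of_set S) (S - \<pi> ` K)"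
 proof (subst openin_subopen, intro ballI)
  fix x assume x: "x \<in> S - \<pi> ` K"
  then obtain T where T: "x \<in> T" "openin (top_of_set S) T" "T \<inter> \<pi> ` K \<noteq> {} \<longrightarrow> T \<subseteq> \<pi> ` K" using hit[of x] by blast
  then have "T \<subseteq> S - \<pi> ` K" using x openin_imp_subset[OF T(2)] by blast
  then show "\<exists>T. openin (top_of_set S) T \<and> x \<in> T \<and> T \<subseteq> S - \<pi> ` K" using T by blast
 qed
 have "S - \<pi> ` K = {}" using conS 1 2 cK unfolding connected_openin by blast
 then have imK: "\<pi> ` K = S" using KC im by blast
 have "covering_space K \<pi> S"
 proof
  show "continuous_on K \<pi>" by (rule continuous_on_subset[OF cont KC])
  show "\<pi> ` K = S" by (rule imK)
  fix x assume "x \<in> S"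
  then obtain T v where T: "x \<in> T" "openin (top_of_set S) T" "\<Union>v = C \<inter> \<pi> -` T" "pairwise disjnt v"
   "\<forall>u\<in>v. openin (top_of_set C) u \<and> connected u \<and> (\<exists>q. homeomorphism u T \<pi> q)" using sheets by metis
  define v' where "v' = {u \<in> v. u \<inter> K \<noteq> {}}"
  have sub: "u \<subseteq> K" if uv: "u \<in> v'" for u
  proof -
   obtain y where y: "y \<in> u" "y \<in> K" using uv unfolding v'_def by blast
   have "openin (top_of_set C) u" "connected u" using T(5) uv by (simp_all add: v'_def)
   then show ?thesis using absorb[OF _ _ y] openin_imp_subset by blast
  qed
  have u1: "\<Union>v' = K \<inter> \<pi> -` T"
  proof
   show "\<Union>v' \<subseteq> K \<inter> \<pi> -` T" using sub T(3) unfolding v'_def by blast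
   show "K \<inter> \<pi> -` T \<subseteq> \<Union>v'" using T(3) KC unfolding v'_def by blast
  qed
  have "openin (top_of_set K) u" if "u \<in> v'" for u
   by (rule openin_subset_trans[OF _ sub[OF that] KC]) (use T(5) that in \<open>simp add: v'_def\<close>)
  moreover have "pairwise disjnt v'" by (rule pairwise_subset[OF T(4)]) (auto simp: v'_def)
  moreover have "\<forall>u\<in>v'. \<exists>q. homeomorphism u T \<pi> q" using T(5) by (simp add: v'_def)
  ultimately show "\<exists>T. x \<in> T \<and> openin (top_of_set S) T \<and> (\<exists>v. \<Union>v = K \<inter> \<pi> -` T \<and> (\<forall>u\<in>v. openin (top_of_set K) u) \<and> pairwise disjnt v \<and> (\<forall>u\<in>v. \<exists>q. homeomorphism u T \<pi> q))"
   using T(1,2) u1 by blast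
 qed
 then show "covering_space (connected_component_set C c) \<pi> S" unfolding K_def .
qed

text \<open>Charts are pulled back from sheets that map homeomorphically onto a whole coordinate
  domain; their transition maps are restrictions of those of S.\<close>

lemma covering_riemann_surface:
 fixes C :: "'c::t2_space set" and S :: "'a::t2_space set"
 assumes rs: "riemann_surface S \<A>" and cov: "covering_space C \<pi> S" and con: "connected C" "C \<noteq> {}"
 obtains \<B> where "riemann_surface C \<B>" "holomorphic_map C \<B> S \<A> \<pi>"
proof -
 have cont: "continuous_on C \<pi>" and im: "\<pi> ` C = S" using cov by (simp_all add: covering_space_def)
 define lift where "lift W U z \<longleftrightarrow> openin (top_of_set C) W \<and> complex_coordinate S \<A> U z \<and> (\<exists>h. homeomorphism W U \<pi> h)" for W U z
 define \<B> where "\<B> = {(W, z \<circ> \<pi>) | W z. \<exists>U. lift W U z}"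
 have ch: "chart C W (z \<circ> \<pi>)" and piW: "\<pi> ` W = U" and injW: "inj_on (z \<circ> \<pi>) W" if lft: "lift W U z" for W U z
 proof -
  obtain h where W: "openin (top_of_set C) W" and ccU: "complex_coordinate S \<A> U z" and h: "homeomorphism W U \<pi> h" using lft unfolding lift_def by blast
  have cU: "chart S U z" by (rule complex_coordinate_chart[OF ccU])
  show piW: "\<pi> ` W = U" using h by (simp add: homeomorphism_def)
  have "inj_on \<pi> W" using h unfolding homeomorphism_def by (metis inj_on_inverseI)
  then show inj: "inj_on (z \<circ> \<pi>) W" using comp_inj_on chartD(3)[OF cU] piW by blast
  have hz: "homeomorphism U (z ` U) z (inv_into U z)" using cU by (simp add: chart_def)
  have hc: "homeomorphism W (z ` U) (z \<circ> \<pi>) (h \<circ> inv_into U z)" by (rule homeomorphism_compose[OF h hz])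
  have "(h \<circ> inv_into U z) x = inv_into W (z \<circ> \<pi>) x" if "x \<in> z ` U" for x
  proof -
   have "x \<in> (z \<circ> \<pi>) ` W" using that unfolding image_comp[symmetric] piW .
   then obtain y where y: "x = (z \<circ> \<pi>) y" "y \<in> W" by (rule imageE)
   then have "(h \<circ> inv_into U z) x = y" using hc by (simp add: homeomorphism_def)
   then show ?thesis using inv_into_f_f[OF inj y(2)] y(1) by simp
  qed
  then have "homeomorphism W (z ` U) (z \<circ> \<pi>) (inv_into W (z \<circ> \<pi>))" by (intro homeomorphism_cong[OF hc]) auto
  moreover have "(z \<circ> \<pi>) ` W = z ` U" unfolding image_comp[symmetric] piW ..
  ultimately show "chart C W (z \<circ> \<pi>)" unfolding chart_def using W chartD(2)[OF cU] by simp
 qed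
 have compat: "((z' \<circ> \<pi>) \<circ> inv_into W (z \<circ> \<pi>)) holomorphic_on (z \<circ> \<pi>) ` (W \<inter> W')" if l: "lift W U z" "lift W' U' z'" for W U z W' U' z'
 proof -
  have ccU: "complex_coordinate S \<A> U z" and ccU': "complex_coordinate S \<A> U' z'" using l by (simp_all add: lift_def)
  have h: "(z' \<circ> inv_into U z) holomorphic_on z ` (U' \<inter> U)" by (rule transition_holomorphic[OF rs ccU' ccU])
  have s: "(z \<circ> \<pi>) ` (W \<inter> W') \<subseteq> z ` (U' \<inter> U)"
   unfolding image_comp[symmetric] using piW[OF l(1)] piW[OF l(2)] by blast
  show ?thesis
  proof (rule holomorphic_transform[OF holomorphic_on_subset[OF h s]])
   fix x assume "x \<in> (z \<circ> \<pi>) ` (W \<inter> W')"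
   then obtain y where y: "x = (z \<circ> \<pi>) y" "y \<in> W \<inter> W'" by (rule imageE)
   then have yW: "y \<in> W" by blast
   then have "\<pi> y \<in> U" using piW[OF l(1)] by blast
   then have "inv_into U z (z (\<pi> y)) = \<pi> y" by (rule chartD(7)[OF complex_coordinate_chart[OF ccU]])
   then show "(z' \<circ> inv_into U z) x = ((z' \<circ> \<pi>) \<circ> inv_into W (z \<circ> \<pi>)) x"
    using inv_into_f_f[OF injW[OF l(1)] yW] y(1) by simp
  qed
 qed
 have exl: "\<exists>W U z. lift W U z \<and> y \<in> W" if y: "y \<in> C" for y
 proof -
  obtain W0 T h where W0: "y \<in> W0" "openin (top_of_set C) W0" and T: "\<pi> y \<in> T" "openin (top_of_set S) T" and h: "homeomorphism W0 T \<pi> h"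
   by (rule covering_space_local_homeomorphism[OF cov y])
  have "\<pi> y \<in> S" using y im by blast
  then obtain U z where U: "(U, z) \<in> \<A>" "\<pi> y \<in> U" using rs unfolding riemann_surface_def by blast
  have ccU: "complex_coordinate S \<A> U z" by (rule atlas_complex_coordinate[OF rs U(1)])
  have oUT: "openin (top_of_set S) (U \<inter> T)" by (rule openin_Int[OF chartD(1)[OF complex_coordinate_chart[OF ccU]] T(2)])
  have cc: "complex_coordinate S \<A> (U \<inter> T) z" by (rule complex_coordinate_subset[OF ccU oUT]) blast
  define W where "W = W0 \<inter> (C \<inter> \<pi> -` (U \<inter> T))"
  have "openin (top_of_set C) (C \<inter> \<pi> -` (U \<inter> T))" by (rule continuous_openin_preimage[OF cont _ oUT]) (use im in blast)
  then have oW: "openin (top_of_set C) W" unfolding W_def by (rule openin_Int[OF W0(2)])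
  have "\<pi> ` W0 = T" using h by (simp add: homeomorphism_def)
  then have "\<pi> ` W = U \<inter> T" unfolding W_def using openin_imp_subset[OF W0(2)] by blast
  then have "homeomorphism W (U \<inter> T) \<pi> h" using homeomorphism_of_subsets[OF h, of W "U \<inter> T"] unfolding W_def by blast
  then have "lift W (U \<inter> T) z" unfolding lift_def using oW cc by blast
  moreover have "y \<in> W" using W0 y U T by (simp add: W_def)
  ultimately show ?thesis by blast
 qed
 have rsC: "riemann_surface C \<B>" unfolding riemann_surface_def
 proof (intro conjI ballI con)
  show "case b of (W, w) \<Rightarrow> chart C W w" if "b \<in> \<B>" for b using that ch by (auto simp: \<B>_def)
  show "(\<Union>(W, w)\<in>\<B>. W) = C"
  proof
   show "(\<Union>(W, w)\<in>\<B>. W) \<subseteq> C" using openin_imp_subset unfolding \<B>_def lift_def by fastforce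
   show "C \<subseteq> (\<Union>(W, w)\<in>\<B>. W)" using exl unfolding \<B>_def by fastforce
  qed
  show "case b of (U, z) \<Rightarrow> \<forall>(V, w)\<in>\<B>. chart_compatible U z V w" if bB: "b \<in> \<B>" for b
  proof -
   obtain W U z where b: "b = (W, z \<circ> \<pi>)" "lift W U z" using bB unfolding \<B>_def by blast
   have "\<forall>b'\<in>\<B>. case b' of (V, w) \<Rightarrow> chart_compatible W (z \<circ> \<pi>) V w"
   proof
    fix b' assume "b' \<in> \<B>"
    then obtain W' U' z' where b': "b' = (W', z' \<circ> \<pi>)" "lift W' U' z'" unfolding \<B>_def by blast
    have "chart_compatible W (z \<circ> \<pi>) W' (z' \<circ> \<pi>)"
     unfolding chart_compatible_def using compat[OF b(2) b'(2)] compat[OF b'(2) b(2)] by (simp add: Int_commute)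
    then show "case b' of (V, w) \<Rightarrow> chart_compatible W (z \<circ> \<pi>) V w" by (simp add: b'(1))
   qed
   then show ?thesis by (simp add: b(1))
  qed
 qed
 have "holomorphic_map C \<B> S \<A> \<pi>" unfolding holomorphic_map_def
 proof (intro conjI allI impI cont)
  show "\<pi> ` C \<subseteq> S" using im by simp
  fix W w U z assume "complex_coordinate C \<B> W w \<and> complex_coordinate S \<A> U z"
  then have ccW: "complex_coordinate C \<B> W w" and ccU: "complex_coordinate S \<A> U z" by simp_all
  have cW: "chart C W w" by (rule complex_coordinate_chart[OF ccW])
  show "(z \<circ> \<pi> \<circ> inv_into W w) holomorphic_on w ` (W \<inter> \<pi> -` U)"
  proof (rule holomorphic_on_local)
   fix x assume "x \<in> w ` (W \<inter> \<pi> -` U)"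
   then obtain y where y: "x = w y" "y \<in> W \<inter> \<pi> -` U" by (rule imageE)
   have yC: "y \<in> C" using y(2) chartD(4)[OF cW] by blast
   obtain W1 U1 z1 where l: "lift W1 U1 z1" "y \<in> W1" using exl[OF yC] by blast
   have ccU1: "complex_coordinate S \<A> U1 z1" using l by (simp add: lift_def)
   have a: "((z1 \<circ> \<pi>) \<circ> inv_into W w) holomorphic_on w ` (W \<inter> W1)"
    using ccW l(1) unfolding complex_coordinate_def chart_compatible_def \<B>_def by blast
   have b: "(z \<circ> inv_into U1 z1) holomorphic_on z1 ` (U \<inter> U1)" by (rule transition_holomorphic[OF rs ccU ccU1])
   define V where "V = W \<inter> W1 \<inter> (C \<inter> \<pi> -` U)"
   have "openin (top_of_set C) (C \<inter> \<pi> -` U)"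
    by (rule continuous_openin_preimage[OF cont _ chartD(1)[OF complex_coordinate_chart[OF ccU]]]) (use im in blast)
   moreover have "openin (top_of_set C) W1" using l by (simp add: lift_def)
   ultimately have oV: "openin (top_of_set C) V" unfolding V_def using chartD(1)[OF cW] by blast
   have oE: "open (w ` V)" by (rule chart_image_open[OF cW oV]) (auto simp: V_def)
   have xE: "x \<in> w ` V" using y l yC by (auto simp: V_def)
   have inv: "inv_into W w (w q) = q" if "q \<in> V" for q by (rule chartD(7)[OF cW]) (use that V_def in blast)
   have pU: "\<pi> q \<in> U \<inter> U1" if "q \<in> V" for q using that piW[OF l(1)] unfolding V_def by blast
   have "((z1 \<circ> \<pi>) \<circ> inv_into W w) ` (w ` V) \<subseteq> z1 ` (U \<inter> U1)"
    unfolding image_image by (rule image_subsetI) (use inv pU in simp)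
   then have "((z \<circ> inv_into U1 z1) \<circ> ((z1 \<circ> \<pi>) \<circ> inv_into W w)) holomorphic_on w ` V"
    by (intro holomorphic_on_compose_gen[OF holomorphic_on_subset[OF a] b]) (auto simp: V_def)
   then have "(z \<circ> \<pi> \<circ> inv_into W w) holomorphic_on w ` V"
   proof (rule holomorphic_transform)
    fix x assume "x \<in> w ` V"
    then obtain q where q: "x = w q" "q \<in> V" by (rule imageE)
    have "inv_into U1 z1 (z1 (\<pi> q)) = \<pi> q" by (rule chartD(7)[OF complex_coordinate_chart[OF ccU1]]) (use pU[OF q(2)] in blast)
    then show "((z \<circ> inv_into U1 z1) \<circ> ((z1 \<circ> \<pi>) \<circ> inv_into W w)) x = (z \<circ> \<pi> \<circ> inv_into W w) x"
     using inv[OF q(2)] q(1) by simp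
   qed
   then show "\<exists>E. open E \<and> x \<in> E \<and> (z \<circ> \<pi> \<circ> inv_into W w) holomorphic_on E" using oE xE by blast
  qed
 qed
 with rsC show ?thesis by (rule that)
qed

lemma (in quat_pair) lift_neg: "lift_at w G \<Longrightarrow> lift_at w (- G)"
 unfolding lift_at_def by (simp add: qmult_bilinear cvec_simps vector_smult_rneg)

lemma f_1_scaleR:
 assumes "open D" "smooth_on D g" "w \<in> D"
 shows "f_1 (\<lambda>w. c *\<^sub>R g w) w = of_real c *s f_1 g w"
proof -
 have l: "of_real c *s (x + y) = of_real c *s x + of_real c *s y" "of_real c *s (k *s x) = k *s (of_real c *s x)" for k and x y :: "complex^'n"
  by (simp_all add: vec_eq_iff algebra_simps)
 show ?thesis
  unfolding f_1_def' cvec_simps by (rule del_clinear(1)[OF l smooth_on_differentiable[OF smooth_on_cvec[OF assms(1,2)] assms(3)]])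
qed

section \<open>The double covering and the minimal surface in the 3-sphere\<close>

context split_surface
begin

lemma S_locally_connected:
 assumes x: "x \<in> S" and T: "openin (top_of_set S) T" "x \<in> T"
 shows "\<exists>T'. openin (top_of_set S) T' \<and> connected T' \<and> x \<in> T' \<and> T' \<subseteq> T"
proof -
 obtain U z r where U: "plus_chart F U z" "x \<in> U" "U \<subseteq> T" "r > 0" "z ` U = ball (z x) r"
  by (rule plus_transform_chart[OF F x T])
 have h: "homeomorphism U (z ` U) z (inv_into U z)" using plus_chartD(3)[OF U(1)] by (simp add: chart_def)
 then have "U = inv_into U z ` (z ` U)" "continuous_on (z ` U) (inv_into U z)" by (simp_all add: homeomorphism_def)
 moreover have "connected (z ` U)" unfolding U(5) by simp
 ultimately have "connected U" using connected_continuous_image by metis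
 then show ?thesis using chartD(1)[OF plus_chartD(3)[OF U(1)]] U by blast
qed

context
 fixes e :: real
 assumes e: "e = 1 \<or> e = -1"
  and sign: "\<And>U z q. plus_chart F U z \<Longrightarrow> q \<in> U \<Longrightarrow>
   sphere_map.K (local_expr sg U z) (z q) = - of_real e * sphere_map.K (local_expr td U z) (z q)"
begin

text \<open>With this sign the K of the two sphere maps are opposite, as \<open>quat_pair\<close>
  demands.\<close>

definition tde where "tde p = e *\<^sub>R td p"

lemma local_tde: "local_expr tde U z = (\<lambda>w. e *\<^sub>R local_expr td U z w)"
 by (rule ext) (simp add: local_expr_def tde_def)

lemma quat:
 assumes pc: "plus_chart F U z"
 shows "quat_pair (z ` U) (local_expr sg U z) (local_expr tde U z)"
proof (intro quat_pair.intro quat_pair_axioms.intro)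
 note sc = sphere_map_scale[OF td_map[OF pc] e, folded local_tde]
 show "sphere_map (z ` U) (local_expr sg U z) (- \<i>)" by (rule sg_map[OF pc])
 show "sphere_map (z ` U) (local_expr tde U z) \<i>" by (rule sc(2))
 fix w assume w: "w \<in> z ` U"
 then obtain q where q: "w = z q" "q \<in> U" by (rule imageE)
 show "rho (local_expr sg U z) w = rho (local_expr tde U z) w"
  unfolding sc(3)[OF w] sg_rho[OF pc w] td_rho[OF pc w] ..
 show k: "sphere_map.K (local_expr sg U z) w = - sphere_map.K (local_expr tde U z) w"
  using sign[OF pc q(2)] sc(1)[OF w] unfolding q(1) by simp
 show "sphere_map.K (local_expr sg U z) w \<noteq> 0"
  unfolding q(1) sign[OF pc q(2)] using K_sign(1)[OF pc imageI[OF q(2)]] e by auto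
qed

definition lift where "lift p G \<longleftrightarrow> (\<exists>U z. plus_chart F U z \<and> p \<in> U \<and> quat_pair.lift_at (local_expr sg U z) (local_expr tde U z) (z p) G)"

text \<open>The derivatives of both sphere maps change by the same factor c, and the relation
  between them is linear, so being a lift does not depend on the coordinate.\<close>

lemma lift_chart:
 assumes V: "plus_chart F V w" "p \<in> V"
 shows "lift p G \<longleftrightarrow> quat_pair.lift_at (local_expr sg V w) (local_expr tde V w) (w p) G"
proof
 assume "lift p G"
 then obtain U z where U: "plus_chart F U z" "p \<in> U" and l: "quat_pair.lift_at (local_expr sg U z) (local_expr tde U z) (z p) G"
  unfolding lift_def by blast
 obtain c where c: "f_1 (local_expr sg V w) (w p) = c *s f_1 (local_expr sg U z) (z p)" "f_1 (local_expr td V w) (w p) = c *s f_1 (local_expr td U z) (z p)"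
  by (rule transition[OF U(1) V(1) U(2) V(2)])
 have ft: "f_1 (local_expr tde U z) (z p) = of_real e *s f_1 (local_expr td U z) (z p)" if "plus_chart F U z" "p \<in> U" for U z
  unfolding local_tde by (rule f_1_scaleR[OF sphere_map.D[OF td_map[OF that(1)]] sphere_map.sm[OF td_map[OF that(1)]] imageI[OF that(2)]])
 have "c *s (of_real e *s x) = of_real e *s (c *s x)" for x :: "complex^4" by (simp add: vec_eq_iff)
 then have c': "f_1 (local_expr tde V w) (w p) = c *s f_1 (local_expr tde U z) (z p)" unfolding ft[OF U] ft[OF V] c(2) by simp
 have ve: "local_expr s U z (z p) = s p" "local_expr s V w (w p) = s p" for s :: "'a \<Rightarrow> real^4"
  by (rule local_expr_chart[OF plus_chartD(3)[OF U(1)] U(2)], rule local_expr_chart[OF plus_chartD(3)[OF V(1)] V(2)])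
 have l': "G \<bullet> G = 1" "G \<star> sg p = tde p \<star> G" and l3: "\<i> *s (cvec G \<star> cvec (sg p) \<star> f_1 (local_expr sg U z) (z p)) = f_1 (local_expr tde U z) (z p) \<star> cvec G"
  using l unfolding quat_pair.lift_at_def[OF quat[OF U(1)]] ve by blast+
 have "\<i> *s (cvec G \<star> cvec (sg p) \<star> (c *s f_1 (local_expr sg U z) (z p))) = c *s (\<i> *s (cvec G \<star> cvec (sg p) \<star> f_1 (local_expr sg U z) (z p)))"
  by (simp add: qmult_bilinear vec_eq_iff)
 then show "quat_pair.lift_at (local_expr sg V w) (local_expr tde V w) (w p) G"
  unfolding quat_pair.lift_at_def[OF quat[OF V(1)]] ve c(1) c' using l' l3 by (simp add: qmult_bilinear(3))
next
 assume "quat_pair.lift_at (local_expr sg V w) (local_expr tde V w) (w p) G"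
 then show "lift p G" unfolding lift_def using V by blast
qed

text \<open>The third entry is determined by the first two. It is recorded so that G1 and G2 are
  projections and C has the type asked for by \<open>is_bipolar_surface\<close>.\<close>

definition C :: "('a \<times> (real^4) \<times> (real^4)) set" where
 "C = {(p, G, N). p \<in> S \<and> lift p G \<and> N = G \<star> sg p}"

lemma C_iff: "y \<in> C \<longleftrightarrow> fst y \<in> S \<and> lift (fst y) (fst (snd y)) \<and> snd (snd y) = fst (snd y) \<star> sg (fst y)"
 by (cases y) (auto simp: C_def)

lemma continuous_sg: "plus_chart F U z \<Longrightarrow> continuous_on U sg"
proof -
 assume pc: "plus_chart F U z"
 note c = plus_chartD(3)[OF pc]
 have "continuous_on U (local_expr sg U z \<circ> z)"
  by (rule continuous_on_compose[OF chartD(5)[OF c] smooth_on_continuous_on[OF sphere_map.sm[OF sg_map[OF pc]]]])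
 then show "continuous_on U sg" by (rule continuous_on_eq) (simp add: local_expr_chart[OF c])
qed

lemma covC: "covering_space C fst S"
proof
 have cf: "continuous_on C fst" by (intro continuous_intros)
 show "continuous_on C fst" by (rule cf)
 have fC: "fst ` C \<subseteq> S" by (auto simp: C_def)
 show im: "fst ` C = S"
 proof
  show "S \<subseteq> fst ` C"
  proof
   fix p assume p: "p \<in> S"
   obtain U z r where U: "plus_chart F U z" "p \<in> U" "U \<subseteq> S" "r > 0" "z ` U = ball (z p) r"
    by (rule plus_transform_chart[OF F p openin_subtopology_self p])
   obtain G where "quat_pair.lift_at (local_expr sg U z) (local_expr tde U z) (z p) G"
    using quat_pair.lift_exists[OF quat[OF U(1)] imageI[OF U(2)]] by blast
   then have "(p, G, G \<star> sg p) \<in> C" unfolding C_iff using lift_chart[OF U(1,2)] p by simp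
   then show "p \<in> fst ` C" by force
  qed
 qed (rule fC)
 fix x assume x: "x \<in> S"
 obtain U z r where U: "plus_chart F U z" "x \<in> U" "U \<subseteq> S" "r > 0" "z ` U = ball (z x) r"
  by (rule plus_transform_chart[OF F x openin_subtopology_self x])
 note cU = plus_chartD(3)[OF U(1)]
 interpret q: quat_pair "z ` U" "local_expr sg U z" "local_expr tde U z" by (rule quat[OF U(1)])
 obtain G0 where G0: "q.lift_at (z x) G0" using q.lift_exists[OF imageI[OF U(2)]] by blast
 define \<sigma> where "\<sigma> = q.sect G0 \<circ> z"
 have c\<sigma>: "continuous_on U \<sigma>" unfolding \<sigma>_def
  by (rule continuous_on_compose[OF chartD(5)[OF cU] smooth_on_continuous_on[OF q.smooth_sect]])
 \<comment> \<open>The section can be normalised where it does not vanish; at x it is 4 G0, so x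
   belongs to this set.\<close>
 define T where "T = U \<inter> \<sigma> -` (- {0})"
 have TU: "T \<subseteq> U" by (auto simp: T_def)
 have "openin (top_of_set U) T" unfolding T_def by (rule continuous_openin_preimage_gen[OF c\<sigma>]) (rule open_Compl, simp)
 then have oT: "openin (top_of_set S) T" using openin_trans chartD(1)[OF cU] by blast
 have "G0 \<bullet> G0 = 1" using G0 by (simp add: q.lift_at_def)
 then have "G0 \<noteq> 0" by auto
 then have xT: "x \<in> T" using q.lift_sect[OF imageI[OF U(2)] G0] U(2) by (simp add: T_def \<sigma>_def)
 define Gl where "Gl p = (1 / norm (\<sigma> p)) *\<^sub>R \<sigma> p" for p
 have nz: "\<sigma> p \<noteq> 0" if "p \<in> T" for p using that by (simp add: T_def)
 have lG: "q.lift_at (z p) (Gl p)" if "p \<in> T" for p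
  unfolding Gl_def \<sigma>_def comp_apply by (rule q.sect_lift) (use that nz[OF that] TU in \<open>auto simp: \<sigma>_def\<close>)
 have GG: "Gl p \<bullet> Gl p = 1" if "p \<in> T" for p using lG[OF that] by (simp add: q.lift_at_def)
 have cG: "continuous_on T Gl" unfolding Gl_def
  by (intro continuous_intros continuous_on_subset[OF c\<sigma> TU]) (use nz in auto)
 define A0 where "A0 = C \<inter> fst -` T"
 have oA: "openin (top_of_set C) A0" unfolding A0_def by (rule continuous_openin_preimage[OF cf _ oT]) (use fC in blast)
 define \<phi> where "\<phi> y = fst (snd y) \<bullet> Gl (fst y)" for y :: "'a \<times> (real^4) \<times> (real^4)"
 have c\<phi>: "continuous_on A0 \<phi>" unfolding \<phi>_def
  by (intro continuous_on_inner continuous_on_compose2[OF cG] continuous_intros) (auto simp: A0_def)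
 \<comment> \<open>The two sheets are separated by the sign of \<phi>, which takes only the values 1
   and -1 because a lift is unique up to sign.\<close>
 define W where "W c = A0 \<inter> (\<lambda>y. c * \<phi> y) -` {0<..}" for c :: real
 have oW: "openin (top_of_set C) (W c)" for c
 proof -
  have "openin (top_of_set A0) (W c)" unfolding W_def
   by (rule continuous_openin_preimage_gen) (intro continuous_intros c\<phi>, simp)
  then show ?thesis using openin_trans oA by blast
 qed
 have pm: "fst (snd y) = Gl (fst y) \<or> fst (snd y) = - Gl (fst y)" if y: "y \<in> A0" for y
 proof -
  have yT: "fst y \<in> T" and l: "lift (fst y) (fst (snd y))" using y by (auto simp: A0_def C_iff)
  have yU: "fst y \<in> U" using yT TU by blast
  show ?thesis by (rule q.lift_unique[OF imageI[OF yU] lG[OF yT]]) (use l lift_chart[OF U(1) yU] in simp)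
 qed
 have \<phi>1: "\<phi> y = 1 \<or> \<phi> y = -1" if "y \<in> A0" for y
  using pm[OF that] GG[of "fst y"] that by (auto simp: \<phi>_def A0_def)
 define h where "h c p = (p, c *\<^sub>R Gl p, (c *\<^sub>R Gl p) \<star> sg p)" for c p
 have ho: "homeomorphism (W c) T fst (h c)" if c: "c = 1 \<or> c = -1" for c
 proof -
  have hW: "h c p \<in> W c" if p: "p \<in> T" for p
  proof -
   have "q.lift_at (z p) (c *\<^sub>R Gl p)" using lG[OF p] q.lift_neg[OF lG[OF p]] c by auto
   then have "lift p (c *\<^sub>R Gl p)" using lift_chart[OF U(1), of p] p TU by blast
   then show ?thesis using p TU U(3) GG[OF p] c by (auto simp: W_def A0_def C_iff h_def \<phi>_def)
  qed
  have hf: "h c (fst y) = y" if y: "y \<in> W c" for y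
  proof -
   have yA: "y \<in> A0" and p: "0 < c * \<phi> y" using y by (auto simp: W_def)
   have T: "fst y \<in> T" and yC: "y \<in> C" using yA by (auto simp: A0_def)
   have "fst (snd y) = c *\<^sub>R Gl (fst y)" using pm[OF yA] c p GG[OF T] by (auto simp: \<phi>_def)
   moreover have "snd (snd y) = fst (snd y) \<star> sg (fst y)" using yC unfolding C_iff by blast
   ultimately show ?thesis unfolding h_def by (simp add: prod_eq_iff)
  qed
  have "continuous_on T (\<lambda>p. c *\<^sub>R Gl p)" by (intro continuous_intros cG)
  then have "continuous_on T (h c)" unfolding h_def
   by (intro continuous_on_Pair continuous_on_id bounded_bilinear.continuous_on[OF bounded_bilinear_qmult(1)]
     continuous_on_subset[OF continuous_sg[OF U(1)] TU])
  moreover have "continuous_on (W c) fst" by (intro continuous_intros)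
  moreover have "fst ` W c = T"
  proof
   show "fst ` W c \<subseteq> T" by (auto simp: W_def A0_def)
   show "T \<subseteq> fst ` W c"
   proof
    fix p assume "p \<in> T"
    then show "p \<in> fst ` W c" using hW[of p] by (intro image_eqI[of _ _ "h c p"]) (simp_all add: h_def)
   qed
  qed
  moreover have "h c ` T = W c"
  proof
   show "h c ` T \<subseteq> W c" using hW by blast
   show "W c \<subseteq> h c ` T"
   proof
    fix y assume y: "y \<in> W c"
    then have "fst y \<in> T" by (simp add: W_def A0_def)
    then show "y \<in> h c ` T" using hf[OF y] by (metis imageI)
   qed
  qed
  moreover have "\<forall>y\<in>W c. h c (fst y) = y" using hf by blast
  moreover have "\<forall>p\<in>T. fst (h c p) = p" by (simp add: h_def)
  ultimately show ?thesis unfolding homeomorphism_def by blast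
 qed
 have un: "\<Union>{W 1, W (-1)} = C \<inter> fst -` T"
 proof -
  have "W 1 \<union> W (-1) = A0" using \<phi>1 by (force simp: W_def)
  then show ?thesis by (simp add: A0_def)
 qed
 have "W 1 \<inter> W (-1) = {}" by (auto simp: W_def)
 then have dj: "pairwise disjnt {W 1, W (-1)}" by (auto simp: pairwise_def disjnt_def)
 show "\<exists>T. x \<in> T \<and> openin (top_of_set S) T \<and> (\<exists>v. \<Union>v = C \<inter> fst -` T \<and> (\<forall>u\<in>v. openin (top_of_set C) u) \<and> pairwise disjnt v \<and> (\<forall>u\<in>v. \<exists>q. homeomorphism u T fst q))"
  by (intro exI[of _ T] conjI xT oT exI[of _ "{W 1, W (-1)}"] un dj) (use oW ho[of 1] ho[of "-1"] in auto)
qed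

text \<open>Orthonormal coordinates with respect to the two eigenspaces of \<open>star\<close>; the
  factor e undoes the sign in \<open>tde\<close>.\<close>

definition join :: "real^6 \<Rightarrow> real^6" where
 "join y = (sqrt 2 / 2) *\<^sub>R vector [y$1 - y$6, y$2 + y$5, y$3 - y$4, e * (y$1 + y$6), e * (y$2 - y$5), e * (y$3 + y$4)]"

lemma orthogonal_join: "orthogonal_transformation join" unfolding orthogonal_transformation_def
proof (intro conjI allI)
 show "linear join" by (rule linearI; rule vec6_eqI; simp add: join_def vector_6 algebra_simps)
 have s2: "sqrt 2 * (sqrt 2 * u) = 2 * u" for u :: real unfolding mult.assoc[symmetric] by simp
 have e2: "e * (e * u) = u" for u using e by auto
 show "join x \<bullet> join y = x \<bullet> y" for x y by (simp add: inner_6 join_def vector_6 s2 e2 algebra_simps)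
qed

text \<open>The self-dual part of \<open>G \<and> N\<close> is \<open>qconj G \<star> N\<close>, the anti-self-dual part is \<open>N \<star> qconj G\<close>.\<close>

lemma f_bipolar:
 assumes p: "p \<in> S" and l: "lift p G"
 shows "f p = A (join (wedge G (G \<star> sg p)))"
proof -
 obtain U z where U: "plus_chart F U z" "p \<in> U" and la: "quat_pair.lift_at (local_expr sg U z) (local_expr tde U z) (z p) G"
  using l unfolding lift_def by blast
 have ve: "local_expr s U z (z p) = s p" for s :: "'a \<Rightarrow> real^4" by (rule local_expr_chart[OF plus_chartD(3)[OF U(1)] U(2)])
 have GG: "G \<bullet> G = 1" and GN: "G \<star> sg p = tde p \<star> G" using la unfolding quat_pair.lift_at_def[OF quat[OF U(1)]] ve by blast+
 have g: "G$1 * G$1 + G$2 * G$2 + G$3 * G$3 + G$4 * G$4 = 1" using GG by (simp add: inner_vec_def sum_4)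
 define N where "N = G \<star> sg p"
 have s1: "sg p $ 1 = 0" "td p $ 1 = 0" by (simp_all add: sg_def td_def L_split)
 have q1: "qconj G \<star> (G \<star> x) = (G$1 * G$1 + G$2 * G$2 + G$3 * G$3 + G$4 * G$4) *\<^sub>R x" for x
  by (rule vec4_eqI; simp add: qmult_nth qconj_nth algebra_simps)
 have q2: "(x \<star> G) \<star> qconj G = (G$1 * G$1 + G$2 * G$2 + G$3 * G$3 + G$4 * G$4) *\<^sub>R x" for x
  by (rule vec4_eqI; simp add: qmult_nth qconj_nth algebra_simps)
 have a: "qconj G \<star> N = sg p" unfolding N_def q1 g by simp
 have b: "N \<star> qconj G = tde p" unfolding N_def GN q2 g by simp
 have w1: "wedge G N $ 1 - wedge G N $ 6 = sg p $ 2" "wedge G N $ 2 + wedge G N $ 5 = sg p $ 3" "wedge G N $ 3 - wedge G N $ 4 = sg p $ 4"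
  unfolding a[symmetric] by (simp_all add: wedge_def vector_6 qmult_nth qconj_nth algebra_simps)
 have w2: "wedge G N $ 1 + wedge G N $ 6 = tde p $ 2" "wedge G N $ 2 - wedge G N $ 5 = tde p $ 3" "wedge G N $ 3 + wedge G N $ 4 = tde p $ 4"
  unfolding b[symmetric] by (simp_all add: wedge_def vector_6 qmult_nth qconj_nth algebra_simps)
 have s2: "sqrt 2 * (sqrt 2 * u) = 2 * u" for u :: real unfolding mult.assoc[symmetric] by simp
 have e2: "e * (e * u) = u" for u using e by auto
 have lin: "R (f p + F p) = R (f p) + R (F p)" "R (f p - F p) = R (f p) - R (F p)"
  by (rule linear_add[OF linear_R], rule linear_diff[OF linear_R])
 have c: "R (F p) $ 1 = R (f p) $ 1" "R (F p) $ 2 = R (f p) $ 2" "R (F p) $ 3 = R (f p) $ 3"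
  "R (F p) $ 4 = - R (f p) $ 4" "R (F p) $ 5 = - R (f p) $ 5" "R (F p) $ 6 = - R (f p) $ 6"
  using RP[OF p] RM[OF p] unfolding lin by auto
 have sgv: "sg p $ 2 = sqrt 2 * R (f p) $ 1" "sg p $ 3 = sqrt 2 * R (f p) $ 2" "sg p $ 4 = sqrt 2 * R (f p) $ 3"
  unfolding sg_def scaleR_one L1_def lin by (simp_all add: vector_4 c)
 have tdv: "tde p $ 2 = e * (sqrt 2 * R (f p) $ 4)" "tde p $ 3 = e * (sqrt 2 * R (f p) $ 5)" "tde p $ 4 = e * (sqrt 2 * R (f p) $ 6)"
  unfolding tde_def td_def scaleR_minus1_left add_uminus_conv_diff L2_def lin by (simp_all add: vector_4 c)
 have "join (wedge G N) = R (f p)"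
  unfolding join_def w1 w2 sgv tdv by (rule vec6_eqI; simp add: vector_6 s2 e2)
 then show ?thesis using AR[of "f p"] by (simp add: N_def)
qed

text \<open>The double covering may be trivial, so one component of C is taken in order to have a
  connected Riemann surface.\<close>

lemma bipolar: "is_bipolar_surface S \<A> f"
proof -
 obtain c where c: "c \<in> C" using S_nonempty covering_space_imp_surjective[OF covC] by blast
 define K where "K = connected_component_set C c"
 have covK: "covering_space K fst S" unfolding K_def
  by (rule connected_component_covering(1)[OF covC connected_S c S_locally_connected])
 have KC: "K \<subseteq> C" unfolding K_def by (rule connected_component_subset)
 have "c \<in> K" unfolding K_def using c by simp
 then have neK: "K \<noteq> {}" by blast
 have conK: "connected K" by (simp add: K_def)
 obtain \<B> where rsK: "riemann_surface K \<B>" and hmK: "holomorphic_map K \<B> S \<A> fst"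
  by (rule covering_riemann_surface[OF rs covK conK neK])
 define G1 :: "'a \<times> (real^4) \<times> (real^4) \<Rightarrow> real^4" where "G1 y = fst (snd y)" for y
 define G2 :: "'a \<times> (real^4) \<times> (real^4) \<Rightarrow> real^4" where "G2 y = snd (snd y)" for y
 \<comment> \<open>Every point has a coordinate lifted from a plus chart, and in it
   \<open>lift_minimal\<close> applies.\<close>
 have loc: thesis if yK: "y \<in> K" and H: "\<And>W v. complex_coordinate K \<B> W v \<Longrightarrow> y \<in> W \<Longrightarrow>
   bipolar_local (v ` W) (local_expr G1 W v) (local_expr G2 W v) \<Longrightarrow>
   \<forall>x\<in>v ` W. cdot (cvec (local_expr G2 W v x)) (f_11 (local_expr G1 W v) x) \<noteq> 0 \<Longrightarrow> thesis" for y thesis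
 proof -
  obtain W0 T h where W0: "y \<in> W0" "openin (top_of_set K) W0" and T: "fst y \<in> T" "openin (top_of_set S) T" and ho: "homeomorphism W0 T fst h"
   by (rule covering_space_local_homeomorphism[OF covK yK])
  have yS: "fst y \<in> S" using yK KC by (auto simp: C_iff)
  obtain U z r where U: "plus_chart F U z" "fst y \<in> U" "U \<subseteq> T" "r > 0" "z ` U = ball (z (fst y)) r"
   by (rule plus_transform_chart[OF F yS T(2,1)])
  note cU = plus_chartD(3)[OF U(1)]
  note L = covering_lift_coordinate[OF rsK hmK ho W0(2) plus_chartD(2)[OF U(1)] U(3)]
  define W where "W = h ` U"
  define v where "v = z \<circ> (fst :: 'a \<times> (real^4) \<times> (real^4) \<Rightarrow> 'a)"
  note L = L[folded W_def v_def]
  have hy: "h (fst y) = y" using ho W0(1) by (simp add: homeomorphism_def)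
  then have yW: "y \<in> W" unfolding W_def using U(2) by (metis imageI)
  have hU: "fst (h p) = p" "lift p (G1 (h p))" "G2 (h p) = G1 (h p) \<star> sg p" if "p \<in> U" for p
  proof -
   have pT: "p \<in> T" using that U(3) by blast
   show f: "fst (h p) = p" using ho pT by (simp add: homeomorphism_def)
   have "h p \<in> W0" using ho pT by (auto simp: homeomorphism_def)
   then have "h p \<in> C" using openin_imp_subset[OF W0(2)] KC by blast
   then show "lift p (G1 (h p))" "G2 (h p) = G1 (h p) \<star> sg p" unfolding C_iff f G1_def G2_def by blast+
  qed
  define \<gamma> where "\<gamma> = local_expr G1 W v"
  have \<gamma>: "\<gamma> x = G1 (h (inv_into U z x))" if "x \<in> z ` U" for x
   using L(3)[OF that] by (simp add: \<gamma>_def local_expr_def)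
  interpret q: quat_pair "z ` U" "local_expr sg U z" "local_expr tde U z" by (rule quat[OF U(1)])
  have o: "open (z ` U)" by (rule chartD(2)[OF cU])
  have l\<gamma>: "q.lift_at x (\<gamma> x)" if x: "x \<in> z ` U" for x
  proof -
   note i = chartD(8,9)[OF cU x]
   show ?thesis using hU(2)[OF i(2)] unfolding lift_chart[OF U(1) i(2)] i(1) \<gamma>[OF x] .
  qed
  have "continuous_on (z ` U) (h \<circ> inv_into U z)"
  proof (rule continuous_on_compose[OF chartD(6)[OF cU]])
   have "continuous_on T h" using ho by (simp add: homeomorphism_def)
   then show "continuous_on (inv_into U z ` z ` U) h"
    by (rule continuous_on_subset) (use chartD(9)[OF cU] U(3) in blast)
  qed
  then have "continuous_on (z ` U) (\<lambda>x. fst (snd ((h \<circ> inv_into U z) x)))" by (rule continuous_on_fst[OF continuous_on_snd])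
  then have c\<gamma>: "continuous_on (z ` U) \<gamma>" by (rule continuous_on_eq) (simp add: \<gamma> G1_def)
  have s\<gamma>: "smooth_on (z ` U) \<gamma>" by (rule q.continuous_lift_smooth[OF o subset_refl c\<gamma> l\<gamma>])
  note lm = q.lift_minimal[OF o subset_refl s\<gamma> l\<gamma>]
  define \<nu> where "\<nu> = local_expr G2 W v"
  have \<nu>: "\<gamma> x \<star> local_expr sg U z x = \<nu> x" if x: "x \<in> z ` U" for x
  proof -
   note i = chartD(8,9)[OF cU x]
   have "\<nu> x = G2 (h (inv_into U z x))" using L(3)[OF x] by (simp add: \<nu>_def local_expr_def)
   then show ?thesis unfolding hU(3)[OF i(2)] \<gamma>[OF x] by (simp add: local_expr_def)
  qed
  interpret b: bipolar_local "z ` U" \<gamma> "\<lambda>w. \<gamma> w \<star> local_expr sg U z w" by (rule lm(2))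
  have B: "bipolar_local (z ` U) \<gamma> \<nu>"
  proof
   show "conf_min (z ` U) \<gamma>" by (rule lm(1))
   show "smooth_on (z ` U) \<nu>"
    using b.smooth_N smooth_on_cong[OF o, of "\<lambda>w. \<gamma> w \<star> local_expr sg U z w" \<nu>] \<nu> by simp
   fix w v assume w: "w \<in> z ` U"
   show "\<nu> w \<bullet> \<nu> w = 1" "\<nu> w \<bullet> \<gamma> w = 0" "\<nu> w \<bullet> dd v \<gamma> w = 0"
    unfolding \<nu>[OF w, symmetric] by (rule b.NN[OF w], rule b.NG[OF w], rule b.NdG[OF w])
  qed
  have B2: "\<forall>x\<in>z ` U. cdot (cvec (\<nu> x)) (f_11 \<gamma> x) \<noteq> 0"
  proof
   fix x assume x: "x \<in> z ` U"
   show "cdot (cvec (\<nu> x)) (f_11 \<gamma> x) \<noteq> 0" unfolding \<nu>[OF x, symmetric] by (rule lm(3), assumption, rule x)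
  qed
  show thesis
   by (rule H[OF L(1) yW B[folded L(2), unfolded \<gamma>_def \<nu>_def] B2[folded L(2), unfolded \<gamma>_def \<nu>_def]])
 qed
 \<comment> \<open>The conditions on G1 and G2 concern all coordinates; an arbitrary one is compared
   with one from \<open>loc\<close> through a holomorphic change \<tau>.\<close>
 have trans: thesis
  if cc: "complex_coordinate K \<B> W w" and x: "x \<in> w ` W"
   and H: "\<And>E \<tau> D \<gamma> \<nu>. open E \<Longrightarrow> x \<in> E \<Longrightarrow> \<tau> holomorphic_on E \<Longrightarrow> \<tau> ` E \<subseteq> D \<Longrightarrow> \<forall>x\<in>E. deriv \<tau> x \<noteq> 0 \<Longrightarrow>
    bipolar_local D \<gamma> \<nu> \<Longrightarrow> \<forall>x\<in>E. local_expr G1 W w x = \<gamma> (\<tau> x) \<Longrightarrow> \<forall>x\<in>E. local_expr G2 W w x = \<nu> (\<tau> x) \<Longrightarrow> thesis"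
  for W w x thesis
 proof -
  obtain y where y: "x = w y" "y \<in> W" using x by (rule imageE)
  have yK: "y \<in> K" using chartD(4)[OF complex_coordinate_chart[OF cc]] y(2) by blast
  obtain V v where V: "complex_coordinate K \<B> V v" "y \<in> V" "bipolar_local (v ` V) (local_expr G1 V v) (local_expr G2 V v)"
   by (rule loc[OF yK])
  note tp = transition_properties[OF rsK V(1) cc]
  have xE: "x \<in> w ` (V \<inter> W)" using y V(2) by blast
  show thesis by (rule H[OF tp(1) xE tp(2,4) _ V(3)]) (use tp(5) tp(6)[of _ G1] tp(6)[of _ G2] in blast)+
 qed
 have cmin: "conf_min (w ` W) (local_expr G1 W w)" if cc: "complex_coordinate K \<B> W w" for W w
 proof (rule conf_min_local)
  show "open (w ` W)" by (rule chartD(2)[OF complex_coordinate_chart[OF cc]])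
  fix x assume x: "x \<in> w ` W"
  obtain E \<tau> D \<gamma> \<nu> where E: "open E" "x \<in> E" "\<tau> holomorphic_on E" "\<tau> ` E \<subseteq> D" "\<forall>x\<in>E. deriv \<tau> x \<noteq> 0"
   "bipolar_local D \<gamma> \<nu>" "\<forall>x\<in>E. local_expr G1 W w x = \<gamma> (\<tau> x)" by (rule trans[OF cc x])
  have "conf_min E (\<lambda>w. \<gamma> (\<tau> w))"
   by (rule conf_min_compose[OF bipolar_local.cm[OF E(6)] E(1,3,4) bspec[OF E(5)]])
  then have "conf_min E (local_expr G1 W w)" using conf_min_cong[OF E(1), of "local_expr G1 W w" "\<lambda>w. \<gamma> (\<tau> w)"] E(7) by simp
  then show "\<exists>E. x \<in> E \<and> conf_min E (local_expr G1 W w)" using E(2) by blast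
 qed
 have "norm (G1 y) = 1" if yK: "y \<in> K" for y
 proof -
  obtain W v where W: "complex_coordinate K \<B> W v" "y \<in> W" by (rule loc[OF yK])
  show ?thesis using conf_minD(3)[OF cmin[OF W(1)] imageI[OF W(2)]] local_expr_chart[OF complex_coordinate_chart[OF W(1)] W(2), of G1] by simp
 qed
 then have mi1: "minimal_immersion K \<B> G1" by (intro conf_min_minimal_immersion[OF cmin]) auto
 have un: "unit_normal_in_sphere K \<B> G1 G2" unfolding unit_normal_in_sphere_def
 proof (intro allI impI)
  fix W w assume cc: "complex_coordinate K \<B> W w"
  have all: "(\<exists>E. open E \<and> x \<in> E \<and> smooth_on E (local_expr G2 W w)) \<and> norm (local_expr G2 W w x) = 1 \<and>
    local_expr G2 W w x \<bullet> local_expr G1 W w x = 0 \<and> (\<forall>v. local_expr G2 W w x \<bullet> dd v (local_expr G1 W w) x = 0)" if x: "x \<in> w ` W" for x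
  proof -
   obtain E \<tau> D \<gamma> \<nu> where E: "open E" "x \<in> E" "\<tau> holomorphic_on E" "\<tau> ` E \<subseteq> D"
    "bipolar_local D \<gamma> \<nu>" "\<forall>x\<in>E. local_expr G1 W w x = \<gamma> (\<tau> x)" "\<forall>x\<in>E. local_expr G2 W w x = \<nu> (\<tau> x)"
    by (rule trans[OF cc x])
   interpret b: bipolar_local D \<gamma> \<nu> by (rule E(5))
   have tx: "\<tau> x \<in> D" using E(2,4) by blast
   have "smooth_on E (\<lambda>w. \<nu> (\<tau> w))" by (rule smooth_on_compose_holomorphic[OF b.D E(1,3,4) b.smooth_N])
   then have 1: "smooth_on E (local_expr G2 W w)" using smooth_on_cong[OF E(1), of "local_expr G2 W w" "\<lambda>w. \<nu> (\<tau> w)"] E(7) by simp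
   have e: "local_expr G1 W w x = \<gamma> (\<tau> x)" "local_expr G2 W w x = \<nu> (\<tau> x)" using E(2,6,7) by blast+
   have 2: "local_expr G2 W w x \<bullet> dd v (local_expr G1 W w) x = 0" for v
   proof -
    have "dd v (local_expr G1 W w) x = dd v (\<lambda>w. \<gamma> (\<tau> w)) x" by (rule dd_cong[OF E(1,2)]) (use E(6) in blast)
    also have "\<dots> = dd (deriv \<tau> x * v) \<gamma> (\<tau> x)"
     by (rule dd_compose_holomorphic(1)[OF holomorphic_on_imp_differentiable_at[OF E(3,1,2)] smooth_on_differentiable[OF conf_minD(2)[OF b.cm] tx]])
    finally show ?thesis unfolding e(2) by (simp add: b.NdG[OF tx])
   qed
   show ?thesis using 1 2 E(1,2) b.NN[OF tx] b.NG[OF tx] unfolding e norm_eq_1 by blast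
  qed
  show "smooth_on (w ` W) (local_expr G2 W w) \<and> (\<forall>x\<in>w ` W. norm (local_expr G2 W w x) = 1 \<and>
    local_expr G2 W w x \<bullet> local_expr G1 W w x = 0 \<and> (\<forall>v. local_expr G2 W w x \<bullet> dd v (local_expr G1 W w) x = 0))"
   using all by (intro conjI ballI smooth_on_local) blast+
 qed
 \<comment> \<open>If \<open>II\<close> vanished, \<open>f_11\<close> of G1 would be tangential,
   against its nonzero product with the normal G2.\<close>
 have ntg: "\<not> totally_geodesic K \<B> G1"
 proof
  assume tg: "totally_geodesic K \<B> G1"
  obtain y where yK: "y \<in> K" using neK by blast
  obtain W v where W: "complex_coordinate K \<B> W v" "y \<in> W" "bipolar_local (v ` W) (local_expr G1 W v) (local_expr G2 W v)"
   and nz': "\<forall>x\<in>v ` W. cdot (cvec (local_expr G2 W v x)) (f_11 (local_expr G1 W v) x) \<noteq> 0" by (rule loc[OF yK])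
  note nz = bspec[OF nz' imageI[OF W(2)]]
  interpret b: bipolar_local "v ` W" "local_expr G1 W v" "local_expr G2 W v" by (rule W(3))
  have vy: "v y \<in> v ` W" using W(2) by blast
  have "II (local_expr G1 W v) (v y) u u' = 0" for u u' using tg W(1) vy unfolding totally_geodesic_def by blast
  then have "f_2 (local_expr G1 W v) (v y) = 0" by (simp add: f_2_def cvec_simps)
  then have "f_11 (local_expr G1 W v) (v y) = (cdot (f_11 (local_expr G1 W v) (v y)) (conj_vec (f_1 (local_expr G1 W v) (v y))) / rho (local_expr G1 W v) (v y)) *s f_1 (local_expr G1 W v) (v y)"
   unfolding conf_min_f_2[OF b.cm vy] right_minus_eq .
  then have "cdot (cvec (local_expr G2 W v (v y))) (f_11 (local_expr G1 W v) (v y)) = 0"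
   using b.N_f_1(1)[OF vy] by (metis cdot_simps(8) mult_zero_right)
  then show False using nz by simp
 qed
 have oAj: "orthogonal_transformation (A \<circ> join)" by (rule orthogonal_transformation_compose[OF oA orthogonal_join])
 have fK: "\<forall>y\<in>K. f (fst y) = (A \<circ> join) (wedge (G1 y) (G2 y))"
 proof
  fix y assume "y \<in> K"
  then have "fst y \<in> S" "lift (fst y) (G1 y)" "G2 y = G1 y \<star> sg (fst y)" using KC unfolding G1_def G2_def by (auto simp: C_iff)
  then show "f (fst y) = (A \<circ> join) (wedge (G1 y) (G2 y))" using f_bipolar by simp
 qed
 show ?thesis unfolding is_bipolar_surface_def
 proof (rule exI[of _ K], rule exI[of _ \<B>], rule exI[of _ fst], rule exI[of _ G1], rule exI[of _ G2], rule exI[of _ "A \<circ> join"], intro conjI)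
  show "riemann_surface K \<B>" by (rule rsK)
  show "covering_space K fst S" by (rule covK)
  show "holomorphic_map K \<B> S \<A> fst" by (rule hmK)
  show "minimal_immersion K \<B> G1" by (rule mi1)
  show "\<not> totally_geodesic K \<B> G1" by (rule ntg)
  show "unit_normal_in_sphere K \<B> G1 G2" by (rule un)
  show "orthogonal_transformation (A \<circ> join)" by (rule oAj)
  show "\<forall>y\<in>K. f (fst y) = (A \<circ> join) (wedge (G1 y) (G2 y))" by (rule fK)
 qed
qed

end

lemma is_bipolar: "is_bipolar_surface S \<A> f"
proof (rule sign_exists)
 fix e :: real
 assume e: "e = 1 \<or> e = -1"
  and s: "\<And>U z q. plus_chart F U z \<Longrightarrow> q \<in> U \<Longrightarrow> sphere_map.K (local_expr sg U z) (z q) = - of_real e * sphere_map.K (local_expr td U z) (z q)"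
 show ?thesis by (rule bipolar[OF e]) (rule s)
qed

end

lemma (in surface) plus_transform_imp_bipolar:
 assumes F: "is_plus_transform S \<A> f F" and gz: "gamma_plus_zero S \<A> f F"
 shows "is_bipolar_surface S \<A> f"
proof -
 obtain A R :: "real^6 \<Rightarrow> real^6" where AR: "orthogonal_transformation A" "orthogonal_transformation R" "\<forall>y. A (R y) = y"
  "\<forall>p\<in>S. R (f p + F p) $ 4 = 0 \<and> R (f p + F p) $ 5 = 0 \<and> R (f p + F p) $ 6 = 0"
  "\<forall>p\<in>S. R (f p - F p) $ 1 = 0 \<and> R (f p - F p) $ 2 = 0 \<and> R (f p - F p) $ 3 = 0"
  by (rule splitting_exists[OF F gz])
 interpret split_surface S \<A> f F A R
  by (intro split_surface.intro split_surface_axioms.intro surface_axioms F gz AR(1,2) AR(3-5)[rule_format])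
 show ?thesis by (rule is_bipolar)
qed

theorem theorem7:
  fixes S :: "'a::t2_space set"
    and \<A> :: "('a set \<times> ('a \<Rightarrow> complex)) set"
    and f :: "'a \<Rightarrow> real^6"
  assumes "riemann_surface S \<A>"
    and "minimal_immersion S \<A> f"
    and "nondegenerate_noncircular_ellipse S \<A> f"
  shows "(\<forall>F. is_plus_transform S \<A> f F \<longrightarrow>
            (gamma_plus_zero S \<A> f F \<longleftrightarrow> is_great_sphere_reflection_of S F f))
       \<and> ((\<exists>F. is_plus_transform S \<A> f F \<and> gamma_plus_zero S \<A> f F)
            \<longleftrightarrow> is_bipolar_surface S \<A> f)
       \<and> ((\<exists>F. is_plus_transform S \<A> f F \<and> is_great_sphere_reflection_of S F f)
            \<longleftrightarrow> is_bipolar_surface S \<A> f)"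
proof -
 interpret surface S \<A> f by (rule surface.intro[OF assms])
 have 1: "gamma_plus_zero S \<A> f F \<longleftrightarrow> is_great_sphere_reflection_of S F f" if "is_plus_transform S \<A> f F" for F
  using gamma_plus_zero_imp_reflection[OF that] reflection_imp_gamma_plus_zero by blast
 have 2: "(\<exists>F. is_plus_transform S \<A> f F \<and> gamma_plus_zero S \<A> f F) \<longleftrightarrow> is_bipolar_surface S \<A> f"
  using plus_transform_imp_bipolar bipolar_imp_plus_transform by blast
 show ?thesis using 1 2 by blast
qed

end
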